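(* The supremum $$D_*:=\sup\{D(\boldsymbol n):\ \boldsymbol n\in\mathcal G\}$$ is attained, and the set $\mathcal G_*:=\{\boldsymbol n\in\mathcal G:\ D(\boldsymbol n)=D_*\}$ is nonempty. If, for each $H>1/4$, $\boldsymbol m_H\in\mathcal A_{-1}$ is a minimizer of $I_{-1}(H)$ (i.e. $E_H(\boldsymbol m_H)=I_{-1}(H)$), then $$\inf_{a\in\mathbb R^2,\ \boldsymbol n\in\mathcal G_*}\big\|\boldsymbol m_H(a+H^{-1/4}\,\cdot\,)-\boldsymbol n\big\|_{H^2(\mathbb R^2)}\to0\quad\text{as }H\to\infty,$$ and $$I_{-1}(H)=\sqrt H\,\widehat I_{-1}(0)-D_*+o(1)\quad\text{as }H\to\infty.$$
   Context: Let $\boldsymbol e_3=(0,0,1)$ and $\mathcal A=\{\boldsymbol m:\mathbb R^2\to\mathbb S^2:\ \boldsymbol m-\boldsymbol e_3\in H^2(\mathbb R^2;\mathbb R^3)\}$; each $\boldsymbol m=(m_1,m_2,m_3)\in\mathcal A$ is identified with its uniformly continuous representative, which tends to $\boldsymbol e_3$ at infinity. The topological degree of $\boldsymbol m\in\mathcal A$ is $$Q(\boldsymbol m)=\frac1{4\pi}\int_{\mathbb R^2}\boldsymbol m\cdot(\partial_1\boldsymbol m\times\partial_2\boldsymbol m)\,dx\in\mathbb Z,$$ and $\mathcal A_{-1}=\{\boldsymbol m\in\mathcal A: Q(\boldsymbol m)=-1\}$. For $H>0$, $$E_H(\boldsymbol m)=\int_{\mathbb R^2}\Big(-\tfrac12|\nabla\boldsymbol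 m|^2+\tfrac12|\Delta\boldsymbol m|^2+H(1-m_3)\Big)dx,\qquad I_{-1}(H)=\inf_{\boldsymbol m\in\mathcal A_{-1}}E_H(\boldsymbol m).$$ Further, $$\mathcal F_0(\boldsymbol n)=\frac12\int_{\mathbb R^2}\big(|\Delta\boldsymbol n|^2+|\boldsymbol n-\boldsymbol e_3|^2\big)dx,\quad \widehat I_{-1}(0)=\inf_{\boldsymbol n\in\mathcal A_{-1}}\mathcal F_0(\boldsymbol n),\quad D(\boldsymbol n)=\frac12\int_{\mathbb R^2}|\nabla\boldsymbol n|^2dx,$$ and $\mathcal G=\{\boldsymbol n\in\mathcal A_{-1}:\ \mathcal F_0(\boldsymbol n)=\widehat I_{-1}(0)\}$. *)

theory Defs
  imports "HOL-Analysis.Analysis" "HOL-Library.Landau_Symbols"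
begin

section \<open>Test functions\<close>

definition partial_deriv :: "'n::finite \<Rightarrow> (real^'n \<Rightarrow> real) \<Rightarrow> real^'n \<Rightarrow> real" where
  "partial_deriv i f x = frechet_derivative f (at x) (axis i 1)"

primrec C_k :: "nat \<Rightarrow> (real^'n::finite \<Rightarrow> real) \<Rightarrow> bool" where
  "C_k 0 f \<longleftrightarrow> continuous_on UNIV f"
| "C_k (Suc k) f \<longleftrightarrow> (\<forall>x. f differentiable (at x)) \<and> (\<forall>i. C_k k (partial_deriv i f))"

definition test_function :: "(real^'n::finite \<Rightarrow> real) \<Rightarrow> bool" where
  "test_function \<phi> \<longleftrightarrow> (\<forall>k. C_k k \<phi>) \<and> compact (closure {x. \<phi> x \<noteq> 0})"


section \<open>Weak derivatives and Sobolev spaces\<close>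

text \<open>
  Elements of Lebesgue spaces are represented by Borel functions; every class modulo null sets
  contains one.
\<close>

definition locally_integrable ::
    "('a::euclidean_space \<Rightarrow> 'b::euclidean_space) \<Rightarrow> bool" where
  "locally_integrable f \<longleftrightarrow> (\<forall>K. compact K \<longrightarrow> set_integrable lborel K f)"

definition square_integrable ::
    "('a::euclidean_space \<Rightarrow> 'b::euclidean_space) \<Rightarrow> bool" where
  "square_integrable f \<longleftrightarrow>
     f \<in> borel_measurable lborel \<and> integrable lborel (\<lambda>x. (norm (f x))\<^sup>2)"

definition has_weak_partial ::
    "'n::finite \<Rightarrow> (real^'n \<Rightarrow> 'b::euclidean_space) \<Rightarrow> (real^'n \<Rightarrow> 'b) \<Rightarrow> bool" where
  "has_weak_partial i f g \<longleftrightarrow>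
     locally_integrable f \<and> locally_integrable g \<and>
     (\<forall>\<phi>. test_function \<phi> \<longrightarrow>
        (LINT x|lborel. partial_deriv i \<phi> x *\<^sub>R f x) = - (LINT x|lborel. \<phi> x *\<^sub>R g x))"

text \<open>
  A weak derivative is unique only up to null sets, so the operator below picks a representative
  (and is arbitrary if there is none). It is only used under integrals, where the choice is
  immaterial.
\<close>

definition weak_partial ::
    "'n::finite \<Rightarrow> (real^'n \<Rightarrow> 'b::euclidean_space) \<Rightarrow> real^'n \<Rightarrow> 'b" where
  "weak_partial i f = (SOME g. has_weak_partial i f g)"

definition weak_laplacian ::
    "(real^'n::finite \<Rightarrow> 'b::euclidean_space) \<Rightarrow> real^'n \<Rightarrow> 'b" where
  "weak_laplacian f x = (\<Sum>i\<in>UNIV. weak_partial i (weak_partial i f) x)"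

text \<open>Squared Frobenius norm of the weak Jacobian.\<close>

definition grad_sq :: "(real^'n::finite \<Rightarrow> 'b::euclidean_space) \<Rightarrow> real^'n \<Rightarrow> real" where
  "grad_sq f x = (\<Sum>i\<in>UNIV. (norm (weak_partial i f x))\<^sup>2)"

primrec sobolev_H :: "nat \<Rightarrow> (real^'n::finite \<Rightarrow> 'b::euclidean_space) \<Rightarrow> bool" where
  "sobolev_H 0 f \<longleftrightarrow> square_integrable f"
| "sobolev_H (Suc k) f \<longleftrightarrow>
     square_integrable f \<and> (\<forall>i. \<exists>g. has_weak_partial i f g \<and> sobolev_H k g)"

definition H2_norm :: "(real^'n::finite \<Rightarrow> 'b::euclidean_space) \<Rightarrow> real" where
  "H2_norm f = sqrt
     ((LINT x|lborel. (norm (f x))\<^sup>2)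
      + (\<Sum>i\<in>UNIV. LINT x|lborel. (norm (weak_partial i f x))\<^sup>2)
      + (\<Sum>i\<in>UNIV. \<Sum>j\<in>UNIV. LINT x|lborel. (norm (weak_partial j (weak_partial i f) x))\<^sup>2))"


section \<open>Admissible maps, degree and energies\<close>

type_synonym plane_map = "real^2 \<Rightarrow> real^3"

definition e3 :: "real^3" where
  "e3 = vector [0, 0, 1]"

text \<open>
  Each class in the admissible set is represented by its uniformly continuous member. The decay to
  \<open>e3\<close> at infinity is a consequence of the Sobolev embedding, not an additional requirement.
\<close>

definition admissible :: "plane_map set" where
  "admissible = {m. (\<forall>x. m x \<in> sphere 0 1) \<and> uniformly_continuous_on UNIV m \<and>
                    sobolev_H 2 (\<lambda>x. m x - e3)}"

definition degree_Q :: "plane_map \<Rightarrow> real" where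
  "degree_Q m = 1 / (4 * pi) *
     (LINT x|lborel. m x \<bullet> cross3 (weak_partial 1 m x) (weak_partial 2 m x))"

definition admissible_neg1 :: "plane_map set" where
  "admissible_neg1 = {m \<in> admissible. degree_Q m = -1}"

definition energy :: "real \<Rightarrow> plane_map \<Rightarrow> real" where
  "energy H m = (LINT x|lborel. - (1/2) * grad_sq m x + 1/2 * (norm (weak_laplacian m x))\<^sup>2
                                 + H * (1 - m x $ 3))"

text \<open>
  The energy is bounded below on the admissible set only for \<open>H \<ge> 1/4\<close>, so the real-valued
  infimum is meaningful only in that range.
\<close>

definition I_neg1 :: "real \<Rightarrow> real" where
  "I_neg1 H = (INF m\<in>admissible_neg1. energy H m)"

definition F0 :: "plane_map \<Rightarrow> real" where
  "F0 n = 1/2 * (LINT x|lborel. (norm (weak_laplacian n x))\<^sup>2 + (norm (n x - e3))\<^sup>2)"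

definition I_hat_neg1_0 :: real where
  "I_hat_neg1_0 = (INF n\<in>admissible_neg1. F0 n)"

definition dirichlet :: "plane_map \<Rightarrow> real" where
  "dirichlet n = 1/2 * (LINT x|lborel. grad_sq n x)"

definition minimizers_G :: "plane_map set" where
  "minimizers_G = {n \<in> admissible_neg1. F0 n = I_hat_neg1_0}"

text \<open>
  As a real supremum this is meaningful only if \<open>dirichlet\<close> is bounded above on
  \<open>minimizers_G\<close> and \<open>minimizers_G\<close> is nonempty.
\<close>

definition D_star :: real where
  "D_star = (SUP n\<in>minimizers_G. dirichlet n)"

definition G_star :: "plane_map set" where
  "G_star = {n \<in> minimizers_G. dirichlet n = D_star}"

end

theory Submission
 imports Defs "HOL-Complex_Analysis.Great_Picard"
begin

text \<open>The rescaling \<open>n(y) = m(H\<^sup>-\<^sup>1\<^sup>/\<^sup>4 y)\<close> turns \<open>E\<^sub>H(m)\<close> into \<open>\<surd>H F\<^sub>0(n) - D(n)\<close>. Comparing a minimizer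
 with a maximizer of \<open>D\<close> on the set of minimizers of \<open>F\<^sub>0\<close> shows that rescaled minimizers form a
 minimizing sequence of \<open>F\<^sub>0\<close> with \<open>D \<ge> D\<^sub>*\<close>, so that everything follows from compactness of such
 sequences up to translations in \<open>H\<^sup>2\<close>.

 Energy and degree split asymptotically under weak convergence, and the degree is an integer: the
 signed areas of the spherical quadrilaterals spanned by the values on the cells of a fine grid add up
 to a multiple of \<open>2\<pi>\<close>. Extracting profiles one by one, each at the cost of a fixed amount of energy,
 leads to a profile of odd degree. Since \<open>8\<pi> |Q| \<le> F\<^sub>0\<close> and an explicit map has \<open>F\<^sub>0 < 24\<pi>\<close>, this
 degree is \<open>\<plusminus>1\<close>. Up to a reflection the profile competes in the minimization, so it carries all the
 energy, and the convergence is strong.\<close>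

section \<open>Square integrable functions\<close>

text \<open>A profile may have any degree, and the degrees of profile and remainder merely add up,
  so degree -1 cannot be looked for directly. Parity can: removing a profile of even degree leaves a
  remainder of odd limiting degree. As the degree is bounded by sup norm times energy, such a
  remainder does not tend to zero uniformly and again has a nonzero profile. Remainders leave the
  sphere, so degree and energy are defined for arbitrary jets (a function with its derivatives),
  while integrality is applied to profiles only: a nonzero profile of a remainder is a profile of
  the original sequence, hence sphere valued. The threshold \<open>24 * pi\<close> is three times
  \<open>8 * pi\<close>; it excludes odd degrees of modulus at least 3. Degree 1 is ruled out last:
  once the remainder has vanishing energy it has vanishing degree, and the profile must have degree
  -1. Weak limits appear as pointwise limits of equicontinuous functions, whose derivatives are
  identified by strongly converging convex combinations.\<close>

notation scaleR (infixr "*R" 75)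

abbreviation seq_tendsto :: "(nat \<Rightarrow> 'a::topological_space) \<Rightarrow> 'a \<Rightarrow> bool" (infixr "---->" 60) where
 "X ----> L \<equiv> (X \<longlongrightarrow> L) sequentially"

abbreviation L2 :: "('a::euclidean_space \<Rightarrow> 'b::euclidean_space) \<Rightarrow> bool" where
 "L2 \<equiv> square_integrable"

abbreviation outside :: "real \<Rightarrow> ('a::real_normed_vector \<Rightarrow> 'b::real_vector) \<Rightarrow> 'a \<Rightarrow> 'b" where
 "outside R f \<equiv> \<lambda>x. indicator (- cball 0 R) x *R f x"

abbreviation inside :: "real \<Rightarrow> ('a::real_normed_vector \<Rightarrow> 'b::real_vector) \<Rightarrow> 'a \<Rightarrow> 'b" where
 "inside R f \<equiv> \<lambda>x. indicator (cball 0 R) x *R f x"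

definition l2 :: "('a::euclidean_space \<Rightarrow> 'b::euclidean_space) \<Rightarrow> real" where
 "l2 f = sqrt (LINT x|lborel. (norm (f x))\<^sup>2)"

lemmas LINT_add = Bochner_Integration.integral_add
lemmas LINT_nonneg = Bochner_Integration.integral_nonneg
lemmas LINT_cong = Bochner_Integration.integral_cong
lemmas LINT_integrable_add = Bochner_Integration.integrable_add
lemmas LINT_integrable_bound = Bochner_Integration.integrable_bound

text \<open>Fixing the constant \<open>C\<close> before \<open>d\<close> absorbs the usual division
  of epsilon by a constant, so that the limit proofs below only have to produce some bound linear in
  \<open>d\<close>.\<close>

lemma tendsto_zeroI:
 fixes a :: "'a \<Rightarrow> real"
 assumes C: "0 \<le> C" and le: "\<And>d. 0 < d \<Longrightarrow> d \<le> 1 \<Longrightarrow> \<forall>\<^sub>F k in F. \<bar>a k\<bar> \<le> C * d"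
 shows "(a \<longlongrightarrow> 0) F"
proof (rule tendstoI)
 fix e :: real assume e: "0 < e"
 define d where "d = min 1 (e / (C + 1))"
 have d: "0 < d" "d \<le> 1" "d \<le> e / (C + 1)" using e C by (auto simp: d_def)
 have "(C + 1) * d \<le> e" using d(3) C by (simp add: pos_le_divide_eq mult.commute)
 then have "C * d < e" using d(1) by (simp add: distrib_right)
 with le[OF d(1,2)] show "\<forall>\<^sub>F k in F. dist (a k) 0 < e" by (auto elim!: eventually_mono)
qed

lemma l2_nonneg [simp]: "0 \<le> l2 f" by (simp add: l2_def)

lemma l2_power2: "(l2 f)\<^sup>2 = (LINT x|lborel. (norm (f x))\<^sup>2)" by (simp add: l2_def)

lemma L2_measurable [measurable_dest]:
 "L2 f \<Longrightarrow> f \<in> borel_measurable borel" by (simp add: square_integrable_def)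

lemma L2_bound:
 fixes f :: "'a::euclidean_space \<Rightarrow> 'b::euclidean_space" and g :: "'a \<Rightarrow> 'c::euclidean_space"
 assumes f: "f \<in> borel_measurable borel" and g: "L2 g"
  and le: "AE x in lborel. norm (f x) \<le> C * norm (g x)"
 shows "L2 f"
proof -
 note [measurable] = f
 have "integrable lborel (\<lambda>x. C\<^sup>2 * (norm (g x))\<^sup>2)" using g by (simp add: square_integrable_def)
 then have "integrable lborel (\<lambda>x. (norm (f x))\<^sup>2)"
 proof (rule LINT_integrable_bound)
  show "AE x in lborel. norm ((norm (f x))\<^sup>2) \<le> norm (C\<^sup>2 * (norm (g x))\<^sup>2)" using le
  proof eventually_elim
   case (elim x)
   then have "(norm (f x))\<^sup>2 \<le> (C * norm (g x))\<^sup>2" by (intro power_mono) auto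
   then show ?case by (simp add: power_mult_distrib)
  qed
 qed measurable
 with f show ?thesis by (simp add: square_integrable_def)
qed

lemma L2_zero [simp]: "L2 (\<lambda>_. 0)" by (simp add: square_integrable_def)

lemma L2_add:
 assumes "L2 f" "L2 g"
 shows "L2 (\<lambda>x. f x + g x)"
proof -
 have [measurable]: "f \<in> borel_measurable borel" "g \<in> borel_measurable borel"
  using assms by (auto simp: square_integrable_def)
 have "integrable lborel (\<lambda>x. 2 * (norm (f x))\<^sup>2 + 2 * (norm (g x))\<^sup>2)"
  using assms by (simp add: square_integrable_def)
 then have "integrable lborel (\<lambda>x. (norm (f x + g x))\<^sup>2)"
 proof (rule LINT_integrable_bound)
  show "AE x in lborel. norm ((norm (f x + g x))\<^sup>2) \<le> norm (2 * (norm (f x))\<^sup>2 + 2 * (norm (g x))\<^sup>2)"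
  proof (rule AE_I2)
   fix x
   have "(norm (f x + g x))\<^sup>2 \<le> (norm (f x) + norm (g x))\<^sup>2" by (intro power_mono norm_triangle_ineq) auto
   also have "\<dots> \<le> 2 * (norm (f x))\<^sup>2 + 2 * (norm (g x))\<^sup>2"
    using sum_squares_bound[of "norm (f x)" "norm (g x)"] by (simp add: power2_sum)
   finally show "norm ((norm (f x + g x))\<^sup>2) \<le> norm (2 * (norm (f x))\<^sup>2 + 2 * (norm (g x))\<^sup>2)" by simp
  qed
 qed measurable
 then show ?thesis by (simp add: square_integrable_def)
qed

lemma L2_bounded_linear:
 assumes "bounded_linear L" "L2 f"
 shows "L2 (\<lambda>x. L (f x))"
proof -
 interpret bounded_linear L by fact
 obtain K where K: "\<And>x. norm (L x) \<le> norm x * K" using bounded by blast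
 have "L \<in> borel_measurable borel" using assms(1) by (intro borel_measurable_continuous_onI linear_continuous_on)
 then have "(\<lambda>x. L (f x)) \<in> borel_measurable borel" using assms(2) by (auto simp: square_integrable_def)
 then show ?thesis by (rule L2_bound[OF _ assms(2), where C = K])
   (use K in \<open>auto simp: mult.commute\<close>)
qed

lemma L2_scaleR: "L2 f \<Longrightarrow> L2 (\<lambda>x. c *R f x)" by (rule L2_bounded_linear[OF bounded_linear_scaleR_right])

lemma L2_minus: "L2 f \<Longrightarrow> L2 (\<lambda>x. - f x)" using L2_scaleR[of f "-1"] by simp

lemma L2_diff:
 "L2 f \<Longrightarrow> L2 g \<Longrightarrow> L2 (\<lambda>x. f x - g x)" using L2_add[of f "\<lambda>x. - g x"] L2_minus[of g] by simp

lemma L2_sum: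
 "(\<And>i. i \<in> I \<Longrightarrow> L2 (f i)) \<Longrightarrow> L2 (\<lambda>x. \<Sum>i\<in>I. f i x)" by (induction I rule: infinite_finite_induct) (auto intro: L2_add)

lemma L2_norm: "L2 f \<Longrightarrow> L2 (\<lambda>x. norm (f x))" by (auto simp: square_integrable_def)

lemma L2_bounded_mult:
 fixes f :: "'a::euclidean_space \<Rightarrow> real" and g :: "'a \<Rightarrow> 'b::euclidean_space"
 assumes "f \<in> borel_measurable borel" "\<And>x. \<bar>f x\<bar> \<le> C" "L2 g"
 shows "L2 (\<lambda>x. f x *R g x)"
proof (rule L2_bound[OF _ assms(3), where C = C])
 have [measurable]: "f \<in> borel_measurable borel" "g \<in> borel_measurable borel"
  using assms by (auto simp: square_integrable_def)
 show "(\<lambda>x. f x *R g x) \<in> borel_measurable borel" by measurable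
qed (use assms(2) in \<open>auto intro!: mult_right_mono\<close>)

lemma integrable_power2: "L2 f \<Longrightarrow> integrable lborel (\<lambda>x. (norm (f x))\<^sup>2)" by (simp add: square_integrable_def)

lemma integrable_norm_mult:
 assumes "L2 f" "L2 g"
 shows "integrable lborel (\<lambda>x. norm (f x) * norm (g x))"
proof -
 have [measurable]: "f \<in> borel_measurable borel" "g \<in> borel_measurable borel"
  using assms by (auto simp: square_integrable_def)
 have "integrable lborel (\<lambda>x. (norm (f x))\<^sup>2 + (norm (g x))\<^sup>2)" using assms by (simp add: square_integrable_def)
 then show ?thesis
 proof (rule LINT_integrable_bound)
  show "AE x in lborel. norm (norm (f x) * norm (g x)) \<le> norm ((norm (f x))\<^sup>2 + (norm (g x))\<^sup>2)"
  proof (rule AE_I2)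
   fix x
   have "norm (f x) * norm (g x) \<le> (norm (f x))\<^sup>2 + (norm (g x))\<^sup>2"
    using sum_squares_bound[of "norm (f x)" "norm (g x)"] mult_nonneg_nonneg[OF norm_ge_zero[of "f x"] norm_ge_zero[of "g x"]]
    by linarith
   then show "norm (norm (f x) * norm (g x)) \<le> norm ((norm (f x))\<^sup>2 + (norm (g x))\<^sup>2)" by simp
  qed
 qed measurable
qed

text \<open>Cauchy-Schwarz for nonnegative integrals gives the squared inequality in the extended
  reals; finiteness of both norms brings it back to the reals.\<close>

lemma integral_norm_mult_le:
 assumes "L2 f" "L2 g"
 shows "(LINT x|lborel. norm (f x) * norm (g x)) \<le> l2 f * l2 g"
proof -
 have [measurable]: "f \<in> borel_measurable borel" "g \<in> borel_measurable borel"
  using assms by (auto simp: square_integrable_def)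
 have nn: "ennreal (LINT x|lborel. norm (f x) * norm (g x)) = (\<integral>\<^sup>+x. ennreal (norm (f x)) * ennreal (norm (g x)) \<partial>lborel)"
  using nn_integral_eq_integral[OF integrable_norm_mult[OF assms]] by (simp add: ennreal_mult)
 have sq: "(\<integral>\<^sup>+x. (ennreal (norm (h x)))\<^sup>2 \<partial>lborel) = ennreal ((l2 h)\<^sup>2)" if "L2 h"
  for h :: "'d::euclidean_space \<Rightarrow> 'e::euclidean_space"
  using nn_integral_eq_integral[OF integrable_power2[OF that]] by (simp add: ennreal_power l2_power2)
 have "(ennreal (LINT x|lborel. norm (f x) * norm (g x)))\<^sup>2 \<le> ennreal ((l2 f)\<^sup>2) * ennreal ((l2 g)\<^sup>2)"
  unfolding nn sq[OF assms(1), symmetric] sq[OF assms(2), symmetric] by (rule Cauchy_Schwarz_nn_integral) measurable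
 then have "ennreal ((LINT x|lborel. norm (f x) * norm (g x))\<^sup>2) \<le> ennreal ((l2 f * l2 g)\<^sup>2)"
  by (simp add: ennreal_power power_mult_distrib flip: ennreal_mult)
 then have "(LINT x|lborel. norm (f x) * norm (g x))\<^sup>2 \<le> (l2 f * l2 g)\<^sup>2" by (subst (asm) ennreal_le_iff) auto
 then show ?thesis by (rule power2_le_imp_le) simp
qed

lemma integrable_bilinear:
 fixes L :: "'b::euclidean_space \<Rightarrow> 'c::euclidean_space \<Rightarrow> 'd::euclidean_space"
  and f :: "'a::euclidean_space \<Rightarrow> 'b"
 assumes L: "bounded_bilinear L" and "L2 f" "L2 g"
 shows "integrable lborel (\<lambda>x. L (f x) (g x))"
proof -
 interpret bounded_bilinear L by fact
 have [measurable]: "f \<in> borel_measurable borel" "g \<in> borel_measurable borel"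
  using assms by (auto simp: square_integrable_def)
 obtain K where K: "\<And>a b. norm (L a b) \<le> norm a * norm b * K" using bounded by blast
 have *: "continuous_on UNIV (\<lambda>p. L (fst p) (snd p))" by (intro continuous_on L continuous_intros)
 have "(\<lambda>x. (\<lambda>p. L (fst p) (snd p)) (f x, g x)) \<in> borel_measurable lborel"
  using borel_measurable_continuous_onI[OF *] by measurable
 then have m: "(\<lambda>x. L (f x) (g x)) \<in> borel_measurable lborel" by simp
 show ?thesis
 proof (rule LINT_integrable_bound)
  show "integrable lborel (\<lambda>x. norm (f x) * norm (g x) * K)"
   by (intro integrable_mult_left integrable_norm_mult assms)
  show "AE x in lborel. norm (L (f x) (g x)) \<le> norm (norm (f x) * norm (g x) * K)"
   by (intro AE_I2 order_trans[OF K]) simp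
 qed (rule m)
qed

lemma integrable_inner:
 "L2 f \<Longrightarrow> L2 g \<Longrightarrow> integrable lborel (\<lambda>x. f x \<bullet> g x)" by (rule integrable_bilinear[OF bounded_bilinear_inner])

lemma integral_inner_le:
 assumes "L2 f" "L2 g"
 shows "\<bar>LINT x|lborel. f x \<bullet> g x\<bar> \<le> l2 f * l2 g"
proof -
 have "\<bar>LINT x|lborel. f x \<bullet> g x\<bar> \<le> (LINT x|lborel. norm (f x \<bullet> g x))"
  using integral_norm_bound[of lborel "\<lambda>x. f x \<bullet> g x"] by simp
 also have "\<dots> \<le> (LINT x|lborel. norm (f x) * norm (g x))"
  by (intro integral_mono integrable_norm integrable_inner integrable_norm_mult assms)
    (simp add: Cauchy_Schwarz_ineq2)
 also have "\<dots> \<le> l2 f * l2 g" by (rule integral_norm_mult_le[OF assms])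
 finally show ?thesis .
qed

lemma l2_power2_add:
 assumes "L2 f" "L2 g"
 shows "(l2 (\<lambda>x. f x + g x))\<^sup>2 = (l2 f)\<^sup>2 + (l2 g)\<^sup>2 + 2 * (LINT x|lborel. f x \<bullet> g x)"
proof -
 have "(norm (f x + g x))\<^sup>2 = (norm (f x))\<^sup>2 + (norm (g x))\<^sup>2 + 2 * (f x \<bullet> g x)" for x
  by (simp add: power2_norm_eq_inner inner_add_left inner_add_right inner_commute)
 then show ?thesis using assms integrable_inner[OF assms] by (simp add: l2_power2 integrable_power2)
qed

lemma l2_scaleR [simp]: "l2 (\<lambda>x. c *R f x) = \<bar>c\<bar> * l2 f" by (simp add: l2_def power_mult_distrib real_sqrt_mult)

lemma l2_minus [simp]: "l2 (\<lambda>x. - f x) = l2 f" by (simp add: l2_def)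

lemma l2_norm_fun [simp]: "l2 (\<lambda>x. norm (f x)) = l2 f" by (simp add: l2_def)

lemma l2_zero [simp]: "l2 (\<lambda>x. 0) = 0" by (simp add: l2_def)

lemma l2_power2_diff:
 assumes "L2 f" "L2 g"
 shows "(l2 (\<lambda>x. f x - g x))\<^sup>2 = (l2 f)\<^sup>2 + (l2 g)\<^sup>2 - 2 * (LINT x|lborel. f x \<bullet> g x)"
 using l2_power2_add[OF assms(1) L2_minus[OF assms(2)]] by simp

lemma l2_triangle:
 assumes "L2 f" "L2 g"
 shows "l2 (\<lambda>x. f x + g x) \<le> l2 f + l2 g"
proof (rule power2_le_imp_le)
 have "(LINT x|lborel. f x \<bullet> g x) \<le> l2 f * l2 g" using integral_inner_le[OF assms] by linarith
 then show "(l2 (\<lambda>x. f x + g x))\<^sup>2 \<le> (l2 f + l2 g)\<^sup>2" unfolding l2_power2_add[OF assms] by (simp add: power2_sum)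
qed simp

lemma l2_triangle_diff:
 assumes "L2 f" "L2 g"
 shows "l2 (\<lambda>x. f x - g x) \<le> l2 f + l2 g" using l2_triangle[OF assms(1) L2_minus[OF assms(2)]] by simp

lemma l2_commute: "l2 (\<lambda>x. f x - g x) = l2 (\<lambda>x. g x - f x)" by (simp add: l2_def norm_minus_commute)

lemma l2_diff_triangle:
 assumes "L2 f" "L2 g" "L2 h"
 shows "l2 (\<lambda>x. f x - h x) \<le> l2 (\<lambda>x. f x - g x) + l2 (\<lambda>x. g x - h x)"
 using l2_triangle[OF L2_diff[OF assms(1,2)] L2_diff[OF assms(2,3)]] by simp

lemma abs_l2_diff_le:
 assumes "L2 f" "L2 g"
 shows "\<bar>l2 f - l2 g\<bar> \<le> l2 (\<lambda>x. f x - g x)" using l2_triangle[OF L2_diff[OF assms] assms(2)]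
  l2_triangle[OF L2_diff[OF assms(2,1)] assms(1)] l2_commute[of f g] by simp

lemma l2_mono:
 assumes "f \<in> borel_measurable borel" "L2 g"
  and "AE x in lborel. norm (f x) \<le> norm (g x)"
 shows "l2 f \<le> l2 g"
proof -
 have f: "L2 f" by (rule L2_bound[OF assms(1,2), where C = 1]) (use assms(3) in simp)
 show ?thesis unfolding l2_def by (intro real_sqrt_le_mono integral_mono_AE integrable_power2 f assms(2))
    (use assms(3) in \<open>auto intro: power_mono\<close>)
qed

lemma l2_cong_AE:
 assumes "f \<in> borel_measurable borel" "g \<in> borel_measurable borel"
  "AE x in lborel. norm (f x) = norm (g x)"
 shows "l2 f = l2 g"
proof -
 have "(LINT x|lborel. (norm (f x))\<^sup>2) = (LINT x|lborel. (norm (g x))\<^sup>2)" using assms by (intro integral_cong_AE) auto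
 then show ?thesis by (simp add: l2_def)
qed

lemma L2_cong_AE:
 assumes "f \<in> borel_measurable borel" "L2 g" "AE x in lborel. f x = g x"
 shows "L2 f" by (rule L2_bound[OF assms(1,2), where C = 1]) (use assms(3) in auto)

lemma l2_eq_0_iff:
 assumes "L2 f"
 shows "l2 f = 0 \<longleftrightarrow> (AE x in lborel. f x = 0)"
 using integral_nonneg_eq_0_iff_AE[OF integrable_power2[OF assms]] by (simp add: l2_def)

lemma nn_integral_l2:
 assumes "L2 f"
 shows "(\<integral>\<^sup>+x. ennreal ((norm (f x))\<^sup>2) \<partial>lborel) = ennreal ((l2 f)\<^sup>2)"
 by (simp add: l2_power2 nn_integral_eq_integral[OF integrable_power2[OF assms]])

text \<open>Fatou's lemma and Tonelli's theorem deliver bounds on nonnegative integrals; this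
  converts them into square integrability and a norm bound in one go.\<close>

lemma square_integrableI_nn:
 assumes [measurable]: "f \<in> borel_measurable borel"
  and le: "(\<integral>\<^sup>+x. ennreal ((norm (f x))\<^sup>2) \<partial>lborel) \<le> ennreal (c\<^sup>2)" and c: "0 \<le> c"
 shows "L2 f" "l2 f \<le> c"
proof -
 have "integrable lborel (\<lambda>x. (norm (f x))\<^sup>2)"
  using le by (intro integrableI_nonneg) (auto simp: less_top[symmetric] top_unique)
 then show *: "L2 f" by (simp add: square_integrable_def)
 have "(l2 f)\<^sup>2 \<le> c\<^sup>2" using le unfolding nn_integral_l2[OF *] by (simp add: ennreal_le_iff)
 then show "l2 f \<le> c" using c by (rule power2_le_imp_le)
qed

subsection \<open>Translations\<close>

lemma integral_shift:
 fixes f :: "'a::euclidean_space \<Rightarrow> 'b::{banach, second_countable_topology}"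
 assumes [measurable]: "f \<in> borel_measurable borel"
 shows "(LINT x|lborel. f (x + a)) = (LINT x|lborel. f x)"
proof -
 have "(LINT x|lborel. f x) = (LINT x|distr lborel borel ((+) a). f x)" by (simp only: lborel_distr_plus)
 also have "\<dots> = (LINT x|lborel. f (x + a))" by (subst integral_distr) (auto simp: add.commute)
 finally show ?thesis by simp
qed

lemma integrable_shift:
 fixes f :: "'a::euclidean_space \<Rightarrow> 'b::{banach, second_countable_topology}"
 assumes "integrable lborel f"
 shows "integrable lborel (\<lambda>x. f (x + a))"
proof -
 have "integrable (distr lborel borel ((+) a)) f" by (simp only: lborel_distr_plus assms)
 then have "integrable lborel (\<lambda>x. f (a + x))" by (subst (asm) integrable_distr_eq) (use assms in auto)
 then show ?thesis by (simp add: add.commute)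
qed

lemma nn_integral_shift:
 assumes [measurable]: "f \<in> borel_measurable borel"
 shows "(\<integral>\<^sup>+x. f (x + a) \<partial>lborel) = (\<integral>\<^sup>+x. f x \<partial>(lborel :: 'a::euclidean_space measure))"
proof -
 have "(\<integral>\<^sup>+x. f x \<partial>lborel) = (\<integral>\<^sup>+x. f x \<partial>(distr lborel borel ((+) a)))" by (simp only: lborel_distr_plus)
 also have "\<dots> = (\<integral>\<^sup>+x. f (x + a) \<partial>lborel)" by (subst nn_integral_distr) (auto simp: add.commute)
 finally show ?thesis by simp
qed

lemma AE_shift:
 fixes a :: "'a::euclidean_space"
 assumes "AE x in lborel. P x"
 shows "AE x in lborel. P (x + a)"
proof -
 have m: "(+) a \<in> measurable lborel (borel :: 'a measure)" by simp
 obtain N where N: "N \<in> null_sets lborel" "{x. \<not> P x} \<subseteq> N" using assms by (auto simp: eventually_ae_filter)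
 have "emeasure (distr lborel borel ((+) a)) N = 0" using N(1) by (simp only: lborel_distr_plus) auto
 then have "emeasure lborel ((+) a -` N) = 0" using N(1) by (subst (asm) emeasure_distr) (auto simp: null_sets_def)
 moreover have "(+) a -` N \<in> sets lborel" using N(1) measurable_sets[OF m, of N] by (auto simp: null_sets_def)
 ultimately have "(+) a -` N \<in> null_sets lborel" by (simp add: null_sets_def)
 moreover have "{x. \<not> P (x + a)} \<subseteq> (+) a -` N" using N(2) by (auto simp: add.commute)
 ultimately show ?thesis by (auto simp: eventually_ae_filter)
qed

lemma L2_shift:
 "L2 f \<Longrightarrow> L2 (\<lambda>x. f (x + a))" unfolding square_integrable_def using integrable_shift[of "\<lambda>x. (norm (f x))\<^sup>2" a] by auto

lemma l2_shift: "L2 f \<Longrightarrow> l2 (\<lambda>x. f (x + a)) = l2 f"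
 unfolding l2_def by (subst integral_shift[of "\<lambda>x. (norm (f x))\<^sup>2" a]) auto

subsection \<open>Limits\<close>

lemma tendsto_integral_inner:
 assumes f: "\<And>k. L2 (f k)" "L2 f'" "(\<lambda>k. l2 (\<lambda>x. f k x - f' x)) ----> 0"
  and g: "\<And>k. L2 (g k)" "L2 g'" "(\<lambda>k. l2 (\<lambda>x. g k x - g' x)) ----> 0"
 shows "(\<lambda>k. LINT x|lborel. f k x \<bullet> g k x) ----> (LINT x|lborel. f' x \<bullet> g' x)"
proof -
 note I = integrable_inner
 \<comment> \<open>Expanding around the limits leaves the product of both errors and two terms with
   one error each, all controlled by Cauchy-Schwarz.\<close>
 have eq: "(LINT x|lborel. f k x \<bullet> g k x) - (LINT x|lborel. f' x \<bullet> g' x) =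
   (LINT x|lborel. (f k x - f' x) \<bullet> (g k x - g' x)) + (LINT x|lborel. (f k x - f' x) \<bullet> g' x)
    + (LINT x|lborel. f' x \<bullet> (g k x - g' x))" for k
  using I[OF f(1)[of k] g(1)[of k]] I[OF f(2) g(2)] I[OF f(1)[of k] g(2)] I[OF f(2) g(1)[of k]]
  by (simp add: inner_diff_left inner_diff_right)
 have "\<bar>(LINT x|lborel. f k x \<bullet> g k x) - (LINT x|lborel. f' x \<bullet> g' x)\<bar>
   \<le> l2 (\<lambda>x. f k x - f' x) * l2 (\<lambda>x. g k x - g' x) + l2 (\<lambda>x. f k x - f' x) * l2 g'
     + l2 f' * l2 (\<lambda>x. g k x - g' x)" for k unfolding eq
  using integral_inner_le[OF L2_diff[OF f(1)[of k] f(2)] L2_diff[OF g(1)[of k] g(2)]]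
   integral_inner_le[OF L2_diff[OF f(1)[of k] f(2)] g(2)]
   integral_inner_le[OF f(2) L2_diff[OF g(1)[of k] g(2)]] by linarith
 moreover have "(\<lambda>k. l2 (\<lambda>x. f k x - f' x) * l2 (\<lambda>x. g k x - g' x) + l2 (\<lambda>x. f k x - f' x) * l2 g'
     + l2 f' * l2 (\<lambda>x. g k x - g' x)) ----> 0 * 0 + 0 * l2 g' + l2 f' * 0" by (intro tendsto_intros f g)
 ultimately have "(\<lambda>k. (LINT x|lborel. f k x \<bullet> g k x) - (LINT x|lborel. f' x \<bullet> g' x)) ----> 0"
  unfolding mult_zero_left mult_zero_right add_0_right
  by (elim Lim_null_comparison[rotated]) (simp only: real_norm_def always_eventually simp_thms)
 then show ?thesis by (rule LIM_zero_cancel)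
qed

text \<open>A subsequence with distances \<open>2\<^sup>-\<^sup>k\<close> converges almost everywhere because
 \<open>\<Sum>\<^sub>k 2\<^sup>k |f\<^sub>k\<^sub>+\<^sub>1 - f\<^sub>k|\<^sup>2\<close> is integrable; Fatou's lemma does the rest.\<close>

lemma l2_complete:
 fixes f :: "nat \<Rightarrow> 'a::euclidean_space \<Rightarrow> 'b::euclidean_space"
 assumes f: "\<And>k. L2 (f k)"
  and C: "\<And>e. 0 < e \<Longrightarrow> \<exists>N. \<forall>j\<ge>N. \<forall>k\<ge>N. l2 (\<lambda>x. f j x - f k x) < e"
 obtains g r where "L2 g" "(\<lambda>k. l2 (\<lambda>x. f k x - g x)) ----> 0"
  "strict_mono (r :: nat \<Rightarrow> nat)" "AE x in lborel. (\<lambda>k. f (r k) x) ----> g x"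
proof -
 have [measurable]: "f k \<in> borel_measurable borel" for k using f by (auto simp: square_integrable_def)
 have "\<exists>r :: nat \<Rightarrow> nat. \<forall>n. (\<forall>j\<ge>r n. \<forall>k\<ge>r n. l2 (\<lambda>x. f j x - f k x) < (1/2)^n) \<and> r n < r (Suc n)"
 proof (rule dependent_nat_choice)
  show "\<exists>N. \<forall>j\<ge>N. \<forall>k\<ge>N. l2 (\<lambda>x. f j x - f k x) < (1/2)^0" using C[of 1] by simp
 next
  fix M n assume "\<forall>j\<ge>M. \<forall>k\<ge>M. l2 (\<lambda>x. f j x - f k x) < (1/2)^n"
  obtain N where "\<forall>j\<ge>N. \<forall>k\<ge>N. l2 (\<lambda>x. f j x - f k x) < (1/2)^Suc n" using C[of "(1/2)^Suc n"] by auto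
  then show "\<exists>N. (\<forall>j\<ge>N. \<forall>k\<ge>N. l2 (\<lambda>x. f j x - f k x) < (1/2)^Suc n) \<and> M < N" by (intro exI[of _ "max N (Suc M)"]) auto
 qed
 then obtain r :: "nat \<Rightarrow> nat" where r: "\<And>n j k. j \<ge> r n \<Longrightarrow> k \<ge> r n \<Longrightarrow> l2 (\<lambda>x. f j x - f k x) < (1/2)^n"
  and "\<And>n. r n < r (Suc n)" by blast
 then have sm: "strict_mono r" by (simp add: strict_mono_Suc_iff)
 define d where "d n x = norm (f (r (Suc n)) x - f (r n) x)" for n x
 have [measurable]: "d n \<in> borel_measurable borel" for n unfolding d_def by measurable
 have "(\<integral>\<^sup>+x. (\<Sum>n. ennreal (2^n * (d n x)\<^sup>2)) \<partial>lborel) = (\<Sum>n. \<integral>\<^sup>+x. ennreal (2^n * (d n x)\<^sup>2) \<partial>lborel)"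
  by (rule nn_integral_suminf) measurable
 also have "\<dots> \<le> (\<Sum>n. ennreal ((1/2)^n))"
 proof (rule suminf_le)
  fix n
  have "l2 (\<lambda>x. f (r (Suc n)) x - f (r n) x) \<le> (1/2)^n"
   using r[of n "r (Suc n)" "r n"] sm by (simp add: strict_mono_less_eq less_imp_le)
  then have "(l2 (\<lambda>x. f (r (Suc n)) x - f (r n) x))\<^sup>2 \<le> ((1/2)^n)\<^sup>2" by (intro power_mono) auto
  moreover have "(\<integral>\<^sup>+x. ennreal (2^n * (d n x)\<^sup>2) \<partial>lborel) = ennreal (2^n * (l2 (\<lambda>x. f (r (Suc n)) x - f (r n) x))\<^sup>2)"
   using nn_integral_l2[OF L2_diff[OF f f], of "r (Suc n)" "r n"] by (simp add: d_def ennreal_mult nn_integral_cmult)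
  moreover have "2^n * ((1/2)^n)\<^sup>2 = (1/2::real)^n" by (simp add: power2_eq_square power_one_over)
  ultimately show "(\<integral>\<^sup>+x. ennreal (2^n * (d n x)\<^sup>2) \<partial>lborel) \<le> ennreal ((1/2)^n)"
   by (simp only:) (rule ennreal_leI, erule subst, erule mult_left_mono, simp)
 qed auto
 also have "\<dots> = ennreal (\<Sum>n. (1/2)^n)" by (intro suminf_ennreal2) (auto intro: summable_geometric)
 finally have "(\<integral>\<^sup>+x. (\<Sum>n. ennreal (2^n * (d n x)\<^sup>2)) \<partial>lborel) \<noteq> \<infinity>" by (auto simp: top_unique)
 then have "AE x in lborel. (\<Sum>n. ennreal (2^n * (d n x)\<^sup>2)) \<noteq> \<infinity>" by (intro nn_integral_noteq_infinite) auto
 then have conv: "AE x in lborel. convergent (\<lambda>n. f (r n) x)"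
 proof eventually_elim
  case (elim x)
  then have e: "(\<Sum>n. ennreal (2^n * (d n x)\<^sup>2)) \<noteq> top" by (simp only: infinity_ennreal_def not_False_eq_True)
  have "summable (\<lambda>n. 2^n * (d n x)\<^sup>2)" by (rule summable_suminf_not_top[OF _ e]) simp
  then have "(\<lambda>n. 2^n * (d n x)\<^sup>2) ----> 0" by (rule summable_LIMSEQ_zero)
  then have "Bseq (\<lambda>n. 2^n * (d n x)\<^sup>2)" by (intro convergent_imp_Bseq convergentI)
  then obtain K where K: "\<And>n. norm (2^n * (d n x)\<^sup>2) \<le> K" by (elim BseqE) blast
  \<comment> \<open>The weighted squares are bounded by \<open>K\<close>, so the increments decay
    geometrically with ratio \<open>sqrt (1/2)\<close>; this makes the telescoping series absolutely
    summable.\<close>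
  have dle: "d n x \<le> sqrt K * (sqrt (1/2))^n" for n
  proof -
   have "2^n * (d n x)\<^sup>2 \<le> K" using K[of n] by simp
   then have "(1/2)^n * (2^n * (d n x)\<^sup>2) \<le> (1/2)^n * K" by (intro mult_left_mono) auto
   moreover have "(1/2)^n * (2^n * (d n x)\<^sup>2) = (d n x)\<^sup>2" by (simp add: power_one_over)
   ultimately have "sqrt ((d n x)\<^sup>2) \<le> sqrt ((1/2)^n * K)" by (intro real_sqrt_le_mono) simp
   moreover have "sqrt ((d n x)\<^sup>2) = d n x" by (simp add: d_def)
   moreover have "sqrt ((1/2)^n * K) = sqrt K * (sqrt (1/2))^n"
    by (simp only: real_sqrt_mult real_sqrt_power mult.commute)
   ultimately show ?thesis by simp
  qed
  have "summable (\<lambda>n. norm (f (r (Suc n)) x - f (r n) x))"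
  proof (rule summable_comparison_test')
   have "norm (sqrt (1/2)) < 1" by (simp add: real_sqrt_divide)
   then show "summable (\<lambda>n. sqrt K * (sqrt (1/2))^n)" by (intro summable_mult summable_geometric)
  next
   fix n :: nat assume "0 \<le> n"
   show "norm (norm (f (r (Suc n)) x - f (r n) x)) \<le> sqrt K * (sqrt (1/2))^n"
    using dle[of n] by (simp only: d_def real_norm_def abs_norm_cancel)
  qed
  then have "summable (\<lambda>n. f (r (Suc n)) x - f (r n) x)" by (rule summable_norm_cancel)
  then have "convergent (\<lambda>n. f (r n) x - f (r 0) x)"
   unfolding summable_iff_convergent using sum_lessThan_telescope[of "\<lambda>n. f (r n) x"] by simp
  then have "convergent (\<lambda>n. (f (r n) x - f (r 0) x) + f (r 0) x)" by (intro convergent_add convergent_const)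
  then show ?case by simp
 qed
 define g where "g x = lim (\<lambda>n. f (r n) x)" for x
 have [measurable]: "g \<in> borel_measurable borel" unfolding g_def by (rule borel_measurable_lim_metric) measurable
 have ae: "AE x in lborel. (\<lambda>k. f (r k) x) ----> g x"
  using conv unfolding g_def by eventually_elim (rule convergent_LIMSEQ_iff[THEN iffD1])
 have key: "(\<integral>\<^sup>+x. ennreal ((norm (f k x - g x))\<^sup>2) \<partial>lborel) \<le> ennreal (((1/2)^n)\<^sup>2)" if "k \<ge> r n" for n k
 proof -
  have "(\<integral>\<^sup>+x. ennreal ((norm (f k x - g x))\<^sup>2) \<partial>lborel) =
     (\<integral>\<^sup>+x. liminf (\<lambda>m. ennreal ((norm (f k x - f (r m) x))\<^sup>2)) \<partial>lborel)"
  proof (rule nn_integral_cong_AE, use ae in eventually_elim)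
   case (elim x)
   then have "(\<lambda>m. ennreal ((norm (f k x - f (r m) x))\<^sup>2)) ----> ennreal ((norm (f k x - g x))\<^sup>2)"
    by (intro tendsto_ennrealI tendsto_intros)
   then show ?case by (rule lim_imp_Liminf[OF trivial_limit_sequentially, symmetric])
  qed
  also have "\<dots> \<le> liminf (\<lambda>m. \<integral>\<^sup>+x. ennreal ((norm (f k x - f (r m) x))\<^sup>2) \<partial>lborel)"
   by (rule nn_integral_liminf[of "\<lambda>m x. ennreal ((norm (f k x - f (r m) x))\<^sup>2)"]) measurable
  also have "\<dots> \<le> liminf (\<lambda>m. ennreal (((1/2)^n)\<^sup>2))"
  proof (rule Liminf_mono[OF eventually_sequentiallyI[of n]])
   fix m assume "n \<le> m"
   then have "r m \<ge> r n" using strict_mono_less_eq[OF sm] by blast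
   then have "l2 (\<lambda>x. f k x - f (r m) x) \<le> (1/2)^n" using r[OF that, of "r m"] by linarith
   then show "(\<integral>\<^sup>+x. ennreal ((norm (f k x - f (r m) x))\<^sup>2) \<partial>lborel) \<le> ennreal (((1/2)^n)\<^sup>2)"
    unfolding nn_integral_l2[OF L2_diff[OF f f]] by (intro ennreal_leI power_mono l2_nonneg)
  qed
  also have "\<dots> = ennreal (((1/2)^n)\<^sup>2)" by (rule Liminf_const[OF trivial_limit_sequentially])
  finally show ?thesis .
 qed
 have m: "(\<lambda>x. f k x - g x) \<in> borel_measurable borel" for k by measurable
 have sd: "L2 (\<lambda>x. f k x - g x)" "l2 (\<lambda>x. f k x - g x) \<le> (1/2)^n" if "k \<ge> r n" for k n
  using square_integrableI_nn[OF m key[OF that]] by simp_all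
 have "L2 (\<lambda>x. f (r 0) x - (f (r 0) x - g x))" by (intro L2_diff[of "f (r 0)"] f sd[of 0]) simp
 then have "L2 g" by simp
 moreover have "(\<lambda>k. l2 (\<lambda>x. f k x - g x)) ----> 0"
 proof (rule LIMSEQ_I)
  fix e :: real assume "e > 0"
  then obtain n where "(1/2)^n < e" using real_arch_pow_inv[of e "1/2"] by auto
  then show "\<exists>N. \<forall>k\<ge>N. norm (l2 (\<lambda>x. f k x - g x) - 0) < e" using sd(2)[of n] by (intro exI[of _ "r n"]) force
 qed
 ultimately show ?thesis using that sm ae by blast
qed

section \<open>Test functions and the fundamental lemma\<close>

text \<open>Differentiability of order \<open>k\<close> is expressed by the existence of a
  derivative of order \<open>k - 1\<close>, so that closure under sums, products and affine
  substitutions is an induction without formulas for higher derivatives.\<close>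

primrec diff1 :: "nat \<Rightarrow> (real \<Rightarrow> real) \<Rightarrow> bool" where
 "diff1 0 g \<longleftrightarrow> True"
| "diff1 (Suc k) g \<longleftrightarrow> (\<exists>g'. (\<forall>x. (g has_real_derivative g' x) (at x)) \<and> diff1 k g')"

definition smooth1 :: "(real \<Rightarrow> real) \<Rightarrow> bool" where
 "smooth1 g \<longleftrightarrow> (\<forall>k. diff1 k g)"

lemma diff1_mono: "diff1 (Suc k) g \<Longrightarrow> diff1 k g"
proof (induction k arbitrary: g)
 case (Suc k)
 then obtain g' where "\<forall>x. (g has_real_derivative g' x) (at x)" "diff1 (Suc k) g'" by (subst (asm) diff1.simps) blast
 with Suc.IH show ?case by auto
qed simp

lemma diff1_add: "diff1 k f \<Longrightarrow> diff1 k g \<Longrightarrow> diff1 k (\<lambda>x. f x + g x)"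
proof (induction k arbitrary: f g)
 case (Suc k)
 then obtain f' g' where "\<And>x. (f has_real_derivative f' x) (at x)" "diff1 k f'"
   "\<And>x. (g has_real_derivative g' x) (at x)" "diff1 k g'" by auto
 with Suc.IH[of f' g'] show ?case by (auto intro!: exI[of _ "\<lambda>x. f' x + g' x"] DERIV_add)
qed simp

lemma diff1_mult: "diff1 k f \<Longrightarrow> diff1 k g \<Longrightarrow> diff1 k (\<lambda>x. f x * g x)"
proof (induction k arbitrary: f g)
 case (Suc k)
 then obtain f' g' where *: "\<And>x. (f has_real_derivative f' x) (at x)" "diff1 k f'"
   "\<And>x. (g has_real_derivative g' x) (at x)" "diff1 k g'" by auto
 have "diff1 k (\<lambda>x. f' x * g x + g' x * f x)"
  using * diff1_mono[OF Suc.prems(1)] diff1_mono[OF Suc.prems(2)] by (intro diff1_add Suc.IH)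
 then show ?case using * by (auto intro!: exI[of _ "\<lambda>x. f' x * g x + g' x * f x"] DERIV_mult)
qed simp

lemma diff1_affine: "diff1 k f \<Longrightarrow> diff1 k (\<lambda>x. c * f (a * x + b))"
proof (induction k arbitrary: f c)
 case (Suc k)
 then obtain f' where *: "\<And>x. (f has_real_derivative f' x) (at x)" "diff1 k f'" by auto
 have "((\<lambda>x. c * f (a * x + b)) has_real_derivative (c * a) * f' (a * x + b)) (at x)" for x
  by (rule derivative_eq_intros DERIV_chain2[OF *(1)] refl | simp)+
 with Suc.IH[OF *(2), of "c * a"] show ?case by (auto intro!: exI[of _ "\<lambda>x. (c * a) * f' (a * x + b)"])
qed simp

text \<open>The classical flat function at 0 with a polynomial factor in \<open>1 / x\<close>: this
  family is closed under differentiation, so smoothness at 0 needs only one computation.\<close>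

definition flat_exp :: "real poly \<Rightarrow> real \<Rightarrow> real" where
 "flat_exp p x = (if 0 < x then poly p (1 / x) * exp (- 1 / x) else 0)"

lemma poly_exp_decay: "((\<lambda>y::real. poly p y * exp (- y)) \<longlongrightarrow> 0) at_top"
proof -
 have "((\<lambda>y. \<Sum>i\<le>degree p. coeff p i * (y ^ i / exp y)) \<longlongrightarrow> (\<Sum>i\<le>degree p. coeff p i * 0)) at_top"
  by (intro tendsto_intros tendsto_power_div_exp_0)
 then show ?thesis by (simp add: poly_altdef sum_distrib_right exp_minus divide_inverse mult.assoc)
qed

lemma flat_exp_decay: "((\<lambda>x. flat_exp p x / x) \<longlongrightarrow> 0) (at 0)"
proof -
 have "((\<lambda>y. poly ([:0,1:] * p) y * exp (- y)) \<longlongrightarrow> 0) at_top" by (rule poly_exp_decay)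
 then have "((\<lambda>x. poly ([:0,1:] * p) (inverse x) * exp (- inverse x)) \<longlongrightarrow> 0) (at_right 0)"
  by (rule filterlim_compose[OF _ filterlim_inverse_at_top_right])
 moreover have "\<forall>\<^sub>F x::real in at_right 0. poly ([:0,1:] * p) (inverse x) * exp (- inverse x) = flat_exp p x / x"
  by (auto simp: eventually_at_filter flat_exp_def field_simps intro!: always_eventually)
 ultimately have R: "((\<lambda>x. flat_exp p x / x) \<longlongrightarrow> 0) (at_right 0)" by (rule Lim_transform_eventually)
 have "\<forall>\<^sub>F x::real in at_left 0. flat_exp p x / x = 0"
  by (auto simp: eventually_at_filter flat_exp_def intro!: always_eventually)
 then have L: "((\<lambda>x. flat_exp p x / x) \<longlongrightarrow> 0) (at_left 0)" by (rule tendsto_eventually)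
 show ?thesis using L R by (simp add: filterlim_split_at)
qed

text \<open>In the variable \<open>y = 1 / x\<close> the operator d/dx is \<open>- y^2\<close> times
  d/dy, which sends \<open>p(y) exp(-y)\<close> to \<open>y^2 (p - p')(y) exp(-y)\<close>; at 0 the
  difference quotient tends to zero by the decay of the exponential.\<close>

lemma flat_exp_derivative:
 "(flat_exp p has_real_derivative flat_exp ([:0,0,1:] * (p - pderiv p)) x) (at x)"
proof -
 consider "0 < x" | "x < 0" | "x = 0" by linarith
 then show ?thesis
 proof cases
  case 1
  have "((\<lambda>x. poly p (1 / x) * exp (- 1 / x)) has_real_derivative
    poly ([:0,0,1:] * (p - pderiv p)) (1 / x) * exp (- 1 / x)) (at x)"
   using 1 by (auto intro!: derivative_eq_intros DERIV_chain2[OF poly_DERIV] simp: field_simps power2_eq_square)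
  moreover have "\<forall>\<^sub>F y in nhds x. poly p (1 / y) * exp (- 1 / y) = flat_exp p y"
   using eventually_nhds_in_open[of "{0<..}" x] 1 by (auto elim!: eventually_mono simp: flat_exp_def)
  ultimately show ?thesis
   using 1 DERIV_cong_ev[of x x "\<lambda>x. poly p (1 / x) * exp (- 1 / x)" "flat_exp p", OF refl _ refl]
   by (simp add: flat_exp_def)
 next
  case 2
  have "\<forall>\<^sub>F y in nhds x. 0 = flat_exp p y" using eventually_nhds_in_open[of "{..<0}" x] 2
   by (auto elim!: eventually_mono simp: flat_exp_def)
  then show ?thesis using 2 DERIV_cong_ev[of x x "\<lambda>_. 0" "flat_exp p" 0, OF refl _ refl] by (simp add: flat_exp_def)
 next
  case 3
  show ?thesis using flat_exp_decay[of p] unfolding 3 has_field_derivative_iff by (simp add: flat_exp_def)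
 qed
qed

lemma diff1_flat_exp: "diff1 k (flat_exp p)" by (induction k arbitrary: p) (use flat_exp_derivative in auto)

text \<open>Smooth, supported in \<open>(a, b)\<close>, with values in \<open>[0, 1]\<close>, tending to the indicator of
 \<open>(a, b)\<close> as \<open>k \<rightarrow> \<infinity>\<close>.\<close>

definition bump1 :: "nat \<Rightarrow> real \<Rightarrow> real \<Rightarrow> real \<Rightarrow> real" where
 "bump1 k a b x = flat_exp 1 (real k * (x - a)) * flat_exp 1 (real k * (b - x))"

lemma smooth1_bump1: "smooth1 (bump1 k a b)"
proof -
 have "diff1 n (\<lambda>x. (1 * flat_exp 1 (real k * x + (- real k * a))) * (1 * flat_exp 1 (- real k * x + real k * b)))" for n
  by (intro diff1_mult diff1_affine diff1_flat_exp)
 moreover have "(\<lambda>x. (1 * flat_exp 1 (real k * x + (- real k * a))) * (1 * flat_exp 1 (- real k * x + real k * b))) = bump1 k a b"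
  by (auto simp: fun_eq_iff bump1_def algebra_simps)
 ultimately show ?thesis by (simp add: smooth1_def)
qed

lemma bump1_bounds: "0 \<le> bump1 k a b x" "bump1 k a b x \<le> 1"
proof -
 have "0 \<le> flat_exp 1 y \<and> flat_exp 1 y \<le> 1" for y by (auto simp: flat_exp_def)
 then show "0 \<le> bump1 k a b x" "bump1 k a b x \<le> 1" unfolding bump1_def by (auto intro: mult_le_one)
qed

lemma bump1_eq_0: "x \<notin> {a<..<b} \<Longrightarrow> bump1 k a b x = 0"
 by (auto simp: bump1_def flat_exp_def zero_less_mult_iff not_less)

lemma flat_exp_scale_tendsto: "0 < y \<Longrightarrow> (\<lambda>k. flat_exp 1 (real k * y)) ----> 1"
proof -
 assume y: "0 < y"
 have "(\<lambda>k. exp (- (1 / y) * (1 / real k))) ----> exp (- (1 / y) * 0)" by (intro tendsto_intros lim_1_over_n)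
 moreover have "\<forall>\<^sub>F k in sequentially. exp (- (1 / y) * (1 / real k)) = flat_exp 1 (real k * y)"
  using y by (intro eventually_sequentiallyI[of 1]) (auto simp: flat_exp_def field_simps)
 ultimately show ?thesis by (auto intro: Lim_transform_eventually)
qed

lemma bump1_tendsto: "(\<lambda>k. bump1 k a b x) ----> indicator {a<..<b} x"
proof (cases "x \<in> {a<..<b}")
 case True
 then have "(\<lambda>k. flat_exp 1 (real k * (x - a)) * flat_exp 1 (real k * (b - x))) ----> 1 * 1"
  by (intro tendsto_mult flat_exp_scale_tendsto) auto
 then show ?thesis using True by (simp add: bump1_def)
qed (simp add: bump1_eq_0)

text \<open>Products of functions of one coordinate: a partial derivative replaces one factor by its
  derivative and stays in the class, which reduces smoothness in several variables to smoothness on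
  the line.\<close>

definition prod_fun :: "('n::finite \<Rightarrow> real \<Rightarrow> real) \<Rightarrow> real^'n \<Rightarrow> real" where
 "prod_fun g x = (\<Prod>j\<in>UNIV. g j (x $ j))"

lemma smooth1_deriv:
 assumes "smooth1 g"
 obtains g' where "\<And>x. (g has_real_derivative g' x) (at x)" "smooth1 g'"
proof -
 obtain g' where g': "\<And>x. (g has_real_derivative g' x) (at x)"
  using assms unfolding smooth1_def by (meson diff1.simps(2))
 have "diff1 k g'" for k
 proof -
  obtain h where h: "\<And>x. (g has_real_derivative h x) (at x)" "diff1 k h"
   using assms unfolding smooth1_def by (meson diff1.simps(2))
  have "h = g'" using DERIV_unique[OF h(1) g'] by auto
  with h show ?thesis by simp
 qed
 with g' that show ?thesis by (auto simp: smooth1_def)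
qed

lemma prod_fun_has_derivative:
 fixes g :: "'n::finite \<Rightarrow> real \<Rightarrow> real"
 assumes "\<And>j x. (g j has_real_derivative g' j x) (at x)"
 shows "(prod_fun g has_derivative (\<lambda>y. \<Sum>i\<in>UNIV. (g' i (x $ i) * (y $ i)) * (\<Prod>j\<in>UNIV - {i}. g j (x $ j)))) (at x)"
 unfolding prod_fun_def
proof (rule has_derivative_prod)
 fix i :: 'n
 have "((\<lambda>x::real^'n. x $ i) has_derivative (\<lambda>y. y $ i)) (at x)"
  by (rule bounded_linear.has_derivative[OF bounded_linear_vec_nth has_derivative_ident])
 from has_derivative_compose[OF this assms[of i "x $ i", unfolded has_field_derivative_def]]
 show "((\<lambda>x. g i (x $ i)) has_derivative (\<lambda>y. g' i (x $ i) * (y $ i))) (at x)" by simp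
qed

lemma C_k_prod_fun:
 fixes g :: "'n::finite \<Rightarrow> real \<Rightarrow> real"
 assumes "\<And>j. smooth1 (g j)"
 shows "C_k k (prod_fun g)" using assms
proof (induction k arbitrary: g)
 case 0
 have "\<exists>g'. \<forall>x. (g j has_real_derivative g' x) (at x)" for j using smooth1_deriv[OF 0[of j]] by metis
 then obtain g' where g': "\<And>j x. (g j has_real_derivative g' j x) (at x)" by metis
 have "prod_fun g differentiable (at x)" for x
  using prod_fun_has_derivative[of g, OF g'] unfolding differentiable_def by blast
 then show ?case by (auto intro!: continuous_at_imp_continuous_on differentiable_imp_continuous_within)
next
 case (Suc k)
 have "\<exists>g'. (\<forall>x. (g j has_real_derivative g' x) (at x)) \<and> smooth1 g'" for j
  using smooth1_deriv[OF Suc.prems[of j]] by metis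
 then obtain g' where g': "\<And>j x. (g j has_real_derivative g' j x) (at x)" "\<And>j. smooth1 (g' j)" by metis
 note D = prod_fun_has_derivative[of g, OF g'(1)]
 have "partial_deriv i (prod_fun g) = prod_fun (g(i := g' i))" for i
 proof
  fix x :: "real^'n"
  have "partial_deriv i (prod_fun g) x =
    (\<Sum>l\<in>UNIV. (g' l (x $ l) * (axis i 1 $ l)) * (\<Prod>j\<in>UNIV - {l}. g j (x $ j)))"
   unfolding partial_deriv_def frechet_derivative_at[OF D, symmetric] ..
  also have "\<dots> = (\<Sum>l\<in>UNIV. if l = i then g' i (x $ i) * (\<Prod>j\<in>UNIV - {i}. g j (x $ j)) else 0)"
   by (intro sum.cong) (auto simp: axis_def)
  also have "\<dots> = g' i (x $ i) * (\<Prod>j\<in>UNIV - {i}. g j (x $ j))" by simp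
  also have "\<dots> = prod_fun (g(i := g' i)) x"
   unfolding prod_fun_def by (subst prod.remove[of UNIV i]) (auto intro!: prod.cong)
  finally show "partial_deriv i (prod_fun g) x = prod_fun (g(i := g' i)) x" .
 qed
 moreover have "C_k k (prod_fun (g(i := g' i)))" for i by (rule Suc.IH) (use g' Suc.prems in auto)
 moreover have "prod_fun g differentiable (at x)" for x using D[of x] unfolding differentiable_def by blast
 ultimately show ?case by simp
qed

definition bump :: "nat \<Rightarrow> real^'n::finite \<Rightarrow> real^'n \<Rightarrow> real^'n \<Rightarrow> real" where
 "bump k a b = prod_fun (\<lambda>j. bump1 k (a $ j) (b $ j))"

lemma bump_eq_0: "x \<notin> box a b \<Longrightarrow> bump k a b x = 0"
 unfolding bump_def prod_fun_def mem_box_cart by (auto simp: prod_zero_iff intro!: bump1_eq_0)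

lemma test_function_bump: "test_function (bump k a b)"
proof -
 have "{x. bump k a b x \<noteq> 0} \<subseteq> cbox a b" using bump_eq_0 box_subset_cbox by blast
 then have "closure {x. bump k a b x \<noteq> 0} \<subseteq> cbox a b" by (rule closure_minimal) (rule closed_cbox)
 then have "compact (closure {x. bump k a b x \<noteq> 0})"
  using compact_Int_closed[OF compact_cbox closed_closure] by (metis inf.absorb2)
 moreover have "C_k n (bump k a b)" for n unfolding bump_def by (intro C_k_prod_fun smooth1_bump1)
 ultimately show ?thesis by (simp add: test_function_def)
qed

lemma bump_bounds: "0 \<le> bump k a b x" "bump k a b x \<le> 1"
 by (auto simp: bump_def prod_fun_def bump1_bounds intro!: prod_nonneg prod_le_1)

lemma bump_tendsto: "(\<lambda>k. bump k a b x) ----> indicator (box a b) x"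
proof -
 have "(\<lambda>k. bump k a b x) ----> (\<Prod>j\<in>UNIV. indicator {a $ j<..<b $ j} (x $ j))"
  unfolding bump_def prod_fun_def by (intro tendsto_prod bump1_tendsto)
 also have "(\<Prod>j\<in>UNIV. indicator {a $ j<..<b $ j} (x $ j)) = (indicator (box a b) x :: real)"
  by (auto simp: indicator_def mem_box_cart prod_zero_iff split: if_splits)
 finally show ?thesis .
qed

section \<open>Elementary properties of test functions\<close>

lemma test_function_continuous: "test_function \<phi> \<Longrightarrow> continuous_on UNIV \<phi>"
 unfolding test_function_def by (metis C_k.simps(1))

lemma test_function_measurable [measurable_dest]: "test_function \<phi> \<Longrightarrow> \<phi> \<in> borel_measurable borel"
 by (intro borel_measurable_continuous_onI test_function_continuous)

lemma test_function_differentiable: "test_function \<phi> \<Longrightarrow> \<phi> differentiable (at x)"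
 unfolding test_function_def by (metis C_k.simps(2))

lemma test_function_support:
 assumes "test_function \<phi>"
 obtains R where "0 < R" "\<And>x. R \<le> norm x \<Longrightarrow> \<phi> x = 0"
proof -
 have "bounded (closure {x. \<phi> x \<noteq> 0})" using assms by (simp add: test_function_def compact_imp_bounded)
 then obtain R where "0 < R" "\<forall>x\<in>closure {x. \<phi> x \<noteq> 0}. norm x \<le> R" by (auto simp: bounded_pos)
 then have "\<And>x. R + 1 \<le> norm x \<Longrightarrow> \<phi> x = 0" using closure_subset[of "{x. \<phi> x \<noteq> 0}"] by force
 with \<open>0 < R\<close> show ?thesis by (intro that[of "R + 1"]) auto
qed

lemma test_function_bounded:
 assumes "test_function \<phi>"
 obtains C where "0 < C" "\<And>x. \<bar>\<phi> x\<bar> \<le> C"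
proof -
 obtain R where R: "0 < R" "\<And>x. R \<le> norm x \<Longrightarrow> \<phi> x = 0" using test_function_support[OF assms] by blast
 have "compact (\<phi> ` cball 0 R)"
  by (intro compact_continuous_image continuous_on_subset[OF test_function_continuous[OF assms]]) auto
 then obtain C where C: "0 < C" "\<forall>y\<in>\<phi> ` cball 0 R. norm y \<le> C" using compact_imp_bounded bounded_pos by metis
 have "\<bar>\<phi> x\<bar> \<le> C" for x using C R(2)[of x] by (cases "norm x \<le> R") auto
 with C(1) that show ?thesis by blast
qed

lemma test_function_partial:
 assumes "test_function \<phi>"
 shows "test_function (partial_deriv i \<phi>)"
proof -
 have "C_k k (partial_deriv i \<phi>)" for k using assms unfolding test_function_def by (metis C_k.simps(2))
 moreover have "closure {x. partial_deriv i \<phi> x \<noteq> 0} \<subseteq> closure {x. \<phi> x \<noteq> 0}"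
 proof (rule closure_minimal)
  show "{x. partial_deriv i \<phi> x \<noteq> 0} \<subseteq> closure {x. \<phi> x \<noteq> 0}"
  proof (rule ccontr)
   assume "\<not> ?thesis"
   then obtain x where x: "partial_deriv i \<phi> x \<noteq> 0" "x \<notin> closure {x. \<phi> x \<noteq> 0}" by blast
   have "(\<phi> has_derivative (\<lambda>_. 0)) (at x)"
   proof (rule has_derivative_transform_within_open[OF has_derivative_const[of 0]])
    show "open (- closure {x. \<phi> x \<noteq> 0})" by auto
    show "x \<in> - closure {x. \<phi> x \<noteq> 0}" using x by simp
    show "\<And>y. y \<in> - closure {x. \<phi> x \<noteq> 0} \<Longrightarrow> 0 = \<phi> y" using closure_subset[of "{x. \<phi> x \<noteq> 0}"] by auto
   qed
   from frechet_derivative_at[OF this] x(1) show False by (simp add: partial_deriv_def) (metis (full_types))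
  qed
 qed simp
 then have "compact (closure {x. partial_deriv i \<phi> x \<noteq> 0})"
  using assms compact_Int_closed[OF _ closed_closure] unfolding test_function_def by (metis inf.absorb2)
 ultimately show ?thesis by (simp add: test_function_def)
qed

lemma has_derivative_affine:
 fixes \<phi> :: "real^'n::finite \<Rightarrow> real"
 assumes "\<And>x. \<phi> differentiable (at x)"
 shows "((\<lambda>x. d * \<phi> (c *R x + a)) has_derivative (\<lambda>y. d * frechet_derivative \<phi> (at (c *R x + a)) (c *R y))) (at x)"
proof -
 have "(\<phi> has_derivative frechet_derivative \<phi> (at (c *R x + a))) (at (c *R x + a))"
  using assms by (auto simp: frechet_derivative_works)
 moreover have "((\<lambda>x. c *R x + a) has_derivative (\<lambda>y. c *R y)) (at x)" by (auto intro!: derivative_eq_intros)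
 ultimately show ?thesis using has_derivative_compose has_derivative_mult_right by blast
qed

lemma partial_deriv_affine:
 fixes \<phi> :: "real^'n::finite \<Rightarrow> real"
 assumes "\<And>x. \<phi> differentiable (at x)"
 shows "partial_deriv i (\<lambda>x. d * \<phi> (c *R x + a)) = (\<lambda>x. (d * c) * partial_deriv i \<phi> (c *R x + a))"
proof
 fix x
 have "linear (frechet_derivative \<phi> (at (c *R x + a)))" using assms by (rule linear_frechet_derivative)
 then show "partial_deriv i (\<lambda>x. d * \<phi> (c *R x + a)) x = (d * c) * partial_deriv i \<phi> (c *R x + a)"
  unfolding partial_deriv_def frechet_derivative_at[OF has_derivative_affine[OF assms], symmetric]
  by (simp add: linear_cmul)
qed

lemma C_k_affine:
 fixes \<phi> :: "real^'n::finite \<Rightarrow> real"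
 shows "C_k k \<phi> \<Longrightarrow> C_k k (\<lambda>x. d * \<phi> (c *R x + a))"
proof (induction k arbitrary: \<phi> d)
 case 0
 then show ?case by (auto intro!: continuous_on_compose2[of UNIV \<phi>] continuous_intros)
next
 case (Suc k)
 then have d: "\<And>x. \<phi> differentiable (at x)" by simp
 have "(\<lambda>x. d * \<phi> (c *R x + a)) differentiable (at x)" for x
  using has_derivative_affine[OF d] unfolding differentiable_def by blast
 then show ?case using Suc by (simp add: partial_deriv_affine[OF d])
qed

lemma test_function_affine:
 fixes \<phi> :: "real^'n::finite \<Rightarrow> real"
 assumes "test_function \<phi>" "c \<noteq> 0"
 shows "test_function (\<lambda>x. \<phi> (c *R x + a))"
proof -
 have "C_k k (\<lambda>x. \<phi> (c *R x + a))" for k using C_k_affine[of k \<phi> 1 c a] assms by (simp add: test_function_def)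
 moreover obtain R where R: "0 < R" "\<And>x. R \<le> norm x \<Longrightarrow> \<phi> x = 0" using test_function_support[OF assms(1)] by blast
 have "bounded {x. \<phi> (c *R x + a) \<noteq> 0}"
 proof (rule boundedI)
  fix x assume "x \<in> {x. \<phi> (c *R x + a) \<noteq> 0}"
  then have "norm (c *R x + a) < R" using R(2) by (auto simp: not_le[symmetric])
  then have "\<bar>c\<bar> * norm x \<le> R + norm a" using norm_triangle_ineq4[of "c *R x + a" a] by simp
  then show "norm x \<le> (R + norm a) / \<bar>c\<bar>" using assms(2) by (simp add: field_simps)
 qed
 ultimately show ?thesis by (simp add: test_function_def)
qed

lemma test_function_shift:
 "test_function \<phi> \<Longrightarrow> test_function (\<lambda>x. \<phi> (x + a))" using test_function_affine[of \<phi> 1 a] by simp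

lemma partial_deriv_shift:
 "test_function \<phi> \<Longrightarrow> partial_deriv i (\<lambda>x. \<phi> (x + a)) = (\<lambda>x. partial_deriv i \<phi> (x + a))"
 using partial_deriv_affine[of \<phi> i 1 1 a, OF test_function_differentiable] by simp

lemma test_function_line_derivative:
 assumes "test_function \<phi>"
 shows "((\<lambda>t. \<phi> (x + t *R axis i 1)) has_real_derivative partial_deriv i \<phi> (x + t *R axis i 1)) (at t)"
proof -
 have *: "(\<phi> has_derivative frechet_derivative \<phi> (at (x + t *R axis i 1))) (at (x + t *R axis i 1))"
  using test_function_differentiable[OF assms] by (auto simp: frechet_derivative_works)
 then interpret bounded_linear "frechet_derivative \<phi> (at (x + t *R axis i 1))" by (rule has_derivative_bounded_linear)
 have "((\<lambda>t. x + t *R axis i 1) has_derivative (\<lambda>s. s *R axis i 1)) (at t)" by (auto intro!: derivative_eq_intros)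
 from has_derivative_compose[OF this *] show ?thesis
  unfolding has_field_derivative_def partial_deriv_def by (simp add: scaleR mult.commute[of _ "frechet_derivative \<phi> (at (x + t *R axis i 1)) (axis i 1)"])
qed

lemma integrable_test_function_mult:
 assumes "test_function \<phi>" "locally_integrable f"
 shows "integrable lborel (\<lambda>x. \<phi> x *R f x)"
proof -
 obtain R where R: "0 < R" "\<And>x. R \<le> norm x \<Longrightarrow> \<phi> x = 0" using test_function_support[OF assms(1)] by blast
 obtain C where C: "0 < C" "\<And>x. \<bar>\<phi> x\<bar> \<le> C" using test_function_bounded[OF assms(1)] by blast
 have i: "integrable lborel (inside R f)"
  using assms(2) compact_cball[of 0 R] unfolding locally_integrable_def set_integrable_def by metis
 have [measurable]: "\<phi> \<in> borel_measurable borel" using assms(1) by (rule test_function_measurable)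
 have eq: "\<phi> x *R f x = \<phi> x *R (indicator (cball 0 R) x *R f x)" for x
  using R(2)[of x] by (cases "R \<le> norm x") (auto simp: indicator_def)
 have "integrable lborel (\<lambda>x. C *R (indicator (cball 0 R) x *R f x))" using i by (rule integrable_scaleR_right)
 then show ?thesis
 proof (rule LINT_integrable_bound)
  show "(\<lambda>x. \<phi> x *R f x) \<in> borel_measurable lborel"
  proof -
   have "(\<lambda>x. \<phi> x *R (indicator (cball 0 R) x *R f x)) \<in> borel_measurable lborel"
    using borel_measurable_integrable[OF i] by measurable
   moreover have "(\<lambda>x. \<phi> x *R (indicator (cball 0 R) x *R f x)) = (\<lambda>x. \<phi> x *R f x)" by (rule ext) (rule eq[symmetric])
   ultimately show ?thesis by simp
  qed
  show "AE x in lborel. norm (\<phi> x *R f x) \<le> norm (C *R (indicator (cball 0 R) x *R f x))"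
   using C by (intro AE_I2, subst eq) (auto intro!: mult_right_mono simp: abs_mult)
 qed
qed

lemma L2_imp_locally_integrable:
 fixes f :: "'a::euclidean_space \<Rightarrow> 'b::euclidean_space"
 assumes "L2 f"
 shows "locally_integrable f" unfolding locally_integrable_def set_integrable_def
proof (intro allI impI)
 fix K :: "'a set" assume K: "compact K"
 have "L2 (\<lambda>x. indicator K x :: real)"
 proof -
  have "K \<in> sets borel" using K by (rule borel_compact)
  moreover have "(norm (indicator K x :: real))\<^sup>2 = indicator K x" for x :: 'a by (simp add: indicator_def)
  ultimately show ?thesis using emeasure_compact_finite[OF K] unfolding square_integrable_def by simp
 qed
 from integrable_bilinear[OF bounded_bilinear_scaleR this assms]
 show "integrable lborel (\<lambda>x. indicat_real K x *R f x)" .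
qed

lemma test_function_locally_integrable:
 "test_function \<phi> \<Longrightarrow> locally_integrable \<phi>" unfolding locally_integrable_def set_integrable_def
 using borel_integrable_compact[OF _ continuous_on_subset[OF test_function_continuous]] by auto

lemma test_function_square_integrable:
 assumes "test_function \<phi>" shows "L2 \<phi>"
 using integrable_test_function_mult[OF assms test_function_locally_integrable[OF assms]] assms
 by (simp add: square_integrable_def power2_eq_square abs_mult[symmetric] test_function_measurable)

section \<open>The fundamental lemma of the calculus of variations\<close>

lemma mem_box_norm_less: "norm x < r \<Longrightarrow> x \<in> box (\<chi> i. - r) (\<chi> i::'n::finite. r)" unfolding mem_box_cart
proof
 fix i :: 'n assume "norm x < r"
 with component_le_norm_cart[of x i] show "(\<chi> i. - r) $ i < x $ i \<and> x $ i < (\<chi> i. r) $ i"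
  by (simp only: vec_lambda_beta) linarith
qed

text \<open>Boxes form an intersection stable generator of the Borel sets, so vanishing integrals
  spread from boxes to all Borel sets by Dynkin's argument.\<close>

lemma AE_zero_if_box_integrals_zero:
 fixes g :: "real^'n::finite \<Rightarrow> 'b::euclidean_space"
 assumes g: "integrable lborel g"
  and box: "\<And>a b. (LINT x|lborel. indicator (box a b) x *R g x) = 0"
 shows "AE x in lborel. g x = 0"
proof (rule sigma_finite_measure.density_zero[OF sigma_finite_lborel g])
 have [measurable]: "g \<in> borel_measurable borel" using g by auto
 have ii: "integrable lborel (\<lambda>x. indicator A x *R g x)" if "A \<in> sets borel" for A
  by (rule integrable_mult_indicator) (use that g in auto)
 \<comment> \<open>Complements in the Dynkin argument require the integral over the whole space,
   which is reached along growing boxes.\<close>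
 have univ: "(LINT x|lborel. g x) = 0"
 proof (rule LIMSEQ_unique)
  show "(\<lambda>k::nat. LINT x|lborel. indicator (box (\<chi> i. - real k) (\<chi> i. real k)) x *R g x) ----> (LINT x|lborel. g x)"
  proof (rule integral_dominated_convergence)
   show "integrable lborel (\<lambda>x. norm (g x))" using g by (rule integrable_norm)
   show "AE x in lborel. (\<lambda>k::nat. indicator (box (\<chi> i. - real k) (\<chi> i. real k)) x *R g x) ----> g x"
   proof (rule AE_I2, rule tendsto_eventually)
    fix x :: "real^'n"
    obtain N :: nat where N: "norm x < real N" using reals_Archimedean2 by blast
    have "x \<in> box (\<chi> i. - real k) (\<chi> i. real k)" if "N \<le> k" for k using N that by (intro mem_box_norm_less) linarith
    then show "\<forall>\<^sub>F k in sequentially. indicator (box (\<chi> i. - real k) (\<chi> i. real k)) x *R g x = g x"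
     by (intro eventually_sequentiallyI[of N]) auto
   qed
  qed (auto simp: indicator_def)
  show "(\<lambda>k::nat. LINT x|lborel. indicator (box (\<chi> i. - real k) (\<chi> i. real k)) x *R g x) ----> 0" by (simp add: box)
 qed
 fix A :: "(real^'n) set" assume "A \<in> sets lborel"
 then have A: "A \<in> sigma_sets UNIV (range (\<lambda>(a, b). box a b :: (real^'n) set))"
  by (simp add: borel_eq_box sets_measure_of)
 have IS: "Int_stable (range (\<lambda>(a, b). box a b :: (real^'n) set))" by (auto simp: Int_stable_def box_Int_box)
 have sub: "range (\<lambda>(a, b). box a b) \<subseteq> Pow (UNIV :: (real^'n) set)" by simp
 show "set_lebesgue_integral lborel A g = 0" unfolding set_lebesgue_integral_def
 proof (rule sigma_sets_induct_disjoint[OF IS sub A, where P = "\<lambda>A. (LINT x|lborel. indicat_real A x *R g x) = 0"])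
  show "(LINT x|lborel. indicat_real {} x *R g x) = 0" by simp
  show "(LINT x|lborel. indicat_real A x *R g x) = 0" if "A \<in> range (\<lambda>(a, b). box a b)" for A using that box by auto
  show "(LINT x|lborel. indicat_real (UNIV - A) x *R g x) = 0"
   if "A \<in> sigma_sets UNIV (range (\<lambda>(a, b). box a b))" "(LINT x|lborel. indicat_real A x *R g x) = 0" for A
  proof -
   have A: "A \<in> sets borel" using that(1) by (simp add: borel_eq_box sets_measure_of)
   have "indicat_real (UNIV - A) x *R g x = g x - indicat_real A x *R g x" for x by (auto simp: indicator_def)
   then show ?thesis using ii[OF A] g that(2) univ by simp
  qed
  show "(LINT x|lborel. indicat_real (\<Union>i. B i) x *R g x) = 0"
   if "disjoint_family B" "range B \<subseteq> sigma_sets UNIV (range (\<lambda>(a, b). box a b))"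
    "\<And>i. (LINT x|lborel. indicat_real (B i) x *R g x) = 0" for B :: "nat \<Rightarrow> _"
  proof -
   have B: "B i \<in> sets lborel" for i using that(2) by (auto simp: borel_eq_box sets_measure_of)
   have "(LINT x:(\<Union>i. B i)|lborel. g x) = (\<Sum>i. (LINT x:(B i)|lborel. g x))"
    by (rule lebesgue_integral_countable_add[OF B])
      (use that(1) ii[of "\<Union>i. B i"] B in \<open>auto simp: disjoint_family_on_def set_integrable_def\<close>)
   then show ?thesis using that(3) by (simp add: set_lebesgue_integral_def)
  qed
 qed
qed

text \<open>The bump functions are test functions tending boundedly to the indicator of a box, so
  testing against them gives the integral over each box.\<close>

lemma fundamental_lemma:
 fixes f :: "real^'n::finite \<Rightarrow> 'b::euclidean_space"
 assumes f: "locally_integrable f" and 0: "\<And>\<phi>. test_function \<phi> \<Longrightarrow> (LINT x|lborel. \<phi> x *R f x) = 0"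
 shows "AE x in lborel. f x = 0"
proof -
 have i: "integrable lborel (\<lambda>x. indicator (box a b) x *R f x)" for a b
 proof -
  have "set_integrable lborel (cbox a b) f" using f by (simp add: locally_integrable_def)
  then have "set_integrable lborel (box a b) f" by (rule set_integrable_subset) (auto simp: box_subset_cbox)
  then show ?thesis by (simp add: set_integrable_def)
 qed
 have box0: "(LINT x|lborel. indicator (box a b) x *R f x) = 0" for a b
 proof (rule LIMSEQ_unique)
  have ic: "integrable lborel (\<lambda>x. indicator (box a b) x *R f x)" by (rule i)
  have eq: "bump k a b x *R f x = bump k a b x *R (indicator (box a b) x *R f x)" for k x
   using bump_eq_0[of x a b k] by (auto simp: indicator_def)
  show "(\<lambda>k. LINT x|lborel. bump k a b x *R f x) ----> (LINT x|lborel. indicator (box a b) x *R f x)"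
  proof (rule integral_dominated_convergence)
   show "integrable lborel (\<lambda>x. norm (indicator (box a b) x *R f x))" by (rule integrable_norm[OF ic])
   show "AE x in lborel. (\<lambda>k. bump k a b x *R f x) ----> indicator (box a b) x *R f x"
    by (intro AE_I2 tendsto_intros bump_tendsto)
   show "AE x in lborel. norm (bump k a b x *R f x) \<le> norm (indicator (box a b) x *R f x)" for k
    using bump_bounds[of k a b]
    by (intro AE_I2, subst eq, simp only: norm_scaleR) (auto intro!: mult_left_le_one_le simp: abs_mult)
   show "(\<lambda>x. bump k a b x *R f x) \<in> borel_measurable lborel" for k
    using integrable_test_function_mult[OF test_function_bump f, of k a b] by simp
  qed (use ic in auto)
  show "(\<lambda>k. LINT x|lborel. bump k a b x *R f x) ----> 0" by (simp add: 0 test_function_bump)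
 qed
 \<comment> \<open>Local integrability gives integrable functions only inside large boxes; a product
   of two box indicators is again a box indicator.\<close>
 have "AE x in lborel. indicator (box (\<chi> i. - real k) (\<chi> i. real k)) x *R f x = 0" for k :: nat
 proof (rule AE_zero_if_box_integrals_zero[OF i])
  fix a b :: "real^'n"
  obtain c d where cd: "box a b \<inter> box (\<chi> i. - real k) (\<chi> i. real k) = box c d" by (rule that[OF box_Int_box])
  have "indicat_real (box a b) x *R indicat_real (box (\<chi> i. - real k) (\<chi> i. real k)) x *R f x = indicator (box c d) x *R f x" for x
   unfolding cd[symmetric] by (auto simp: indicator_def)
  then show "(LINT x|lborel. indicat_real (box a b) x *R indicat_real (box (\<chi> i. - real k) (\<chi> i. real k)) x *R f x) = 0"
   by (simp only: box0)
 qed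
 then have "AE x in lborel. \<forall>k::nat. indicator (box (\<chi> i. - real k) (\<chi> i. real k)) x *R f x = 0"
  unfolding AE_all_countable by blast
 then show ?thesis
 proof eventually_elim
  case (elim x)
  obtain k :: nat where N: "norm x < real k" using reals_Archimedean2 by blast
  have "x \<in> box (\<chi> i. - real k) (\<chi> i. real k)" using N by (rule mem_box_norm_less)
  with elim[rule_format, of k] show ?case by simp
 qed
qed

section \<open>Continuity of translations in the mean\<close>

lemma l2_dominated:
 fixes f :: "nat \<Rightarrow> 'a::euclidean_space \<Rightarrow> 'b::euclidean_space" and w :: "'a \<Rightarrow> 'c::euclidean_space"
 assumes f: "\<And>k. f k \<in> borel_measurable borel" and w: "L2 w"
  and le: "\<And>k. AE x in lborel. norm (f k x) \<le> norm (w x)"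
  and lim: "AE x in lborel. (\<lambda>k. f k x) ----> 0"
 shows "(\<lambda>k. l2 (f k)) ----> 0"
proof -
 note [measurable] = f
 have "(\<lambda>k. LINT x|lborel. (norm (f k x))\<^sup>2) ----> (LINT x|(lborel::'a measure). 0)"
 proof (rule integral_dominated_convergence)
  show "integrable lborel (\<lambda>x. (norm (w x))\<^sup>2)" using w by (rule integrable_power2)
  show "AE x in lborel. (\<lambda>k. (norm (f k x))\<^sup>2) ----> 0" using lim
  proof eventually_elim
   case (elim x)
   then have "(\<lambda>k. (norm (f k x))\<^sup>2) ----> (norm (0::'b))\<^sup>2" by (intro tendsto_intros)
   then show ?case by simp
  qed
  show "AE x in lborel. norm ((norm (f k x))\<^sup>2) \<le> (norm (w x))\<^sup>2" for k
   using le[of k] by eventually_elim (simp add: power_mono)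
 qed measurable
 then have "(\<lambda>k. sqrt (LINT x|lborel. (norm (f k x))\<^sup>2)) ----> sqrt 0" by (intro tendsto_real_sqrt) simp
 then show ?thesis by (simp add: l2_def)
qed

lemma L2_cball: "L2 (indicator (cball (0::'a::euclidean_space) R) :: 'a \<Rightarrow> real)"
proof -
 have "(norm (indicator (cball 0 R) x :: real))\<^sup>2 = indicator (cball 0 R) x" for x :: 'a by (simp add: indicator_def)
 moreover have "cball (0::'a) R \<in> sets borel" by (simp add: borel_closed)
 ultimately show ?thesis using emeasure_compact_finite[OF compact_cball[of "0::'a" R]]
  unfolding square_integrable_def by (simp add: borel_measurable_indicator)
qed

lemma L2_cball_bounded:
 fixes f :: "'a::euclidean_space \<Rightarrow> 'b::euclidean_space"
 assumes f: "f \<in> borel_measurable borel" and "\<And>x. norm (f x) \<le> C * indicator (cball 0 R) x"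
 shows "L2 f" "l2 f \<le> \<bar>C\<bar> * l2 (indicator (cball (0::'a) R) :: 'a \<Rightarrow> real)"
proof -
 note i = L2_cball[where 'a = 'a, of R]
 show sf: "L2 f" by (rule L2_bound[OF f i, where C = C]) (use assms(2) in simp)
 have "l2 f \<le> l2 (\<lambda>x. C *R (indicator (cball (0::'a) R) x :: real))"
  by (intro l2_mono f L2_scaleR i AE_I2 order_trans[OF assms(2)]) (simp only: real_norm_def real_scaleR_def abs_ge_self)
 then show "l2 f \<le> \<bar>C\<bar> * l2 (indicator (cball (0::'a) R) :: 'a \<Rightarrow> real)" by (simp only: l2_scaleR)
qed

text \<open>Truncation in the domain and in the range leaves a bounded function of bounded support;
  measurability then supplies continuous functions converging to it almost everywhere, and dominated
  convergence turns this into convergence in norm.\<close>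

lemma l2_dense_continuous:
 fixes f :: "'a::euclidean_space \<Rightarrow> 'b::euclidean_space"
 assumes f: "L2 f" and e: "0 < e"
 obtains g R where "continuous_on UNIV g" "0 < R" "\<And>x. R \<le> norm x \<Longrightarrow> g x = 0"
  "L2 g" "l2 (\<lambda>x. f x - g x) < e"
proof -
 have [measurable]: "f \<in> borel_measurable borel" using f by auto
 define T where "T M x = (if norm x \<le> M \<and> norm (f x) \<le> M then f x else 0)" for M x
 have T_meas [measurable]: "T M \<in> borel_measurable borel" for M unfolding T_def by measurable
 have "(\<lambda>k::nat. l2 (\<lambda>x. f x - T (real k) x)) ----> 0"
 proof (rule l2_dominated[OF _ f])
  show "AE x in lborel. (\<lambda>k. f x - T (real k) x) ----> 0"
  proof (rule AE_I2, rule tendsto_eventually)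
   fix x
   obtain N :: nat where N: "max (norm x) (norm (f x)) < real N" using reals_Archimedean2 by blast
   have "f x - T (real k) x = 0" if "N \<le> k" for k using N that unfolding T_def by (auto simp: not_le)
   then show "\<forall>\<^sub>F k in sequentially. f x - T (real k) x = 0" by (intro eventually_sequentiallyI[of N]) auto
  qed
 qed (auto simp: T_def)
 then obtain k :: nat where k: "l2 (\<lambda>x. f x - T (real k) x) < e / 2" using e LIMSEQ_D[of _ 0 "e/2"] by fastforce
 define M where "M = max 1 (real k)"
 have M0: "0 < M" by (simp add: M_def)
 have Tk: "norm (T k x) \<le> M" "M < norm x \<Longrightarrow> T k x = 0" for x unfolding T_def M_def using norm_ge_zero[of x] by auto
 have "T k \<in> borel_measurable lebesgue" by (rule measurable_completion) (use T_meas[of k] in simp)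
 then have "T k measurable_on UNIV" by (simp add: measurable_on_iff_borel_measurable lebesgue_on_UNIV_eq)
 then obtain N g where N: "negligible N" and g: "\<And>n. continuous_on UNIV (g n)"
  and lim: "\<And>x. x \<notin> N \<Longrightarrow> (\<lambda>n. g n x) ----> T k x" unfolding measurable_on_def by auto
 define c where "c = (\<lambda>x::'a. max 0 (min 1 (M + 1 - norm x)))"
 have c_cont: "continuous_on UNIV c" unfolding c_def by (intro continuous_intros)
 \<comment> \<open>Projecting onto the ball of radius \<open>M\<close> and multiplying by a cutoff
   yields a common bound and a common compact support without changing the limit, since
   \<open>T k\<close> already satisfies both constraints.\<close>
 define G where "G n x = c x *R closest_point (cball 0 M) (g n x)" for n x
 have G_cont: "continuous_on UNIV (G n)" for n unfolding G_def using M0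
  by (intro continuous_on_scaleR c_cont continuous_on_compose2[OF continuous_on_closest_point[of "cball 0 M" UNIV] g]) auto
 have [measurable]: "G n \<in> borel_measurable borel" for n by (intro borel_measurable_continuous_onI G_cont)
 have G0: "G n x = 0" if "M + 1 \<le> norm x" for n x using that by (simp add: G_def c_def)
 have GM: "norm (G n x) \<le> M" for n x
 proof -
  have "closest_point (cball 0 M) (g n x) \<in> cball 0 M" using M0 by (intro closest_point_in_set) auto
  then have "\<bar>c x\<bar> * norm (closest_point (cball 0 M) (g n x)) \<le> 1 * M" by (intro mult_mono) (auto simp: c_def)
  then show ?thesis by (simp add: G_def)
 qed
 have sqG: "L2 (G n)" for n by (rule L2_cball_bounded[where C = M and R = "M + 1"])
    (use GM G0 in \<open>auto simp: indicator_def not_le\<close>)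
 define w where "w = (\<lambda>x::'a. 2 * M * indicator (cball 0 (M + 1)) x :: real)"
 have w: "L2 w" using L2_scaleR[OF L2_cball[of "M + 1"], of "2 * M"] by (simp add: w_def)
 have "(\<lambda>n. l2 (\<lambda>x. T k x - G n x)) ----> 0"
 proof (rule l2_dominated[OF _ w])
  show "AE x in lborel. norm (T k x - G n x) \<le> norm (w x)" for n
  proof (rule AE_I2)
   fix x
   show "norm (T k x - G n x) \<le> norm (w x)"
    using norm_triangle_ineq4[of "T k x" "G n x"] Tk[of x] GM[of n x] G0[of x n] M0
    by (cases "norm x \<le> M + 1") (auto simp: w_def)
  qed
  have "AE x in lebesgue. (\<lambda>n. T k x - G n x) ----> 0"
  proof (rule AE_I')
   show "N \<in> null_sets lebesgue" using N by (simp add: negligible_iff_null_sets)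
   show "{x \<in> space lebesgue. \<not> (\<lambda>n. T k x - G n x) ----> 0} \<subseteq> N"
   proof -
    have "(\<lambda>n. T k x - G n x) ----> 0" if "x \<notin> N" for x
    proof -
     have "continuous_on UNIV (closest_point (cball 0 M :: 'b set))"
      using M0 by (intro continuous_on_closest_point) auto
     then have "isCont (closest_point (cball 0 M :: 'b set)) (T k x)" by (simp add: continuous_on_eq_continuous_at)
     then have "(\<lambda>n. closest_point (cball 0 M) (g n x)) ----> closest_point (cball 0 M) (T k x)"
      by (rule isCont_tendsto_compose) (rule lim[OF that])
     then have "(\<lambda>n. T k x - G n x) ----> T k x - c x *R closest_point (cball 0 M) (T k x)"
      unfolding G_def by (intro tendsto_intros)
     moreover have "closest_point (cball 0 M) (T k x) = T k x" using Tk(1)[of x] by (intro closest_point_self) auto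
     moreover have "c x *R T k x = T k x" using Tk(2)[of x] by (cases "M < norm x") (auto simp: c_def)
     ultimately show ?thesis by simp
    qed
    then show ?thesis by blast
   qed
  qed
  then show "AE x in lborel. (\<lambda>n. T k x - G n x) ----> 0" by (simp add: AE_completion_iff)
 qed measurable
 then obtain n where n: "l2 (\<lambda>x. T k x - G n x) < e / 2" using e LIMSEQ_D[of _ 0 "e/2"] by fastforce
 have sqT: "L2 (T k)" by (rule L2_bound[OF _ f, where C = 1]) (auto simp: T_def)
 have "l2 (\<lambda>x. f x - G n x) < e" using l2_diff_triangle[OF f sqT sqG[of n]] k n by simp
 then show ?thesis using that[of "G n" "M + 1"] G_cont M0 G0 sqG by auto
qed

lemma l2_shift_continuous:
 fixes f :: "'a::euclidean_space \<Rightarrow> 'b::euclidean_space"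
 assumes f: "L2 f"
 shows "((\<lambda>y. l2 (\<lambda>x. f (x + y) - f x)) \<longlongrightarrow> 0) (at 0)"
proof (rule tendstoI)
 fix e :: real assume e: "0 < e"
 obtain g R where g: "continuous_on UNIV g" "0 < R" "\<And>x. R \<le> norm x \<Longrightarrow> g x = 0"
  "L2 g" "l2 (\<lambda>x. f x - g x) < e / 3" using l2_dense_continuous[OF f, of "e/3"] e by auto
 \<comment> \<open>All translates by vectors shorter than 1 are supported in the ball of radius
   \<open>R + 1\<close>; the modulus of continuity is chosen relative to the norm of its indicator,
   with \<open>V + 1\<close> avoiding a zero denominator.\<close>
 define V where "V = l2 (indicator (cball (0::'a) (R + 1)) :: 'a \<Rightarrow> real)"
 have "compact (cball (0::'a) (R + 2))" by simp
 then have "uniformly_continuous_on (cball 0 (R + 2)) g"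
  by (rule compact_uniformly_continuous[OF continuous_on_subset[OF g(1)], rotated]) simp
 moreover have "0 < e / (3 * (V + 1))" using e l2_nonneg[of "indicator (cball (0::'a) (R + 1)) :: 'a \<Rightarrow> real"]
  unfolding V_def by (intro divide_pos_pos mult_pos_pos) linarith+
 ultimately have "\<exists>d>0. \<forall>x\<in>cball 0 (R+2). \<forall>y\<in>cball 0 (R+2). dist y x < d \<longrightarrow> dist (g y) (g x) < e / (3 * (V + 1))"
  unfolding uniformly_continuous_on_def by blast
 then obtain d where d: "0 < d" "\<And>x y. x \<in> cball 0 (R+2) \<Longrightarrow> y \<in> cball 0 (R+2) \<Longrightarrow> dist y x < d \<Longrightarrow> dist (g y) (g x) < e / (3 * (V + 1))"
  by blast
 have [measurable]: "g \<in> borel_measurable borel" using g by (intro borel_measurable_continuous_onI)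
 have "dist (l2 (\<lambda>x. f (x + y) - f x)) 0 < e" if y: "norm y < min 1 d" for y
 proof -
  have "norm (g (x + y) - g x) \<le> e / (3 * (V + 1)) * indicator (cball 0 (R + 1)) x" for x
  proof (cases "norm x \<le> R + 1")
   case True
   then have "x \<in> cball 0 (R + 2)" "x + y \<in> cball 0 (R + 2)" using y norm_triangle_ineq[of x y] by auto
   from d(2)[OF this] True y show ?thesis by (simp add: dist_norm)
  next
   case False
   then have "R \<le> norm (x + y)" "R \<le> norm x" using y norm_triangle_ineq4[of "x + y" y] by auto
   then show ?thesis using g(3) False by simp
  qed
  from L2_cball_bounded(2)[OF _ this]
  have 1: "l2 (\<lambda>x. g (x + y) - g x) \<le> \<bar>e / (3 * (V + 1))\<bar> * V" unfolding V_def by simp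
  have "V \<ge> 0" by (simp add: V_def)
  then have "V / (V + 1) \<le> 1" by simp
  then have "e / 3 * (V / (V + 1)) \<le> e / 3 * 1" using e by (intro mult_left_mono) auto
  moreover have "\<bar>e / (3 * (V + 1))\<bar> * V = e / 3 * (V / (V + 1))" using e \<open>V \<ge> 0\<close> by (simp add: abs_divide)
  ultimately have 2: "l2 (\<lambda>x. g (x + y) - g x) \<le> e / 3" using 1 by linarith
  have "l2 (\<lambda>x. f (x + y) - g (x + y)) < e / 3" using l2_shift[OF L2_diff[OF f g(4)], of y] g(5) by simp
  moreover have "l2 (\<lambda>x. f (x + y) - f x) \<le> l2 (\<lambda>x. f (x + y) - g (x + y)) + l2 (\<lambda>x. g (x + y) - f x)"
   by (intro l2_diff_triangle L2_shift f g(4))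
  moreover have "l2 (\<lambda>x. g (x + y) - f x) \<le> l2 (\<lambda>x. g (x + y) - g x) + l2 (\<lambda>x. g x - f x)"
   by (intro l2_diff_triangle L2_shift f g(4))
  ultimately show ?thesis using 2 g(5) l2_commute[of f g] by simp
 qed
 moreover have "0 < min 1 d" using d(1) by simp
 ultimately show "\<forall>\<^sub>F y in at 0. dist (l2 (\<lambda>x. f (x + y) - f x)) 0 < e"
  unfolding eventually_at by (intro exI[of _ "min 1 d"]) (auto simp: dist_norm)
qed

section \<open>Weak derivatives and difference quotients\<close>

text \<open>Increments along a segment become averages over the unit interval, and total mass 1
  gives Jensen's inequality and the norm bounds for averages with constant 1.\<close>

definition unif :: "real measure" where
 "unif = density lborel (\<lambda>s. ennreal (indicator {0..1} s))"

lemma prob_space_unif: "emeasure unif (space unif) = 1"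
 unfolding unif_def by (subst emeasure_density) (auto simp: ennreal_indicator)

lemma sets_unif [simp, measurable_cong]: "sets unif = sets borel" by (simp add: unif_def)

lemma space_unif [simp]: "space unif = UNIV" by (simp add: unif_def)

interpretation U: finite_measure unif by (rule finite_measureI) (simp add: prob_space_unif[simplified])

interpretation U_pair: pair_sigma_finite unif "lborel :: (real^'n::finite) measure" ..

lemma measure_unif [simp]: "measure unif UNIV = 1" using prob_space_unif by (simp add: measure_def)

lemma integral_unif:
 fixes f :: "real \<Rightarrow> 'b::euclidean_space"
 assumes "f \<in> borel_measurable borel"
 shows "(LINT s|unif. f s) = (LINT s:{0..1}|lborel. f s)"
 unfolding unif_def set_lebesgue_integral_def by (rule integral_density) (auto simp: assms)

lemma AE_unif: "AE s in unif. s \<in> {0..1}" unfolding unif_def by (subst AE_density) (auto simp: indicator_def)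

lemma nn_integral_power2_le:
 assumes "f \<in> borel_measurable borel"
 shows "(\<integral>\<^sup>+s. f s \<partial>unif)\<^sup>2 \<le> (\<integral>\<^sup>+s. (f s)\<^sup>2 \<partial>unif)"
proof -
 have "f \<in> borel_measurable unif" using assms by simp
 from Cauchy_Schwarz_nn_integral[OF this borel_measurable_const[of 1]] show ?thesis
  by (simp only: mult_1_right power_one nn_integral_const prob_space_unif)
qed

text \<open>Jensen in the parameter and Tonelli bound the norm of an average by the largest norm of
  its members; the same finite double integral yields integrability in the parameter for almost
  every point.\<close>

lemma l2_average:
 fixes k :: "real^'n::finite \<Rightarrow> real \<Rightarrow> 'b::euclidean_space"
 assumes [measurable]: "(\<lambda>(x, s). k x s) \<in> borel_measurable (borel \<Otimes>\<^sub>M borel)"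
  and le: "\<And>s. s \<in> {0..1} \<Longrightarrow> L2 (\<lambda>x. k x s) \<and> l2 (\<lambda>x. k x s) \<le> c"
 shows "L2 (\<lambda>x. LINT s|unif. k x s)" "l2 (\<lambda>x. LINT s|unif. k x s) \<le> c"
  "AE x in lborel. integrable unif (\<lambda>s. k x s)"
proof -
 have c: "0 \<le> c" using order_trans[OF l2_nonneg[of "\<lambda>x. k x 0"]] le[of 0] by simp
 have *: "(\<integral>\<^sup>+x. (\<integral>\<^sup>+s. ennreal ((norm (k x s))\<^sup>2) \<partial>unif) \<partial>lborel) \<le> ennreal (c\<^sup>2)"
 proof -
  have "(\<integral>\<^sup>+x. (\<integral>\<^sup>+s. ennreal ((norm (k x s))\<^sup>2) \<partial>unif) \<partial>lborel)
    = (\<integral>\<^sup>+s. (\<integral>\<^sup>+x. ennreal ((norm (k x s))\<^sup>2) \<partial>lborel) \<partial>unif)" by (rule U_pair.Fubini') measurable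
  also have "\<dots> \<le> (\<integral>\<^sup>+s. ennreal (c\<^sup>2) \<partial>unif)"
  proof (rule nn_integral_mono_AE, use AE_unif in eventually_elim)
   case (elim s)
   then show ?case using le[OF elim] by (simp add: nn_integral_l2 ennreal_leI power_mono)
  qed
  also have "\<dots> = ennreal (c\<^sup>2)" using prob_space_unif by simp
  finally show ?thesis .
 qed
 have **: "(ennreal (norm (LINT s|unif. k x s)))\<^sup>2 \<le> (\<integral>\<^sup>+s. ennreal ((norm (k x s))\<^sup>2) \<partial>unif)" for x
 proof -
  have "ennreal (norm (LINT s|unif. k x s)) \<le> (\<integral>\<^sup>+s. ennreal (norm (k x s)) \<partial>unif)" by (cases "integrable unif (k x)")
     (auto intro: integral_norm_bound_ennreal simp: not_integrable_integral_eq)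
  then have "(ennreal (norm (LINT s|unif. k x s)))\<^sup>2 \<le> (\<integral>\<^sup>+s. ennreal (norm (k x s)) \<partial>unif)\<^sup>2"
   by (intro power_mono) auto
  also have "\<dots> \<le> (\<integral>\<^sup>+s. (ennreal (norm (k x s)))\<^sup>2 \<partial>unif)" by (rule nn_integral_power2_le) measurable
  finally show ?thesis by (simp add: ennreal_power)
 qed
 have m: "(\<lambda>x. LINT s|unif. k x s) \<in> borel_measurable borel" by measurable
 have "(\<integral>\<^sup>+x. ennreal ((norm (LINT s|unif. k x s))\<^sup>2) \<partial>lborel) \<le> ennreal (c\<^sup>2)"
  by (rule order_trans[OF nn_integral_mono *]) (use ** in \<open>simp add: ennreal_power\<close>)
 from square_integrableI_nn[OF m this c]
 show "L2 (\<lambda>x. LINT s|unif. k x s)" "l2 (\<lambda>x. LINT s|unif. k x s) \<le> c" .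
 have "(\<integral>\<^sup>+x. (\<integral>\<^sup>+s. ennreal ((norm (k x s))\<^sup>2) \<partial>unif) \<partial>lborel) \<noteq> \<infinity>" using * by (auto simp: top_unique)
 then have "AE x in lborel. (\<integral>\<^sup>+s. ennreal ((norm (k x s))\<^sup>2) \<partial>unif) \<noteq> \<infinity>"
  by (intro nn_integral_noteq_infinite) measurable
 then show "AE x in lborel. integrable unif (\<lambda>s. k x s)"
 proof eventually_elim
  case (elim x)
  have "integrable unif (\<lambda>s. (norm (k x s))\<^sup>2)"
   using elim by (intro integrableI_nonneg) (auto simp: less_top[symmetric])
  then have "integrable unif (\<lambda>s. 1 + (norm (k x s))\<^sup>2)" by simp
  then show ?case
  proof (rule LINT_integrable_bound)
   show "AE s in unif. norm (k x s) \<le> norm (1 + (norm (k x s))\<^sup>2)"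
   proof (rule AE_I2)
    fix s
    have "2 * norm (k x s) \<le> 1 + (norm (k x s))\<^sup>2" using sum_squares_bound[of 1 "norm (k x s)"] by simp
    then show "norm (k x s) \<le> norm (1 + (norm (k x s))\<^sup>2)"
     using norm_ge_zero[of "k x s"] unfolding real_norm_def by linarith
   qed
  qed measurable
 qed
qed

lemma Fubini_average:
 fixes B :: "'b::euclidean_space \<Rightarrow> 'c::euclidean_space \<Rightarrow> 'd::euclidean_space"
  and k :: "real^'n::finite \<Rightarrow> real \<Rightarrow> 'c"
 assumes B: "bounded_bilinear B" and a: "L2 a"
  and m[measurable]: "(\<lambda>(x, s). k x s) \<in> borel_measurable (borel \<Otimes>\<^sub>M borel)"
  and le: "\<And>s. L2 (\<lambda>x. k x s) \<and> l2 (\<lambda>x. k x s) \<le> c"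
 shows "(LINT x|lborel. B (a x) (LINT s|unif. k x s)) = (LINT s|unif. (LINT x|lborel. B (a x) (k x s)))"
proof -
 interpret bounded_bilinear B by (rule B)
 obtain K where K: "0 \<le> K" "\<And>x y. norm (B x y) \<le> norm x * norm y * K" using nonneg_bounded by blast
 note [measurable] = a[THEN L2_measurable]
 have "continuous_on UNIV (\<lambda>p. B (fst p) (snd p))" by (intro continuous_on continuous_intros)
 note [measurable] = borel_measurable_continuous_onI[OF this]
 have "(\<lambda>(s, x). (\<lambda>p. B (fst p) (snd p)) (a x, k x s)) \<in> borel_measurable (unif \<Otimes>\<^sub>M lborel)" by measurable
 then have mB[measurable]: "(\<lambda>(s, x). B (a x) (k x s)) \<in> borel_measurable (unif \<Otimes>\<^sub>M lborel)" by simp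
 have "integrable (unif \<Otimes>\<^sub>M lborel) (\<lambda>(s, x). B (a x) (k x s))"
 proof (rule U_pair.Fubini_integrable[OF mB])
  show "AE s in unif. integrable lborel (\<lambda>x. case (s, x) of (s, x) \<Rightarrow> B (a x) (k x s))"
   unfolding prod.case by (intro AE_I2 integrable_bilinear[OF B a] conjunct1[OF le])
  have "norm (LINT x|lborel. norm (B (a x) (k x s))) \<le> l2 a * c * K" for s
  proof -
   have "(LINT x|lborel. norm (B (a x) (k x s))) \<le> (LINT x|lborel. norm (a x) * norm (k x s) * K)"
    by (intro integral_mono integrable_norm integrable_bilinear[OF B a] integrable_mult_left integrable_norm_mult a conjunct1[OF le] K(2))
   also have "\<dots> \<le> l2 a * l2 (\<lambda>x. k x s) * K"
    using integral_norm_mult_le[OF a, of "\<lambda>x. k x s"] le K(1) by (simp add: mult_right_mono)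
   also have "\<dots> \<le> l2 a * c * K" using le K(1) by (intro mult_right_mono mult_left_mono) auto
   finally show ?thesis by simp
  qed
  then show "integrable unif (\<lambda>s. LINT x|lborel. norm (case (s, x) of (s, x) \<Rightarrow> B (a x) (k x s)))"
   by (intro U.integrable_const_bound[where B = "l2 a * c * K"]) auto
 qed
 from U_pair.Fubini_integral[OF this]
 have "(LINT s|unif. (LINT x|lborel. B (a x) (k x s))) = (LINT x|lborel. (LINT s|unif. B (a x) (k x s)))" by simp
 also have "\<dots> = (LINT x|lborel. B (a x) (LINT s|unif. k x s))"
 proof (rule integral_cong_AE)
  show "AE x in lborel. (LINT s|unif. B (a x) (k x s)) = B (a x) (LINT s|unif. k x s)"
   using l2_average(3)[OF m le] by eventually_elim (rule integral_bounded_linear[OF bounded_linear_right])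
  have "(\<lambda>x. (\<lambda>p. B (fst p) (snd p)) (a x, LINT s|unif. k x s)) \<in> borel_measurable lborel" by measurable
  then show "(\<lambda>x. B (a x) (LINT s|unif. k x s)) \<in> borel_measurable lborel" by simp
 qed measurable
 finally show ?thesis ..
qed

section \<open>The fundamental theorem of calculus along lines\<close>

lemma unif_FTC:
 fixes F :: "real \<Rightarrow> 'b::euclidean_space"
 assumes F: "\<And>t. (F has_vector_derivative F' t) (at t)" and c: "continuous_on UNIV F'"
 shows "h *R (LINT s|unif. F' (s * h)) = F h - F 0"
proof -
 have c': "continuous_on UNIV (\<lambda>s. F' (s * h))" by (intro continuous_on_compose2[OF c] continuous_intros) auto
 have "((\<lambda>s. h *R F' (s * h)) has_integral (F (1 * h) - F (0 * h))) {0..1}"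
 proof (rule fundamental_theorem_of_calculus)
  fix s :: real
  have "((\<lambda>s. s * h) has_vector_derivative h) (at s)" by (auto intro!: derivative_eq_intros)
  from vector_diff_chain_at[OF this, of F "F' (s * h)"] F[of "s * h"]
  have "(F \<circ> (\<lambda>s. s * h) has_vector_derivative h *R F' (s * h)) (at s)" by blast
  then show "((\<lambda>s. F (s * h)) has_vector_derivative h *R F' (s * h)) (at s within {0..1})"
   unfolding o_def by (rule has_vector_derivative_at_within)
 qed simp
 moreover have "set_integrable lborel {0..1} (\<lambda>s. h *R F' (s * h))" unfolding set_integrable_def
  by (intro borel_integrable_compact continuous_intros continuous_on_subset[OF c']) auto
 then have "(LINT s:{0..1}|lborel. h *R F' (s * h)) = integral {0..1} (\<lambda>s. h *R F' (s * h))"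
  by (rule set_borel_integral_eq_integral(2))
 ultimately have "(LINT s:{0..1}|lborel. h *R F' (s * h)) = F h - F 0"
  by (simp only: integral_unique mult_1 mult_zero_left)
 moreover have "(LINT s:{0..1}|lborel. h *R F' (s * h)) = (LINT s|unif. h *R F' (s * h))"
  by (rule integral_unif[symmetric])
    (intro borel_measurable_continuous_onI continuous_intros c')
 ultimately show ?thesis by simp
qed

lemma test_function_FTC:
 assumes "test_function \<phi>"
 shows "h * (LINT s|unif. partial_deriv i \<phi> (x + (s * h) *R axis i 1)) = \<phi> (x + h *R axis i 1) - \<phi> x"
proof -
 have "continuous_on UNIV (\<lambda>t. partial_deriv i \<phi> (x + t *R axis i 1))"
  by (rule continuous_on_compose2[OF test_function_continuous[OF test_function_partial[OF assms]]])
    (auto intro!: continuous_intros)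
 from unif_FTC[OF test_function_line_derivative[OF assms, unfolded has_real_derivative_iff_has_vector_derivative] this]
 show ?thesis by simp
qed

text \<open>Tested against a smooth function, both sides can be moved to the test function by
  translation and by the definition of the weak derivative; there the identity is the classical
  fundamental theorem, averaged with Fubini.\<close>

lemma weak_partial_line:
 fixes f g :: "real^'n::finite \<Rightarrow> 'b::euclidean_space"
 assumes fg: "has_weak_partial i f g" and f: "L2 f" and g: "L2 g"
 shows "AE x in lborel. f (x + h *R axis i 1) - f x = h *R (LINT s|unif. g (x + (s * h) *R axis i 1))"
proof -
 define e :: "real \<Rightarrow> real^'n" where "e s = (s * h) *R axis i 1" for s
 have [measurable]: "f \<in> borel_measurable borel" "g \<in> borel_measurable borel" "e \<in> borel_measurable borel"
  using f g by (auto simp: e_def[abs_def])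
 have sh: "L2 (\<lambda>x. k (x + y)) \<and> l2 (\<lambda>x. k (x + y)) \<le> l2 k" if "L2 k" for k :: "real^'n \<Rightarrow> 'c::euclidean_space" and y
  using L2_shift[OF that] l2_shift[OF that] by simp
 have m: "(\<lambda>(x, s). g (x + e s)) \<in> borel_measurable (borel \<Otimes>\<^sub>M borel)" by measurable
 note av = l2_average[OF m sh[OF g]]
 let ?a = "\<lambda>x. LINT s|unif. g (x + e s)"
 define F where "F x = f (x + h *R axis i 1) - f x - h *R ?a x" for x
 have F: "L2 F" unfolding F_def by (intro L2_diff L2_scaleR L2_shift f av)
 have "AE x in lborel. F x = 0"
 proof (rule fundamental_lemma)
  show "locally_integrable F" by (rule L2_imp_locally_integrable[OF F])
  fix \<phi> :: "real^'n \<Rightarrow> real" assume \<phi>: "test_function \<phi>"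
  define \<psi> where "\<psi> = partial_deriv i \<phi>"
  have t: "test_function \<psi>" unfolding \<psi>_def by (rule test_function_partial[OF \<phi>])
  have [measurable]: "\<phi> \<in> borel_measurable borel" "\<psi> \<in> borel_measurable borel" using \<phi> t by (auto intro: test_function_measurable)
  note \<phi>2 = test_function_square_integrable[OF \<phi>] and I = integrable_bilinear[OF bounded_bilinear_scaleR]
  have shift: "(LINT x|lborel. \<phi> x *R k (x + y)) = (LINT x|lborel. \<phi> (x - y) *R k x)"
   if "L2 k" for k :: "real^'n \<Rightarrow> 'b" and y using integral_shift[of "\<lambda>x. \<phi> (x - y) *R k x" y] that by auto
  have weak: "(LINT x|lborel. \<phi> x *R g (x + e s)) = - (LINT x|lborel. \<psi> (x + - e s) *R f x)" for s
   using fg test_function_shift[OF \<phi>, of "- e s"] unfolding shift[OF g] \<psi>_def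
   by (auto simp: has_weak_partial_def partial_deriv_shift[OF \<phi>, of i "- e s", simplified])
  have FTC: "h * (LINT s|unif. \<psi> (x + - e s)) = \<phi> x - \<phi> (x - h *R axis i 1)" for x
   using test_function_FTC[OF \<phi>, of "- h" i x] by (simp add: \<psi>_def e_def)
  have m': "(\<lambda>(x, s). \<psi> (x + - e s)) \<in> borel_measurable (borel \<Otimes>\<^sub>M borel)" by measurable
  have "(LINT x|lborel. \<phi> x *R ?a x) = (LINT s|unif. (LINT x|lborel. \<phi> x *R g (x + e s)))"
   by (rule Fubini_average[OF bounded_bilinear_scaleR \<phi>2 m sh[OF g]])
  also have "\<dots> = - (LINT s|unif. (LINT x|lborel. \<psi> (x + - e s) *R f x))" unfolding weak by simp
  also have "(LINT s|unif. (LINT x|lborel. \<psi> (x + - e s) *R f x)) = (LINT x|lborel. (LINT s|unif. \<psi> (x + - e s)) *R f x)"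
   by (rule Fubini_average[OF bounded_bilinear.flip[OF bounded_bilinear_scaleR] f m' sh[OF test_function_square_integrable[OF t]], symmetric])
  finally have "(LINT x|lborel. h *R (\<phi> x *R ?a x)) = - (LINT x|lborel. h *R ((LINT s|unif. \<psi> (x + - e s)) *R f x))"
   unfolding integral_scaleR_right by simp
  also have "\<dots> = - (LINT x|lborel. \<phi> x *R f x - \<phi> (x - h *R axis i 1) *R f x)"
   by (simp only: scaleR_scaleR FTC scaleR_diff_left)
  also have "\<dots> = (LINT x|lborel. \<phi> x *R f (x + h *R axis i 1)) - (LINT x|lborel. \<phi> x *R f x)"
   using I[OF \<phi>2 f] I[OF L2_shift[OF \<phi>2, of "- (h *R axis i 1)"] f] shift[OF f] by simp
  finally show "(LINT x|lborel. \<phi> x *R F x) = 0" unfolding F_def scaleR_left_commute[of h]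
   using I[OF \<phi>2 f] I[OF \<phi>2 L2_shift[OF f, of "h *R axis i 1"]] I[OF \<phi>2 L2_scaleR[OF av(1), of h]]
   by (simp add: scaleR_diff_right del: scaleR_scaleR)
 qed
 then show ?thesis by eventually_elim (simp add: F_def e_def)
qed

subsection \<open>Calculus of weak derivatives\<close>

lemma integral_affine:
 fixes f :: "'a::euclidean_space \<Rightarrow> 'b::euclidean_space"
 assumes c: "c \<noteq> 0" and f[measurable]: "f \<in> borel_measurable borel"
 shows "(LINT x|lborel. f (a + c *R x)) = (1 / \<bar>c\<bar> ^ DIM('a)) *R (LINT x|lborel. f x)"
proof -
 have "(LINT x|lborel. f x) = (LINT x|density (distr lborel borel (\<lambda>x. a + c *R x)) (\<lambda>_. ennreal (\<bar>c\<bar> ^ DIM('a))). f x)"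
  using lborel_affine[OF c, of a] by simp
 also have "\<dots> = (LINT x|distr lborel borel (\<lambda>x. a + c *R x). \<bar>c\<bar> ^ DIM('a) *R f x)" by (rule integral_density) auto
 also have "\<dots> = (LINT x|lborel. \<bar>c\<bar> ^ DIM('a) *R f (a + c *R x))" by (rule integral_distr) auto
 also have "\<dots> = \<bar>c\<bar> ^ DIM('a) *R (LINT x|lborel. f (a + c *R x))" by (rule integral_scaleR_right)
 finally show ?thesis using c by simp
qed

lemma integrable_affine:
 fixes f :: "'a::euclidean_space \<Rightarrow> 'b::euclidean_space"
 assumes c: "c \<noteq> 0" and f: "integrable lborel f"
 shows "integrable lborel (\<lambda>x. f (a + c *R x))"
proof -
 have [measurable]: "f \<in> borel_measurable borel" using f by auto
 have "integrable (density (distr lborel borel (\<lambda>x. a + c *R x)) (\<lambda>_. ennreal (\<bar>c\<bar> ^ DIM('a)))) f"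
  using lborel_affine[OF c, of a] f by simp
 then have "integrable (distr lborel borel (\<lambda>x. a + c *R x)) (\<lambda>x. \<bar>c\<bar> ^ DIM('a) *R f x)"
  by (subst (asm) integrable_density) auto
 then have "integrable lborel (\<lambda>x. \<bar>c\<bar> ^ DIM('a) *R f (a + c *R x))" by (subst (asm) integrable_distr_eq) auto
 from integrable_scaleR_right[OF this, of "1 / \<bar>c\<bar> ^ DIM('a)"] show ?thesis using c by (simp only: scaleR_scaleR) simp
qed

lemma L2_affine:
 assumes "c \<noteq> 0" "L2 f"
 shows "L2 (\<lambda>x. f (a + c *R x))"
proof -
 note [measurable] = assms(2)[THEN L2_measurable]
 have "(\<lambda>x. f (a + c *R x)) \<in> borel_measurable borel" by measurable
 then show ?thesis using integrable_affine[OF assms(1) integrable_power2[OF assms(2)], of a]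
  unfolding square_integrable_def by simp
qed

lemma locally_integrable_measurable:
 fixes f :: "'a::euclidean_space \<Rightarrow> 'b::euclidean_space"
 shows "locally_integrable f \<Longrightarrow> f \<in> borel_measurable borel"
proof -
 assume f: "locally_integrable f"
 have m: "(inside (real n) f) \<in> borel_measurable borel" for n :: nat
 proof -
  have "set_integrable lborel (cball 0 (real n)) f"
   using f compact_cball[of 0 "real n"] unfolding locally_integrable_def by metis
  from borel_measurable_integrable[OF this[unfolded set_integrable_def]] show ?thesis by simp
 qed
 show ?thesis
 proof (rule borel_measurable_LIMSEQ_metric[OF m])
  fix x :: 'a
  obtain N :: nat where N: "norm x \<le> real N" using real_arch_simple by blast
  show "(\<lambda>n. indicator (cball 0 (real n)) x *R f x) ----> f x"
   by (rule tendsto_eventually, rule eventually_sequentiallyI[of N]) (use N in auto)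
 qed
qed

lemma locally_integrable_cong_AE:
 fixes f f' :: "'a::euclidean_space \<Rightarrow> 'b::euclidean_space"
 assumes f: "locally_integrable f" and [measurable]: "f' \<in> borel_measurable borel"
  and ae: "AE x in lborel. f x = f' x"
 shows "locally_integrable f'" unfolding locally_integrable_def
proof (intro allI impI)
 fix K :: "'a set" assume K: "compact K"
 have [measurable]: "f \<in> borel_measurable borel" by (rule locally_integrable_measurable[OF f])
 have [measurable]: "K \<in> sets borel" using K by (rule borel_compact)
 have "integrable lborel (\<lambda>x. indicator K x *R f x)"
  using f K by (auto simp: locally_integrable_def set_integrable_def)
 moreover have "integrable lborel (\<lambda>x. indicator K x *R f x) = integrable lborel (\<lambda>x. indicator K x *R f' x)"
  by (rule integrable_cong_AE) (use ae in \<open>auto elim: eventually_mono\<close>)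
 ultimately show "set_integrable lborel K f'" unfolding set_integrable_def by simp
qed

lemma locally_integrable_bounded_linear:
 fixes f :: "'a::euclidean_space \<Rightarrow> 'b::euclidean_space" and L :: "'b \<Rightarrow> 'c::euclidean_space"
 assumes "bounded_linear L" "locally_integrable f"
 shows "locally_integrable (\<lambda>x. L (f x))" unfolding locally_integrable_def set_integrable_def
proof (intro allI impI)
 interpret bounded_linear L by fact
 fix K :: "'a set" assume "compact K"
 then have "integrable lborel (\<lambda>x. indicator K x *R f x)"
  using assms(2) by (auto simp: locally_integrable_def set_integrable_def)
 from integrable_bounded_linear[OF assms(1) this]
 show "integrable lborel (\<lambda>x. indicat_real K x *R L (f x))" by (simp add: scaleR)
qed

lemma locally_integrable_add:
 "locally_integrable f \<Longrightarrow> locally_integrable g \<Longrightarrow> locally_integrable (\<lambda>x. f x + g x)"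
 unfolding locally_integrable_def by (auto intro: set_integral_add(1))

lemma locally_integrable_affine:
 fixes f :: "'a::euclidean_space \<Rightarrow> 'b::euclidean_space"
 assumes c: "c \<noteq> 0" and f: "locally_integrable f"
 shows "locally_integrable (\<lambda>x. f (a + c *R x))" unfolding locally_integrable_def set_integrable_def
proof (intro allI impI)
 fix K :: "'a set" assume "compact K"
 then have "compact ((\<lambda>x. a + c *R x) ` K)" by (intro compact_continuous_image continuous_intros)
 then have "integrable lborel (\<lambda>x. indicator ((\<lambda>x. a + c *R x) ` K) x *R f x)"
  using f by (auto simp: locally_integrable_def set_integrable_def)
 from integrable_affine[OF c this, of a]
 moreover have "indicat_real ((\<lambda>x. a + c *R x) ` K) (a + c *R x) = indicat_real K x" for x
  using c by (auto simp: indicator_def)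
 ultimately show "integrable lborel (\<lambda>x. indicat_real K x *R f (a + c *R x))" by simp
qed

lemma locally_integrable_continuous:
 "continuous_on UNIV f \<Longrightarrow> locally_integrable f" unfolding locally_integrable_def set_integrable_def
 using borel_integrable_compact continuous_on_subset by blast

lemma has_weak_partialD:
 "has_weak_partial i f g \<Longrightarrow> test_function \<phi> \<Longrightarrow>
  (LINT x|lborel. partial_deriv i \<phi> x *R f x) = - (LINT x|lborel. \<phi> x *R g x)"
 "has_weak_partial i f g \<Longrightarrow> locally_integrable f"
 "has_weak_partial i f g \<Longrightarrow> locally_integrable g" by (auto simp: has_weak_partial_def)

lemma has_weak_partial_cong_AE:
 assumes fg: "has_weak_partial i f g"
  and m[measurable]: "f' \<in> borel_measurable borel" "g' \<in> borel_measurable borel"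
  and ae: "AE x in lborel. f x = f' x" "AE x in lborel. g x = g' x"
 shows "has_weak_partial i f' g'"
proof -
 note [measurable] = locally_integrable_measurable[OF has_weak_partialD(2)[OF fg]]
  locally_integrable_measurable[OF has_weak_partialD(3)[OF fg]]
 have "(LINT x|lborel. partial_deriv i \<phi> x *R f' x) = - (LINT x|lborel. \<phi> x *R g' x)" if \<phi>: "test_function \<phi>" for \<phi>
 proof -
  note [measurable] = test_function_measurable[OF \<phi>] test_function_measurable[OF test_function_partial[OF \<phi>, of i]]
  have "(LINT x|lborel. partial_deriv i \<phi> x *R f' x) = (LINT x|lborel. partial_deriv i \<phi> x *R f x)"
   by (rule integral_cong_AE) (use ae(1) in \<open>auto elim: eventually_mono\<close>)
  moreover have "(LINT x|lborel. \<phi> x *R g' x) = (LINT x|lborel. \<phi> x *R g x)"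
   by (rule integral_cong_AE) (use ae(2) in \<open>auto elim: eventually_mono\<close>)
  ultimately show ?thesis using has_weak_partialD(1)[OF fg \<phi>] by simp
 qed
 then show ?thesis unfolding has_weak_partial_def
  using locally_integrable_cong_AE[OF has_weak_partialD(2)[OF fg] m(1) ae(1)]
   locally_integrable_cong_AE[OF has_weak_partialD(3)[OF fg] m(2) ae(2)] by blast
qed

lemma has_weak_partial_bounded_linear:
 fixes f g :: "real^'n::finite \<Rightarrow> 'b::euclidean_space" and L :: "'b \<Rightarrow> 'c::euclidean_space"
 assumes L: "bounded_linear L" and fg: "has_weak_partial i f g"
 shows "has_weak_partial i (\<lambda>x. L (f x)) (\<lambda>x. L (g x))" unfolding has_weak_partial_def
proof (intro conjI allI impI)
 interpret bounded_linear L by fact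
 show "locally_integrable (\<lambda>x. L (f x))" "locally_integrable (\<lambda>x. L (g x))"
  by (intro locally_integrable_bounded_linear[OF L] has_weak_partialD[OF fg])+
 fix \<phi> :: "real^'n \<Rightarrow> real" assume \<phi>: "test_function \<phi>"
 have "(LINT x|lborel. L (partial_deriv i \<phi> x *R f x)) = L (LINT x|lborel. partial_deriv i \<phi> x *R f x)"
  by (rule integral_bounded_linear[OF L integrable_test_function_mult[OF test_function_partial[OF \<phi>] has_weak_partialD(2)[OF fg]]])
 moreover have "(LINT x|lborel. L (\<phi> x *R g x)) = L (LINT x|lborel. \<phi> x *R g x)"
  by (rule integral_bounded_linear[OF L integrable_test_function_mult[OF \<phi> has_weak_partialD(3)[OF fg]]])
 ultimately show "(LINT x|lborel. partial_deriv i \<phi> x *R L (f x)) = - (LINT x|lborel. \<phi> x *R L (g x))"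
  using has_weak_partialD(1)[OF fg \<phi>] by (simp add: scaleR neg)
qed

lemma has_weak_partial_add:
 assumes fg: "has_weak_partial i f g" "has_weak_partial i f' g'"
 shows "has_weak_partial i (\<lambda>x. f x + f' x) (\<lambda>x. g x + g' x)" unfolding has_weak_partial_def
proof (intro conjI allI impI)
 show "locally_integrable (\<lambda>x. f x + f' x)" "locally_integrable (\<lambda>x. g x + g' x)"
  by (intro locally_integrable_add has_weak_partialD[OF fg(1)] has_weak_partialD[OF fg(2)])+
 fix \<phi> :: "real^'a \<Rightarrow> real" assume \<phi>: "test_function \<phi>"
 note I = integrable_test_function_mult[OF \<phi>] integrable_test_function_mult[OF test_function_partial[OF \<phi>]]
 show "(LINT x|lborel. partial_deriv i \<phi> x *R (f x + f' x)) = - (LINT x|lborel. \<phi> x *R (g x + g' x))"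
  using has_weak_partialD(1)[OF fg(1) \<phi>] has_weak_partialD(1)[OF fg(2) \<phi>]
   I(1)[OF has_weak_partialD(3)[OF fg(1)]] I(1)[OF has_weak_partialD(3)[OF fg(2)]]
   I(2)[OF has_weak_partialD(2)[OF fg(1)], of i] I(2)[OF has_weak_partialD(2)[OF fg(2)], of i]
  by (simp add: scaleR_add_right)
qed

lemma has_weak_partial_scaleR:
 "has_weak_partial i f g \<Longrightarrow> has_weak_partial i (\<lambda>x. c *R f x) (\<lambda>x. c *R g x)"
 by (rule has_weak_partial_bounded_linear[OF bounded_linear_scaleR_right])

lemma has_weak_partial_diff:
 assumes "has_weak_partial i f g" "has_weak_partial i f' g'"
 shows "has_weak_partial i (\<lambda>x. f x - f' x) (\<lambda>x. g x - g' x)"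
 using has_weak_partial_add[OF assms(1) has_weak_partial_scaleR[OF assms(2), of "-1"]] by simp

lemma has_weak_partial_unique:
 assumes "has_weak_partial i f g" "has_weak_partial i f g'"
 shows "AE x in lborel. g x = g' x"
proof -
 have d: "has_weak_partial i (\<lambda>x. f x - f x) (\<lambda>x. g x - g' x)" by (rule has_weak_partial_diff[OF assms])
 have "AE x in lborel. g x - g' x = 0"
 proof (rule fundamental_lemma[OF has_weak_partialD(3)[OF d]])
  fix \<phi> :: "real^'a \<Rightarrow> real" assume "test_function \<phi>"
  from has_weak_partialD(1)[OF d this] show "(LINT x|lborel. \<phi> x *R (g x - g' x)) = 0" by simp
 qed
 then show ?thesis by simp
qed

lemma has_weak_partial_weak_partial:
 "has_weak_partial i f g \<Longrightarrow> has_weak_partial i f (weak_partial i f)"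
 unfolding weak_partial_def by (rule someI[of "has_weak_partial i f"])

lemma weak_partial_AE:
 "has_weak_partial i f g \<Longrightarrow> AE x in lborel. weak_partial i f x = g x"
 using has_weak_partial_unique[OF has_weak_partial_weak_partial] .

lemma has_weak_partial_affine:
 fixes f :: "real^'n::finite \<Rightarrow> 'b::euclidean_space"
 assumes c: "c \<noteq> 0" and fg: "has_weak_partial i f g"
 shows "has_weak_partial i (\<lambda>x. f (a + c *R x)) (\<lambda>x. c *R g (a + c *R x))" unfolding has_weak_partial_def
proof (intro conjI allI impI)
 note [measurable] = locally_integrable_measurable[OF has_weak_partialD(2)[OF fg]]
  locally_integrable_measurable[OF has_weak_partialD(3)[OF fg]]
 show "locally_integrable (\<lambda>x. f (a + c *R x))" by (rule locally_integrable_affine[OF c has_weak_partialD(2)[OF fg]])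
 show "locally_integrable (\<lambda>x. c *R g (a + c *R x))"
  by (rule locally_integrable_bounded_linear[OF bounded_linear_scaleR_right locally_integrable_affine[OF c has_weak_partialD(3)[OF fg]]])
 fix \<phi> :: "real^'n \<Rightarrow> real" assume \<phi>: "test_function \<phi>"
 define b where "b = - (1 / c) *R a"
 define \<psi> where "\<psi> = (\<lambda>y. \<phi> ((1 / c) *R y + b))"
 have \<psi>: "test_function \<psi>" unfolding \<psi>_def using c by (intro test_function_affine \<phi>) simp
 note [measurable] = test_function_measurable[OF \<psi>] test_function_measurable[OF test_function_partial[OF \<psi>, of i]]
 have \<psi>': "partial_deriv i \<psi> = (\<lambda>y. (1 / c) * partial_deriv i \<phi> ((1 / c) *R y + b))"
  unfolding \<psi>_def using partial_deriv_affine[of \<phi> i 1 "1 / c" b, OF test_function_differentiable[OF \<phi>]] by simp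
 have inv: "(1 / c) *R (a + c *R x) + b = x" for x using c by (simp add: b_def scaleR_add_right)
 have 1: "(LINT x|lborel. partial_deriv i \<phi> x *R f (a + c *R x)) = (LINT x|lborel. (\<lambda>y. c *R (partial_deriv i \<psi> y *R f y)) (a + c *R x))"
  using c by (simp add: \<psi>' inv)
 have 2: "(LINT x|lborel. \<phi> x *R (c *R g (a + c *R x))) = (LINT x|lborel. (\<lambda>y. c *R (\<psi> y *R g y)) (a + c *R x))"
  by (simp add: \<psi>_def inv mult.commute)
 show "(LINT x|lborel. partial_deriv i \<phi> x *R f (a + c *R x)) = - (LINT x|lborel. \<phi> x *R (c *R g (a + c *R x)))"
  unfolding 1 2 by (subst (1 2) integral_affine[OF c], measurable)
   (simp only: integral_scaleR_right has_weak_partialD(1)[OF fg \<psi>] scaleR_minus_right)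
qed

lemma has_weak_partial_shift:
 fixes f :: "real^'n::finite \<Rightarrow> 'b::euclidean_space"
 shows "has_weak_partial i f g \<Longrightarrow> has_weak_partial i (\<lambda>x. f (x + a)) (\<lambda>x. g (x + a))"
 using has_weak_partial_affine[of 1 i f g a] by (simp add: add.commute)

text \<open>If \<open>F'\<close> is a derivative of \<open>F\<close> along the \<open>i\<close>-th axis, integrating the increment of \<open>F\<close>
 over a unit step and translating gives zero.\<close>

lemma integral_partial_zero:
 fixes F F' :: "real^'n::finite \<Rightarrow> 'b::euclidean_space"
 assumes F: "integrable lborel F" and F': "integrable lborel F'"
  and line: "\<And>x. F (x + axis i 1) - F x = (LINT s|unif. F' (x + s *R axis i 1))"
 shows "(LINT x|lborel. F' x) = 0"
proof -
 have [measurable]: "F' \<in> borel_measurable borel" "F \<in> borel_measurable borel" using F F' by auto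
 have "integrable (unif \<Otimes>\<^sub>M lborel) (\<lambda>(s, x). F' (x + s *R axis i 1))"
 proof (rule U_pair.Fubini_integrable)
  show "(\<lambda>(s, x). F' (x + s *R axis i 1)) \<in> borel_measurable (unif \<Otimes>\<^sub>M lborel)" by measurable
  show "AE s in unif. integrable lborel (\<lambda>x. case (s, x) of (s, x) \<Rightarrow> F' (x + s *R axis i 1))"
   unfolding prod.case by (intro AE_I2 integrable_shift F')
  have "(LINT x|lborel. norm (F' (x + s *R axis i 1))) = (LINT x|lborel. norm (F' x))" for s
   by (rule integral_shift[of "\<lambda>x. norm (F' x)"]) measurable
  then show "integrable unif (\<lambda>s. LINT x|lborel. norm (case (s, x) of (s, x) \<Rightarrow> F' (x + s *R axis i 1)))"
   unfolding prod.case by simp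
 qed
 from U_pair.Fubini_integral[OF this]
 have "(LINT x|lborel. (LINT s|unif. F' (x + s *R axis i 1))) = (LINT s|unif. (LINT x|lborel. F' (x + s *R axis i 1)))"
  by simp
 also have "\<dots> = (LINT s|unif. (LINT x|lborel. F' x))" by (intro LINT_cong refl integral_shift) measurable
 also have "\<dots> = (LINT x|lborel. F' x)" by simp
 also have "(LINT x|lborel. (LINT s|unif. F' (x + s *R axis i 1))) = (LINT x|lborel. F (x + axis i 1) - F x)"
  by (simp only: line)
 also have "\<dots> = 0" using integrable_shift[OF F, of "axis i 1"] F integral_shift[of F "axis i 1"] by simp
 finally show ?thesis by simp
qed

text \<open>By the product rule, the product of the test function and \<open>f\<close> is an
  antiderivative along the axis of the sum of both integrands, and the integral of such a derivative
  vanishes.\<close>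

lemma has_weak_partial_classical:
 fixes f f' :: "real^'n::finite \<Rightarrow> 'b::euclidean_space"
 assumes f: "continuous_on UNIV f" "continuous_on UNIV f'"
  and d: "\<And>x t. ((\<lambda>t. f (x + t *R axis i 1)) has_vector_derivative f' (x + t *R axis i 1)) (at t)"
 shows "has_weak_partial i f f'" unfolding has_weak_partial_def
proof (intro conjI allI impI)
 show l: "locally_integrable f" "locally_integrable f'" by (intro locally_integrable_continuous f)+
 fix \<phi> :: "real^'n \<Rightarrow> real" assume \<phi>: "test_function \<phi>"
 note i1 = integrable_test_function_mult[OF test_function_partial[OF \<phi>] l(1), of i]
 note i2 = integrable_test_function_mult[OF \<phi> l(2)]
 have c: "continuous_on UNIV (\<lambda>x. partial_deriv i \<phi> x *R f x + \<phi> x *R f' x)"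
  by (intro continuous_intros f test_function_continuous \<phi> test_function_partial)
 have "(LINT x|lborel. partial_deriv i \<phi> x *R f x + \<phi> x *R f' x) = 0"
 proof (rule integral_partial_zero)
  show "integrable lborel (\<lambda>x. \<phi> x *R f x)" by (rule integrable_test_function_mult[OF \<phi> l(1)])
  show "integrable lborel (\<lambda>x. partial_deriv i \<phi> x *R f x + \<phi> x *R f' x)" using i1 i2 by simp
  fix x
  have "((\<lambda>t. \<phi> (x + t *R axis i 1) *R f (x + t *R axis i 1)) has_vector_derivative
    (partial_deriv i \<phi> (x + t *R axis i 1) *R f (x + t *R axis i 1) + \<phi> (x + t *R axis i 1) *R f' (x + t *R axis i 1))) (at t)" for t
   using has_vector_derivative_scaleR[OF test_function_line_derivative[OF \<phi>] d] by (simp add: add.commute)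
  moreover have "continuous_on UNIV (\<lambda>t. partial_deriv i \<phi> (x + t *R axis i 1) *R f (x + t *R axis i 1) + \<phi> (x + t *R axis i 1) *R f' (x + t *R axis i 1))"
   by (rule continuous_on_compose2[OF c]) (auto intro!: continuous_intros)
  ultimately have "1 *R (LINT s|unif. partial_deriv i \<phi> (x + (s * 1) *R axis i 1) *R f (x + (s * 1) *R axis i 1) + \<phi> (x + (s * 1) *R axis i 1) *R f' (x + (s * 1) *R axis i 1))
   = \<phi> (x + 1 *R axis i 1) *R f (x + 1 *R axis i 1) - \<phi> (x + 0 *R axis i 1) *R f (x + 0 *R axis i 1)"
   by (rule unif_FTC)
  then show "\<phi> (x + axis i 1) *R f (x + axis i 1) - \<phi> x *R f x =
   (LINT s|unif. partial_deriv i \<phi> (x + s *R axis i 1) *R f (x + s *R axis i 1) + \<phi> (x + s *R axis i 1) *R f' (x + s *R axis i 1))"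
   by simp
 qed
 then show "(LINT x|lborel. partial_deriv i \<phi> x *R f x) = - (LINT x|lborel. \<phi> x *R f' x)"
  using i1 i2 by (simp add: add_eq_0_iff2)
qed

lemma has_weak_partial_const: "has_weak_partial i (\<lambda>_. c) (\<lambda>_. 0)" by (rule has_weak_partial_classical) auto

text \<open>Stated as an equality of predicates, because \<open>weak_partial\<close> chooses from
  this predicate: the chosen derivatives of \<open>f\<close> and of \<open>f\<close> plus a constant
  are then literally equal.\<close>

lemma has_weak_partial_add_const:
 "has_weak_partial i (\<lambda>x. f x + c) = has_weak_partial i f"
proof
 fix g
 show "has_weak_partial i (\<lambda>x. f x + c) g = has_weak_partial i f g"
  using has_weak_partial_add[OF _ has_weak_partial_const, of i f g c]
   has_weak_partial_diff[OF _ has_weak_partial_const, of i "\<lambda>x. f x + c" g c] by auto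
qed

lemma has_weak_partial_test_function:
 "test_function \<phi> \<Longrightarrow> has_weak_partial i \<phi> (partial_deriv i \<phi>)" using test_function_line_derivative[of \<phi>]
 by (intro has_weak_partial_classical test_function_continuous test_function_partial)
   (auto simp: has_real_derivative_iff_has_vector_derivative)

lemma tendsto_integral_scaleR:
 fixes f :: "nat \<Rightarrow> 'a::euclidean_space \<Rightarrow> 'b::euclidean_space"
 assumes \<phi>: "L2 \<phi>" and f: "\<And>k. L2 (f k)" "L2 g"
  and lim: "(\<lambda>k. l2 (\<lambda>x. f k x - g x)) ----> 0"
 shows "(\<lambda>k. LINT x|lborel. \<phi> x *R f k x) ----> (LINT x|lborel. \<phi> x *R g x)"
proof (rule LIM_zero_cancel, rule Lim_null_comparison)
 note I = integrable_bilinear[OF bounded_bilinear_scaleR \<phi>]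
 show "\<forall>\<^sub>F k in sequentially. norm ((LINT x|lborel. \<phi> x *R f k x) - (LINT x|lborel. \<phi> x *R g x)) \<le> l2 \<phi> * l2 (\<lambda>x. f k x - g x)"
 proof (intro always_eventually allI)
  fix k
  have "norm ((LINT x|lborel. \<phi> x *R f k x) - (LINT x|lborel. \<phi> x *R g x)) = norm (LINT x|lborel. \<phi> x *R (f k x - g x))"
   using I[OF f(1)] I[OF f(2)] by (simp add: scaleR_diff_right)
  also have "\<dots> \<le> (LINT x|lborel. norm (\<phi> x) * norm (f k x - g x))"
   using integral_norm_bound[of lborel "\<lambda>x. \<phi> x *R (f k x - g x)"] by simp
  also have "\<dots> \<le> l2 \<phi> * l2 (\<lambda>x. f k x - g x)" by (intro integral_norm_mult_le \<phi> L2_diff f)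
  finally show "norm ((LINT x|lborel. \<phi> x *R f k x) - (LINT x|lborel. \<phi> x *R g x)) \<le> l2 \<phi> * l2 (\<lambda>x. f k x - g x)" .
 qed
 show "(\<lambda>k. l2 \<phi> * l2 (\<lambda>x. f k x - g x)) ----> 0" using tendsto_mult_right_zero[OF lim] by simp
qed

text \<open>Both sides of the defining identity are continuous under convergence in norm; this
  closedness is what identifies the derivatives of limits later.\<close>

lemma has_weak_partial_limit:
 assumes fg: "\<And>k. has_weak_partial i (f k) (g k)"
  and f: "\<And>k. L2 (f k)" "L2 F" "(\<lambda>k. l2 (\<lambda>x. f k x - F x)) ----> 0"
  and g: "\<And>k. L2 (g k)" "L2 G" "(\<lambda>k. l2 (\<lambda>x. g k x - G x)) ----> 0"
 shows "has_weak_partial i F G" unfolding has_weak_partial_def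
proof (intro conjI allI impI)
 show "locally_integrable F" "locally_integrable G" by (intro L2_imp_locally_integrable f g)+
 fix \<phi> :: "real^'a \<Rightarrow> real" assume \<phi>: "test_function \<phi>"
 note \<phi>2 = test_function_square_integrable[OF \<phi>] test_function_square_integrable[OF test_function_partial[OF \<phi>]]
 show "(LINT x|lborel. partial_deriv i \<phi> x *R F x) = - (LINT x|lborel. \<phi> x *R G x)"
 proof (rule LIMSEQ_unique)
  show "(\<lambda>k. LINT x|lborel. partial_deriv i \<phi> x *R f k x) ----> (LINT x|lborel. partial_deriv i \<phi> x *R F x)"
   by (rule tendsto_integral_scaleR[OF \<phi>2(2) f])
  have "(\<lambda>k. - (LINT x|lborel. \<phi> x *R g k x)) ----> - (LINT x|lborel. \<phi> x *R G x)"
   by (rule tendsto_minus[OF tendsto_integral_scaleR[OF \<phi>2(1) g]])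
  then show "(\<lambda>k. LINT x|lborel. partial_deriv i \<phi> x *R f k x) ----> - (LINT x|lborel. \<phi> x *R G x)"
   by (simp only: has_weak_partialD(1)[OF fg \<phi>])
 qed
qed

subsection \<open>Difference quotients\<close>

definition dq :: "'n::finite \<Rightarrow> real \<Rightarrow> (real^'n \<Rightarrow> 'b::euclidean_space) \<Rightarrow> real^'n \<Rightarrow> 'b" where
 "dq i h f x = (1 / h) *R (f (x + h *R axis i 1) - f x)"

lemma L2_dq: "L2 f \<Longrightarrow> L2 (dq i h f)" unfolding dq_def[abs_def] by (intro L2_scaleR L2_diff L2_shift)

lemma has_weak_partial_dq:
 "has_weak_partial j f g \<Longrightarrow> has_weak_partial j (dq i h f) (dq i h g)" unfolding dq_def[abs_def]
 by (intro has_weak_partial_scaleR has_weak_partial_diff has_weak_partial_shift)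

lemma l2_shift_diff_le:
 fixes f g :: "real^'n::finite \<Rightarrow> 'b::euclidean_space"
 assumes fg: "has_weak_partial i f g" "L2 f" "L2 g"
 shows "l2 (\<lambda>x. f (x + h *R axis i 1) - f x) \<le> \<bar>h\<bar> * l2 g"
proof -
 note [measurable] = fg(2,3)[THEN L2_measurable]
 have m: "(\<lambda>(x, s). g (x + (s * h) *R axis i 1)) \<in> borel_measurable (borel \<Otimes>\<^sub>M borel)" by measurable
 have sg: "L2 (\<lambda>x. g (x + (s * h) *R axis i 1)) \<and> l2 (\<lambda>x. g (x + (s * h) *R axis i 1)) \<le> l2 g" for s
  using L2_shift[OF fg(3)] l2_shift[OF fg(3)] by simp
 note av = l2_average[OF m sg]
 have "l2 (\<lambda>x. f (x + h *R axis i 1) - f x) = l2 (\<lambda>x. h *R (LINT s|unif. g (x + (s * h) *R axis i 1)))"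
  by (rule l2_cong_AE) (use weak_partial_line[OF fg, of h] in \<open>auto elim: eventually_mono\<close>)
 also have "\<dots> = \<bar>h\<bar> * l2 (\<lambda>x. LINT s|unif. g (x + (s * h) *R axis i 1))" by (rule l2_scaleR)
 also have "\<dots> \<le> \<bar>h\<bar> * l2 g" using av(2) by (intro mult_left_mono) auto
 finally show ?thesis .
qed

text \<open>The difference quotient is the average of the translates of \<open>g\<close> over the
  segment from 0 to \<open>h\<close>, so its error is at most the largest translation error on that
  segment.\<close>

lemma l2_dq_le:
 fixes f g :: "real^'n::finite \<Rightarrow> 'b::euclidean_space"
 assumes fg: "has_weak_partial i f g" "L2 f" "L2 g" and h: "h \<noteq> 0"
  and c: "\<And>s. s \<in> {0..1} \<Longrightarrow> l2 (\<lambda>x. g (x + (s * h) *R axis i 1) - g x) \<le> c"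
 shows "l2 (\<lambda>x. dq i h f x - g x) \<le> c"
proof -
 note [measurable] = fg(2,3)[THEN L2_measurable]
 have m: "(\<lambda>(x, s). g (x + (s * h) *R axis i 1) - g x) \<in> borel_measurable (borel \<Otimes>\<^sub>M borel)" by measurable
 have m': "(\<lambda>(x, s). g (x + (s * h) *R axis i 1)) \<in> borel_measurable (borel \<Otimes>\<^sub>M borel)" by measurable
 have s: "L2 (\<lambda>x. g (x + y))" for y by (rule L2_shift[OF fg(3)])
 have ls: "l2 (\<lambda>x. g (x + y)) \<le> l2 g" for y using l2_shift[OF fg(3), of y] by simp
 have "L2 (\<lambda>x. g (x + (s * h) *R axis i 1) - g x) \<and> l2 (\<lambda>x. g (x + (s * h) *R axis i 1) - g x) \<le> c" if "s \<in> {0..1}" for s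
  using L2_diff[OF s fg(3)] c[OF that] by blast
 note av = l2_average[OF m this]
 have "L2 (\<lambda>x. g (x + (s * h) *R axis i 1)) \<and> l2 (\<lambda>x. g (x + (s * h) *R axis i 1)) \<le> l2 g" for s using s ls by blast
 note av' = l2_average[OF m' this]
 have "l2 (\<lambda>x. dq i h f x - g x) = l2 (\<lambda>x. LINT s|unif. g (x + (s * h) *R axis i 1) - g x)"
 proof (rule l2_cong_AE)
  show "AE x in lborel. norm (dq i h f x - g x) = norm (LINT s|unif. g (x + (s * h) *R axis i 1) - g x)"
   using weak_partial_line[OF fg, of h] av'(3)
  proof eventually_elim
   case (elim x)
   then show ?case using h by (simp add: dq_def)
  qed
  show "(\<lambda>x. dq i h f x - g x) \<in> borel_measurable borel" unfolding dq_def by measurable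
 qed measurable
 with av(2) show ?thesis by simp
qed

text \<open>A second derivative turns the modulus of continuity of translations into a rate linear
  in \<open>h\<close>. The rate is uniform over families with bounded second derivatives, which is
  what compactness of gradients needs.\<close>

lemma dq_rate:
 fixes f g k :: "real^'n::finite \<Rightarrow> 'b::euclidean_space"
 assumes fg: "has_weak_partial i f g" "has_weak_partial i g k"
  and sq: "L2 f" "L2 g" "L2 k" and h: "h \<noteq> 0"
 shows "l2 (\<lambda>x. dq i h f x - g x) \<le> \<bar>h\<bar> * l2 k"
proof (rule l2_dq_le[OF fg(1) sq(1,2) h])
 fix s :: real assume "s \<in> {0..1}"
 then have "\<bar>s * h\<bar> * l2 k \<le> 1 * \<bar>h\<bar> * l2 k"
  by (intro mult_right_mono) (auto simp: abs_mult intro: mult_left_le_one_le)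
 then show "l2 (\<lambda>x. g (x + (s * h) *R axis i 1) - g x) \<le> \<bar>h\<bar> * l2 k"
  using l2_shift_diff_le[OF fg(2) sq(2,3), of "s * h"] by simp
qed

lemma dq_tendsto:
 fixes f g :: "real^'n::finite \<Rightarrow> 'b::euclidean_space"
 assumes fg: "has_weak_partial i f g" "L2 f" "L2 g"
 shows "((\<lambda>h. l2 (\<lambda>x. dq i h f x - g x)) \<longlongrightarrow> 0) (at 0)"
proof (rule tendstoI)
 fix e :: real assume e: "0 < e"
 have "\<forall>\<^sub>F y in at 0. dist (l2 (\<lambda>x. g (x + y) - g x)) 0 < e / 2"
  using tendstoD[OF l2_shift_continuous[OF fg(3)], of "e / 2"] e by simp
 then obtain d where d: "0 < d" "\<And>y. y \<noteq> 0 \<Longrightarrow> norm y < d \<Longrightarrow> l2 (\<lambda>x. g (x + y) - g x) < e / 2"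
  unfolding eventually_at by (auto simp: dist_norm)
 have "dist (l2 (\<lambda>x. dq i h f x - g x)) 0 < e" if h: "h \<noteq> 0" "\<bar>h\<bar> < d" for h
 proof -
  have "l2 (\<lambda>x. dq i h f x - g x) \<le> e / 2"
  proof (rule l2_dq_le[OF fg h(1)])
   fix s :: real assume s: "s \<in> {0..1}"
   have "\<bar>s * h\<bar> \<le> 1 * \<bar>h\<bar>" unfolding abs_mult using s by (intro mult_right_mono) auto
   then have n: "norm ((s * h) *R axis i (1::real)) < d" using h(2) by simp
   show "l2 (\<lambda>x. g (x + (s * h) *R axis i 1) - g x) \<le> e / 2"
   proof (cases "(s * h) *R axis i (1::real) = 0")
    case True
    then show ?thesis using e by (simp only: add_0_right diff_self l2_zero)
   next
    case False
    then show ?thesis using d(2)[OF False n] by simp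
   qed
  qed
  then show ?thesis using e l2_nonneg[of "\<lambda>x. dq i h f x - g x"] unfolding dist_real_def by linarith
 qed
 then show "\<forall>\<^sub>F h in at 0. dist (l2 (\<lambda>x. dq i h f x - g x)) 0 < e"
  unfolding eventually_at using d(1) by (intro exI[of _ d]) auto
qed

definition hseq :: "nat \<Rightarrow> real" where "hseq k = 1 / real (Suc k)"

lemma hseq: "hseq k \<noteq> 0" "0 < hseq k" "filterlim hseq (at 0) sequentially" "filterlim (\<lambda>k. - hseq k) (at 0) sequentially"
proof -
 show "hseq k \<noteq> 0" "0 < hseq k" by (auto simp: hseq_def)
 have l: "hseq ----> 0" unfolding hseq_def[abs_def] using LIMSEQ_Suc[OF lim_1_over_n] by simp
 then show "filterlim hseq (at 0) sequentially" by (auto simp: filterlim_at hseq_def)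
 from tendsto_minus[OF l] show "filterlim (\<lambda>k. - hseq k) (at 0) sequentially" by (auto simp: filterlim_at hseq_def)
qed

lemma integral_dq:
 assumes f: "L2 f" "L2 g"
 shows "(LINT x|lborel. dq i h f x \<bullet> g x) = - (LINT x|lborel. f x \<bullet> dq i (- h) g x)"
proof -
 have [measurable]: "f \<in> borel_measurable borel" "g \<in> borel_measurable borel" using f by auto
 define e where "e = h *R axis i (1::real)"
 note I = integrable_inner[OF f] integrable_inner[OF L2_shift[OF f(1), of e] f(2)]
   integrable_inner[OF f(1) L2_shift[OF f(2), of "- e"]]
 have "(LINT x|lborel. f (x + e) \<bullet> g x) = (LINT x|lborel. f x \<bullet> g (x - e))"
  using integral_shift[of "\<lambda>x. f x \<bullet> g (x - e)" e] by simp
 moreover have "(LINT x|lborel. dq i h f x \<bullet> g x) = (1 / h) * ((LINT x|lborel. f (x + e) \<bullet> g x) - (LINT x|lborel. f x \<bullet> g x))"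
  using I by (simp add: dq_def e_def[symmetric] inner_diff_left)
 moreover have "(LINT x|lborel. f x \<bullet> dq i (- h) g x) = (1 / - h) * ((LINT x|lborel. f x \<bullet> g (x - e)) - (LINT x|lborel. f x \<bullet> g x))"
  using I by (simp add: dq_def e_def[symmetric] inner_diff_right)
 ultimately show ?thesis by simp
qed

text \<open>Difference quotients satisfy an exact summation by parts by translation invariance, and
  both sides converge as the step tends to zero.\<close>

lemma weak_integration_by_parts:
 fixes f g :: "real^'n::finite \<Rightarrow> 'b::euclidean_space"
 assumes f: "has_weak_partial i f f'" "L2 f" "L2 f'"
  and g: "has_weak_partial i g g'" "L2 g" "L2 g'"
 shows "(LINT x|lborel. f' x \<bullet> g x) = - (LINT x|lborel. f x \<bullet> g' x)"
proof (rule LIMSEQ_unique)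
 show "(\<lambda>k. LINT x|lborel. dq i (hseq k) f x \<bullet> g x) ----> (LINT x|lborel. f' x \<bullet> g x)"
  by (rule tendsto_integral_inner)
    (auto intro: L2_dq f g filterlim_compose[OF dq_tendsto[OF f] hseq(3)])
 have "(\<lambda>k. - (LINT x|lborel. f x \<bullet> dq i (- hseq k) g x)) ----> - (LINT x|lborel. f x \<bullet> g' x)"
  by (rule tendsto_minus[OF tendsto_integral_inner])
    (auto intro: L2_dq f g filterlim_compose[OF dq_tendsto[OF g] hseq(4)])
 then show "(\<lambda>k. LINT x|lborel. dq i (hseq k) f x \<bullet> g x) ----> - (LINT x|lborel. f x \<bullet> g' x)"
  by (simp only: integral_dq[OF f(2) g(2)])
qed

text \<open>The form \<open>\<partial>\<^sub>j a \<bullet> \<partial>\<^sub>i b - \<partial>\<^sub>i a \<bullet> \<partial>\<^sub>j b\<close> is a null Lagrangian on \<open>H\<^sup>1\<close>.\<close>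

lemma weak_partial_exchange:
 fixes a b :: "real^'n::finite \<Rightarrow> 'b::euclidean_space"
 assumes a: "has_weak_partial i a ai" "has_weak_partial j a aj"
  "L2 a" "L2 ai" "L2 aj"
  and b: "has_weak_partial i b bi" "has_weak_partial j b bj"
  "L2 b" "L2 bi" "L2 bj"
 shows "(LINT x|lborel. aj x \<bullet> bi x) = (LINT x|lborel. ai x \<bullet> bj x)"
proof (rule LIMSEQ_unique)
 show "(\<lambda>k. LINT x|lborel. aj x \<bullet> dq i (hseq k) b x) ----> (LINT x|lborel. aj x \<bullet> bi x)"
  by (rule tendsto_integral_inner)
    (auto intro: L2_dq a b filterlim_compose[OF dq_tendsto[OF b(1,3,4)] hseq(3)])
 \<comment> \<open>For fixed \<open>h\<close> no second derivative occurs: the derivative in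
   direction \<open>j\<close> moves from \<open>a\<close> to the quotient of \<open>b\<close>, then
   the quotient moves to \<open>a\<close>.\<close>
 have "(LINT x|lborel. aj x \<bullet> dq i h b x) = (LINT x|lborel. dq i (- h) a x \<bullet> bj x)" for h
 proof -
  have "(LINT x|lborel. aj x \<bullet> dq i h b x) = - (LINT x|lborel. a x \<bullet> dq i h bj x)"
   by (rule weak_integration_by_parts[OF a(2,3,5) has_weak_partial_dq[OF b(2)]])
     (intro L2_dq b)+
  then show ?thesis using integral_dq[OF a(3) b(5), of i "- h"] by simp
 qed
 moreover have "(\<lambda>k. LINT x|lborel. dq i (- hseq k) a x \<bullet> bj x) ----> (LINT x|lborel. ai x \<bullet> bj x)"
  by (rule tendsto_integral_inner)
    (auto intro: L2_dq a b filterlim_compose[OF dq_tendsto[OF a(1,3,4)] hseq(4)])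
 ultimately show "(\<lambda>k. LINT x|lborel. aj x \<bullet> dq i (hseq k) b x) ----> (LINT x|lborel. ai x \<bullet> bj x)" by simp
qed

text \<open>The null Lagrangian identity with a test function in one slot, read component by
  component, shows that both mixed derivatives have the same integrals against test
  functions.\<close>

lemma weak_partial_commute:
 fixes u :: "real^'n::finite \<Rightarrow> 'b::euclidean_space"
 assumes u: "L2 u" "has_weak_partial i u p" "has_weak_partial j u q" "L2 p" "L2 q"
  and p: "has_weak_partial j p pj" and q: "has_weak_partial i q qi"
 shows "AE x in lborel. pj x = qi x"
proof -
 have l: "locally_integrable (\<lambda>x. pj x - qi x)"
  using locally_integrable_add[OF has_weak_partialD(3)[OF p] locally_integrable_bounded_linear[OF bounded_linear_minus[OF bounded_linear_ident] has_weak_partialD(3)[OF q]]]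
  by simp
 have "AE x in lborel. pj x - qi x = 0"
 proof (rule fundamental_lemma[OF l])
  fix \<phi> :: "real^'n \<Rightarrow> real" assume \<phi>: "test_function \<phi>"
  note \<phi>i = test_function_partial[OF \<phi>, of i] and \<phi>j = test_function_partial[OF \<phi>, of j]
  note I = integrable_test_function_mult
  have "(LINT x|lborel. partial_deriv j \<phi> x *R p x) = (LINT x|lborel. partial_deriv i \<phi> x *R q x)"
  proof (rule euclidean_eqI)
   fix b :: 'b assume "b \<in> Basis"
   have "(LINT x|lborel. partial_deriv j \<phi> x \<bullet> (p x \<bullet> b)) = (LINT x|lborel. partial_deriv i \<phi> x \<bullet> (q x \<bullet> b))"
    by (rule weak_partial_exchange[OF has_weak_partial_test_function[OF \<phi>] has_weak_partial_test_function[OF \<phi>]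
       test_function_square_integrable[OF \<phi>] test_function_square_integrable[OF \<phi>i] test_function_square_integrable[OF \<phi>j]
       has_weak_partial_bounded_linear[OF bounded_linear_inner_left u(2)]
       has_weak_partial_bounded_linear[OF bounded_linear_inner_left u(3)]
       L2_bounded_linear[OF bounded_linear_inner_left u(1)]
       L2_bounded_linear[OF bounded_linear_inner_left u(4)]
       L2_bounded_linear[OF bounded_linear_inner_left u(5)]])
   then show "(LINT x|lborel. partial_deriv j \<phi> x *R p x) \<bullet> b = (LINT x|lborel. partial_deriv i \<phi> x *R q x) \<bullet> b"
    using I[OF \<phi>j L2_imp_locally_integrable[OF u(4)]] I[OF \<phi>i L2_imp_locally_integrable[OF u(5)]]
    by (simp flip: integral_inner_left)
  qed
  then show "(LINT x|lborel. \<phi> x *R (pj x - qi x)) = 0"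
   using has_weak_partialD(1)[OF p \<phi>] has_weak_partialD(1)[OF q \<phi>]
    I[OF \<phi> has_weak_partialD(3)[OF p]] I[OF \<phi> has_weak_partialD(3)[OF q]] by (simp add: scaleR_diff_right)
 qed
 then show ?thesis by simp
qed

section \<open>Second order Sobolev functions on the plane\<close>

text \<open>A function with explicit first and second weak derivatives, \<open>K i j\<close> being
  the derivative of \<open>G i\<close> in direction \<open>j\<close>. Unlike the chosen
  representatives of \<open>weak_partial\<close>, these data translate, rescale and add up
  literally.\<close>

definition jet2 :: "(real^'n::finite \<Rightarrow> 'b::euclidean_space) \<Rightarrow> ('n \<Rightarrow> real^'n \<Rightarrow> 'b) \<Rightarrow>
  ('n \<Rightarrow> 'n \<Rightarrow> real^'n \<Rightarrow> 'b) \<Rightarrow> bool" where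
 "jet2 u G K \<longleftrightarrow> L2 u \<and>
   (\<forall>i. has_weak_partial i u (G i) \<and> L2 (G i)) \<and>
   (\<forall>i j. has_weak_partial j (G i) (K i j) \<and> L2 (K i j))"

lemma jet2D:
 assumes "jet2 u G K"
 shows "L2 u" "has_weak_partial i u (G i)" "L2 (G i)"
  "has_weak_partial j (G i) (K i j)" "L2 (K i j)" using assms by (auto simp: jet2_def)

lemma sobolev_H_2: "sobolev_H 2 u \<longleftrightarrow> L2 u \<and>
  (\<forall>i. \<exists>g. has_weak_partial i u g \<and> L2 g \<and>
   (\<forall>j. \<exists>k. has_weak_partial j g k \<and> L2 k))" by (simp add: numeral_2_eq_2)

lemma jet2_weak_partial:
 assumes "sobolev_H 2 u"
 shows "jet2 u (\<lambda>i. weak_partial i u) (\<lambda>i j. weak_partial j (weak_partial i u))"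
proof -
 have 1: "has_weak_partial i u (weak_partial i u) \<and> L2 (weak_partial i u) \<and>
   (\<forall>j. has_weak_partial j (weak_partial i u) (weak_partial j (weak_partial i u)) \<and>
    L2 (weak_partial j (weak_partial i u)))" for i
 proof -
  obtain g where g: "has_weak_partial i u g" "L2 g"
   and k: "\<And>j. \<exists>k. has_weak_partial j g k \<and> L2 k" using assms unfolding sobolev_H_2 by blast
  have w: "has_weak_partial i u (weak_partial i u)" by (rule has_weak_partial_weak_partial[OF g(1)])
  have m: "weak_partial i u \<in> borel_measurable borel"
   by (rule locally_integrable_measurable[OF has_weak_partialD(3)[OF w]])
  have ae: "AE x in lborel. weak_partial i u x = g x" by (rule weak_partial_AE[OF g(1)])
  have s: "L2 (weak_partial i u)" by (rule L2_cong_AE[OF m g(2) ae])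
  have "has_weak_partial j (weak_partial i u) (weak_partial j (weak_partial i u)) \<and>
    L2 (weak_partial j (weak_partial i u))" for j
  proof -
   obtain k where k: "has_weak_partial j g k" "L2 k" using k by blast
   have mk: "k \<in> borel_measurable borel" using k(2) by auto
   \<comment> \<open>The second derivative is known for the representative \<open>g\<close>, whereas
     \<open>weak_partial\<close> may have chosen another one; equality almost everywhere transfers
     it.\<close>
   have wk: "has_weak_partial j (weak_partial i u) k"
    by (rule has_weak_partial_cong_AE[OF k(1) m mk]) (use ae in \<open>auto elim: eventually_mono\<close>)
   have w2: "has_weak_partial j (weak_partial i u) (weak_partial j (weak_partial i u))"
    by (rule has_weak_partial_weak_partial[OF wk])
   moreover have "L2 (weak_partial j (weak_partial i u))"
    by (rule L2_cong_AE[OF locally_integrable_measurable[OF has_weak_partialD(3)[OF w2]] k(2) weak_partial_AE[OF wk]])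
   ultimately show ?thesis by blast
  qed
  with w s show ?thesis by blast
 qed
 then show ?thesis using assms unfolding jet2_def sobolev_H_2 by blast
qed

lemma jet2_sobolev_H: "jet2 u G K \<Longrightarrow> sobolev_H 2 u" unfolding jet2_def sobolev_H_2 by blast

lemma jet2_AE:
 assumes "jet2 u G K"
 shows "AE x in lborel. weak_partial i u x = G i x"
  "AE x in lborel. weak_partial j (weak_partial i u) x = K i j x"
proof -
 note J = jet2D[OF assms] and W = jet2D[OF jet2_weak_partial[OF jet2_sobolev_H[OF assms]]]
 show ae: "AE x in lborel. weak_partial i u x = G i x" by (rule weak_partial_AE[OF J(2)])
 have "has_weak_partial j (weak_partial i u) (K i j)"
  by (rule has_weak_partial_cong_AE[OF J(4)]) (use J(5) W(3) ae in \<open>auto elim: eventually_mono\<close>)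
 then show "AE x in lborel. weak_partial j (weak_partial i u) x = K i j x" by (rule weak_partial_AE)
qed

lemma jet2_l2:
 assumes "jet2 u G K"
 shows "l2 (weak_partial i u) = l2 (G i)" "l2 (weak_partial j (weak_partial i u)) = l2 (K i j)"
proof -
 note J = jet2D[OF assms] and W = jet2D[OF jet2_weak_partial[OF jet2_sobolev_H[OF assms]]]
 show "l2 (weak_partial i u) = l2 (G i)"
  by (rule l2_cong_AE) (use J(3) W(3) jet2_AE(1)[OF assms, of i] in \<open>auto elim: eventually_mono\<close>)
 show "l2 (weak_partial j (weak_partial i u)) = l2 (K i j)"
  by (rule l2_cong_AE) (use J(5) W(5) jet2_AE(2)[OF assms, of j i] in \<open>auto elim: eventually_mono\<close>)
qed

lemma jet2_diff:
 assumes "jet2 u G K" "jet2 u' G' K'"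
 shows "jet2 (\<lambda>x. u x - u' x) (\<lambda>i x. G i x - G' i x) (\<lambda>i j x. K i j x - K' i j x)"
 using assms unfolding jet2_def by (blast intro: L2_diff has_weak_partial_diff)

lemma jet2_bounded_linear:
 fixes L :: "'b::euclidean_space \<Rightarrow> 'c::euclidean_space"
 assumes "bounded_linear L" "jet2 u G K"
 shows "jet2 (\<lambda>x. L (u x)) (\<lambda>i x. L (G i x)) (\<lambda>i j x. L (K i j x))" using assms unfolding jet2_def
 by (blast intro: L2_bounded_linear has_weak_partial_bounded_linear)

lemma jet2_affine:
 assumes c: "c \<noteq> 0" and J: "jet2 u G K"
 shows "jet2 (\<lambda>x. u (a + c *R x)) (\<lambda>i x. c *R G i (a + c *R x)) (\<lambda>i j x. (c * c) *R K i j (a + c *R x))"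
proof -
 note J = jet2D[OF J]
 have "has_weak_partial j (\<lambda>x. c *R G i (a + c *R x)) (\<lambda>x. c *R (c *R K i j (a + c *R x)))" for i j
  by (rule has_weak_partial_scaleR[OF has_weak_partial_affine[OF c J(4)]])
 then show ?thesis unfolding jet2_def using J c by (auto intro!: L2_affine L2_scaleR has_weak_partial_affine)
qed

lemma jet2_shift:
 "jet2 u G K \<Longrightarrow> jet2 (\<lambda>x. u (x + a)) (\<lambda>i x. G i (x + a)) (\<lambda>i j x. K i j (x + a))"
 using jet2_affine[of 1 u G K a] by (simp add: add.commute)

subsection \<open>The Laplacian controls all second derivatives\<close>

lemma gradient_l2:
 assumes J: "jet2 u G K"
 shows "(\<Sum>i\<in>UNIV. (l2 (G i))\<^sup>2) = - (LINT x|lborel. u x \<bullet> (\<Sum>i\<in>UNIV. K i i x))"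
proof -
 note J = jet2D[OF J]
 have "(l2 (G i))\<^sup>2 = - (LINT x|lborel. u x \<bullet> K i i x)" for i
  using weak_integration_by_parts[OF J(2,1,3) J(4,3,5), of i i] by (simp add: l2_power2 power2_norm_eq_inner)
 then show ?thesis using integrable_inner[OF J(1) J(5)] by (simp add: inner_sum_right sum_negf)
qed

text \<open>The null Lagrangian identity for a pair of first derivatives trades the product of mixed
  derivatives for the product of pure ones; with symmetric mixed derivatives the double sum becomes
  the square of the Laplacian.\<close>

lemma hessian_l2:
 fixes u :: "real^'n::finite \<Rightarrow> 'b::euclidean_space"
 assumes J: "jet2 u G K"
 shows "(\<Sum>i\<in>UNIV. \<Sum>j\<in>UNIV. (l2 (K i j))\<^sup>2) = (l2 (\<lambda>x. \<Sum>i\<in>UNIV. K i i x))\<^sup>2"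
proof -
 note J = jet2D[OF J]
 have "(l2 (K i j))\<^sup>2 = (LINT x|lborel. K i i x \<bullet> K j j x)" for i j
 proof -
  have "(LINT x|lborel. K i j x \<bullet> K j i x) = (LINT x|lborel. K i i x \<bullet> K j j x)"
   by (rule weak_partial_exchange[OF J(4)[of i i] J(4)[of j i] J(3) J(5) J(5) J(4)[of i j] J(4)[of j j] J(3) J(5) J(5)])
  moreover have ae: "AE x in lborel. K i j x = K j i x"
   by (rule weak_partial_commute[OF J(1) J(2)[of i] J(2)[of j] J(3) J(3) J(4) J(4)])
  have "(LINT x|lborel. K i j x \<bullet> K j i x) = (LINT x|lborel. (norm (K i j x))\<^sup>2)"
  proof (rule integral_cong_AE)
   note [measurable] = J(5)[of i j, THEN L2_measurable] J(5)[of j i, THEN L2_measurable]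
   show "(\<lambda>x. K i j x \<bullet> K j i x) \<in> borel_measurable lborel" "(\<lambda>x. (norm (K i j x))\<^sup>2) \<in> borel_measurable lborel"
    by measurable
   show "AE x in lborel. K i j x \<bullet> K j i x = (norm (K i j x))\<^sup>2"
    using ae by eventually_elim (simp add: power2_norm_eq_inner)
  qed
  ultimately show ?thesis by (simp add: l2_power2)
 qed
 moreover have "(l2 (\<lambda>x. \<Sum>i\<in>UNIV. K i i x))\<^sup>2 = (\<Sum>i\<in>UNIV. \<Sum>j\<in>UNIV. LINT x|lborel. K i i x \<bullet> K j j x)"
  using integrable_inner[OF J(5) J(5)] by (simp add: l2_power2 power2_norm_eq_inner inner_sum_left inner_sum_right)
    (subst sum.swap, rule refl)
 ultimately show ?thesis by simp
qed

subsection \<open>Pointwise bounds\<close>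

lemma AE_continuous_le:
 fixes f :: "'a::euclidean_space \<Rightarrow> 'b::real_normed_vector"
 assumes f: "continuous_on UNIV f" and ae: "AE x in lborel. norm (f x) \<le> c"
 shows "norm (f x) \<le> c"
proof (rule ccontr)
 assume "\<not> norm (f x) \<le> c"
 then have x: "x \<in> {y. c < norm (f y)}" by simp
 have o: "open {y. c < norm (f y)}" by (intro open_Collect_less continuous_intros f)
 obtain N where N: "{y. \<not> norm (f y) \<le> c} \<subseteq> N" "N \<in> null_sets lborel" using ae by (auto simp: eventually_ae_filter)
 then have "{y. c < norm (f y)} \<in> null_sets lborel" using o by (intro null_sets_subset[OF N(2)]) (auto simp: not_le)
 then have "negligible {y. c < norm (f y)}" by (simp add: negligible_iff_null_sets null_sets_completionI)
 with open_not_negligible[OF o] x show False by blast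
qed

lemma nn_integral_unif:
 assumes "w \<in> borel_measurable borel"
 shows "(\<integral>\<^sup>+r. w r \<partial>unif) = (\<integral>\<^sup>+r. indicator {0..1} r * w r \<partial>lborel)"
 unfolding unif_def using assms by (subst nn_integral_density) (auto simp: ennreal_indicator)

text \<open>The substitution of \<open>r * s\<close> for \<open>r\<close> shows that the left side
  is the integral of \<open>w\<close> over the shorter segment from 0 to \<open>s\<close>.\<close>

lemma unif_scale_le:
 fixes w :: "real \<Rightarrow> ennreal"
 assumes [measurable]: "w \<in> borel_measurable borel" and s: "s \<in> {0..1}"
 shows "ennreal s * (\<integral>\<^sup>+r. w (r * s) \<partial>unif) \<le> (\<integral>\<^sup>+r. w r \<partial>unif)"
proof (cases "s = 0")
 case False
 with s have s0: "0 < s" "s \<le> 1" by auto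
 have "(\<integral>\<^sup>+r. indicator {0..s} r * w r \<partial>lborel) = ennreal \<bar>s\<bar> * (\<integral>\<^sup>+r. indicator {0..s} (0 + s * r) * w (0 + s * r) \<partial>lborel)"
  by (rule nn_integral_real_affine) (use False in auto)
 also have "(\<integral>\<^sup>+r. indicator {0..s} (0 + s * r) * w (0 + s * r) \<partial>lborel) = (\<integral>\<^sup>+r. indicator {0..1} r * w (r * s) \<partial>lborel)"
  using s0 by (intro nn_integral_cong) (auto simp: indicator_def mult.commute zero_le_mult_iff split: if_splits)
 finally have "ennreal s * (\<integral>\<^sup>+r. w (r * s) \<partial>unif) = (\<integral>\<^sup>+r. indicator {0..s} r * w r \<partial>lborel)"
  using s0 by (simp add: nn_integral_unif)
 also have "\<dots> \<le> (\<integral>\<^sup>+r. indicator {0..1} r * w r \<partial>lborel)"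
  using s0 by (intro nn_integral_mono mult_right_mono) (auto simp: indicator_def)
 finally show ?thesis by (simp add: nn_integral_unif)
qed simp

text \<open>The exceptional null set may depend on the parameter; Fubini exchanges the two almost
  everywhere quantifiers.\<close>

lemma AE_swap_unif:
 fixes P :: "real^'n::finite \<Rightarrow> real \<Rightarrow> bool"
 assumes m: "Measurable.pred (unif \<Otimes>\<^sub>M lborel) (\<lambda>(s, x). P x s)"
  and ae: "\<And>s. s \<in> {0..1} \<Longrightarrow> AE x in lborel. P x s"
 shows "AE x in lborel. AE s in unif. P x s"
proof -
 have "AE s in unif. AE x in lborel. P x s" using AE_unif by eventually_elim (rule ae)
 then show ?thesis using m by (subst (asm) U_pair.AE_commute) (auto simp: pred_def split_beta')
qed

lemma norm_integral_le_nn_integral: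
 fixes f :: "'a \<Rightarrow> 'b::euclidean_space"
 shows "ennreal (norm (LINT s|M. f s)) \<le> (\<integral>\<^sup>+s. ennreal (norm (f s)) \<partial>M)"
 by (cases "integrable M f") (auto intro: integral_norm_bound_ennreal simp: not_integrable_integral_eq)

text \<open>A fundamental theorem of calculus argument averaged over the starting point.\<close>

lemma norm_le_line_average:
 fixes f g :: "real^'n::finite \<Rightarrow> 'b::euclidean_space"
 assumes fg: "has_weak_partial i f g" "L2 f" "L2 g"
 shows "AE x in lborel. ennreal (norm (f x)) \<le>
  (\<integral>\<^sup>+s. ennreal (norm (f (x + s *R axis i 1)) + norm (g (x + s *R axis i 1))) \<partial>unif)"
proof -
 note [measurable] = fg(2,3)[THEN L2_measurable]
 define C where "C x = (\<integral>\<^sup>+r. ennreal (norm (g (x + r *R axis i 1))) \<partial>unif)" for x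
 have [measurable]: "C \<in> borel_measurable borel" unfolding C_def by measurable
 have "AE x in lborel. ennreal (norm (f x)) \<le> ennreal (norm (f (x + s *R axis i 1))) + C x" if s: "s \<in> {0..1}" for s
  using weak_partial_line[OF fg, of s]
 proof eventually_elim
  case (elim x)
  have "ennreal (norm (s *R (LINT r|unif. g (x + (r * s) *R axis i 1))))
    = ennreal s * ennreal (norm (LINT r|unif. g (x + (r * s) *R axis i 1)))" using s by (simp add: ennreal_mult)
  also have "\<dots> \<le> ennreal s * (\<integral>\<^sup>+r. ennreal (norm (g (x + (r * s) *R axis i 1))) \<partial>unif)"
   by (intro mult_left_mono norm_integral_le_nn_integral) simp
  also have "\<dots> \<le> C x"
   unfolding C_def by (rule unif_scale_le[OF _ s, of "\<lambda>r. ennreal (norm (g (x + r *R axis i 1)))"]) measurable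
  finally have c: "ennreal (norm (s *R (LINT r|unif. g (x + (r * s) *R axis i 1)))) \<le> C x" .
  have "norm (f x) \<le> norm (f (x + s *R axis i 1)) + norm (f (x + s *R axis i 1) - f x)"
   using norm_triangle_ineq4[of "f (x + s *R axis i 1)" "f (x + s *R axis i 1) - f x"] by simp
  then have "ennreal (norm (f x)) \<le> ennreal (norm (f (x + s *R axis i 1))) + ennreal (norm (f (x + s *R axis i 1) - f x))"
   by (simp add: ennreal_leI flip: ennreal_plus)
  also have "\<dots> \<le> ennreal (norm (f (x + s *R axis i 1))) + C x" unfolding elim by (intro add_left_mono c)
  finally show ?case .
 qed
 then have "AE x in lborel. AE s in unif. ennreal (norm (f x)) \<le> ennreal (norm (f (x + s *R axis i 1))) + C x"
  by (intro AE_swap_unif) measurable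
 then show ?thesis
 proof eventually_elim
  case (elim x)
  have "ennreal (norm (f x)) = (\<integral>\<^sup>+s. ennreal (norm (f x)) \<partial>unif)" using prob_space_unif by simp
  also have "\<dots> \<le> (\<integral>\<^sup>+s. ennreal (norm (f (x + s *R axis i 1))) + C x \<partial>unif)" by (rule nn_integral_mono_AE[OF elim])
  also have "\<dots> = (\<integral>\<^sup>+s. ennreal (norm (f (x + s *R axis i 1))) \<partial>unif) + C x"
   using prob_space_unif by (subst nn_integral_add) simp_all
  also have "\<dots> = (\<integral>\<^sup>+s. ennreal (norm (f (x + s *R axis i 1)) + norm (g (x + s *R axis i 1))) \<partial>unif)"
   unfolding C_def by (subst nn_integral_add[symmetric]) simp_all
  finally show ?case .
 qed
qed

lemma UNIV_2_cases: "i \<noteq> j \<Longrightarrow> (UNIV :: 2 set) = {i, j}" using exhaust_2 by (auto simp: set_eq_iff) metis+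

text \<open>Opens the plane integral to Tonelli along the axes \<open>i\<close> and \<open>j\<close>
  in either order, so that lines in both directions are treated alike.\<close>

lemma plane_coordinates:
 assumes ij: "i \<noteq> (j::2)"
 shows "(lborel :: (real^2) measure) = distr (lborel \<Otimes>\<^sub>M lborel) borel (\<lambda>(s, r). s *R axis i 1 + r *R axis j 1)"
proof (rule lborel_eqI)
 let ?T = "\<lambda>(s::real, r::real). s *R axis i 1 + r *R axis j (1::real) :: real^2"
 have B: "Basis = {axis i (1::real), axis j 1}" using UNIV_2_cases[OF ij] by (auto simp: Basis_vec_def)
 have ne: "axis i (1::real) \<noteq> axis j 1" using ij by (simp add: axis_eq_axis)
 have T[measurable]: "?T \<in> borel_measurable (lborel \<Otimes>\<^sub>M lborel)" by measurable
 fix l u :: "real^2" assume lu: "\<And>b. b \<in> Basis \<Longrightarrow> l \<bullet> b \<le> u \<bullet> b"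
 have all: "(\<forall>k. P k) \<longleftrightarrow> P i \<and> P j" for P using UNIV_2_cases[OF ij] by (metis UNIV_I insertE singletonD)
 have comp: "(s *R axis i 1 + r *R axis j 1 :: real^2) $ i = s" "(s *R axis i 1 + r *R axis j 1 :: real^2) $ j = r" for s r
  using ij by (simp_all add: axis_def)
 have vim: "?T -` box l u \<inter> space (lborel \<Otimes>\<^sub>M lborel) = {l $ i<..<u $ i} \<times> {l $ j<..<u $ j}"
 proof (rule set_eqI)
  fix p :: "real \<times> real"
  show "p \<in> ?T -` box l u \<inter> space (lborel \<Otimes>\<^sub>M lborel) \<longleftrightarrow> p \<in> {l $ i<..<u $ i} \<times> {l $ j<..<u $ j}"
   by (cases p) (simp only: vimage_eq Int_iff prod.case mem_box_cart all comp space_pair_measure space_lborel space_borel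
     mem_Times_iff fst_conv snd_conv greaterThanLessThan_iff UNIV_I simp_thms)
 qed
 have "emeasure (distr (lborel \<Otimes>\<^sub>M lborel) borel ?T) (box l u) = emeasure (lborel \<Otimes>\<^sub>M lborel) ({l $ i<..<u $ i} \<times> {l $ j<..<u $ j})"
  unfolding vim[symmetric] by (rule emeasure_distr[OF T]) simp
 also have "\<dots> = ennreal (u $ i - l $ i) * ennreal (u $ j - l $ j)" using lu[of "axis i 1"] lu[of "axis j 1"] B
  by (subst lborel.emeasure_pair_measure_Times) (auto simp: cart_eq_inner_axis)
 also have "\<dots> = ennreal (\<Prod>b\<in>Basis. (u - l) \<bullet> b)"
 proof -
  have "(\<Prod>b\<in>Basis. (u - l) \<bullet> b) = (u $ i - l $ i) * (u $ j - l $ j)"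
   unfolding B using ne by (simp add: cart_eq_inner_axis inner_diff_left)
  moreover have "l $ i \<le> u $ i" "l $ j \<le> u $ j"
   using lu[of "axis i 1"] lu[of "axis j 1"] unfolding B by (auto simp: cart_eq_inner_axis)
  ultimately show ?thesis by (simp add: ennreal_mult)
 qed
 finally show "emeasure (distr (lborel \<Otimes>\<^sub>M lborel) borel ?T) (box l u) = ennreal (\<Prod>b\<in>Basis. (u - l) \<bullet> b)" .
qed simp

text \<open>The average is taken over a rectangle with sides \<open>h\<close> and 1, whose area is
  the modulus of \<open>h\<close>.\<close>

lemma rectangle_average_le:
 fixes F :: "real^2 \<Rightarrow> ennreal"
 assumes ij: "i \<noteq> (j::2)" and h: "h \<noteq> 0" and [measurable]: "F \<in> borel_measurable borel"
 shows "(\<integral>\<^sup>+s. (\<integral>\<^sup>+r. F (x + (s * h) *R axis i 1 + r *R axis j 1) \<partial>unif) \<partial>unif)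
  \<le> ennreal (1 / \<bar>h\<bar>) * (\<integral>\<^sup>+y. F y \<partial>lborel)"
proof -
 define w where "w s = (\<integral>\<^sup>+r. F (x + s *R axis i 1 + r *R axis j 1) \<partial>lborel)" for s
 have [measurable]: "w \<in> borel_measurable borel" unfolding w_def by measurable
 have le: "(\<integral>\<^sup>+r. k r \<partial>unif) \<le> (\<integral>\<^sup>+r. k r \<partial>lborel)" if "k \<in> borel_measurable borel" for k
  unfolding nn_integral_unif[OF that] by (intro nn_integral_mono) (auto simp: indicator_def)
 have "(\<integral>\<^sup>+y. F y \<partial>lborel) = (\<integral>\<^sup>+y. F (y + x) \<partial>lborel)" by (rule nn_integral_shift[symmetric]) measurable
 also have "\<dots> = (\<integral>\<^sup>+y. F (y + x) \<partial>(distr (lborel \<Otimes>\<^sub>M lborel) borel (\<lambda>(s, r). s *R axis i 1 + r *R axis j 1)))"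
  by (subst plane_coordinates[OF ij]) (rule refl)
 also have "\<dots> = (\<integral>\<^sup>+p. F ((\<lambda>(s, r). s *R axis i 1 + r *R axis j 1) p + x) \<partial>(lborel \<Otimes>\<^sub>M lborel))"
  by (rule nn_integral_distr) measurable
 also have "\<dots> = (\<integral>\<^sup>+s. (\<integral>\<^sup>+r. F ((\<lambda>(s, r). s *R axis i 1 + r *R axis j 1) (s, r) + x) \<partial>lborel) \<partial>lborel)"
  by (rule lborel.nn_integral_fst[symmetric]) measurable
 also have "\<dots> = (\<integral>\<^sup>+s. w s \<partial>lborel)" unfolding w_def prod.case by (intro nn_integral_cong) (simp add: add_ac)
 also have "\<dots> = ennreal \<bar>h\<bar> * (\<integral>\<^sup>+s. w (0 + h * s) \<partial>lborel)" by (rule nn_integral_real_affine) (use h in auto)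
 finally have eq: "(\<integral>\<^sup>+y. F y \<partial>lborel) = ennreal \<bar>h\<bar> * (\<integral>\<^sup>+s. w (h * s) \<partial>lborel)" by simp
 have "(\<integral>\<^sup>+s. (\<integral>\<^sup>+r. F (x + (s * h) *R axis i 1 + r *R axis j 1) \<partial>unif) \<partial>unif)
   \<le> (\<integral>\<^sup>+s. w (s * h) \<partial>unif)" unfolding w_def by (intro nn_integral_mono le) measurable
 also have "\<dots> \<le> (\<integral>\<^sup>+s. w (s * h) \<partial>lborel)" by (rule le) measurable
 also have "\<dots> = ennreal (1 / \<bar>h\<bar>) * (\<integral>\<^sup>+y. F y \<partial>lborel)"
  unfolding eq using h by (simp add: mult.assoc[symmetric] mult.commute[of _ h] flip: ennreal_mult)
 finally show ?thesis .
qed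

lemma ennreal_power2_le_imp_le:
 assumes "x\<^sup>2 \<le> (ennreal b)\<^sup>2" "0 \<le> b"
 shows "x \<le> ennreal b"
proof (cases x)
 case (real a)
 then have "a\<^sup>2 \<le> b\<^sup>2" using assms by (simp add: ennreal_power ennreal_le_iff)
 then have "a \<le> b" using assms(2) by (rule power2_le_imp_le)
 then show ?thesis unfolding real(2) by (rule ennreal_leI)
next
 case top
 then have "top \<le> ennreal (b * b)" using assms by (simp add: ennreal_mult power2_eq_square)
 then show ?thesis by (simp only: top_unique ennreal_neq_top)
qed

text \<open>Jensen in both variables puts the area of the rectangle under a square root; this is the
  origin of the Hoelder exponent 1/2 below.\<close>

lemma rectangle_average_l2:
 fixes W :: "real^2 \<Rightarrow> real"
 assumes ij: "i \<noteq> (j::2)" and h: "h \<noteq> 0" and W: "L2 W" "\<And>x. 0 \<le> W x"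
 shows "(\<integral>\<^sup>+s. (\<integral>\<^sup>+r. ennreal (W (x + (s * h) *R axis i 1 + r *R axis j 1)) \<partial>unif) \<partial>unif)
  \<le> ennreal (l2 W / sqrt \<bar>h\<bar>)" (is "?L \<le> _")
proof -
 have [measurable]: "W \<in> borel_measurable borel" using W by auto
 have "?L\<^sup>2 \<le> (\<integral>\<^sup>+s. (\<integral>\<^sup>+r. ennreal (W (x + (s * h) *R axis i 1 + r *R axis j 1)) \<partial>unif)\<^sup>2 \<partial>unif)"
  by (rule nn_integral_power2_le) measurable
 also have "\<dots> \<le> (\<integral>\<^sup>+s. (\<integral>\<^sup>+r. (ennreal (W (x + (s * h) *R axis i 1 + r *R axis j 1)))\<^sup>2 \<partial>unif) \<partial>unif)"
  by (intro nn_integral_mono nn_integral_power2_le) measurable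
 also have "\<dots> \<le> ennreal (1 / \<bar>h\<bar>) * (\<integral>\<^sup>+y. (ennreal (W y))\<^sup>2 \<partial>lborel)"
  by (rule rectangle_average_le[OF ij h]) measurable
 also have "(\<integral>\<^sup>+y. (ennreal (W y))\<^sup>2 \<partial>lborel) = ennreal ((l2 W)\<^sup>2)"
  using nn_integral_l2[OF W(1)] W(2) by (simp add: ennreal_power)
 also have "ennreal (1 / \<bar>h\<bar>) * ennreal ((l2 W)\<^sup>2) = (ennreal (l2 W / sqrt \<bar>h\<bar>))\<^sup>2"
  by (simp add: ennreal_power power_divide flip: ennreal_mult)
 finally show ?thesis by (rule ennreal_power2_le_imp_le) simp
qed

text \<open>Integrals over segments are controlled in the plane at the cost of one transverse
  derivative: each point of the segment is bounded by an average along the other axis.\<close>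

lemma AE_line_le_rectangle:
 fixes f g :: "real^2 \<Rightarrow> 'b::euclidean_space"
 assumes ij: "i \<noteq> (j::2)" and h: "h \<noteq> 0"
  and fg: "has_weak_partial j f g" "L2 f" "L2 g"
 shows "AE x in lborel. (\<integral>\<^sup>+s. ennreal (norm (f (x + (s * h) *R axis i 1))) \<partial>unif)
  \<le> ennreal ((l2 f + l2 g) / sqrt \<bar>h\<bar>)"
proof -
 note [measurable] = fg(2,3)[THEN L2_measurable]
 define W where "W x = norm (f x) + norm (g x)" for x
 have W: "L2 W" unfolding W_def[abs_def] by (intro L2_add L2_norm fg)
 have [measurable]: "W \<in> borel_measurable borel" using W by auto
 have lW: "l2 W \<le> l2 f + l2 g" unfolding W_def[abs_def]
  using l2_triangle[OF L2_norm[OF fg(2)] L2_norm[OF fg(3)]] by simp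
 have "AE x in lborel. ennreal (norm (f (x + (s * h) *R axis i 1))) \<le> (\<integral>\<^sup>+r. ennreal (W (x + (s * h) *R axis i 1 + r *R axis j 1)) \<partial>unif)" for s
  unfolding W_def by (rule AE_shift[OF norm_le_line_average[OF fg]])
 then have "AE x in lborel. AE s in unif. ennreal (norm (f (x + (s * h) *R axis i 1))) \<le> (\<integral>\<^sup>+r. ennreal (W (x + (s * h) *R axis i 1 + r *R axis j 1)) \<partial>unif)"
  by (intro AE_swap_unif) measurable
 then show ?thesis
 proof eventually_elim
  case (elim x)
  have "(\<integral>\<^sup>+s. ennreal (norm (f (x + (s * h) *R axis i 1))) \<partial>unif)
    \<le> (\<integral>\<^sup>+s. (\<integral>\<^sup>+r. ennreal (W (x + (s * h) *R axis i 1 + r *R axis j 1)) \<partial>unif) \<partial>unif)"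
   by (rule nn_integral_mono_AE[OF elim])
  also have "\<dots> \<le> ennreal (l2 W / sqrt \<bar>h\<bar>)" by (rule rectangle_average_l2[OF ij h W]) (simp add: W_def)
  also have "\<dots> \<le> ennreal ((l2 f + l2 g) / sqrt \<bar>h\<bar>)" by (intro ennreal_leI divide_right_mono lW) simp
  finally show ?case .
 qed
qed

text \<open>The value at a point is bounded by averages of \<open>u\<close> and \<open>G 1\<close>
  along a segment in direction 1; each of these costs one derivative in direction 2, hence the mixed
  derivative \<open>K 1 2\<close>.\<close>

lemma sup_bound:
 fixes u :: "real^2 \<Rightarrow> 'b::euclidean_space"
 assumes J: "jet2 u G K" and c: "continuous_on UNIV u"
 shows "norm (u x) \<le> l2 u + l2 (G 1) + l2 (G 2) + l2 (K 1 2)"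
proof (rule AE_continuous_le[OF c])
 note J = jet2D[OF J]
 note [measurable] = J(1)[THEN L2_measurable] J(3)[of 1, THEN L2_measurable]
 have ne: "(1::2) \<noteq> 2" and one: "(1::real) \<noteq> 0" by simp_all
 show "AE x in lborel. norm (u x) \<le> l2 u + l2 (G 1) + l2 (G 2) + l2 (K 1 2)"
  using norm_le_line_average[OF J(2)[of 1] J(1) J(3)]
   AE_line_le_rectangle[OF ne one J(2)[of 2] J(1) J(3)]
   AE_line_le_rectangle[OF ne one J(4)[of 2 1] J(3) J(5)]
 proof eventually_elim
  case (elim x)
  note elim(1)
  also have "(\<integral>\<^sup>+s. ennreal (norm (u (x + s *R axis 1 1)) + norm (G 1 (x + s *R axis 1 1))) \<partial>unif)
    = (\<integral>\<^sup>+s. ennreal (norm (u (x + s *R axis 1 1))) \<partial>unif) + (\<integral>\<^sup>+s. ennreal (norm (G 1 (x + s *R axis 1 1))) \<partial>unif)"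
   by (subst nn_integral_add[symmetric]) simp_all
  also have "\<dots> \<le> ennreal (l2 u + l2 (G 2)) + ennreal (l2 (G 1) + l2 (K 1 2))"
   using elim(2,3) by (intro add_mono) simp_all
  also have "\<dots> = ennreal (l2 u + l2 (G 1) + l2 (G 2) + l2 (K 1 2))"
   by (subst ennreal_plus[symmetric]) (auto simp: algebra_simps)
  finally show ?case by (subst (asm) ennreal_le_iff) auto
 qed
qed

text \<open>The increment carries a factor \<open>h\<close> from the fundamental theorem, and the
  average of the derivative over the segment costs one over the root of \<open>h\<close>.\<close>

lemma hoelder_bound:
 fixes u :: "real^2 \<Rightarrow> 'b::euclidean_space"
 assumes J: "jet2 u G K" and c: "continuous_on UNIV u" and ij: "i \<noteq> j"
 shows "norm (u (x + h *R axis i 1) - u x) \<le> sqrt \<bar>h\<bar> * (l2 (G i) + l2 (K i j))"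
proof (cases "h = 0")
 case False
 note J = jet2D[OF J]
 have c': "continuous_on UNIV (\<lambda>x. u (x + h *R axis i 1) - u x)"
  by (intro continuous_intros c continuous_on_compose2[OF c]) auto
 show ?thesis
 proof (rule AE_continuous_le[OF c'])
  show "AE x in lborel. norm (u (x + h *R axis i 1) - u x) \<le> sqrt \<bar>h\<bar> * (l2 (G i) + l2 (K i j))"
   using weak_partial_line[OF J(2)[of i] J(1) J(3), of h]
    AE_line_le_rectangle[OF ij False J(4)[of j i] J(3) J(5)]
  proof eventually_elim
   case (elim x)
   have "ennreal (norm (u (x + h *R axis i 1) - u x)) = ennreal \<bar>h\<bar> * ennreal (norm (LINT s|unif. G i (x + (s * h) *R axis i 1)))"
    unfolding elim(1) by (simp add: ennreal_mult)
   also have "\<dots> \<le> ennreal \<bar>h\<bar> * ennreal ((l2 (G i) + l2 (K i j)) / sqrt \<bar>h\<bar>)"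
    by (intro mult_left_mono order_trans[OF norm_integral_le_nn_integral elim(2)]) simp
   also have "\<dots> = ennreal (\<bar>h\<bar> * ((l2 (G i) + l2 (K i j)) / sqrt \<bar>h\<bar>))" by (rule ennreal_mult[symmetric]) auto
   also have "\<bar>h\<bar> * ((l2 (G i) + l2 (K i j)) / sqrt \<bar>h\<bar>) = sqrt \<bar>h\<bar> * (l2 (G i) + l2 (K i j))"
    using real_div_sqrt[OF abs_ge_zero, of h] by (metis times_divide_eq_left times_divide_eq_right)
   finally show ?case by (subst (asm) ennreal_le_iff) auto
  qed
 qed
qed simp

lemma sobolev_representative_bounds:
 assumes "sobolev_H 2 u"
 shows "(H2_norm u)\<^sup>2 = (l2 u)\<^sup>2 + (\<Sum>i\<in>UNIV. (l2 (weak_partial i u))\<^sup>2)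
  + (\<Sum>i\<in>UNIV. \<Sum>j\<in>UNIV. (l2 (weak_partial j (weak_partial i u)))\<^sup>2)"
  and "0 \<le> H2_norm u" "l2 u \<le> H2_norm u" "l2 (weak_partial i u) \<le> H2_norm u"
  "l2 (weak_partial j (weak_partial i u)) \<le> H2_norm u"
proof -
 show eq: "(H2_norm u)\<^sup>2 = (l2 u)\<^sup>2 + (\<Sum>i\<in>UNIV. (l2 (weak_partial i u))\<^sup>2)
  + (\<Sum>i\<in>UNIV. \<Sum>j\<in>UNIV. (l2 (weak_partial j (weak_partial i u)))\<^sup>2)" unfolding H2_norm_def l2_power2[symmetric]
  by (rule real_sqrt_pow2) (intro add_nonneg_nonneg sum_nonneg zero_le_power2)
 show H0: "0 \<le> H2_norm u" unfolding H2_norm_def l2_power2[symmetric]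
  by (intro real_sqrt_ge_zero add_nonneg_nonneg sum_nonneg zero_le_power2)
 have a: "(l2 (weak_partial i u))\<^sup>2 \<le> (\<Sum>i\<in>UNIV. (l2 (weak_partial i u))\<^sup>2)" for i by (rule member_le_sum) auto
 have b: "(l2 (weak_partial j (weak_partial i u)))\<^sup>2 \<le> (\<Sum>i\<in>UNIV. \<Sum>j\<in>UNIV. (l2 (weak_partial j (weak_partial i u)))\<^sup>2)" for i j
 proof -
  have "(l2 (weak_partial j (weak_partial i u)))\<^sup>2 \<le> (\<Sum>j\<in>UNIV. (l2 (weak_partial j (weak_partial i u)))\<^sup>2)"
   by (rule member_le_sum) auto
  also have "\<dots> \<le> (\<Sum>i\<in>UNIV. \<Sum>j\<in>UNIV. (l2 (weak_partial j (weak_partial i u)))\<^sup>2)"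
   by (rule member_le_sum[of i UNIV "\<lambda>i. \<Sum>j\<in>UNIV. (l2 (weak_partial j (weak_partial i u)))\<^sup>2"]) (auto intro: sum_nonneg)
  finally show ?thesis .
 qed
 have nn: "0 \<le> (\<Sum>i\<in>UNIV. (l2 (weak_partial i u))\<^sup>2)" "0 \<le> (\<Sum>i\<in>UNIV. \<Sum>j\<in>UNIV. (l2 (weak_partial j (weak_partial i u)))\<^sup>2)"
  by (intro sum_nonneg zero_le_power2)+
 have "(l2 u)\<^sup>2 \<le> (H2_norm u)\<^sup>2" unfolding eq using nn by linarith
 then show "l2 u \<le> H2_norm u" using H0 by (rule power2_le_imp_le)
 have "(l2 (weak_partial i u))\<^sup>2 \<le> (H2_norm u)\<^sup>2" unfolding eq using nn a[of i] zero_le_power2[of "l2 u"] by linarith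
 then show "l2 (weak_partial i u) \<le> H2_norm u" using H0 by (rule power2_le_imp_le)
 have "(l2 (weak_partial j (weak_partial i u)))\<^sup>2 \<le> (H2_norm u)\<^sup>2"
  unfolding eq using nn b[of j i] zero_le_power2[of "l2 u"] by linarith
 then show "l2 (weak_partial j (weak_partial i u)) \<le> H2_norm u" using H0 by (rule power2_le_imp_le)
qed

section \<open>Weak compactness\<close>

definition comb :: "nat \<Rightarrow> (nat \<Rightarrow> real) \<Rightarrow> (nat \<Rightarrow> 'a \<Rightarrow> 'b::real_vector) \<Rightarrow> 'a \<Rightarrow> 'b" where
 "comb m c F x = (\<Sum>k<m. c k *R F k x)"

text \<open>Convex weights supported on the indices from \<open>n\<close> to \<open>m - 1\<close>:
  combinations taken from later and later tails inherit every pointwise limit of the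
  sequence.\<close>

definition tail_weights :: "nat \<Rightarrow> nat \<Rightarrow> (nat \<Rightarrow> real) \<Rightarrow> bool" where
 "tail_weights n m c \<longleftrightarrow> (\<forall>k. 0 \<le> c k) \<and> (\<forall>k<n. c k = 0) \<and> (\<forall>k\<ge>m. c k = 0) \<and> (\<Sum>k<m. c k) = 1"

lemma tail_weights_extend: "tail_weights n m c \<Longrightarrow> m \<le> m' \<Longrightarrow> tail_weights n m' c" unfolding tail_weights_def
 using sum.mono_neutral_left[of "{..<m'}" "{..<m}" c] by (auto simp: lessThan_subset_iff)

lemma comb_extend:
 assumes "tail_weights n m c" "m \<le> m'"
 shows "comb m' c F = comb m c F"
proof
 fix x
 have "(\<Sum>k<m. c k *R F k x) = (\<Sum>k<m'. c k *R F k x)"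
  by (rule sum.mono_neutral_left) (use assms in \<open>auto simp: tail_weights_def\<close>)
 then show "comb m' c F x = comb m c F x" by (simp add: comb_def)
qed

lemma tail_weights_mono: "tail_weights n m c \<Longrightarrow> n' \<le> n \<Longrightarrow> tail_weights n' m c" by (auto simp: tail_weights_def)

lemma tail_weights_midpoint:
 assumes "tail_weights n m c" "tail_weights n m' c'"
 shows "tail_weights n (max m m') (\<lambda>k. (c k + c' k) / 2)"
proof -
 note 1 = tail_weights_extend[OF assms(1), of "max m m'"] tail_weights_extend[OF assms(2), of "max m m'"]
 have "(\<Sum>k<max m m'. (c k + c' k) / 2) = ((\<Sum>k<max m m'. c k) + (\<Sum>k<max m m'. c' k)) / 2"
  by (simp add: sum.distrib flip: sum_divide_distrib)
 then show ?thesis using 1 by (auto simp: tail_weights_def)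
qed

lemma comb_midpoint:
 assumes "tail_weights n m c" "tail_weights n m' c'"
 shows "comb (max m m') (\<lambda>k. (c k + c' k) / 2) F x = (1/2) *R (comb m c F x + comb m' c' F x)"
proof -
 have "comb m c F = comb (max m m') c F" "comb m' c' F = comb (max m m') c' F"
  using comb_extend[OF assms(1), of "max m m'" F] comb_extend[OF assms(2), of "max m m'" F] by auto
 then show ?thesis
  by (simp add: comb_def sum.distrib[symmetric] scaleR_sum_right scaleR_add_left[symmetric] add_divide_distrib)
qed

lemma tail_weights_tendsto:
 fixes a :: "nat \<Rightarrow> 'b::real_normed_vector"
 assumes w: "\<And>n. tail_weights n (m n) (c n)" and a: "a ----> l"
 shows "(\<lambda>n. \<Sum>k<m n. c n k *R a k) ----> l"
proof (rule LIMSEQ_I)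
 fix e :: real assume e: "0 < e"
 obtain N where N: "\<And>k. N \<le> k \<Longrightarrow> norm (a k - l) < e / 2" using LIMSEQ_D[OF a, of "e/2"] e by auto
 have "norm ((\<Sum>k<m n. c n k *R a k) - l) < e" if "N \<le> n" for n
 proof -
  have s1: "(\<Sum>k<m n. c n k) = 1" and c0: "\<And>k. 0 \<le> c n k" and cz: "\<And>k. k < n \<Longrightarrow> c n k = 0"
   using w[of n] by (auto simp: tail_weights_def)
  have "(\<Sum>k<m n. c n k *R a k) - l = (\<Sum>k<m n. c n k *R (a k - l))"
   using s1 by (simp add: scaleR_diff_right sum_subtractf flip: scaleR_sum_left)
  also have "norm \<dots> \<le> (\<Sum>k<m n. c n k * (e / 2))"
  proof (rule sum_norm_le)
   fix k
   show "norm (c n k *R (a k - l)) \<le> c n k * (e / 2)"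
   proof (cases "k < n")
    case False
    then have "c n k * norm (a k - l) \<le> c n k * (e / 2)"
     using that by (intro mult_left_mono less_imp_le[OF N] c0) simp
    then show ?thesis using c0[of k] by simp
   qed (simp add: cz)
  qed
  also have "\<dots> = e / 2" using s1 by (simp flip: sum_distrib_right sum_divide_distrib)
  finally show ?thesis using e by simp
 qed
 then show "\<exists>N. \<forall>n\<ge>N. norm ((\<Sum>k<m n. c n k *R a k) - l) < e" by blast
qed

lemma L2_comb:
 "(\<And>k. L2 (F k)) \<Longrightarrow> L2 (comb m c F)" unfolding comb_def[abs_def] by (intro L2_sum L2_scaleR)

lemma l2_comb_le:
 assumes F: "\<And>k. L2 (F k)" "\<And>k. l2 (F k) \<le> M" and w: "tail_weights n m c"
 shows "l2 (comb m c F) \<le> M"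
proof -
 have "l2 (comb m c F) \<le> (\<Sum>k<m. c k * M)" unfolding comb_def[abs_def]
 proof (induction m)
  case (Suc m)
  have "l2 (\<lambda>x. \<Sum>k<Suc m. c k *R F k x) \<le> l2 (\<lambda>x. \<Sum>k<m. c k *R F k x) + l2 (\<lambda>x. c m *R F m x)"
   using l2_triangle[of "\<lambda>x. \<Sum>k<m. c k *R F k x" "\<lambda>x. c m *R F m x"] F(1) by (simp add: L2_sum L2_scaleR)
  also have "l2 (\<lambda>x. c m *R F m x) \<le> c m * M" using F(2) w by (auto simp: tail_weights_def intro!: mult_left_mono)
  finally show ?case using Suc by simp
 qed simp
 also have "\<dots> = M" using w by (simp add: tail_weights_def flip: sum_distrib_right)
 finally show ?thesis .
qed

text \<open>Mazur's lemma in the form of the classical minimal norm argument: near-minimizers of the norm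
 over the convex hulls of the tails form a Cauchy sequence by the parallelogram law.\<close>

lemma mazur:
 fixes F :: "'i \<Rightarrow> nat \<Rightarrow> 'a::euclidean_space \<Rightarrow> 'b::euclidean_space"
 assumes A: "finite A" and F: "\<And>a k. a \<in> A \<Longrightarrow> L2 (F a k)" "\<And>a k. a \<in> A \<Longrightarrow> l2 (F a k) \<le> M"
 obtains m c where "\<And>n. tail_weights n (m n) (c n)"
  "\<And>a e. a \<in> A \<Longrightarrow> 0 < e \<Longrightarrow> \<exists>N. \<forall>i\<ge>N. \<forall>j\<ge>N. l2 (\<lambda>x. comb (m i) (c i) (F a) x - comb (m j) (c j) (F a) x) < e"
proof -
 \<comment> \<open>Summing over the finite family lets one choice of weights serve all members at
   once; the family will be a function together with its derivatives.\<close>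
 define Q where "Q m c = (\<Sum>a\<in>A. (l2 (comb m c (F a)))\<^sup>2)" for m c
 define S where "S n = {Q m c |m c. tail_weights n m c}" for n
 define d where "d n = Inf (S n)" for n
 have Q0: "0 \<le> Q m c" for m c by (simp add: Q_def sum_nonneg)
 have QM: "Q m c \<le> card A * M\<^sup>2" if "tail_weights n m c" for n m c unfolding Q_def
  by (rule sum_bounded_above) (use l2_comb_le[OF F that] in \<open>auto intro: power_mono\<close>)
 have bdd: "bdd_below (S n)" for n unfolding S_def by (rule bdd_belowI[of _ 0]) (use Q0 in auto)
 have unit: "tail_weights n (Suc n) (\<lambda>k. if k = n then 1 else 0)" for n by (auto simp: tail_weights_def)
 then have ne: "S n \<noteq> {}" for n unfolding S_def by blast
 have dQ: "d n \<le> Q m c" if "tail_weights n m c" for n m c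
  unfolding d_def using that by (intro cInf_lower bdd) (auto simp: S_def)
 have mono: "d n \<le> d n'" if "n \<le> n'" for n n'
  unfolding d_def by (intro cInf_superset_mono ne bdd) (use tail_weights_mono[OF _ that] in \<open>unfold S_def, blast\<close>)
 have dub: "d n \<le> card A * M\<^sup>2" for n using dQ[OF unit] QM[OF unit] order_trans by blast
 have inc: "incseq d" using mono by (simp add: incseq_def)
 obtain D where D: "d ----> D" and dD: "\<And>n. d n \<le> D" using incseq_convergent[OF inc, of "card A * M\<^sup>2"] dub by blast
 have "\<exists>m c. tail_weights n m c \<and> Q m c < d n + 1 / real (Suc n)" for n
 proof -
  have "Inf (S n) < d n + 1 / real (Suc n)" by (simp add: d_def)
  then obtain y where "y \<in> S n" "y < d n + 1 / real (Suc n)" using cInf_lessD[OF ne] by blast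
  then show ?thesis by (auto simp: S_def)
 qed
 then obtain m c where w: "\<And>n. tail_weights n (m n) (c n)" and q: "\<And>n. Q (m n) (c n) < d n + 1 / real (Suc n)"
  by metis
 let ?d = "\<lambda>i j a. l2 (\<lambda>x. comb (m i) (c i) (F a) x - comb (m j) (c j) (F a) x)"
 let ?s = "\<lambda>i j a. (l2 (\<lambda>x. comb (m i) (c i) (F a) x + comb (m j) (c j) (F a) x))\<^sup>2"
 let ?e = "\<lambda>n. 2 * (D - d n) + 2 * (D - d n) + 4 * (1 / real (Suc n))"
 have diff: "(\<Sum>a\<in>A. (?d i j a)\<^sup>2) \<le> ?e n"
  if ij: "n \<le> i" "n \<le> j" for i j n
 proof -
  note wi = tail_weights_mono[OF w ij(1)] and wj = tail_weights_mono[OF w ij(2)]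
  let ?M = "max (m i) (m j)" and ?c = "\<lambda>k. (c i k + c j k) / 2"
  \<comment> \<open>Tails are nested, so the midpoint of two later combinations still competes in
    the \<open>n\<close>-th minimization; this is the lower bound fed into the parallelogram
    law.\<close>
  have "d n \<le> Q ?M ?c" by (rule dQ[OF tail_weights_midpoint[OF wi wj]])
  also have "4 * Q ?M ?c = (\<Sum>a\<in>A. ?s i j a)"
  proof -
   have "comb ?M ?c (F a) = (\<lambda>x. (1/2) *R (comb (m i) (c i) (F a) x + comb (m j) (c j) (F a) x))" for a
    by (rule ext) (rule comb_midpoint[OF wi wj])
   then have "4 * (l2 (comb ?M ?c (F a)))\<^sup>2 = ?s i j a" for a by (simp only: l2_scaleR) (simp add: power2_eq_square)
   then show ?thesis by (simp add: Q_def sum_distrib_left)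
  qed
  finally have mid: "4 * d n \<le> (\<Sum>a\<in>A. ?s i j a)" by simp
  have "(l2 (\<lambda>x. f x - g x))\<^sup>2 + (l2 (\<lambda>x. f x + g x))\<^sup>2 = 2 * (l2 f)\<^sup>2 + 2 * (l2 g)\<^sup>2"
   if "L2 f" "L2 g" for f g :: "'a \<Rightarrow> 'b" using l2_power2_add[OF that] l2_power2_diff[OF that] by simp
  then have par: "(\<Sum>a\<in>A. (?d i j a)\<^sup>2)
    + (\<Sum>a\<in>A. ?s i j a) = 2 * Q (m i) (c i) + 2 * Q (m j) (c j)"
   unfolding Q_def sum_distrib_left sum.distrib[symmetric] by (intro sum.cong refl) (simp add: L2_comb F(1))
  have "1 / real (Suc i) \<le> 1 / real (Suc n)" "1 / real (Suc j) \<le> 1 / real (Suc n)"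
   using ij by (auto intro!: divide_left_mono)
  then show ?thesis using par mid q[of i] q[of j] dD[of i] dD[of j] by (simp add: algebra_simps)
 qed
 have small: "\<exists>N. \<forall>i\<ge>N. \<forall>j\<ge>N. ?d i j a < e"
  if a: "a \<in> A" and e: "0 < e" for a e
 proof -
  have "(\<lambda>n. ?e n) ----> 2 * (D - D) + 2 * (D - D) + 4 * 0" by (intro tendsto_intros D LIMSEQ_Suc[OF lim_1_over_n])
  then have "\<forall>\<^sub>F n in sequentially. ?e n < e\<^sup>2" by (rule order_tendstoD(2)) (use e in simp)
  then obtain n where n: "?e n < e\<^sup>2" by (auto simp: eventually_sequentially)
  have "?d i j a < e" if ij: "n \<le> i" "n \<le> j" for i j
  proof -
   have "(?d i j a)\<^sup>2
     \<le> (\<Sum>a\<in>A. (?d i j a)\<^sup>2)" by (rule member_le_sum[OF a, of "\<lambda>a. (?d i j a)\<^sup>2"]) (use A in auto)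
   also have "\<dots> < e\<^sup>2" using diff[OF ij] n by linarith
   finally show ?thesis using e by (rule power2_less_imp_less[OF _ less_imp_le])
  qed
  then show ?thesis by blast
 qed
 show ?thesis using that[of m c, OF w small] by blast
qed

lemma has_weak_partial_sum:
 assumes "\<And>k. has_weak_partial i (f k) (g k)"
 shows "has_weak_partial i (comb m c f) (comb m c g)" unfolding comb_def[abs_def]
proof (induction m)
 case 0
 then show ?case by (simp add: has_weak_partial_const)
next
 case (Suc m)
 then show ?case by (simp add: has_weak_partial_add has_weak_partial_scaleR assms)
qed

text \<open>Components of a jet are addressed by the list of differentiation indices.\<close>

fun jet_component :: "('n \<Rightarrow> 'b) \<Rightarrow> 'b \<Rightarrow> ('n \<Rightarrow> 'n \<Rightarrow> 'b) \<Rightarrow> 'n list \<Rightarrow> 'b" where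
 "jet_component G u K [] = u"
| "jet_component G u K [i] = G i"
| "jet_component G u K (i # j # _) = K i j"

definition jet_bounded :: "real \<Rightarrow> (real^'n::finite \<Rightarrow> 'b::euclidean_space) \<Rightarrow> ('n \<Rightarrow> real^'n \<Rightarrow> 'b) \<Rightarrow>
  ('n \<Rightarrow> 'n \<Rightarrow> real^'n \<Rightarrow> 'b) \<Rightarrow> bool" where
 "jet_bounded M u G K \<longleftrightarrow> jet2 u G K \<and> l2 u \<le> M \<and> (\<forall>i. l2 (G i) \<le> M) \<and> (\<forall>i j. l2 (K i j) \<le> M)"

text \<open>Convex combinations of tails converge strongly together with their derivatives, and
  their limits are again derivatives of each other. Pointwise convergence passes to the
  combinations, so the limit function is \<open>v\<close> itself.\<close>

lemma pointwise_limit_jet: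
 fixes u :: "nat \<Rightarrow> real^'n::finite \<Rightarrow> 'b::euclidean_space"
 assumes J: "\<And>k. jet_bounded M (u k) (G k) (K k)" and lim: "\<And>x. (\<lambda>k. u k x) ----> v x"
 obtains G' K' m c where "jet_bounded M v G' K'" "\<And>n. tail_weights n (m n) (c n)"
  "(\<lambda>n. l2 (\<lambda>x. comb (m n) (c n) u x - v x)) ----> 0"
  "\<And>i. (\<lambda>n. l2 (\<lambda>x. comb (m n) (c n) (\<lambda>k. G k i) x - G' i x)) ----> 0"
  "\<And>i j. (\<lambda>n. l2 (\<lambda>x. comb (m n) (c n) (\<lambda>k. K k i j) x - K' i j x)) ----> 0"
proof -
 define F where "F a k = jet_component (G k) (u k) (K k) a" for a k
 define A :: "'n list set" where "A = {a. set a \<subseteq> UNIV \<and> length a \<le> 2}"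
 have A: "finite A" unfolding A_def by (rule finite_lists_length_le) simp
 have F0: "F [] = u" "\<And>i. F [i] = (\<lambda>k. G k i)" "\<And>i j. F [i, j] = (\<lambda>k. K k i j)" by (auto simp: F_def fun_eq_iff)
 have inA: "[] \<in> A" "\<And>i. [i] \<in> A" "\<And>i j. [i, j] \<in> A" by (auto simp: A_def)
 have jet: "jet2 (u k) (G k) (K k)" for k using J by (auto simp: jet_bounded_def)
 note JD = jet2D[OF jet]
 have Fs: "L2 (F a k)" "l2 (F a k) \<le> M" for a k
 proof -
  have b: "l2 (u k) \<le> M" "\<And>i. l2 (G k i) \<le> M" "\<And>i j. l2 (K k i j) \<le> M"
   using J[of k] unfolding jet_bounded_def by blast+
  consider "a = []" | i where "a = [i]" | i j l where "a = i # j # l" by (metis list.exhaust)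
  then show "L2 (F a k)" by cases (simp_all only: F_def jet_component.simps JD)
  consider "a = []" | i where "a = [i]" | i j l where "a = i # j # l" by (metis list.exhaust)
  then show "l2 (F a k) \<le> M" by cases (simp_all only: F_def jet_component.simps b)
 qed
 obtain m c where w: "\<And>n. tail_weights n (m n) (c n)"
  and C: "\<And>a e. a \<in> A \<Longrightarrow> 0 < e \<Longrightarrow> \<exists>N. \<forall>i\<ge>N. \<forall>j\<ge>N. l2 (\<lambda>x. comb (m i) (c i) (F a) x - comb (m j) (c j) (F a) x) < e"
  using mazur[OF A, of F M] Fs by blast
 let ?C = "\<lambda>n. comb (m n) (c n)"
 have sc: "L2 (?C n (F a))" for n a by (rule L2_comb[OF Fs(1)])
 have "\<exists>g r. L2 g \<and> (\<lambda>n. l2 (\<lambda>x. ?C n (F a) x - g x)) ----> 0 \<and>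
   strict_mono (r :: nat \<Rightarrow> nat) \<and> (AE x in lborel. (\<lambda>n. ?C (r n) (F a) x) ----> g x)" if aA: "a \<in> A" for a
 proof -
  obtain g r where "L2 g" "(\<lambda>n. l2 (\<lambda>x. ?C n (F a) x - g x)) ----> 0"
   "strict_mono (r :: nat \<Rightarrow> nat)" "AE x in lborel. (\<lambda>n. ?C (r n) (F a) x) ----> g x"
   by (rule l2_complete[of "\<lambda>n. ?C n (F a)", OF sc C[OF aA]])
  then show ?thesis by blast
 qed
 then have "\<forall>a\<in>A. \<exists>g. \<exists>r. L2 g \<and> (\<lambda>n. l2 (\<lambda>x. ?C n (F a) x - g x)) ----> 0 \<and>
   strict_mono (r :: nat \<Rightarrow> nat) \<and> (AE x in lborel. (\<lambda>n. ?C (r n) (F a) x) ----> g x)" by blast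
 from bchoice[OF this] obtain g where "\<forall>a\<in>A. \<exists>r. L2 (g a) \<and> (\<lambda>n. l2 (\<lambda>x. ?C n (F a) x - g a x)) ----> 0 \<and>
   strict_mono (r :: nat \<Rightarrow> nat) \<and> (AE x in lborel. (\<lambda>n. ?C (r n) (F a) x) ----> g a x)" ..
 from bchoice[OF this] obtain r where gr: "\<forall>a\<in>A. L2 (g a) \<and> (\<lambda>n. l2 (\<lambda>x. ?C n (F a) x - g a x)) ----> 0 \<and>
   strict_mono (r a :: nat \<Rightarrow> nat) \<and> (AE x in lborel. (\<lambda>n. ?C (r a n) (F a) x) ----> g a x)" ..
 have g: "\<And>a. a \<in> A \<Longrightarrow> L2 (g a)"
   "\<And>a. a \<in> A \<Longrightarrow> (\<lambda>n. l2 (\<lambda>x. ?C n (F a) x - g a x)) ----> 0"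
   "\<And>a. a \<in> A \<Longrightarrow> strict_mono (r a :: nat \<Rightarrow> nat)"
   "\<And>a. a \<in> A \<Longrightarrow> AE x in lborel. (\<lambda>n. ?C (r a n) (F a) x) ----> g a x" using gr by blast+
 have gM: "l2 (g a) \<le> M" if a: "a \<in> A" for a
 proof (rule LIMSEQ_le_const)
  show "(\<lambda>n. M + l2 (\<lambda>x. ?C n (F a) x - g a x)) ----> M" using tendsto_add[OF tendsto_const g(2)[OF a], of M] by simp
  show "\<exists>N. \<forall>n\<ge>N. l2 (g a) \<le> M + l2 (\<lambda>x. ?C n (F a) x - g a x)"
  proof (intro exI[of _ 0] allI impI)
   fix n
   show "l2 (g a) \<le> M + l2 (\<lambda>x. ?C n (F a) x - g a x)"
    using abs_l2_diff_le[OF sc[of n a] g(1)[OF a]] l2_comb_le[of "F a" M n "m n" "c n", OF Fs w] by linarith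
  qed
 qed
 have pw: "(\<lambda>n. ?C n u x) ----> v x" for x unfolding comb_def by (rule tail_weights_tendsto[OF w lim])
 note [measurable] = JD(1)[THEN L2_measurable]
 have vm: "v \<in> borel_measurable borel" by (rule borel_measurable_LIMSEQ_metric[OF _ lim]) simp
 have vae: "AE x in lborel. g [] x = v x" using g(4)[OF inA(1)]
 proof eventually_elim
  case (elim x)
  have "(\<lambda>n. ?C (r [] n) u x) ----> v x" using LIMSEQ_subseq_LIMSEQ[OF pw g(3)[OF inA(1)]] by (simp add: o_def)
  with elim show ?case unfolding F0 by (rule LIMSEQ_unique)
 qed
 have vs: "L2 v" by (rule L2_cong_AE[OF vm g(1)[OF inA(1)]]) (use vae in \<open>auto elim: eventually_mono\<close>)
 have l2v: "l2 (\<lambda>x. f x - g [] x) = l2 (\<lambda>x. f x - v x)" if "L2 f" for f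
  by (rule l2_cong_AE) (use vae vm g(1)[OF inA(1)] that in \<open>auto elim: eventually_mono intro!: borel_measurable_diff\<close>)
 have limv: "(\<lambda>n. l2 (\<lambda>x. ?C n u x - v x)) ----> 0" using g(2)[OF inA(1)] l2v[OF sc[of _ "[]"]] unfolding F0 by simp
 have lv: "l2 v \<le> M"
 proof -
  have "l2 v = l2 (g [])" by (rule l2_cong_AE[OF vm]) (use vae g(1)[OF inA(1)] in \<open>auto elim: eventually_mono\<close>)
  then show ?thesis using gM[OF inA(1)] by simp
 qed
 have su: "L2 (?C n u)" "L2 (?C n (\<lambda>k. G k i))"
  "L2 (?C n (\<lambda>k. K k i j))" for n i j using sc[of n "[]"] sc[of n "[i]"] sc[of n "[i, j]"] unfolding F0 by auto
 have P1: "has_weak_partial i v (g [i])" for i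
  by (rule has_weak_partial_limit[OF has_weak_partial_sum[of i u "\<lambda>k. G k i", OF JD(2)] su(1) vs limv su(2) g(1)[OF inA(2)]])
    (use g(2)[OF inA(2), of i] in \<open>simp add: F0\<close>)
 have P2: "has_weak_partial j (g [i]) (g [i, j])" for i j
  by (rule has_weak_partial_limit[OF has_weak_partial_sum[of j "\<lambda>k. G k i" "\<lambda>k. K k i j", OF JD(4)] su(2) g(1)[OF inA(2)] _ su(3) g(1)[OF inA(3)]])
    (use g(2)[OF inA(2), of i] g(2)[OF inA(3), of i j] in \<open>simp_all add: F0\<close>)
 have "jet_bounded M v (\<lambda>i. g [i]) (\<lambda>i j. g [i, j])"
  unfolding jet_bounded_def jet2_def using vs lv P1 P2 g(1) gM inA by auto
 then show ?thesis by (rule that[OF _ w limv]) (use g(2)[OF inA(2)] g(2)[OF inA(3)] in \<open>simp_all add: F0\<close>)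
qed

text \<open>Weak convergence to zero. If the integrals converge, their tail averages have the same
  limit, while the corresponding combinations of functions tend to zero in norm; boundedness reduces
  the general case to convergent subsequences.\<close>

lemma weak_null_integral:
 fixes u :: "nat \<Rightarrow> real^'n::finite \<Rightarrow> 'b::euclidean_space"
 assumes J: "\<And>k. jet_bounded M (u k) (G k) (K k)" and lim: "\<And>x. (\<lambda>k. u k x) ----> 0"
  and g: "L2 g"
 shows "(\<lambda>k. LINT x|lborel. g x \<bullet> u k x) ----> 0" "(\<lambda>k. LINT x|lborel. g x \<bullet> K k i j x) ----> 0"
proof -
 have main: "b = 0" if J': "\<And>k. jet_bounded M (u' k) (G' k) (K' k)" and lim': "\<And>x. (\<lambda>k. u' k x) ----> 0"
  and b: "(\<lambda>k. LINT x|lborel. g x \<bullet> K' k i j x) ----> b \<or> (\<lambda>k. LINT x|lborel. g x \<bullet> u' k x) ----> b" for u' G' K' b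
 proof -
  obtain G0 K0 m c where J0: "jet_bounded M (\<lambda>_. 0 :: 'b) G0 K0" and w: "\<And>n. tail_weights n (m n) (c n)"
   and l0: "(\<lambda>n. l2 (\<lambda>x. comb (m n) (c n) u' x - 0)) ----> 0"
   and "\<And>i. (\<lambda>n. l2 (\<lambda>x. comb (m n) (c n) (\<lambda>k. G' k i) x - G0 i x)) ----> 0"
   and l2: "\<And>i j. (\<lambda>n. l2 (\<lambda>x. comb (m n) (c n) (\<lambda>k. K' k i j) x - K0 i j x)) ----> 0"
   by (rule pointwise_limit_jet[OF J' lim']) (rule that; assumption)
  have jet: "jet2 (u' k) (G' k) (K' k)" for k using J' by (auto simp: jet_bounded_def)
  note JD = jet2D[OF jet]
  have jet0: "jet2 (\<lambda>_. 0 :: 'b) G0 K0" using J0 by (auto simp: jet_bounded_def)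
  \<comment> \<open>Uniqueness of weak derivatives forces the norm limits of the second derivatives
    to vanish.\<close>
  have "jet2 (\<lambda>_. 0 :: 'b) (\<lambda>(i::'n) x. 0) (\<lambda>i j x. 0)" by (simp add: jet2_def has_weak_partial_const)
  from jet2_l2[OF this] jet2_l2[OF jet0] have "l2 (K0 i j) = 0" by simp
  then have K0: "AE x in lborel. K0 i j x = 0" using l2_eq_0_iff[OF jet2D(5)[OF jet0]] by blast
  have lin: "(LINT x|lborel. g x \<bullet> comb (m n) (c n) f x) = (\<Sum>k<m n. c n k *R (LINT x|lborel. g x \<bullet> f k x))"
   if "\<And>k. L2 (f k)" for f :: "nat \<Rightarrow> real^'n \<Rightarrow> 'b" and n
   unfolding comb_def using integrable_inner[OF g that] by (simp add: inner_sum_right)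
  have z: "(LINT x|lborel. g x \<bullet> K0 i j x) = 0" by (rule integral_eq_zero_AE) (use K0 in \<open>auto elim: eventually_mono\<close>)
  from b show "b = 0"
  proof
   assume b: "(\<lambda>k. LINT x|lborel. g x \<bullet> K' k i j x) ----> b"
   have "(\<lambda>n. LINT x|lborel. g x \<bullet> comb (m n) (c n) (\<lambda>k. K' k i j) x) ----> (LINT x|lborel. g x \<bullet> K0 i j x)"
    by (rule tendsto_integral_inner[OF g g _ _ jet2D(5)[OF jet0] l2]) (auto intro: L2_comb JD)
   moreover have "(\<lambda>n. LINT x|lborel. g x \<bullet> comb (m n) (c n) (\<lambda>k. K' k i j) x) ----> b"
    unfolding lin[of "\<lambda>k. K' k i j", OF JD(5)] by (rule tail_weights_tendsto[OF w b])
   ultimately show "b = 0" unfolding z using LIMSEQ_unique by blast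
  next
   assume b: "(\<lambda>k. LINT x|lborel. g x \<bullet> u' k x) ----> b"
   have "(\<lambda>n. LINT x|lborel. g x \<bullet> comb (m n) (c n) u' x) ----> (LINT x|lborel. g x \<bullet> 0)"
    by (rule tendsto_integral_inner[OF g g _ _ _ l0]) (auto intro: L2_comb JD)
   moreover have "(\<lambda>n. LINT x|lborel. g x \<bullet> comb (m n) (c n) u' x) ----> b"
    unfolding lin[OF JD(1)] by (rule tail_weights_tendsto[OF w b])
   ultimately show "b = 0" using LIMSEQ_unique by fastforce
  qed
 qed
 have tend: "a ----> 0" if bd: "\<And>k. \<bar>a k\<bar> \<le> B" and sub: "\<And>r b. strict_mono r \<Longrightarrow> (\<lambda>k. a (r k)) ----> b \<Longrightarrow> b = 0"
  for a :: "nat \<Rightarrow> real" and B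
 proof (rule ccontr)
  assume "\<not> a ----> 0"
  then obtain e where e: "0 < e" "\<And>N. \<exists>n\<ge>N. e \<le> \<bar>a n\<bar>" unfolding lim_sequentially by (auto simp: not_less dist_real_def)
  then have "infinite {n. e \<le> \<bar>a n\<bar>}" by (simp add: infinite_nat_iff_unbounded_le)
  then obtain r :: "nat \<Rightarrow> nat" where r: "strict_mono r" "\<And>n. e \<le> \<bar>a (r n)\<bar>"
   using infinite_enumerate[of "{n. e \<le> \<bar>a n\<bar>}"] by auto
  have "bounded (range (\<lambda>n. a (r n)))" by (intro boundedI[of _ B]) (use bd in auto)
  from bounded_imp_convergent_subsequence[OF this] obtain b s where s: "strict_mono s" "((\<lambda>n. a (r n)) \<circ> s) ----> b" by blast
  have "b = 0" using sub[of "r \<circ> s" b] strict_mono_o[OF r(1) s(1)] s(2) by (simp add: o_def)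
  with s(2) have "(\<lambda>n. \<bar>a (r (s n))\<bar>) ----> 0" using tendsto_rabs_zero by (auto simp: o_def)
  from LIMSEQ_le_const[OF this, of e] r(2) e(1) show False by auto
 qed
 have bd: "\<bar>LINT x|lborel. g x \<bullet> f x\<bar> \<le> l2 g * M" if "L2 f" "l2 f \<le> M" for f :: "real^'n \<Rightarrow> 'b"
  using integral_inner_le[OF g that(1)] mult_left_mono[OF that(2), of "l2 g"] by simp
 show "(\<lambda>k. LINT x|lborel. g x \<bullet> u k x) ----> 0"
 proof (rule tend)
  show "\<bar>LINT x|lborel. g x \<bullet> u k x\<bar> \<le> l2 g * M" for k
   using J[of k] by (intro bd) (auto simp: jet_bounded_def jet2_def)
  fix r :: "nat \<Rightarrow> nat" and b assume r: "strict_mono r" and b: "(\<lambda>k. LINT x|lborel. g x \<bullet> u (r k) x) ----> b"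
  have "(\<lambda>k. u (r k) x) ----> 0" for x using LIMSEQ_subseq_LIMSEQ[OF lim r] by (simp add: o_def)
  then show "b = 0" using main[of "\<lambda>k. u (r k)" "\<lambda>k. G (r k)" "\<lambda>k. K (r k)" b] J b by blast
 qed
 show "(\<lambda>k. LINT x|lborel. g x \<bullet> K k i j x) ----> 0"
 proof (rule tend)
  show "\<bar>LINT x|lborel. g x \<bullet> K k i j x\<bar> \<le> l2 g * M" for k
   using J[of k] by (intro bd) (auto simp: jet_bounded_def jet2_def)
  fix r :: "nat \<Rightarrow> nat" and b assume r: "strict_mono r" and b: "(\<lambda>k. LINT x|lborel. g x \<bullet> K (r k) i j x) ----> b"
  have "(\<lambda>k. u (r k) x) ----> 0" for x using LIMSEQ_subseq_LIMSEQ[OF lim r] by (simp add: o_def)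
  then show "b = 0" using main[of "\<lambda>k. u (r k)" "\<lambda>k. G (r k)" "\<lambda>k. K (r k)" b] J b by blast
 qed
qed

section \<open>Bounded sequences on the plane\<close>

lemma UNIV_2: "(UNIV :: 2 set) = {1, 2}" using UNIV_2_cases[of 1 2] by simp

lemma jet_boundedD:
 assumes "jet_bounded M u G K"
 shows "jet2 u G K" "l2 u \<le> M" "l2 (G i) \<le> M" "l2 (K i j) \<le> M" "0 \<le> M"
 using assms order_trans[OF l2_nonneg[of u]] by (auto simp: jet_bounded_def)

lemma sup_bound_bounded:
 fixes u :: "real^2 \<Rightarrow> 'b::euclidean_space"
 assumes "jet_bounded M u G K" "continuous_on UNIV u"
 shows "norm (u x) \<le> 4 * M"
 using sup_bound[OF jet_boundedD(1)[OF assms(1)] assms(2), of x] jet_boundedD(2)[OF assms(1)]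
  jet_boundedD(3)[OF assms(1), of 1] jet_boundedD(3)[OF assms(1), of 2] jet_boundedD(4)[OF assms(1), of 1 2]
 by linarith

lemma hoelder_bounded:
 fixes u :: "real^2 \<Rightarrow> 'b::euclidean_space"
 assumes J: "jet_bounded M u G K" and c: "continuous_on UNIV u"
 shows "norm (u x - u y) \<le> 4 * M * sqrt (norm (x - y))"
proof -
 note M = jet_boundedD[OF J]
 have step: "norm (u (z + h *R axis i 1) - u z) \<le> sqrt (norm (x - y)) * (2 * M)"
  if ij: "i \<noteq> j" and h: "\<bar>h\<bar> \<le> norm (x - y)" for z h and i j :: 2
 proof -
  have "norm (u (z + h *R axis i 1) - u z) \<le> sqrt \<bar>h\<bar> * (l2 (G i) + l2 (K i j))" by (rule hoelder_bound[OF M(1) c ij])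
  also have "\<dots> \<le> sqrt (norm (x - y)) * (2 * M)" using M(3)[of i] M(4)[of i j] h by (intro mult_mono) auto
  finally show ?thesis .
 qed
 \<comment> \<open>A path with one corner, first along axis 1 and then along axis 2, reduces the
   estimate to increments along the axes.\<close>
 define z where "z = y + (x $ 1 - y $ 1) *R axis 1 1"
 have x: "x = z + (x $ 2 - y $ 2) *R axis 2 1" by (simp add: vec_eq_iff forall_2 z_def axis_def)
 have c: "\<bar>x $ i - y $ i\<bar> \<le> norm (x - y)" for i using component_le_norm_cart[of "x - y" i] by simp
 have "norm (u z - u y) \<le> sqrt (norm (x - y)) * (2 * M)" unfolding z_def by (rule step[of 1 2]) (auto intro: c)
 moreover have "norm (u x - u z) \<le> sqrt (norm (x - y)) * (2 * M)" by (subst x, rule step[of 2 1]) (auto intro: c)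
 moreover have "norm (u x - u y) \<le> norm (u x - u z) + norm (u z - u y)"
  using norm_triangle_ineq[of "u x - u z" "u z - u y"] by simp
 moreover have "sqrt (norm (x - y)) * (2 * M) + sqrt (norm (x - y)) * (2 * M) = 4 * M * sqrt (norm (x - y))" by simp
 ultimately show ?thesis by linarith
qed

lemma uniformly_continuous_hoelder:
 fixes v :: "real^2 \<Rightarrow> 'b::euclidean_space"
 assumes H: "\<And>x y. norm (v x - v y) \<le> C * sqrt (norm (x - y))" and C: "0 \<le> C"
 shows "isUCont v" unfolding uniformly_continuous_on_def
proof (intro allI impI)
 fix e :: real assume e: "0 < e"
 define d where "d = (e / (C + 1))\<^sup>2"
 have d: "0 < d" using e C by (simp add: d_def)
 have "dist (v y) (v x) < e" if "dist y x < d" for x y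
 proof -
  have "sqrt (norm (y - x)) \<le> sqrt d" using that by (simp add: dist_norm)
  also have "sqrt d = e / (C + 1)" using e C by (simp add: d_def)
  finally have "C * sqrt (norm (y - x)) \<le> C * (e / (C + 1))" using C by (rule mult_left_mono)
  also have "\<dots> < e" using e C by (simp add: field_simps)
  finally show ?thesis using H[of y x] by (simp add: dist_norm)
 qed
 with d show "\<exists>d>0. \<forall>x\<in>UNIV. \<forall>x'\<in>UNIV. dist x' x < d \<longrightarrow> dist (v x') (v x) < e" by blast
qed

lemma pointwise_limit_hoelder:
 fixes u :: "nat \<Rightarrow> real^2 \<Rightarrow> 'b::euclidean_space"
 assumes J: "\<And>k. jet_bounded M (u k) (G k) (K k)" and c: "\<And>k. continuous_on UNIV (u k)"
  and lim: "\<And>x. (\<lambda>k. u k x) ----> v x"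
 shows "norm (v x - v y) \<le> 4 * M * sqrt (norm (x - y))" "isUCont v"
proof -
 show H: "norm (v x - v y) \<le> 4 * M * sqrt (norm (x - y))" for x y
 proof (rule LIMSEQ_le_const2)
  show "(\<lambda>k. norm (u k x - u k y)) ----> norm (v x - v y)" by (intro tendsto_intros lim)
  show "\<exists>N. \<forall>k\<ge>N. norm (u k x - u k y) \<le> 4 * M * sqrt (norm (x - y))" using hoelder_bounded[OF J c] by blast
 qed
 show "isUCont v" by (rule uniformly_continuous_hoelder[OF H]) (use jet_boundedD(5)[OF J] in simp)
qed

text \<open>The Arzela-Ascoli argument: a diagonal subsequence converges on a countable dense set,
  and the uniform Hoelder bound extends convergence to all points.\<close>

lemma pointwise_subsequence:
 fixes u :: "nat \<Rightarrow> real^2 \<Rightarrow> 'b::euclidean_space"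
 assumes J: "\<And>k. jet_bounded M (u k) (G k) (K k)" and c: "\<And>k. continuous_on UNIV (u k)"
 obtains r v where "strict_mono (r :: nat \<Rightarrow> nat)" "\<And>x. (\<lambda>k. u (r k) x) ----> v x"
proof -
 obtain T :: "(real^2) set" where T: "countable T" "UNIV \<subseteq> closure T" using separable[of UNIV] by auto
 obtain r where r: "strict_mono (r :: nat \<Rightarrow> nat)" and conv: "\<And>x. x \<in> T \<Longrightarrow> \<exists>l. (\<lambda>n. u (r n) x) ----> l"
  using function_convergent_subsequence[OF T(1), of u "4 * M"] sup_bound_bounded[OF J c] by blast
 have M0: "0 \<le> M" by (rule jet_boundedD(5)[OF J])
 have "convergent (\<lambda>n. u (r n) x)" for x
 proof -
  have "Cauchy (\<lambda>n. u (r n) x)"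
  proof (rule metric_CauchyI)
   fix e :: real assume e: "0 < e"
   \<comment> \<open>Chosen so that \<open>4 * M * sqrt d\<close> stays below \<open>e / 3\<close>;
     the summand 12 covers the case \<open>M = 0\<close>.\<close>
   define d where "d = (e / (12 * M + 12))\<^sup>2"
   have "0 < d" using e M0 by (simp add: d_def)
   then obtain q where q: "q \<in> T" "dist q x < d" using T(2) closure_approachable[of x T] by blast
   have near: "norm (u k x - u k q) < e / 3" for k
   proof -
    have "norm (u k x - u k q) \<le> 4 * M * sqrt (norm (x - q))" by (rule hoelder_bounded[OF J c])
    also have "\<dots> \<le> 4 * M * sqrt d"
     using q(2) M0 by (intro mult_left_mono real_sqrt_le_mono) (auto simp: dist_norm norm_minus_commute)
    also have "sqrt d = e / (12 * M + 12)" using e M0 by (simp add: d_def)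
    also have "4 * M * (e / (12 * M + 12)) < e / 3" using e M0 by (simp add: field_simps)
    finally show ?thesis .
   qed
   have "Cauchy (\<lambda>n. u (r n) q)" using conv[OF q(1)] by (auto intro: LIMSEQ_imp_Cauchy)
   then obtain N where N: "\<And>m n. N \<le> m \<Longrightarrow> N \<le> n \<Longrightarrow> dist (u (r m) q) (u (r n) q) < e / 3"
    using metric_CauchyD[of _ "e/3"] e by fastforce
   have "dist (u (r m) x) (u (r n) x) < e" if "N \<le> m" "N \<le> n" for m n
    using norm_triangle_ineq[of "u (r m) x - u (r m) q" "u (r m) q - u (r n) x"]
     norm_triangle_ineq[of "u (r m) q - u (r n) q" "u (r n) q - u (r n) x"]
     near[of "r m"] near[of "r n"] N[OF that] by (simp add: dist_norm norm_minus_commute[of "u (r n) q" "u (r n) x"])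
   then show "\<exists>N. \<forall>m\<ge>N. \<forall>n\<ge>N. dist (u (r m) x) (u (r n) x) < e" by blast
  qed
  then show ?thesis by (rule Cauchy_convergent)
 qed
 then have "\<And>x. (\<lambda>n. u (r n) x) ----> lim (\<lambda>n. u (r n) x)" by (rule convergent_LIMSEQ_iff[THEN iffD1])
 from that[OF r this] show ?thesis .
qed

lemma l2_tail:
 fixes g :: "'a::euclidean_space \<Rightarrow> 'b::euclidean_space"
 assumes g: "L2 g" and e: "0 < e"
 obtains R where "0 < R" "\<And>R'. R \<le> R' \<Longrightarrow> l2 (outside R' g) < e"
proof -
 have [measurable]: "g \<in> borel_measurable borel" using g by auto
 have sets: "- cball (0::'a) R \<in> sets borel" for R by (simp add: borel_open)
 have s: "L2 (outside R g)" for R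
  by (rule L2_bounded_mult[where C = 1]) (auto simp: g indicator_def intro: borel_measurable_indicator sets)
 have "(\<lambda>k::nat. l2 (outside (real k) g)) ----> 0"
 proof (rule l2_dominated[OF _ g])
  show "AE x in lborel. (\<lambda>k. indicator (- cball 0 (real k)) x *R g x) ----> 0"
  proof (rule AE_I2, rule tendsto_eventually)
   fix x :: 'a
   obtain N :: nat where N: "norm x \<le> real N" using real_arch_simple by blast
   show "\<forall>\<^sub>F k in sequentially. indicator (- cball 0 (real k)) x *R g x = 0"
    by (rule eventually_sequentiallyI[of N]) (use N in \<open>auto simp: indicator_def\<close>)
  qed
 qed (use s in \<open>auto simp: indicator_def\<close>)
 then obtain N where N: "\<And>k. N \<le> k \<Longrightarrow> l2 (outside (real k) g) < e" using LIMSEQ_D[of _ 0 e] e by fastforce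
 show ?thesis
 proof (rule that[of "real (max N 1)"])
  fix R' assume R': "real (max N 1) \<le> R'"
  have "l2 (outside R' g) \<le> l2 (\<lambda>x. indicator (- cball 0 (real (max N 1))) x *R g x)"
   by (rule l2_mono[OF _ s]) (use R' s[of R'] in \<open>auto simp: indicator_def\<close>)
  then show "l2 (outside R' g) < e" using N[of "max N 1"] by simp
 qed simp
qed

text \<open>A large value at a distant point persists on a ball of fixed radius, and such a ball
  would contribute a fixed amount to the norm of the tail.\<close>

lemma uniformly_continuous_decay:
 fixes v :: "real^'n::finite \<Rightarrow> 'b::euclidean_space"
 assumes v: "L2 v" "isUCont v" and e: "0 < e"
 obtains R where "0 < R" "\<And>x. R \<le> norm x \<Longrightarrow> norm (v x) \<le> e"
proof -
 obtain d where d: "0 < d" "\<And>x y. dist y x < d \<Longrightarrow> dist (v y) (v x) < e / 2"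
 proof -
  have "0 < e / 2" using e by simp
  from v(2)[unfolded uniformly_continuous_on_def, rule_format, OF this] show ?thesis using that by blast
 qed
 define I where "I x = (\<lambda>y. indicator (cball x (d/2)) y :: real)" for x :: "real^'n"
 have I0: "I x = (\<lambda>y. I 0 (y + (- x)))" for x
  by (auto simp: I_def indicator_def fun_eq_iff dist_norm norm_minus_commute)
 have sI0: "L2 (I 0)" unfolding I_def by (rule L2_cball)
 have sI: "L2 (I x)" "l2 (I x) = l2 (I 0)" for x unfolding I0[of x] by (rule L2_shift[OF sI0], rule l2_shift[OF sI0])
 have pos: "0 < l2 (I 0)"
 proof (rule ccontr)
  assume "\<not> 0 < l2 (I 0)"
  then have "l2 (I 0) = 0" using l2_nonneg[of "I 0"] by linarith
  then have "AE y in lborel. I 0 y = 0" using l2_eq_0_iff[OF sI0] by blast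
  then have "AE y in lborel. y \<notin> ball (0::real^'n) (d/2)"
   by eventually_elim (auto simp: I_def indicator_def split: if_splits)
  then have "ball (0::real^'n) (d/2) \<in> null_sets lborel" by (intro AE_iff_null_sets[THEN iffD2]) auto
  then have "negligible (ball (0::real^'n) (d/2))" by (simp add: negligible_iff_null_sets null_sets_completionI)
  moreover have "0 \<in> ball (0::real^'n) (d/2)" using d(1) by simp
  ultimately show False using open_not_negligible[OF open_ball] by blast
 qed
 have "0 < e / 2 * l2 (I 0)" using e pos by simp
 from l2_tail[OF v(1) this] obtain R where R0: "0 < R"
  and R': "\<And>R'. R \<le> R' \<Longrightarrow> l2 (outside R' v) < e / 2 * l2 (I 0)" by blast
 note R = R0 R'[OF order_refl]
 have [measurable]: "v \<in> borel_measurable borel" using v by auto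
 have "norm (v x) \<le> e" if x: "R + d \<le> norm x" for x
 proof (rule ccontr)
  assume "\<not> norm (v x) \<le> e"
  have big: "norm ((e/2) *R I x y) \<le> norm (indicator (- cball 0 R) y *R v y)" for y
  proof (cases "y \<in> cball x (d/2)")
   case True
   then have "dist y x < d" using d(1) by (simp add: dist_commute)
   then have "dist (v y) (v x) < e / 2" by (rule d(2))
   then have "e / 2 \<le> norm (v y)"
    using \<open>\<not> norm (v x) \<le> e\<close> norm_triangle_ineq2[of "v x" "v y"] by (simp add: dist_norm norm_minus_commute)
   moreover have "R < norm y"
    using x \<open>dist y x < d\<close> norm_triangle_ineq2[of x y] d(1) True by (simp add: dist_norm norm_minus_commute)
   ultimately show ?thesis using True e by (simp add: I_def)
  qed (simp add: I_def)
  have "- cball (0::real^'n) R \<in> sets borel" by (simp add: borel_open)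
  then have "L2 (\<lambda>y. indicator (- cball 0 R) y *R v y)"
   by (intro L2_bounded_mult[where C = 1] v(1)) (auto simp: indicator_def intro: borel_measurable_indicator)
  then have "l2 (\<lambda>y. (e/2) *R I x y) \<le> l2 (outside R v)"
   by (rule l2_mono[OF L2_measurable[OF L2_scaleR[OF sI(1)]]]) (intro AE_I2 big)
  then have "e / 2 * l2 (I 0) \<le> l2 (outside R v)" unfolding l2_scaleR sI(2)[of x] using e by simp
  with R(2) show False by linarith
 qed
 with that[of "R + d"] R(1) d(1) show ?thesis by auto
qed

text \<open>Local strong convergence of gradients: a difference quotient is uniformly close to the
 derivative because the second derivatives are bounded.\<close>

lemma gradient_local_convergence:
 fixes w :: "nat \<Rightarrow> real^2 \<Rightarrow> 'b::euclidean_space"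
 assumes J: "\<And>k. jet_bounded M (w k) (G k) (K k)" and c: "\<And>k. continuous_on UNIV (w k)"
  and lim: "\<And>x. (\<lambda>k. w k x) ----> 0"
 shows "(\<lambda>k. l2 (inside R (G k i))) ----> 0"
proof (rule tendsto_zeroI)
 have M0: "0 \<le> M" by (rule jet_boundedD(5)[OF J])
 then show "0 \<le> 1 + M" by simp
 fix h :: real assume h: "0 < h"
 note JD = jet2D[OF jet_boundedD(1)[OF J]]
 have Bm: "(\<lambda>x. indicator (cball 0 R) x :: real) \<in> borel_measurable borel" by (intro borel_measurable_indicator borel_closed) simp
 have loc: "L2 (inside R f)" "l2 (inside R f) \<le> l2 f"
  if "L2 f" for f :: "real^2 \<Rightarrow> 'b"
 proof -
  show s: "L2 (inside R f)" by (rule L2_bounded_mult[OF Bm _ that, where C = 1]) (auto simp: indicator_def)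
  show "l2 (inside R f) \<le> l2 f" by (rule l2_mono[OF _ that]) (use s in \<open>auto simp: indicator_def L2_measurable\<close>)
 qed
 \<comment> \<open>For fixed \<open>h\<close> the quotient is bounded and tends to zero pointwise,
   so dominated convergence applies on the ball; the smallness of \<open>h\<close> enters only
   afterwards.\<close>
 have "(\<lambda>k. l2 (inside R (dq i h (w k)))) ----> 0"
 proof (rule l2_dominated)
  show "(inside R (dq i h (w k))) \<in> borel_measurable borel" for k
   using loc(1)[OF L2_dq[OF JD(1)]] by (rule L2_measurable)
  show "L2 (\<lambda>x. (1 / h * (8 * M)) *R indicator (cball 0 R) x :: real)" by (rule L2_scaleR[OF L2_cball])
  show "AE x in lborel. norm (indicator (cball 0 R) x *R dq i h (w k) x) \<le> norm ((1 / h * (8 * M)) *R indicator (cball 0 R) x :: real)" for k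
  proof (rule AE_I2)
   fix x
   have "norm (dq i h (w k) x) \<le> 1 / h * (8 * M)" unfolding dq_def norm_scaleR
    using norm_triangle_ineq4[of "w k (x + h *R axis i 1)" "w k x"] h
     sup_bound_bounded[OF J c, of k x] sup_bound_bounded[OF J c, of k "x + h *R axis i 1"] by (intro mult_mono) auto
   then show "norm (indicator (cball 0 R) x *R dq i h (w k) x) \<le> norm ((1 / h * (8 * M)) *R indicator (cball 0 R) x :: real)"
    using h M0 by (auto simp: indicator_def)
  qed
  show "AE x in lborel. (\<lambda>k. indicator (cball 0 R) x *R dq i h (w k) x) ----> 0"
  proof (rule AE_I2)
   fix x
   have "(\<lambda>k. indicator (cball 0 R) x *R ((1 / h) *R (w k (x + h *R axis i 1) - w k x))) ----> indicator (cball 0 R) x *R ((1 / h) *R (0 - 0))"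
    by (intro tendsto_intros lim)
   then show "(\<lambda>k. indicator (cball 0 R) x *R dq i h (w k) x) ----> 0" by (simp add: dq_def)
  qed
 qed
 from order_tendstoD(2)[OF this h] show "\<forall>\<^sub>F k in sequentially. \<bar>l2 (inside R (G k i))\<bar> \<le> (1 + M) * h"
 proof eventually_elim
  case (elim k)
  have s: "L2 (\<lambda>x. G k i x - dq i h (w k) x)" by (intro L2_diff JD L2_dq)
  have "l2 (inside R (G k i))
    = l2 (\<lambda>x. indicator (cball 0 R) x *R dq i h (w k) x + indicator (cball 0 R) x *R (G k i x - dq i h (w k) x))"
   by (simp add: scaleR_diff_right)
  also have "\<dots> \<le> l2 (inside R (dq i h (w k))) + l2 (\<lambda>x. indicator (cball 0 R) x *R (G k i x - dq i h (w k) x))"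
   by (intro l2_triangle loc s L2_dq JD)
  also have "l2 (\<lambda>x. indicator (cball 0 R) x *R (G k i x - dq i h (w k) x)) \<le> l2 (\<lambda>x. dq i h (w k) x - G k i x)"
   using loc(2)[OF s] l2_commute[of "G k i" "dq i h (w k)"] by simp
  also have "\<dots> \<le> \<bar>h\<bar> * l2 (K k i i)" by (rule dq_rate[OF JD(2,4,1,3,5)]) (use h in simp)
  also have "\<dots> \<le> h * M" using h jet_boundedD(4)[OF J] by (auto intro!: mult_left_mono)
  finally show ?case using elim by (simp add: algebra_simps)
 qed
qed

section \<open>Energy and degree under weak convergence\<close>

text \<open>The degree integral of \<open>e3 + u\<close> with derivatives taken from the jet. No
  constraint on \<open>u\<close> is imposed, since remainders after subtracting a profile leave the
  sphere.\<close>

definition jet_degree :: "(real^2 \<Rightarrow> real^3) \<Rightarrow> (2 \<Rightarrow> real^2 \<Rightarrow> real^3) \<Rightarrow> real" where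
 "jet_degree u G = 1 / (4 * pi) * (LINT x|lborel. (e3 + u x) \<bullet> cross3 (G 1 x) (G 2 x))"

definition jet_energy :: "(real^2 \<Rightarrow> 'b::euclidean_space) \<Rightarrow> (2 \<Rightarrow> 2 \<Rightarrow> real^2 \<Rightarrow> 'b) \<Rightarrow> real" where
 "jet_energy u K = ((l2 u)\<^sup>2 + (l2 (\<lambda>x. \<Sum>i\<in>UNIV. K i i x))\<^sup>2) / 2"

section \<open>Triple products and bounds by the energy\<close>

lemma norm_cross3_le: "norm (cross3 a b) \<le> norm a * norm b"
proof (rule power2_le_imp_le)
 show "(norm (cross3 a b))\<^sup>2 \<le> (norm a * norm b)\<^sup>2"
  using norm_cross_dot[of a b] zero_le_power2[of "a \<bullet> b"] by linarith
qed simp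

lemma triple_le: "\<bar>a \<bullet> cross3 b c\<bar> \<le> norm a * (norm b * norm c)"
proof -
 have "\<bar>a \<bullet> cross3 b c\<bar> \<le> norm a * norm (cross3 b c)" by (rule Cauchy_Schwarz_ineq2)
 also have "\<dots> \<le> norm a * (norm b * norm c)" by (intro mult_left_mono norm_cross3_le) simp
 finally show ?thesis .
qed

lemma bounded_bilinear_cross3: "bounded_bilinear cross3" using bilinear_cross bilinear_conv_bounded_bilinear by blast

lemma borel_measurable_cross3 [measurable]:
 assumes [measurable]: "f \<in> borel_measurable M" "g \<in> borel_measurable M"
 shows "(\<lambda>x. cross3 (f x) (g x)) \<in> borel_measurable M"
proof -
 have "continuous_on UNIV (\<lambda>p. cross3 (fst p) (snd p))"
  by (intro bounded_bilinear.continuous_on[OF bounded_bilinear_cross3] continuous_intros)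
 note [measurable] = borel_measurable_continuous_onI[OF this]
 have "(\<lambda>x. (\<lambda>p. cross3 (fst p) (snd p)) (f x, g x)) \<in> borel_measurable M" by measurable
 then show ?thesis by simp
qed

lemma integrable_triple:
 assumes a: "a \<in> borel_measurable borel" "\<And>x. norm (a x) \<le> C" and b: "L2 b" "L2 c"
 shows "integrable lborel (\<lambda>x::'a::euclidean_space. a x \<bullet> cross3 (b x) (c x))"
proof -
 note [measurable] = a(1) b[THEN L2_measurable]
 have "integrable lborel (\<lambda>x. C * (norm (b x) * norm (c x)))" by (intro integrable_mult_right integrable_norm_mult b)
 then show ?thesis
 proof (rule LINT_integrable_bound)
  show "AE x in lborel. norm (a x \<bullet> cross3 (b x) (c x)) \<le> norm (C * (norm (b x) * norm (c x)))"
  proof (rule AE_I2)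
   fix x
   have "\<bar>a x \<bullet> cross3 (b x) (c x)\<bar> \<le> norm (a x) * (norm (b x) * norm (c x))" by (rule triple_le)
   also have "\<dots> \<le> C * (norm (b x) * norm (c x))" by (intro mult_right_mono a) simp
   finally show "norm (a x \<bullet> cross3 (b x) (c x)) \<le> norm (C * (norm (b x) * norm (c x)))" by simp
  qed
 qed measurable
qed

lemma e3_components: "e3 $ 1 = 0" "e3 $ 2 = 0" "e3 $ 3 = 1" by (simp_all add: e3_def)

lemma norm_e3: "norm e3 = 1" by (simp add: norm_eq_sqrt_inner inner_vec_def sum_3 e3_components)

lemma e3_cross: "e3 \<bullet> cross3 a b = a $ 1 * b $ 2 - a $ 2 * b $ 1"
 by (simp add: inner_vec_def sum_3 e3_components cross_components)

lemma norm_e3_add_le: "norm (u x) \<le> C \<Longrightarrow> norm (e3 + u x) \<le> 1 + C"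
 using norm_triangle_ineq[of e3 "u x"] norm_e3 by linarith

text \<open>The contribution of the constant vector \<open>e3\<close> is the Jacobian of the first
  two components, a null Lagrangian with zero integral. What remains is small when \<open>u\<close>
  is small.\<close>

lemma jet_degree_alt:
 assumes J: "jet2 u G K" and m: "\<And>x. norm (u x) \<le> C"
 shows "jet_degree u G = 1 / (4 * pi) * (LINT x|lborel. u x \<bullet> cross3 (G 1 x) (G 2 x))"
proof -
 note J = jet2D[OF J]
 have um: "u \<in> borel_measurable borel" using J(1) by auto
 note L = bounded_linear_vec_nth
 have "(LINT x|lborel. e3 \<bullet> cross3 (G 1 x) (G 2 x)) = (LINT x|lborel. G 1 x $ 1 \<bullet> G 2 x $ 2 - G 2 x $ 1 \<bullet> G 1 x $ 2)"
  by (simp add: e3_cross mult.commute)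
 also have "\<dots> = (LINT x|lborel. G 1 x $ 1 \<bullet> G 2 x $ 2) - (LINT x|lborel. G 2 x $ 1 \<bullet> G 1 x $ 2)"
  by (intro Bochner_Integration.integral_diff integrable_inner L2_bounded_linear[OF L] J)
 also have "(LINT x|lborel. G 1 x $ 1 \<bullet> G 2 x $ 2) = (LINT x|lborel. G 2 x $ 1 \<bullet> G 1 x $ 2)"
  by (rule weak_partial_exchange[OF has_weak_partial_bounded_linear[OF L J(2)[of 2]] has_weak_partial_bounded_linear[OF L J(2)[of 1]]
     _ _ _ has_weak_partial_bounded_linear[OF L J(2)[of 2]] has_weak_partial_bounded_linear[OF L J(2)[of 1]]])
    (intro L2_bounded_linear[OF L] J)+
 finally have "(LINT x|lborel. e3 \<bullet> cross3 (G 1 x) (G 2 x)) = 0" by simp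
 moreover have "integrable lborel (\<lambda>x. e3 \<bullet> cross3 (G 1 x) (G 2 x))"
  by (rule integrable_triple[of "\<lambda>_. e3" 1]) (auto simp: norm_e3 J)
 moreover have "integrable lborel (\<lambda>x. u x \<bullet> cross3 (G 1 x) (G 2 x))" by (rule integrable_triple[OF um m J(3) J(3)])
 ultimately show ?thesis by (simp add: jet_degree_def inner_add_left)
qed

text \<open>Integration by parts bounds the gradient by the product of the norms of \<open>u\<close>
  and of its Laplacian, and the arithmetic mean of their squares is the energy.\<close>

lemma gradient_le_energy:
 assumes J: "jet2 u G K"
 shows "(l2 (G 1))\<^sup>2 + (l2 (G 2))\<^sup>2 \<le> jet_energy u K"
proof -
 have s: "L2 (\<lambda>x. \<Sum>i\<in>UNIV. K i i x)" by (intro L2_sum jet2D[OF J])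
 have "(l2 (G 1))\<^sup>2 + (l2 (G 2))\<^sup>2 = - (LINT x|lborel. u x \<bullet> (\<Sum>i\<in>UNIV. K i i x))"
  using gradient_l2[OF J] by (simp add: UNIV_2)
 also have "\<dots> \<le> l2 u * l2 (\<lambda>x. \<Sum>i\<in>UNIV. K i i x)" using integral_inner_le[OF jet2D(1)[OF J] s] by linarith
 also have "\<dots> \<le> jet_energy u K"
  using sum_squares_bound[of "l2 u" "l2 (\<lambda>x. \<Sum>i\<in>UNIV. K i i x)"] by (simp add: jet_energy_def)
 finally show ?thesis .
qed

lemma jet_energy_nonneg: "0 \<le> jet_energy u K" by (simp add: jet_energy_def)

lemma jet_bounded_energy:
 assumes J: "jet2 u G K" and E: "jet_energy u K \<le> E"
 shows "jet_bounded (sqrt (2 * E)) u G K"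
proof -
 have "0 \<le> E" using jet_energy_nonneg[of u K] E by linarith
 have le: "a \<le> sqrt (2 * E)" if "a\<^sup>2 \<le> 2 * E" for a :: real using that by (metis real_le_rsqrt)
 have "(l2 u)\<^sup>2 \<le> 2 * jet_energy u K" by (simp add: jet_energy_def)
 also have "\<dots> \<le> 2 * E" using E by simp
 finally have "l2 u \<le> sqrt (2 * E)" by (rule le)
 moreover have "l2 (G i) \<le> sqrt (2 * E)" for i
 proof -
  consider "i = 1" | "i = 2" using UNIV_2 by blast
  then have "(l2 (G i))\<^sup>2 \<le> 2 * E"
   using gradient_le_energy[OF J] E \<open>0 \<le> E\<close> zero_le_power2[of "l2 (G 1)"] zero_le_power2[of "l2 (G 2)"]
   by cases (hypsubst, linarith)+
  then show ?thesis by (rule le)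
 qed
 moreover have "l2 (K i j) \<le> sqrt (2 * E)" for i j
 proof (rule le)
  have "(l2 (K i j))\<^sup>2 \<le> (\<Sum>j\<in>UNIV. (l2 (K i j))\<^sup>2)" by (rule member_le_sum) auto
  also have "\<dots> \<le> (\<Sum>i\<in>UNIV. \<Sum>j\<in>UNIV. (l2 (K i j))\<^sup>2)"
   by (rule member_le_sum[of i UNIV "\<lambda>i. \<Sum>j\<in>UNIV. (l2 (K i j))\<^sup>2"]) (auto intro: sum_nonneg)
  also have "\<dots> \<le> 2 * E"
  proof -
   have "(l2 (\<lambda>x. \<Sum>i\<in>UNIV. K i i x))\<^sup>2 \<le> 2 * jet_energy u K" by (simp add: jet_energy_def)
   then show ?thesis unfolding hessian_l2[OF J] using E by linarith
  qed
  finally show "(l2 (K i j))\<^sup>2 \<le> 2 * E" .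
 qed
 ultimately show ?thesis using J by (simp add: jet_bounded_def)
qed

text \<open>The product of the two gradient norms is at most half the sum of their squares, and this
  sum is at most the energy.\<close>

lemma integral_triple_le:
 assumes J: "jet2 u G K" and a: "a \<in> borel_measurable borel" "\<And>x. norm (a x) \<le> C"
 shows "\<bar>LINT x|lborel. a x \<bullet> cross3 (G 1 x) (G 2 x)\<bar> \<le> C / 2 * jet_energy u K"
proof -
 note JD = jet2D[OF J]
 have C: "0 \<le> C" using order_trans[OF norm_ge_zero a(2)] .
 have "\<bar>LINT x|lborel. a x \<bullet> cross3 (G 1 x) (G 2 x)\<bar> \<le> (LINT x|lborel. \<bar>a x \<bullet> cross3 (G 1 x) (G 2 x)\<bar>)"
  using integral_norm_bound[of lborel "\<lambda>x. a x \<bullet> cross3 (G 1 x) (G 2 x)"] by simp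
 also have "\<dots> \<le> (LINT x|lborel. C * (norm (G 1 x) * norm (G 2 x)))"
 proof (rule integral_mono)
  show "integrable lborel (\<lambda>x. \<bar>a x \<bullet> cross3 (G 1 x) (G 2 x)\<bar>)" by (intro integrable_abs integrable_triple[OF a] JD)
  show "integrable lborel (\<lambda>x. C * (norm (G 1 x) * norm (G 2 x)))"
   by (intro integrable_mult_right integrable_norm_mult JD)
  show "\<bar>a x \<bullet> cross3 (G 1 x) (G 2 x)\<bar> \<le> C * (norm (G 1 x) * norm (G 2 x))" for x
   by (rule order_trans[OF triple_le]) (intro mult_right_mono a, simp)
 qed
 also have "\<dots> \<le> C * (l2 (G 1) * l2 (G 2))"
  using integral_norm_mult_le[OF JD(3)[of 1] JD(3)[of 2]] C by (simp add: mult_left_mono)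
 also have "\<dots> \<le> C * (jet_energy u K / 2)"
 proof (rule mult_left_mono[OF _ C])
  show "l2 (G 1) * l2 (G 2) \<le> jet_energy u K / 2"
   using sum_squares_bound[of "l2 (G 1)" "l2 (G 2)"] gradient_le_energy[OF J] by linarith
 qed
 finally show ?thesis by simp
qed

text \<open>After the contribution of \<open>e3\<close> has dropped out, only the size of
  \<open>u\<close> enters. A sequence of bounded energy with degrees away from zero therefore cannot
  vanish uniformly.\<close>

lemma jet_degree_le:
 assumes J: "jet2 u G K" and m: "\<And>x. norm (u x) \<le> C"
 shows "\<bar>jet_degree u G\<bar> \<le> C / (8 * pi) * jet_energy u K"
proof -
 have "u \<in> borel_measurable borel" using jet2D(1)[OF J] by auto
 from integral_triple_le[OF J this m]
 have "1 / (4 * pi) * \<bar>LINT x|lborel. u x \<bullet> cross3 (G 1 x) (G 2 x)\<bar> \<le> 1 / (4 * pi) * (C / 2 * jet_energy u K)"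
  by (rule mult_left_mono) simp
 then show ?thesis unfolding jet_degree_alt[OF J m] by (simp add: abs_mult)
qed

text \<open>Here the whole vector \<open>e3 + u\<close> is kept under the integral, as it has length
  1; this produces the constant \<open>8 * pi\<close> against which the energy of the explicit map
  is measured.\<close>

lemma jet_degree_sphere_le:
 assumes J: "jet2 u G K" and m: "\<And>x. norm (e3 + u x) = 1"
 shows "\<bar>jet_degree u G\<bar> \<le> jet_energy u K / (8 * pi)"
proof -
 have "u \<in> borel_measurable borel" using jet2D(1)[OF J] by auto
 then have "(\<lambda>x. e3 + u x) \<in> borel_measurable borel" by measurable
 from integral_triple_le[OF J this, of 1] m
 have "1 / (4 * pi) * \<bar>LINT x|lborel. (e3 + u x) \<bullet> cross3 (G 1 x) (G 2 x)\<bar> \<le> 1 / (4 * pi) * (1 / 2 * jet_energy u K)"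
  by (intro mult_left_mono) simp_all
 then show ?thesis unfolding jet_degree_def by (simp add: abs_mult)
qed

section \<open>Independence of representatives and translation invariance\<close>

lemma jet_degree_unique:
 assumes "jet2 u G K" "jet2 u G' K'"
 shows "jet_degree u G = jet_degree u G'"
proof -
 have ae: "AE x in lborel. G i x = G' i x" for i
  by (rule has_weak_partial_unique[OF jet2D(2)[OF assms(1)] jet2D(2)[OF assms(2)]])
 note [measurable] = jet2D(1)[OF assms(1), THEN L2_measurable]
 have m: "(\<lambda>x. cross3 (H 1 x) (H 2 x)) \<in> borel_measurable lborel" if "jet2 u H L" for H L
  using borel_measurable_integrable[OF integrable_bilinear[OF bounded_bilinear_cross3 jet2D(3)[OF that] jet2D(3)[OF that]]] .
 note [measurable] = m[OF assms(1)] m[OF assms(2)]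
 have "(LINT x|lborel. (e3 + u x) \<bullet> cross3 (G 1 x) (G 2 x)) = (LINT x|lborel. (e3 + u x) \<bullet> cross3 (G' 1 x) (G' 2 x))"
 proof (rule integral_cong_AE)
  show "AE x in lborel. (e3 + u x) \<bullet> cross3 (G 1 x) (G 2 x) = (e3 + u x) \<bullet> cross3 (G' 1 x) (G' 2 x)"
   using ae[of 1] ae[of 2] by eventually_elim simp
 qed measurable
 then show ?thesis by (simp add: jet_degree_def)
qed

lemma jet_energy_unique:
 fixes u :: "real^2 \<Rightarrow> 'b::euclidean_space"
 assumes "jet2 u G K" "jet2 u G' K'"
 shows "jet_energy u K = jet_energy u K'"
proof -
 have "(l2 (\<lambda>x. \<Sum>i\<in>UNIV. K i i x))\<^sup>2 = (l2 (\<lambda>x. \<Sum>i\<in>UNIV. K' i i x))\<^sup>2"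
  unfolding hessian_l2[OF assms(1), symmetric] hessian_l2[OF assms(2), symmetric]
  using jet2_l2(2)[OF assms(1)] jet2_l2(2)[OF assms(2)] by simp
 then show ?thesis by (simp add: jet_energy_def)
qed

lemma jet_energy_shift:
 assumes J: "jet2 u G K"
 shows "jet_energy (\<lambda>x. u (x + a)) (\<lambda>i j x. K i j (x + a)) = jet_energy u K"
proof -
 have "L2 (\<lambda>x. \<Sum>i\<in>UNIV. K i i x)" by (intro L2_sum jet2D[OF J])
 from l2_shift[OF this, of a] l2_shift[OF jet2D(1)[OF J], of a] show ?thesis by (simp add: jet_energy_def)
qed

lemma jet_degree_shift:
 assumes J: "jet2 u G K"
 shows "jet_degree (\<lambda>x. u (x + a)) (\<lambda>i x. G i (x + a)) = jet_degree u G"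
proof -
 note [measurable] = jet2D(1,3)[OF J, THEN L2_measurable]
 have "(\<lambda>x. (e3 + u x) \<bullet> cross3 (G 1 x) (G 2 x)) \<in> borel_measurable borel" by measurable
 from integral_shift[OF this, of a] show ?thesis by (simp add: jet_degree_def)
qed

lemma indicator_split_mult:
 fixes a b :: "'a \<Rightarrow> 'b::real_normed_vector"
 shows "norm (a x) * norm (b x) = norm (a x) * norm (indicator S x *R b x) + norm (indicator (- S) x *R a x) * norm (b x)"
 by (simp add: indicator_def)

lemma L2_restrict:
 assumes "S \<in> sets borel" "L2 f"
 shows "L2 (\<lambda>x. indicator S x *R f x)"
proof (rule L2_bounded_mult[where C = 1])
 show "indicat_real S \<in> borel_measurable borel" by (rule borel_measurable_indicator[OF assms(1)])
qed (auto simp: assms indicator_def)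

section \<open>Asymptotic splitting along sequences tending weakly to zero\<close>

context
 fixes w :: "nat \<Rightarrow> real^2 \<Rightarrow> real^3" and G K M
 assumes J: "\<And>k. jet_bounded M (w k) (G k) (K k)" and c: "\<And>k. continuous_on UNIV (w k)"
  and lim: "\<And>x. (\<lambda>k. w k x) ----> 0"
begin

text \<open>Outside a large ball the fixed function is small in norm, inside it the gradients tend
  to zero.\<close>

lemma null_product:
 fixes g :: "real^2 \<Rightarrow> real^3"
 assumes g: "L2 g"
 shows "(\<lambda>k. LINT x|lborel. norm (g x) * norm (G k i x)) ----> 0"
proof (rule tendsto_zeroI)
 have M0: "0 \<le> M" by (rule jet_boundedD(5)[OF J])
 then show "0 \<le> l2 g + M" by simp
 fix e :: real assume e: "0 < e"
 note s = jet2D(3)[OF jet_boundedD(1)[OF J]]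
 obtain R where R: "l2 (outside R g) < e" using l2_tail[OF g e] by (metis order_refl)
 have B: "cball (0::real^2) R \<in> sets borel" "- cball (0::real^2) R \<in> sets borel" by (simp_all add: borel_closed borel_open)
 show "\<forall>\<^sub>F k in sequentially. \<bar>LINT x|lborel. norm (g x) * norm (G k i x)\<bar> \<le> (l2 g + M) * e"
  using order_tendstoD(2)[OF gradient_local_convergence[OF J c lim, of R i] e]
 proof eventually_elim
  case (elim k)
  note r = L2_restrict[OF B(1) s[of k i]] L2_restrict[OF B(2) g]
  have "(LINT x|lborel. norm (g x) * norm (G k i x))
    = (LINT x|lborel. norm (g x) * norm (indicator (cball 0 R) x *R G k i x) + norm (indicator (- cball 0 R) x *R g x) * norm (G k i x))"
   by (intro LINT_cong refl indicator_split_mult)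
  also have "\<dots> = (LINT x|lborel. norm (g x) * norm (indicator (cball 0 R) x *R G k i x))
    + (LINT x|lborel. norm (indicator (- cball 0 R) x *R g x) * norm (G k i x))"
   by (intro LINT_add integrable_norm_mult g r s)
  also have "\<dots> \<le> l2 g * l2 (inside R (G k i)) + l2 (outside R g) * l2 (G k i)"
   by (intro add_mono integral_norm_mult_le g r s)
  also have "\<dots> \<le> l2 g * e + e * M" using elim R jet_boundedD(3)[OF J, of k i] e by (intro add_mono mult_mono) auto
  finally show ?case by (simp add: LINT_nonneg algebra_simps)
 qed
qed

text \<open>Two weakly null gradients may have a product that does not become small far away; there
  the decay of \<open>v\<close> takes over, and local convergence of one gradient settles the
  rest.\<close>

lemma null_product_decay:
 fixes v :: "real^2 \<Rightarrow> real^3"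
 assumes v: "v \<in> borel_measurable borel" "\<And>x. norm (v x) \<le> C"
  and decay: "\<And>e. 0 < e \<Longrightarrow> \<exists>R. \<forall>x. R \<le> norm x \<longrightarrow> norm (v x) \<le> e"
 shows "(\<lambda>k. LINT x|lborel. norm (v x) * (norm (G k i x) * norm (G k j x))) ----> 0"
proof (rule tendsto_zeroI)
 have M0: "0 \<le> M" by (rule jet_boundedD(5)[OF J])
 have C0: "0 \<le> C" using order_trans[OF norm_ge_zero v(2)] .
 then show "0 \<le> C * M + M * M" using M0 by simp
 fix e :: real assume e: "0 < e"
 note s = jet2D(3)[OF jet_boundedD(1)[OF J]]
 obtain R where R: "\<And>x. R \<le> norm x \<Longrightarrow> norm (v x) \<le> e" using decay[OF e] by blast
 note [measurable] = v
 have B: "cball (0::real^2) R \<in> sets borel" by (simp add: borel_closed)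
 show "\<forall>\<^sub>F k in sequentially. \<bar>LINT x|lborel. norm (v x) * (norm (G k i x) * norm (G k j x))\<bar> \<le> (C * M + M * M) * e"
  using order_tendstoD(2)[OF gradient_local_convergence[OF J c lim, of R i] e]
 proof eventually_elim
  case (elim k)
  let ?p = "\<lambda>x. norm (G k i x) * norm (G k j x)" and ?q = "\<lambda>x. norm (indicator (cball 0 R) x *R G k i x) * norm (G k j x)"
  note [measurable] = s[of k i, THEN L2_measurable] s[of k j, THEN L2_measurable]
  note r = L2_restrict[OF B s[of k i]]
  have ile: "integrable lborel (\<lambda>x. norm (v x) * ?p x)"
  proof (rule LINT_integrable_bound[OF integrable_mult_right[OF integrable_norm_mult[OF s[of k i] s[of k j]], of C]])
   show "AE x in lborel. norm (norm (v x) * ?p x) \<le> norm (C * ?p x)"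
    using v(2) C0 by (intro AE_I2) (simp add: mult_right_mono)
  qed measurable
  have pt: "norm (v x) * ?p x \<le> C * ?q x + e * ?p x" for x
  proof (cases "norm x \<le> R")
   case True
   have "norm (v x) * ?p x \<le> C * ?p x" by (intro mult_right_mono v) simp
   moreover have "0 \<le> e * ?p x" using e by simp
   ultimately show ?thesis using True by simp
  next
   case False
   then have "norm (v x) * ?p x \<le> e * ?p x" by (intro mult_right_mono R) auto
   then show ?thesis using False by simp
  qed
  have "(LINT x|lborel. norm (v x) * ?p x)
   \<le> (LINT x|lborel. C * ?q x + e * ?p x)"
   by (intro integral_mono ile pt LINT_integrable_add integrable_mult_right integrable_norm_mult r s)
  also have "\<dots> = C * (LINT x|lborel. ?q x) + e * (LINT x|lborel. ?p x)" by (subst LINT_add)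
     (intro integrable_mult_right integrable_norm_mult r s, intro integrable_mult_right integrable_norm_mult r s, simp only: integral_mult_right_zero)
  also have "\<dots> \<le> C * (l2 (inside R (G k i)) * l2 (G k j)) + e * (l2 (G k i) * l2 (G k j))"
   using C0 e by (intro add_mono mult_left_mono integral_norm_mult_le r s) auto
  also have "\<dots> \<le> C * (e * M) + e * (M * M)"
   using C0 e M0 elim jet_boundedD(3)[OF J, of k i] jet_boundedD(3)[OF J, of k j]
   by (intro add_mono mult_left_mono mult_mono) auto
  finally show ?case by (simp add: LINT_nonneg algebra_simps)
 qed
qed

lemma null_product_dominated:
 fixes a b :: "real^2 \<Rightarrow> real^3"
 assumes "L2 a" "L2 b"
 shows "(\<lambda>k. LINT x|lborel. norm (w k x) * (norm (a x) * norm (b x))) ----> 0"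
proof -
 note [measurable] = assms[THEN L2_measurable]
 note [measurable] = jet2D(1)[OF jet_boundedD(1)[OF J], THEN L2_measurable]
 have "(\<lambda>k. LINT x|lborel. norm (w k x) * (norm (a x) * norm (b x))) ----> (LINT x|(lborel::(real^2) measure). 0)"
 proof (rule integral_dominated_convergence)
  show "integrable lborel (\<lambda>x. 4 * M * (norm (a x) * norm (b x)))"
   by (intro integrable_mult_right integrable_norm_mult assms)
  show "AE x in lborel. (\<lambda>k. norm (w k x) * (norm (a x) * norm (b x))) ----> 0"
  proof (rule AE_I2)
   fix x
   have "(\<lambda>k. norm (w k x) * (norm (a x) * norm (b x))) ----> norm (0::real^3) * (norm (a x) * norm (b x))"
    by (intro tendsto_intros lim)
   then show "(\<lambda>k. norm (w k x) * (norm (a x) * norm (b x))) ----> 0" by simp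
  qed
  show "AE x in lborel. norm (norm (w k x) * (norm (a x) * norm (b x))) \<le> 4 * M * (norm (a x) * norm (b x))" for k
   using sup_bound_bounded[OF J c] by (intro AE_I2) (simp add: mult_right_mono)
 qed measurable
 then show ?thesis by simp
qed

text \<open>In the expanded triple product every mixed term pairs fixed factors with null ones: a
  fixed and a null gradient, or a null function with two fixed gradients, or the decaying
  \<open>v\<close> with two null gradients.\<close>

lemma jet_degree_split:
 assumes Jv: "jet2 v Gv Kv" and uc: "isUCont v" and C: "\<And>x. norm (v x) \<le> C"
 shows "(\<lambda>k. jet_degree (\<lambda>x. v x + w k x) (\<lambda>i x. Gv i x + G k i x) - jet_degree (w k) (G k)) ----> jet_degree v Gv"
proof -
 note s = jet2D(3)[OF jet_boundedD(1)[OF J]]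
 note v = jet2D[OF Jv]
 have M0: "0 \<le> M" by (rule jet_boundedD(5)[OF J])
 have vm[measurable]: "v \<in> borel_measurable borel" using v(1) by auto
 have wm[measurable]: "w k \<in> borel_measurable borel" for k using jet2D(1)[OF jet_boundedD(1)[OF J]] by auto
 have wb: "norm (w k x) \<le> 4 * M" for k x by (rule sup_bound_bounded[OF J c])
 define D where "D k x = (e3 + (v x + w k x)) \<bullet> cross3 (Gv 1 x + G k 1 x) (Gv 2 x + G k 2 x)
   - (e3 + w k x) \<bullet> cross3 (G k 1 x) (G k 2 x) - (e3 + v x) \<bullet> cross3 (Gv 1 x) (Gv 2 x)" for k x
 define B where "B = 1 + C + 4 * M"
 define P where "P k x = B * (norm (Gv 1 x) * norm (G k 2 x)) + B * (norm (Gv 2 x) * norm (G k 1 x))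
   + norm (w k x) * (norm (Gv 1 x) * norm (Gv 2 x)) + norm (v x) * (norm (G k 1 x) * norm (G k 2 x))" for k x
 have DP: "\<bar>D k x\<bar> \<le> P k x" for k x
 proof -
  let ?e = "e3 + (v x + w k x)"
  have eq: "D k x = ?e \<bullet> cross3 (Gv 1 x) (G k 2 x) + ?e \<bullet> cross3 (G k 1 x) (Gv 2 x)
    + w k x \<bullet> cross3 (Gv 1 x) (Gv 2 x) + v x \<bullet> cross3 (G k 1 x) (G k 2 x)"
   unfolding D_def by (simp add: cross_add_left cross_add_right inner_add_left inner_add_right)
  have eB: "norm ?e \<le> B"
   using norm_triangle_ineq[of e3 "v x + w k x"] norm_triangle_ineq[of "v x" "w k x"] C[of x] wb[of k x] norm_e3
   unfolding B_def by linarith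
  have "\<bar>?e \<bullet> cross3 (Gv 1 x) (G k 2 x)\<bar> \<le> B * (norm (Gv 1 x) * norm (G k 2 x))"
   by (rule order_trans[OF triple_le]) (intro mult_right_mono eB, simp)
  moreover have "\<bar>?e \<bullet> cross3 (G k 1 x) (Gv 2 x)\<bar> \<le> B * (norm (G k 1 x) * norm (Gv 2 x))"
   by (rule order_trans[OF triple_le]) (intro mult_right_mono eB, simp)
  ultimately show ?thesis unfolding eq P_def
   using triple_le[of "w k x" "Gv 1 x" "Gv 2 x"] triple_le[of "v x" "G k 1 x" "G k 2 x"]
   by (simp only: mult.commute[of "norm (G k 1 x)" "norm (Gv 2 x)"])
 qed
 have i1: "integrable lborel (\<lambda>x. (e3 + (v x + w k x)) \<bullet> cross3 (Gv 1 x + G k 1 x) (Gv 2 x + G k 2 x))" for k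
  by (rule integrable_triple[where C = "1 + (C + 4 * M)"])
    (auto intro!: norm_e3_add_le[of "\<lambda>x. v x + w k x"] order_trans[OF norm_triangle_ineq] add_mono C wb L2_add v s simp: norm_e3)
 have i2: "integrable lborel (\<lambda>x. (e3 + w k x) \<bullet> cross3 (G k 1 x) (G k 2 x))" for k
  by (rule integrable_triple[where C = "1 + 4 * M"]) (auto intro!: norm_e3_add_le wb s)
 have i3: "integrable lborel (\<lambda>x. (e3 + v x) \<bullet> cross3 (Gv 1 x) (Gv 2 x))"
  by (rule integrable_triple[where C = "1 + C"]) (auto intro!: norm_e3_add_le C v)
 have iD: "integrable lborel (D k)" for k unfolding D_def[abs_def] using i1 i2 i3 by simp
 note [measurable] = s[THEN L2_measurable] v(3)[THEN L2_measurable]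
 have j3: "integrable lborel (\<lambda>x. norm (w k x) * (norm (Gv 1 x) * norm (Gv 2 x)))" for k
  by (rule LINT_integrable_bound[OF integrable_mult_right[OF integrable_norm_mult[OF v(3)[of 1] v(3)[of 2]], of "4 * M"]])
    (use wb M0 in \<open>auto intro!: AE_I2 mult_right_mono simp: abs_mult\<close>)
 have j4: "integrable lborel (\<lambda>x. norm (v x) * (norm (G k 1 x) * norm (G k 2 x)))" for k
  by (rule LINT_integrable_bound[OF integrable_mult_right[OF integrable_norm_mult[OF s[of k 1] s[of k 2]], of C]])
    (use C order_trans[OF norm_ge_zero C] in \<open>auto intro!: AE_I2 mult_right_mono simp: abs_mult\<close>)
 have j1: "integrable lborel (\<lambda>x. B * (norm (Gv 1 x) * norm (G k 2 x)))" "integrable lborel (\<lambda>x. B * (norm (Gv 2 x) * norm (G k 1 x)))" for k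
  by (intro integrable_mult_right integrable_norm_mult v s)+
 have iP: "integrable lborel (P k)" for k unfolding P_def[abs_def] by (intro LINT_integrable_add j1 j3 j4)
 have IP: "(LINT x|lborel. P k x) = B * (LINT x|lborel. norm (Gv 1 x) * norm (G k 2 x)) + B * (LINT x|lborel. norm (Gv 2 x) * norm (G k 1 x))
   + (LINT x|lborel. norm (w k x) * (norm (Gv 1 x) * norm (Gv 2 x))) + (LINT x|lborel. norm (v x) * (norm (G k 1 x) * norm (G k 2 x)))" for k
  unfolding P_def[abs_def] by (simp only: LINT_add LINT_integrable_add j1 j3 j4 integral_mult_right_zero)
 have decay: "\<exists>R. \<forall>x. R \<le> norm x \<longrightarrow> norm (v x) \<le> e" if "0 < e" for e
  using uniformly_continuous_decay[OF v(1) uc that] by metis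
 have "(\<lambda>k. LINT x|lborel. P k x) ----> B * 0 + B * 0 + 0 + 0"
  unfolding IP by (intro tendsto_intros null_product null_product_dominated null_product_decay[OF vm C decay] v)
 then have lP: "(\<lambda>k. LINT x|lborel. P k x) ----> 0" by simp
 have lD: "(\<lambda>k. LINT x|lborel. D k x) ----> 0"
 proof (rule Lim_null_comparison[OF _ lP], rule always_eventually, rule allI)
  fix k
  have "norm (LINT x|lborel. D k x) \<le> (LINT x|lborel. \<bar>D k x\<bar>)" using integral_norm_bound[of lborel "D k"] by simp
  also have "\<dots> \<le> (LINT x|lborel. P k x)" by (intro integral_mono integrable_abs iD iP DP)
  finally show "norm (LINT x|lborel. D k x) \<le> (LINT x|lborel. P k x)" .
 qed
 have "1 / (4 * pi) * (LINT x|lborel. D k x) + jet_degree v Gv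
   = jet_degree (\<lambda>x. v x + w k x) (\<lambda>i x. Gv i x + G k i x) - jet_degree (w k) (G k)" for k
  unfolding D_def jet_degree_def
  by (simp only: Bochner_Integration.integral_diff Bochner_Integration.integrable_diff i1 i2 i3) (simp add: algebra_simps)
 moreover have "(\<lambda>k. 1 / (4 * pi) * (LINT x|lborel. D k x) + jet_degree v Gv) ----> 1 / (4 * pi) * 0 + jet_degree v Gv"
  by (intro tendsto_intros lD)
 ultimately show ?thesis by simp
qed

text \<open>The energy is quadratic, and its two cross terms test weakly null sequences against
  fixed functions.\<close>

lemma jet_energy_split:
 assumes Jv: "jet2 v Gv Kv"
 shows "(\<lambda>k. jet_energy (\<lambda>x. v x + w k x) (\<lambda>i j x. Kv i j x + K k i j x) - jet_energy (w k) (K k)) ----> jet_energy v Kv"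
proof -
 note v = jet2D[OF Jv] and J' = jet2D[OF jet_boundedD(1)[OF J]]
 let ?L = "\<lambda>K x. \<Sum>i\<in>UNIV. K i i x"
 have sv: "L2 (?L Kv)" by (intro L2_sum v)
 have sk: "L2 (?L (K k))" for k by (intro L2_sum J')
 have "(\<lambda>k. \<Sum>i\<in>UNIV. LINT x|lborel. ?L Kv x \<bullet> K k i i x) ----> (\<Sum>i\<in>(UNIV::2 set). 0)"
  by (intro tendsto_sum weak_null_integral(2)[OF J lim sv])
 moreover have "(\<Sum>i\<in>UNIV. LINT x|lborel. ?L Kv x \<bullet> K k i i x) = (LINT x|lborel. ?L Kv x \<bullet> ?L (K k) x)" for k
  by (simp only: inner_sum_right) (intro Bochner_Integration.integral_sum[symmetric] integrable_inner sv J')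
 ultimately have l2: "(\<lambda>k. LINT x|lborel. ?L Kv x \<bullet> ?L (K k) x) ----> 0" by simp
 have l1: "(\<lambda>k. LINT x|lborel. v x \<bullet> w k x) ----> 0" by (rule weak_null_integral(1)[OF J lim v(1)])
 have "jet_energy (\<lambda>x. v x + w k x) (\<lambda>i j x. Kv i j x + K k i j x) - jet_energy (w k) (K k)
   = jet_energy v Kv + (LINT x|lborel. v x \<bullet> w k x) + (LINT x|lborel. ?L Kv x \<bullet> ?L (K k) x)" for k
  unfolding jet_energy_def
  using l2_power2_add[OF v(1) J'(1)] l2_power2_add[OF sv sk] by (simp add: sum.distrib field_simps)
 moreover have "(\<lambda>k. jet_energy v Kv + (LINT x|lborel. v x \<bullet> w k x) + (LINT x|lborel. ?L Kv x \<bullet> ?L (K k) x)) ----> jet_energy v Kv + 0 + 0"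
  by (intro tendsto_intros l1 l2)
 ultimately show ?thesis by simp
qed

end

section \<open>Integrality of the degree\<close>

text \<open>A unit vector \<open>a\<close> is represented by a unit spinor in \<open>\<complex>\<^sup>2\<close> whose projector is
 \<open>(1 + a \<cdot> \<sigma>) / 2\<close>.\<close>

definition spinor :: "real^3 \<Rightarrow> complex \<times> complex" where
 "spinor a = (if a $ 3 = -1 then (0, 1)
   else (of_real (sqrt ((1 + a $ 3) / 2)), Complex (a $ 1) (a $ 2) / of_real (sqrt (2 * (1 + a $ 3)))))"

text \<open>The Hermitian product of two spinors. The phase chosen in \<open>spinor\<close> is
  discontinuous at the south pole, but it cancels from products around closed polygons.\<close>

definition overlap :: "real^3 \<Rightarrow> real^3 \<Rightarrow> complex" where
 "overlap a b = cnj (fst (spinor a)) * fst (spinor b) + cnj (snd (spinor a)) * snd (spinor b)"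

lemma norm_3_eq: "(norm (a :: real^3))\<^sup>2 = (a $ 1)\<^sup>2 + (a $ 2)\<^sup>2 + (a $ 3)\<^sup>2"
 unfolding power2_norm_eq_inner by (simp add: inner_vec_def sum_3 power2_eq_square)

lemma spinor_projector:
 assumes a: "norm a = 1"
 shows "fst (spinor a) * cnj (fst (spinor a)) = of_real ((1 + a $ 3) / 2)"
  "snd (spinor a) * cnj (snd (spinor a)) = of_real ((1 - a $ 3) / 2)"
  "fst (spinor a) * cnj (snd (spinor a)) = Complex (a $ 1 / 2) (- (a $ 2) / 2)"
  "snd (spinor a) * cnj (fst (spinor a)) = Complex (a $ 1 / 2) (a $ 2 / 2)"
proof -
 have n: "(a $ 1)\<^sup>2 + (a $ 2)\<^sup>2 + (a $ 3)\<^sup>2 = 1" using norm_3_eq[of a] a by simp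
 have "(a $ 3)\<^sup>2 \<le> 1" using n zero_le_power2[of "a $ 1"] zero_le_power2[of "a $ 2"] by linarith
 then have ge: "-1 \<le> a $ 3" by (metis abs_le_D2 abs_square_le_1 minus_le_iff)
 have "fst (spinor a) * cnj (fst (spinor a)) = of_real ((1 + a $ 3) / 2) \<and>
  snd (spinor a) * cnj (snd (spinor a)) = of_real ((1 - a $ 3) / 2) \<and>
  fst (spinor a) * cnj (snd (spinor a)) = Complex (a $ 1 / 2) (- (a $ 2) / 2)"
 proof (cases "a $ 3 = -1")
  case True
  with n have z: "(a $ 1)\<^sup>2 + (a $ 2)\<^sup>2 = 0" by simp
  then have "a $ 1 = 0" "a $ 2 = 0" by (simp_all add: sum_power2_eq_zero_iff)
  with True show ?thesis by (simp add: spinor_def complex_eq_iff)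
 next
  case False
  with ge have p: "0 < 1 + a $ 3" by simp
  define s where "s = sqrt (2 * (1 + a $ 3))"
  have s: "0 < s" "s * s = 2 * (1 + a $ 3)" using p by (auto simp: s_def)
  have s2: "sqrt ((1 + a $ 3) / 2) = s / 2"
  proof (rule real_sqrt_unique)
   show "(s / 2)\<^sup>2 = (1 + a $ 3) / 2" using s(2) by (simp add: power2_eq_square)
  qed (use s in simp)
  have sp: "spinor a = (of_real (s / 2), Complex (a $ 1) (a $ 2) / of_real s)"
   unfolding spinor_def s2 s_def[symmetric] using False by simp
  have "(a $ 1)\<^sup>2 + (a $ 2)\<^sup>2 = (1 - a $ 3) * (1 + a $ 3)" using n by (simp add: algebra_simps power2_eq_square)
  then have q: "((a $ 1)\<^sup>2 + (a $ 2)\<^sup>2) / (s * s) = (1 - a $ 3) / 2" unfolding s(2) using p by (simp add: field_simps)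
  have "fst (spinor a) * cnj (fst (spinor a)) = of_real ((s * s) / 4)" by (simp add: sp complex_eq_iff)
  also have "(s * s) / 4 = (1 + a $ 3) / 2" using s(2) by simp
  finally have f1: "fst (spinor a) * cnj (fst (spinor a)) = of_real ((1 + a $ 3) / 2)" .
  have "snd (spinor a) * cnj (snd (spinor a)) = of_real (((a $ 1)\<^sup>2 + (a $ 2)\<^sup>2) / (s * s))"
   using s(1) by (simp add: sp complex_eq_iff power2_eq_square add_divide_distrib)
  then have f2: "snd (spinor a) * cnj (snd (spinor a)) = of_real ((1 - a $ 3) / 2)" by (simp only: q)
  have "fst (spinor a) * cnj (snd (spinor a)) = Complex (a $ 1 / 2) (- (a $ 2) / 2)"
   using s(1) by (simp add: sp complex_eq_iff)
  with f1 f2 show ?thesis by blast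
 qed
 then show "fst (spinor a) * cnj (fst (spinor a)) = of_real ((1 + a $ 3) / 2)"
  "snd (spinor a) * cnj (snd (spinor a)) = of_real ((1 - a $ 3) / 2)"
  and 3: "fst (spinor a) * cnj (snd (spinor a)) = Complex (a $ 1 / 2) (- (a $ 2) / 2)" by auto
 have "snd (spinor a) * cnj (fst (spinor a)) = cnj (fst (spinor a) * cnj (snd (spinor a)))" by simp
 also have "\<dots> = Complex (a $ 1 / 2) (a $ 2 / 2)" unfolding 3 by (simp add: complex_eq_iff)
 finally show "snd (spinor a) * cnj (fst (spinor a)) = Complex (a $ 1 / 2) (a $ 2 / 2)" .
qed

lemma overlap_commute: "overlap b a = cnj (overlap a b)" by (simp add: overlap_def mult.commute)

text \<open>A product around a triangle is the trace of the product of the three projectors, so it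
  depends on the vectors only; its value is the Bargmann invariant of the triangle.\<close>

lemma overlap_triple:
 assumes "norm a = 1" "norm b = 1" "norm c = 1"
 shows "overlap a b * overlap b c * overlap c a =
  Complex (1 + a \<bullet> b + b \<bullet> c + c \<bullet> a) (a \<bullet> cross3 b c) / 4"
proof -
 note A = spinor_projector[OF assms(1)] and B = spinor_projector[OF assms(2)] and C = spinor_projector[OF assms(3)]
 define p1 p2 q1 q2 r1 r2 where d: "p1 = fst (spinor a)" "p2 = snd (spinor a)" "q1 = fst (spinor b)" "q2 = snd (spinor b)"
  "r1 = fst (spinor c)" "r2 = snd (spinor c)"
 have "overlap a b * overlap b c * overlap c a =
   (p1 * cnj p1) * (q1 * cnj q1) * (r1 * cnj r1) + (p2 * cnj p1) * (q1 * cnj q1) * (r1 * cnj r2)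
  + (p1 * cnj p1) * (q1 * cnj q2) * (r2 * cnj r1) + (p2 * cnj p1) * (q1 * cnj q2) * (r2 * cnj r2)
  + (p1 * cnj p2) * (q2 * cnj q1) * (r1 * cnj r1) + (p2 * cnj p2) * (q2 * cnj q1) * (r1 * cnj r2)
  + (p1 * cnj p2) * (q2 * cnj q2) * (r2 * cnj r1) + (p2 * cnj p2) * (q2 * cnj q2) * (r2 * cnj r2)"
  unfolding overlap_def d[symmetric] by (simp add: algebra_simps)
 also have "\<dots> = Complex (1 + a \<bullet> b + b \<bullet> c + c \<bullet> a) (a \<bullet> cross3 b c) / 4" unfolding d A B C
  by (simp add: complex_eq_iff inner_vec_def sum_3 cross_components) (simp add: field_simps)
 finally show ?thesis .
qed

text \<open>Half the signed solid angle of the spherical triangle, in the form given by the tangent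
  of half the spherical excess. The arctangent is the argument of the overlap product as long as the
  denominator is positive.\<close>

definition triple_angle :: "real^3 \<Rightarrow> real^3 \<Rightarrow> real^3 \<Rightarrow> real" where
 "triple_angle a b c = arctan ((a \<bullet> cross3 b c) / (1 + a \<bullet> b + b \<bullet> c + c \<bullet> a))"

lemma unit_inner: "norm a = 1 \<Longrightarrow> norm b = 1 \<Longrightarrow> a \<bullet> b = 1 - (norm (a - b))\<^sup>2 / 2"
 by (simp add: power2_norm_eq_inner inner_diff_left inner_diff_right inner_commute norm_eq_1 diff_divide_distrib)

text \<open>Vectors at mutual distance at most 1 keep the denominator of \<open>triple_angle\<close>
  at least 5/2, and it tends to 4 as the triangle shrinks.\<close>

lemma triple_real_part:
 assumes "norm a = 1" "norm b = 1" "norm c = 1"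
  and "norm (a - b) \<le> d" "norm (b - c) \<le> d" "norm (c - a) \<le> d"
 shows "4 - 3 * d\<^sup>2 / 2 \<le> 1 + a \<bullet> b + b \<bullet> c + c \<bullet> a" "1 + a \<bullet> b + b \<bullet> c + c \<bullet> a \<le> 4"
proof -
 have "(norm (a - b))\<^sup>2 \<le> d\<^sup>2" "(norm (b - c))\<^sup>2 \<le> d\<^sup>2" "(norm (c - a))\<^sup>2 \<le> d\<^sup>2"
  using assms by (auto intro: power_mono)
 then show "4 - 3 * d\<^sup>2 / 2 \<le> 1 + a \<bullet> b + b \<bullet> c + c \<bullet> a" "1 + a \<bullet> b + b \<bullet> c + c \<bullet> a \<le> 4"
  using unit_inner[OF assms(1,2)] unit_inner[OF assms(2,3)] unit_inner[OF assms(3,1)]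
   zero_le_power2[of "norm (a - b)"] zero_le_power2[of "norm (b - c)"] zero_le_power2[of "norm (c - a)"] by linarith+
qed

lemma cis_arctan:
 assumes "0 < r"
 shows "cis (arctan (y / r)) = sgn (Complex r y)"
proof -
 have n: "cmod (Complex r y) = r * sqrt (1 + (y / r)\<^sup>2)"
 proof -
  have "r\<^sup>2 + y\<^sup>2 = r\<^sup>2 * (1 + (y / r)\<^sup>2)" using assms by (simp add: field_simps power_divide)
  then have "cmod (Complex r y) = sqrt (r\<^sup>2 * (1 + (y / r)\<^sup>2))" by (simp add: complex_norm)
  then show ?thesis using assms by (simp add: real_sqrt_mult)
 qed
 have "0 < 1 + (y / r)\<^sup>2" by (simp add: add_pos_nonneg)
 then have "0 < sqrt (1 + (y / r)\<^sup>2)" by simp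
 then show ?thesis unfolding sgn_eq n using assms by (simp add: complex_eq_iff cos_arctan sin_arctan field_simps)
qed

lemma cis_triple_angle:
 assumes u: "norm a = 1" "norm b = 1" "norm c = 1"
  and d: "norm (a - b) \<le> 1" "norm (b - c) \<le> 1" "norm (c - a) \<le> 1"
 shows "cis (triple_angle a b c) = sgn (overlap a b) * sgn (overlap b c) * sgn (overlap c a)"
proof -
 have "0 < 1 + a \<bullet> b + b \<bullet> c + c \<bullet> a" using triple_real_part(1)[OF u d] by simp
 then have "cis (triple_angle a b c) = sgn (Complex (1 + a \<bullet> b + b \<bullet> c + c \<bullet> a) (a \<bullet> cross3 b c))"
  unfolding triple_angle_def by (rule cis_arctan)
 also have "\<dots> = sgn (4 * (overlap a b * overlap b c * overlap c a))" unfolding overlap_triple[OF u] by simp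
 also have "\<dots> = sgn (overlap a b) * sgn (overlap b c) * sgn (overlap c a)" by (simp add: sgn_mult sgn_eq norm_mult)
 finally show ?thesis .
qed

text \<open>The degenerate triangle \<open>a\<close>, \<open>b\<close>, \<open>b\<close> contains
  the overlap as a factor, and its product has positive real part.\<close>

lemma overlap_nonzero:
 assumes u: "norm a = 1" "norm b = 1" and d: "norm (a - b) \<le> 1"
 shows "overlap a b \<noteq> 0"
proof
 assume "overlap a b = 0"
 then have "Complex (1 + a \<bullet> b + b \<bullet> b + b \<bullet> a) (a \<bullet> cross3 b b) / 4 = 0" using overlap_triple[OF u u(2)] by simp
 then have "1 + a \<bullet> b + b \<bullet> b + b \<bullet> a = 0" by (simp add: complex_eq_iff)
 moreover have "4 - 3 * 1\<^sup>2 / 2 \<le> 1 + a \<bullet> b + b \<bullet> b + b \<bullet> a"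
  by (rule triple_real_part(1)[OF u u(2)]) (use d in \<open>auto simp: norm_minus_commute\<close>)
 ultimately show False by simp
qed

lemma sgn_cnj_mult: "z \<noteq> 0 \<Longrightarrow> sgn z * sgn (cnj z) = (1::complex)"
proof -
 assume z: "z \<noteq> 0"
 have "z * cnj z = of_real ((cmod z)\<^sup>2)" by (rule complex_norm_square[symmetric])
 then show ?thesis using z by (simp add: sgn_eq power2_eq_square)
qed

text \<open>The four corners are listed cyclically, with \<open>d\<close> opposite to
  \<open>a\<close>; the square is cut along the diagonal from \<open>a\<close> to
  \<open>d\<close>.\<close>

definition square_angle :: "real^3 \<Rightarrow> real^3 \<Rightarrow> real^3 \<Rightarrow> real^3 \<Rightarrow> real" where
 "square_angle a b d c = triple_angle a b d + triple_angle a d c"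

text \<open>Around a square the diagonal phases cancel, so that the product over a grid telescopes to the
 phases along its boundary.\<close>

lemma cis_square_angle:
 assumes u: "norm a = 1" "norm b = 1" "norm c = 1" "norm d = 1"
  and n: "norm (a - b) \<le> 1" "norm (b - d) \<le> 1" "norm (d - a) \<le> 1" "norm (d - c) \<le> 1" "norm (c - a) \<le> 1"
 shows "cis (square_angle a b d c) =
  (sgn (overlap a b) * cnj (sgn (overlap c d))) * (sgn (overlap b d) * cnj (sgn (overlap a c)))"
proof -
 have n': "norm (a - d) \<le> 1" using n(3) by (simp add: norm_minus_commute)
 have cs: "sgn (cnj z) = cnj (sgn z)" for z by (simp add: sgn_eq)
 have "cis (square_angle a b d c) = cis (triple_angle a b d) * cis (triple_angle a d c)"
  by (simp add: square_angle_def cis_mult)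
 also have "\<dots> = sgn (overlap a b) * sgn (overlap b d) * (sgn (overlap d a) * sgn (overlap a d)) * sgn (overlap d c) * sgn (overlap c a)"
  using cis_triple_angle[OF u(1,2,4) n(1,2,3)] cis_triple_angle[OF u(1,4,3) n' n(4,5)] by simp
 also have "sgn (overlap d a) * sgn (overlap a d) = 1"
  using sgn_cnj_mult[OF overlap_nonzero[OF u(4,1) n(3)]] overlap_commute[of a d] by simp
 finally show ?thesis by (simp add: overlap_commute[of d c] overlap_commute[of c a] cs)
qed

lemma prod_telescope_unit:
 fixes X :: "nat \<Rightarrow> complex"
 assumes "\<And>j. j \<le> n \<Longrightarrow> X j * cnj (X j) = 1"
 shows "(\<Prod>j<n. X j * cnj (X (Suc j))) = X 0 * cnj (X n)" using assms
proof (induction n)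
 case (Suc n)
 have "(\<Prod>j<Suc n. X j * cnj (X (Suc j))) = (X 0 * cnj (X n)) * (X n * cnj (X (Suc n)))" using Suc by simp
 also have "\<dots> = X 0 * (X n * cnj (X n)) * cnj (X (Suc n))" by (simp only: mult_ac)
 also have "X n * cnj (X n) = 1" using Suc.prems by simp
 finally show ?case by simp
qed simp

text \<open>In each direction the edge phases telescope to two boundary values, which coincide
  because the map is constant along the boundary. The exponential of the summed angles is therefore
  1.\<close>

lemma grid_quantization:
 fixes V :: "nat \<Rightarrow> nat \<Rightarrow> real^3"
 assumes u: "\<And>i j. norm (V i j) = 1"
  and n: "\<And>i j. norm (V i j - V (Suc i) j) \<le> 1" "\<And>i j. norm (V i j - V i (Suc j)) \<le> 1"
   "\<And>i j. norm (V i j - V (Suc i) (Suc j)) \<le> 1"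
  and bd: "\<And>i. V i 0 = e3" "\<And>i. V i m = e3" "\<And>j. V 0 j = e3" "\<And>j. V m j = e3"
 shows "\<exists>k::int. (\<Sum>i<m. \<Sum>j<m. square_angle (V i j) (V (Suc i) j) (V (Suc i) (Suc j)) (V i (Suc j))) = 2 * pi * k"
proof -
 define X where "X i j = sgn (overlap (V i j) (V (Suc i) j))" for i j
 define Y where "Y i j = sgn (overlap (V i j) (V i (Suc j)))" for i j
 have cs: "sgn (cnj z) = cnj (sgn z)" for z :: complex by (simp add: sgn_eq)
 have X1: "X i j * cnj (X i j) = 1" for i j
  using sgn_cnj_mult[OF overlap_nonzero[OF u u n(1)[of i j]]] by (simp add: X_def cs)
 have Y1: "Y i j * cnj (Y i j) = 1" for i j
  using sgn_cnj_mult[OF overlap_nonzero[OF u u n(2)[of i j]]] by (simp add: Y_def cs)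
 have "cis (square_angle (V i j) (V (Suc i) j) (V (Suc i) (Suc j)) (V i (Suc j)))
   = (X i j * cnj (X i (Suc j))) * (Y (Suc i) j * cnj (Y i j))" for i j unfolding X_def Y_def
  by (rule cis_square_angle[OF u u u u]) (use n in \<open>auto simp: norm_minus_commute\<close>)
 moreover have "(\<Prod>i<m. \<Prod>j<m. X i j * cnj (X i (Suc j))) = 1"
 proof -
  have "(\<Prod>j<m. X i j * cnj (X i (Suc j))) = 1" for i
  proof -
   have "X i 0 = X i m" by (simp add: X_def bd)
   then show ?thesis using prod_telescope_unit[of m "X i", OF X1] X1[of i m] by (simp only:)
  qed
  then show ?thesis by simp
 qed
 moreover have "(\<Prod>i<m. \<Prod>j<m. Y (Suc i) j * cnj (Y i j)) = 1"
 proof -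
  \<comment> \<open>The phases \<open>Y\<close> telescope in the first index, so the two products
    are interchanged first.\<close>
  have "(\<Prod>i<m. \<Prod>j<m. Y (Suc i) j * cnj (Y i j)) = (\<Prod>j<m. \<Prod>i<m. Y (Suc i) j * cnj (Y i j))" by (rule prod.swap)
  also have "\<dots> = (\<Prod>j<m. 1)"
  proof (intro prod.cong refl)
   fix j
   have "(\<Prod>i<m. Y (Suc i) j * cnj (Y i j)) = (\<Prod>i<m. cnj (Y i j * cnj (Y (Suc i) j)))" by (intro prod.cong refl) simp
   also have "\<dots> = cnj (\<Prod>i<m. Y i j * cnj (Y (Suc i) j))" by (rule cnj_prod[symmetric])
   also have "\<dots> = cnj (Y 0 j * cnj (Y m j))" using prod_telescope_unit[of m "\<lambda>i. Y i j", OF Y1] by (simp only:)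
   also have "Y 0 j = Y m j" by (simp add: Y_def bd)
   finally show "(\<Prod>i<m. Y (Suc i) j * cnj (Y i j)) = 1" by (simp only: Y1 complex_cnj_one)
  qed
  also have "\<dots> = 1" by simp
  finally show ?thesis .
 qed
 ultimately have "(\<Prod>i<m. \<Prod>j<m. cis (square_angle (V i j) (V (Suc i) j) (V (Suc i) (Suc j)) (V i (Suc j)))) = 1"
  by (simp add: prod.distrib)
 moreover have cs': "(\<Prod>j<m. cis (f j)) = cis (\<Sum>j<m. f j)" for f :: "nat \<Rightarrow> real" by (induction m) (auto simp: cis_mult)
 ultimately have "cis (\<Sum>i<m. \<Sum>j<m. square_angle (V i j) (V (Suc i) j) (V (Suc i) (Suc j)) (V i (Suc j))) = 1" by simp
 then have "cos (\<Sum>i<m. \<Sum>j<m. square_angle (V i j) (V (Suc i) j) (V (Suc i) (Suc j)) (V i (Suc j))) = 1"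
  by (simp add: complex_eq_iff)
 then show ?thesis unfolding cos_one_2pi_int by (metis mult.assoc mult.commute)
qed

section \<open>Angles of small triangles compared with triple products\<close>

lemma arctan_diff_le: "\<bar>arctan t - t\<bar> \<le> t\<^sup>2 * \<bar>t\<bar>"
proof -
 have "norm ((arctan t - t) - (arctan 0 - 0)) \<le> t\<^sup>2 * norm (t - 0)"
 proof (rule field_differentiable_bound[where S = "{- \<bar>t\<bar>..\<bar>t\<bar>}" and f = "\<lambda>s. arctan s - s" and f' = "\<lambda>s. inverse (1 + s\<^sup>2) - 1"])
  fix s assume s: "s \<in> {- \<bar>t\<bar>..\<bar>t\<bar>}"
  show "((\<lambda>s. arctan s - s) has_real_derivative inverse (1 + s\<^sup>2) - 1) (at s within {- \<bar>t\<bar>..\<bar>t\<bar>})"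
   by (auto intro!: derivative_eq_intros)
  have "s\<^sup>2 \<le> t\<^sup>2" using s by (auto simp: abs_le_square_iff[symmetric])
  have "0 < 1 + s\<^sup>2" by (simp add: add_pos_nonneg)
  then have "inverse (1 + s\<^sup>2) - 1 = - (s\<^sup>2 / (1 + s\<^sup>2))" by (simp add: field_simps)
  moreover have "s\<^sup>2 / (1 + s\<^sup>2) \<le> s\<^sup>2 / 1" by (rule divide_left_mono) (use \<open>0 < 1 + s\<^sup>2\<close> in auto)
  moreover have "0 \<le> s\<^sup>2 / (1 + s\<^sup>2)" by simp
  ultimately show "norm (inverse (1 + s\<^sup>2) - 1) \<le> t\<^sup>2" using \<open>s\<^sup>2 \<le> t\<^sup>2\<close> unfolding real_norm_def by linarith
 qed auto
 then show ?thesis by simp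
qed

text \<open>Replacing \<open>b\<close> and \<open>c\<close> by their differences from
  \<open>a\<close> shows that the triple product is quadratic in \<open>d\<close>. The denominator
  differs from 4 by order \<open>d^2\<close> and the arctangent from its argument by third order,
  which gives a relative error of order \<open>d^2\<close>.\<close>

lemma triple_angle_bounds:
 assumes u: "norm a = 1" "norm b = 1" "norm c = 1"
  and n: "norm (a - b) \<le> d" "norm (b - c) \<le> d" "norm (c - a) \<le> d" and d: "d \<le> 1"
 shows "\<bar>triple_angle a b c - (a \<bullet> cross3 b c) / 4\<bar> \<le> d\<^sup>2 * \<bar>a \<bullet> cross3 b c\<bar>"
  "\<bar>triple_angle a b c\<bar> \<le> 2 * \<bar>a \<bullet> cross3 b c\<bar>"
proof -
 define y where "y = a \<bullet> cross3 b c"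
 define r where "r = 1 + a \<bullet> b + b \<bullet> c + c \<bullet> a"
 have d0: "0 \<le> d" using n(1) norm_ge_zero order_trans by blast
 have d2: "d\<^sup>2 \<le> 1" using d d0 by (simp add: abs_square_le_1)
 have r: "4 - 3 * d\<^sup>2 / 2 \<le> r" "r \<le> 4" unfolding r_def by (rule triple_real_part[OF u n])+
 have r2: "2 \<le> r" using r(1) d2 by linarith
 have "y = a \<bullet> cross3 (b - a) (c - a)"
  unfolding y_def by (simp add: Cross3.left_diff_distrib Cross3.right_diff_distrib inner_diff_right dot_cross_self)
 then have "\<bar>y\<bar> \<le> norm a * (norm (b - a) * norm (c - a))" using triple_le by metis
 also have "\<dots> \<le> 1 * (d * d)" using u(1) n d0 by (intro mult_mono) (auto simp: norm_minus_commute)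
 finally have y: "\<bar>y\<bar> \<le> d\<^sup>2" by (simp add: power2_eq_square)
 define t where "t = y / r"
 have ta: "triple_angle a b c = arctan t" by (simp add: triple_angle_def t_def y_def r_def)
 have t1: "\<bar>t\<bar> \<le> \<bar>y\<bar> / 2" unfolding t_def abs_divide using r2 by (intro divide_left_mono) auto
 have "t\<^sup>2 \<le> d\<^sup>2 / 2"
 proof -
  have t3: "\<bar>t\<bar> \<le> d\<^sup>2 / 2" using t1 y by linarith
  then have "\<bar>t\<bar> \<le> 1" using d2 by linarith
  have "t\<^sup>2 = \<bar>t\<bar> * \<bar>t\<bar>" by (simp add: power2_eq_square)
  also have "\<dots> \<le> (d\<^sup>2 / 2) * 1" using t3 \<open>\<bar>t\<bar> \<le> 1\<close> by (intro mult_mono) auto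
  finally show ?thesis by simp
 qed
 then have "t\<^sup>2 * \<bar>t\<bar> \<le> d\<^sup>2 / 2 * (\<bar>y\<bar> / 2)" using t1 by (intro mult_mono) auto
 then have 1: "\<bar>arctan t - t\<bar> \<le> d\<^sup>2 * \<bar>y\<bar> / 4" using arctan_diff_le[of t] by simp
 have "t - y / 4 = y * ((4 - r) / (4 * r))" unfolding t_def using r2 by (simp add: field_simps)
 then have "\<bar>t - y / 4\<bar> = \<bar>y\<bar> * ((4 - r) / (4 * r))" using r r2 by (simp add: abs_mult)
 also have "\<dots> \<le> \<bar>y\<bar> * ((3 * d\<^sup>2 / 2) / 8)" using r r2 by (intro mult_left_mono frac_le) auto
 finally have 2: "\<bar>t - y / 4\<bar> \<le> 3 / 16 * (d\<^sup>2 * \<bar>y\<bar>)" by (simp add: mult_ac)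
 have nn: "0 \<le> d\<^sup>2 * \<bar>y\<bar>" by simp
 show 3: "\<bar>triple_angle a b c - (a \<bullet> cross3 b c) / 4\<bar> \<le> d\<^sup>2 * \<bar>a \<bullet> cross3 b c\<bar>"
  unfolding ta y_def[symmetric] using 1 2 nn by linarith
 have "d\<^sup>2 * \<bar>y\<bar> \<le> 1 * \<bar>y\<bar>" using d2 by (intro mult_right_mono) auto
 then show "\<bar>triple_angle a b c\<bar> \<le> 2 * \<bar>a \<bullet> cross3 b c\<bar>" using 3 unfolding y_def[symmetric] by linarith
qed

definition e_1 :: "real^2" where "e_1 = axis 1 1"
definition e_2 :: "real^2" where "e_2 = axis 2 1"

lemma norm_e_12 [simp]: "norm e_1 = 1" "norm e_2 = 1" by (simp_all add: e_1_def e_2_def)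

lemma e_12_components [simp]: "e_1 $ 1 = 1" "e_1 $ 2 = 0" "e_2 $ 1 = 0" "e_2 $ 2 = 1"
 by (simp_all add: e_1_def e_2_def axis_def)

definition cell_angle :: "real \<Rightarrow> (real^2 \<Rightarrow> real^3) \<Rightarrow> real^2 \<Rightarrow> real" where
 "cell_angle h m x = square_angle (m x) (m (x + h *R e_1)) (m (x + h *R e_1 + h *R e_2)) (m (x + h *R e_2))"

lemma continuous_triple_angle:
 fixes f1 f2 f3 :: "real^2 \<Rightarrow> real^3"
 assumes c: "continuous_on UNIV f1" "continuous_on UNIV f2" "continuous_on UNIV f3"
  and u: "\<And>x. norm (f1 x) = 1" "\<And>x. norm (f2 x) = 1" "\<And>x. norm (f3 x) = 1"
  and n: "\<And>x. norm (f1 x - f2 x) \<le> 1" "\<And>x. norm (f2 x - f3 x) \<le> 1" "\<And>x. norm (f3 x - f1 x) \<le> 1"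
 shows "continuous_on UNIV (\<lambda>x. triple_angle (f1 x) (f2 x) (f3 x))"
proof -
 have "0 < 1 + f1 x \<bullet> f2 x + f2 x \<bullet> f3 x + f3 x \<bullet> f1 x" for x using triple_real_part(1)[OF u n, of x] by simp
 then have "1 + f1 x \<bullet> f2 x + f2 x \<bullet> f3 x + f3 x \<bullet> f1 x \<noteq> 0" for x by (metis less_irrefl)
 then show ?thesis unfolding triple_angle_def by (intro continuous_intros continuous_on_cross c) auto
qed

lemma continuous_cell_angle:
 assumes c: "continuous_on UNIV m" and u: "\<And>x. norm (m x) = 1"
  and n: "\<And>x y. norm (x - y) \<le> 2 * h \<Longrightarrow> norm (m x - m y) \<le> 1" and h: "0 < h"
 shows "continuous_on UNIV (cell_angle h m)"
proof -
 have cs: "continuous_on UNIV (\<lambda>x. m (x + a))" for a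
  by (rule continuous_on_compose2[OF c]) (auto intro!: continuous_intros)
 have cs2: "continuous_on UNIV (\<lambda>x. m (x + a + b))" for a b
  by (rule continuous_on_compose2[OF c]) (auto intro!: continuous_intros)
 have b: "norm (h *R e_1) \<le> 2 * h" "norm (h *R e_2) \<le> 2 * h" "norm (h *R e_1 + h *R e_2) \<le> 2 * h"
  using h norm_triangle_ineq[of "h *R e_1" "h *R e_2"] by auto
 have eq: "x + h *R e_1 - (x + h *R e_1 + h *R e_2) = - (h *R e_2)" "x - (x + h *R e_1) = - (h *R e_1)"
  "x + h *R e_1 + h *R e_2 - x = h *R e_1 + h *R e_2" "x - (x + h *R e_1 + h *R e_2) = - (h *R e_1 + h *R e_2)"
  "x + h *R e_1 + h *R e_2 - (x + h *R e_2) = h *R e_1" "x + h *R e_2 - x = h *R e_2" for x by simp_all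
 show ?thesis unfolding cell_angle_def[abs_def] square_angle_def
  by (intro continuous_on_add continuous_triple_angle c cs cs2 u n) (simp_all only: eq norm_minus_cancel b)
qed

lemma triple_angle_e3 [simp]: "triple_angle a a a = 0" by (simp add: triple_angle_def)

section \<open>Averaging the grid over its position\<close>

lemma indicator_intervals_sum:
 assumes h: "0 < (h::real)"
 shows "(\<Sum>i<N. indicator {a + real i * h..<a + real (Suc i) * h} t) = (indicator {a..<a + real N * h} t :: real)"
proof (induction N)
 case (Suc N)
 have "{a..<a + real (Suc N) * h} = {a..<a + real N * h} \<union> {a + real N * h..<a + real (Suc N) * h}"
  using h by (intro ivl_disj_un_two(3)[symmetric]) auto
 moreover have "{a..<a + real N * h} \<inter> {a + real N * h..<a + real (Suc N) * h} = {}" by auto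
 ultimately have "(indicator {a..<a + real (Suc N) * h} t :: real) = indicator {a..<a + real N * h} t + indicator {a + real N * h..<a + real (Suc N) * h} t"
  by (simp only: indicator_disj_union)
 with Suc show ?case by simp
qed simp

text \<open>Half-open in both coordinates, so that its translates along the grid tile without
  overlap.\<close>

definition cell :: "real \<Rightarrow> real^2 \<Rightarrow> real" where
 "cell h x = indicator {0..<h} (x $ 1) * indicator {0..<h} (x $ 2)"

lemma borel_measurable_coordinate [measurable]: "(\<lambda>x::real^2. x $ i) \<in> borel_measurable borel"
 by (intro borel_measurable_continuous_onI linear_continuous_on bounded_linear_vec_nth)

text \<open>The half-open square lies between the open and the closed box, whose measures
  agree.\<close>

lemma cell_integral:
 assumes h: "0 < h"
 shows "integrable lborel (cell h)" "(LINT x|lborel. cell h x) = h\<^sup>2"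
proof -
 define S :: "(real^2) set" where "S = {x. x $ 1 \<in> {0..<h} \<and> x $ 2 \<in> {0..<h}}"
 have cell: "cell h = indicator S" by (auto simp: cell_def S_def fun_eq_iff indicator_def)
 have [measurable]: "S \<in> sets borel" unfolding S_def by measurable
 let ?b = "(\<chi> i. h) :: real^2"
 have prod: "(\<Prod>b\<in>Basis. (?b - 0) \<bullet> b) = h\<^sup>2"
 proof -
  have "?b \<bullet> b = h" if "b \<in> Basis" for b using that by (auto simp: Basis_vec_def inner_axis)
  then have "(\<Prod>b\<in>Basis. (?b - 0) \<bullet> b) = (\<Prod>b\<in>(Basis::(real^2) set). h)" by (intro prod.cong) auto
  also have "\<dots> = h\<^sup>2" by simp
  finally show ?thesis .
 qed
 have "emeasure lborel (box 0 ?b) = ennreal (h\<^sup>2)"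
  unfolding prod[symmetric] by (rule emeasure_lborel_box) (use h in \<open>auto simp: Basis_vec_def inner_axis\<close>)
 moreover have "emeasure lborel (cbox 0 ?b) = ennreal (h\<^sup>2)"
  unfolding prod[symmetric] by (rule emeasure_lborel_cbox) (use h in \<open>auto simp: Basis_vec_def inner_axis\<close>)
 moreover have "emeasure lborel (box 0 ?b) \<le> emeasure lborel S"
  by (rule emeasure_mono) (auto simp: S_def mem_box_cart forall_2)
 moreover have "emeasure lborel S \<le> emeasure lborel (cbox 0 ?b)"
  by (rule emeasure_mono) (auto simp: S_def mem_box_cart forall_2)
 ultimately have S: "emeasure lborel S = ennreal (h\<^sup>2)" by simp
 show "integrable lborel (cell h)" unfolding cell using S by (simp add: integrable_indicator_iff)
 show "(LINT x|lborel. cell h x) = h\<^sup>2" unfolding cell using S by (simp add: measure_def)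
qed

text \<open>For a map that is constant outside a disc, the grid sum is a continuous function of the position
 of the grid with values in \<open>2\<pi>\<int>\<close>, hence constant, hence equal to its average.\<close>

lemma cell_angle_quantization:
 fixes m :: "real^2 \<Rightarrow> real^3"
 assumes c: "continuous_on UNIV m" and u: "\<And>x. norm (m x) = 1"
  and R: "0 < R" "\<And>x. R \<le> norm x \<Longrightarrow> m x = e3" and h: "0 < h" "h \<le> 1"
  and n: "\<And>x y. norm (x - y) \<le> 2 * h \<Longrightarrow> norm (m x - m y) \<le> 1"
 shows "\<exists>k::int. (LINT x|lborel. cell_angle h m x) = h\<^sup>2 * (2 * pi * k)"
proof -
 \<comment> \<open>The margin 1 is at least \<open>h\<close>, so for every position of the grid in
   \<open>C\<close> its boundary nodes stay outside the open disc of radius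
   \<open>R\<close>.\<close>
 define L where "L = R + 1"
 obtain N :: nat where N: "2 * L / h \<le> real N" using real_arch_simple by blast
 then have Nh: "2 * L \<le> real N * h" using h by (simp add: field_simps)
 define p where "p i j = (- L + real i * h) *R e_1 + (- L + real j * h) *R e_2" for i j :: nat
 have pc: "p i j $ 1 = - L + real i * h" "p i j $ 2 = - L + real j * h" for i j by (simp_all add: p_def)
 have pS: "p (Suc i) j = p i j + h *R e_1" "p i (Suc j) = p i j + h *R e_2" for i j
  by (simp_all add: p_def algebra_simps)
 define f where "f = cell_angle h m"
 have fc: "continuous_on UNIV f" unfolding f_def by (rule continuous_cell_angle[OF c u n h(1)])
 have fm[measurable]: "f \<in> borel_measurable borel" by (rule borel_measurable_continuous_onI[OF fc])
 define S where "S x = (\<Sum>i<N. \<Sum>j<N. f (x + p i j))" for x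
 define C where "C = cbox (0::real^2) (\<chi> i. h)"
 have far: "m x = e3" if "R \<le> \<bar>x $ i\<bar>" for x i using R(2)[of x] that component_le_norm_cart[of x i] by simp
 have Sint: "\<exists>k::int. S x = 2 * pi * k" if x: "x \<in> C" for x
 proof -
  have x': "0 \<le> x $ 1" "x $ 1 \<le> h" "0 \<le> x $ 2" "x $ 2 \<le> h" using x by (auto simp: C_def mem_box_cart)
  define V where "V i j = m (x + p i j)" for i j
  have "f (x + p i j) = square_angle (V i j) (V (Suc i) j) (V (Suc i) (Suc j)) (V i (Suc j))" for i j
   by (simp add: f_def cell_angle_def V_def pS add.assoc)
  moreover have "\<exists>k::int. (\<Sum>i<N. \<Sum>j<N. square_angle (V i j) (V (Suc i) j) (V (Suc i) (Suc j)) (V i (Suc j))) = 2 * pi * k"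
  proof (rule grid_quantization)
   have 3: "norm (h *R e_1 + h *R e_2) \<le> 2 * h" using norm_triangle_ineq[of "h *R e_1" "h *R e_2"] h by simp
   show "norm (V i j - V (Suc i) j) \<le> 1" "norm (V i j - V i (Suc j)) \<le> 1" "norm (V i j - V (Suc i) (Suc j)) \<le> 1" for i j
    unfolding V_def using h 3 by (auto intro!: n simp: pS norm_minus_commute algebra_simps)
   show "V i 0 = e3" for i unfolding V_def by (rule far[where i = 2]) (use x' h in \<open>simp add: pc L_def\<close>)
   show "V i N = e3" for i unfolding V_def by (rule far[where i = 2]) (use x' h Nh in \<open>simp add: pc L_def\<close>)
   show "V 0 j = e3" for j unfolding V_def by (rule far[where i = 1]) (use x' h in \<open>simp add: pc L_def\<close>)
   show "V N j = e3" for j unfolding V_def by (rule far[where i = 1]) (use x' h Nh in \<open>simp add: pc L_def\<close>)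
  qed (simp add: V_def u)
  ultimately show ?thesis by (simp add: S_def)
 qed
 have "S constant_on C"
 proof (rule continuous_discrete_range_constant)
  show "connected C" unfolding C_def by (intro convex_connected convex_box)
  show "continuous_on C S" unfolding S_def by (intro continuous_intros continuous_on_compose2[OF fc]) auto
  fix x assume x: "x \<in> C"
  have "2 * pi \<le> norm (S y - S x)" if y: "y \<in> C" "S y \<noteq> S x" for y
  proof -
   obtain k l :: int where kl: "S x = 2 * pi * k" "S y = 2 * pi * l" using Sint x y(1) by blast
   then have "k \<noteq> l" using y(2) by auto
   then have "1 \<le> \<bar>l - k\<bar>" by linarith
   then have "1 \<le> \<bar>real_of_int l - real_of_int k\<bar>" by (metis of_int_1_le_iff of_int_abs of_int_diff)
   then have "2 * pi * 1 \<le> 2 * pi * \<bar>real_of_int l - real_of_int k\<bar>" by (intro mult_left_mono) auto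
   also have "\<dots> = \<bar>S y - S x\<bar>" unfolding kl by (simp add: abs_mult flip: right_diff_distrib)
   finally show ?thesis by simp
  qed
  then show "\<exists>e>0. \<forall>y. y \<in> C \<and> S y \<noteq> S x \<longrightarrow> e \<le> norm (S y - S x)" by (intro exI[of _ "2 * pi"]) auto
 qed
 then obtain s where s: "\<And>x. x \<in> C \<Longrightarrow> S x = s" by (auto simp: constant_on_def)
 have "0 \<in> C" using h by (auto simp: C_def mem_box_cart)
 then obtain k :: int where k: "s = 2 * pi * k" using Sint[of 0] s by metis
 \<comment> \<open>Cells based outside the square covered by the grid see only the value
   \<open>e3\<close> at their corners.\<close>
 have f0: "f x = 0" if "x $ i \<notin> {- L..<- L + real N * h}" for x i
 proof -
  have "m (x + y) = e3" if "0 \<le> y $ i" "y $ i \<le> h" for y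
   by (rule far[where i = i]) (use \<open>x $ i \<notin> _\<close> that Nh h in \<open>auto simp: L_def not_le not_less\<close>)
  from this[of 0] this[of "h *R e_1"] this[of "h *R e_1 + h *R e_2"] this[of "h *R e_2"]
  have "m x = e3" "m (x + h *R e_1) = e3" "m (x + h *R e_1 + h *R e_2) = e3" "m (x + h *R e_2) = e3"
   using h exhaust_2[of i] by (auto simp: add.assoc)
  then show ?thesis by (simp add: f_def cell_angle_def square_angle_def)
 qed
 have fi: "integrable lborel f"
 proof -
  let ?B = "cbox (\<chi> i. - L) (\<chi> i. - L + real N * h) :: (real^2) set"
  have "integrable lborel (\<lambda>x. indicator ?B x *R f x)"
   by (intro borel_integrable_compact continuous_on_subset[OF fc]) auto
  moreover have "indicator ?B x *R f x = f x" for x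
  proof (cases "x \<in> ?B")
   case False
   then have "x $ 1 \<notin> {- L..<- L + real N * h} \<or> x $ 2 \<notin> {- L..<- L + real N * h}"
    by (auto simp: mem_box_cart forall_2)
   then have "f x = 0" using f0 by blast
   then show ?thesis by simp
  qed simp
  ultimately show ?thesis by (simp only:)
 qed
 define I where "I i t = (indicator {- L + real i * h..<- L + real (Suc i) * h} t :: real)" for i :: nat and t
 define W where "W i j x = I i (x $ 1) * I j (x $ 2)" for i j and x :: "real^2"
 have [measurable]: "W i j \<in> borel_measurable borel" for i j unfolding W_def I_def by measurable
 have shift: "W i j (x + p i j) = cell h x" for i j x
  by (auto simp: W_def I_def cell_def indicator_def pc algebra_simps)
 have Ifi: "integrable lborel (\<lambda>x. W i j x * f x)" for i j
  by (rule LINT_integrable_bound[OF fi]) (auto simp: W_def I_def indicator_def)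
 have cellfi: "integrable lborel (\<lambda>x. cell h x * f (x + p i j))" for i j
  using integrable_shift[OF Ifi[of i j], of "p i j"] by (simp only: shift)
 have fsum: "f x = (\<Sum>i<N. \<Sum>j<N. W i j x * f x)" for x
 proof -
  have "(\<Sum>i<N. \<Sum>j<N. W i j x * f x) = (\<Sum>i<N. I i (x $ 1)) * (\<Sum>j<N. I j (x $ 2)) * f x"
   unfolding W_def sum_product unfolding sum_distrib_right ..
  also have "\<dots> = indicator {- L..<- L + real N * h} (x $ 1) * indicator {- L..<- L + real N * h} (x $ 2) * f x"
   unfolding I_def indicator_intervals_sum[OF h(1)] ..
  also have "\<dots> = f x" using f0[of x 1] f0[of x 2] by (auto simp: indicator_def)
  finally show ?thesis by simp
 qed
 \<comment> \<open>The integral over the plane folds onto one cell, where the summed angles have the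
   constant value \<open>s\<close>.\<close>
 have "(LINT x|lborel. f x) = (LINT x|lborel. (\<Sum>i<N. \<Sum>j<N. W i j x * f x))" by (intro LINT_cong refl fsum)
 also have "\<dots> = (\<Sum>i<N. \<Sum>j<N. LINT x|lborel. W i j x * f x)"
  by (subst Bochner_Integration.integral_sum) (auto intro!: Bochner_Integration.integrable_sum Bochner_Integration.integral_sum sum.cong Ifi)
 also have "\<dots> = (\<Sum>i<N. \<Sum>j<N. LINT x|lborel. cell h x * f (x + p i j))"
 proof (intro sum.cong refl)
  fix i j
  have "(\<lambda>x. W i j x * f x) \<in> borel_measurable borel" by measurable
  from integral_shift[OF this, of "p i j"]
  show "(LINT x|lborel. W i j x * f x) = (LINT x|lborel. cell h x * f (x + p i j))" by (simp only: shift)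
 qed
 also have "\<dots> = (LINT x|lborel. (\<Sum>i<N. \<Sum>j<N. cell h x * f (x + p i j)))"
  by (subst Bochner_Integration.integral_sum) (auto intro!: Bochner_Integration.integrable_sum Bochner_Integration.integral_sum[symmetric] sum.cong cellfi)
 also have "\<dots> = (LINT x|lborel. cell h x * s)"
 proof (intro LINT_cong refl)
  fix x
  have "x \<in> C" if "cell h x \<noteq> 0" using that by (auto simp: cell_def C_def mem_box_cart forall_2 indicator_def split: if_splits)
  then have "cell h x * S x = cell h x * s" using s by (cases "cell h x = 0") auto
  then show "(\<Sum>i<N. \<Sum>j<N. cell h x * f (x + p i j)) = cell h x * s" by (simp add: S_def sum_distrib_left)
 qed
 also have "\<dots> = h\<^sup>2 * s" using cell_integral[OF h(1)] by simp
 finally show ?thesis using k by (auto simp: f_def)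
qed

text \<open>The triple products of the two triangles of a cell, rewritten through increments along
  the axes so that they become difference quotients. In both, an increment in direction 1 precedes
  one in direction 2, which fixes the orientation.\<close>

definition det_lower :: "real \<Rightarrow> (real^2 \<Rightarrow> real^3) \<Rightarrow> real^2 \<Rightarrow> real" where
 "det_lower h m x = m x \<bullet> cross3 (m (x + h *R e_1) - m x) (m (x + h *R e_1 + h *R e_2) - m (x + h *R e_1))"

definition det_upper :: "real \<Rightarrow> (real^2 \<Rightarrow> real^3) \<Rightarrow> real^2 \<Rightarrow> real" where
 "det_upper h m x = m x \<bullet> cross3 (m (x + h *R e_2 + h *R e_1) - m (x + h *R e_2)) (m (x + h *R e_2) - m x)"

lemma cell_angle_bounds:
 assumes u: "\<And>x. norm (m x) = 1" and h: "0 < h" and d: "d \<le> 1"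
  and n: "\<And>x y. norm (x - y) \<le> 2 * h \<Longrightarrow> norm (m x - m y) \<le> d"
 shows "\<bar>cell_angle h m x - (det_lower h m x + det_upper h m x) / 4\<bar> \<le> d\<^sup>2 * (\<bar>det_lower h m x\<bar> + \<bar>det_upper h m x\<bar>)"
  "\<bar>cell_angle h m x\<bar> \<le> 2 * (\<bar>det_lower h m x\<bar> + \<bar>det_upper h m x\<bar>)"
proof -
 define a b e c where abc: "a = m x" "b = m (x + h *R e_1)" "e = m (x + h *R e_1 + h *R e_2)" "c = m (x + h *R e_2)"
 have e: "e = m (x + h *R e_2 + h *R e_1)" unfolding abc by (simp add: add_ac)
 have tri: "a \<bullet> cross3 b e = det_lower h m x" "a \<bullet> cross3 e c = det_upper h m x"
 proof -
  show "a \<bullet> cross3 b e = det_lower h m x" unfolding det_lower_def abc[symmetric]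
   by (simp add: Cross3.left_diff_distrib Cross3.right_diff_distrib inner_diff_right inner_add_right dot_cross_self)
  show "a \<bullet> cross3 e c = det_upper h m x" unfolding det_upper_def e[symmetric] abc[symmetric]
   by (simp add: Cross3.left_diff_distrib Cross3.right_diff_distrib inner_diff_right inner_add_right dot_cross_self)
 qed
 have un: "norm a = 1" "norm b = 1" "norm e = 1" "norm c = 1" by (simp_all add: abc u)
 have b: "norm (h *R e_1 + h *R e_2) \<le> 2 * h" using h norm_triangle_ineq[of "h *R e_1" "h *R e_2"] by auto
 have dist: "norm (a - b) \<le> d" "norm (b - e) \<le> d" "norm (e - a) \<le> d" "norm (a - e) \<le> d" "norm (e - c) \<le> d" "norm (c - a) \<le> d"
 proof -
  show "norm (a - b) \<le> d" unfolding abc by (rule n) (use h in simp)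
  show "norm (b - e) \<le> d" unfolding abc by (rule n) (use h in simp)
  show 1: "norm (e - a) \<le> d" unfolding abc by (rule n) (use b in \<open>simp add: add.assoc\<close>)
  show "norm (a - e) \<le> d" using 1 by (simp add: norm_minus_commute)
  show "norm (e - c) \<le> d" unfolding abc by (rule n) (use h in simp)
  show "norm (c - a) \<le> d" unfolding abc by (rule n) (use h in simp)
 qed
 note 1 = triple_angle_bounds[OF un(1,2,3) dist(1,2,3) d] and 2 = triple_angle_bounds[OF un(1,3,4) dist(4,5,6) d]
 have q: "cell_angle h m x = triple_angle a b e + triple_angle a e c"
  by (simp add: cell_angle_def square_angle_def abc)
 show "\<bar>cell_angle h m x - (det_lower h m x + det_upper h m x) / 4\<bar> \<le> d\<^sup>2 * (\<bar>det_lower h m x\<bar> + \<bar>det_upper h m x\<bar>)"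
  using 1(1) 2(1) unfolding q tri distrib_left add_divide_distrib by linarith
 show "\<bar>cell_angle h m x\<bar> \<le> 2 * (\<bar>det_lower h m x\<bar> + \<bar>det_upper h m x\<bar>)"
  using 1(2) 2(2) unfolding q tri distrib_left by linarith
qed

lemma det_bounds:
 assumes u: "\<And>x. norm (m x) = 1"
  and P1: "\<And>x. norm (m (x + h *R e_1) - m x) \<le> P1 x" and P2: "\<And>x. norm (m (x + h *R e_2) - m x) \<le> P2 x"
 shows "\<bar>det_lower h m x\<bar> \<le> P1 x * P2 (x + h *R e_1)" "\<bar>det_upper h m x\<bar> \<le> P1 (x + h *R e_2) * P2 x"
proof -
 have nn: "0 \<le> P1 x" "0 \<le> P2 x" for x using order_trans[OF norm_ge_zero P1] order_trans[OF norm_ge_zero P2] .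
 show "\<bar>det_lower h m x\<bar> \<le> P1 x * P2 (x + h *R e_1)" unfolding det_lower_def
  by (rule order_trans[OF triple_le]) (simp only: u mult_1, intro mult_mono P1 P2 nn norm_ge_zero)
 show "\<bar>det_upper h m x\<bar> \<le> P1 (x + h *R e_2) * P2 x" unfolding det_upper_def
  by (rule order_trans[OF triple_le]) (simp only: u mult_1, intro mult_mono P1 P2 nn norm_ge_zero)
qed

text \<open>By cyclic symmetry the bounded factor can be attached to \<open>g\<close>;
  multiplication by it is continuous in norm, and an inner product of two convergent sequences
  remains.\<close>

lemma tendsto_integral_triple:
 fixes f g :: "nat \<Rightarrow> real^2 \<Rightarrow> real^3"
 assumes a: "a \<in> borel_measurable borel" "\<And>x. norm (a x) \<le> C"
  and f: "\<And>k. L2 (f k)" "L2 f'" "(\<lambda>k. l2 (\<lambda>x. f k x - f' x)) ----> 0"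
  and g: "\<And>k. L2 (g k)" "L2 g'" "(\<lambda>k. l2 (\<lambda>x. g k x - g' x)) ----> 0"
 shows "(\<lambda>k. LINT x|lborel. a x \<bullet> cross3 (f k x) (g k x)) ----> (LINT x|lborel. a x \<bullet> cross3 (f' x) (g' x))"
proof -
 have cyc: "a \<bullet> cross3 b c = b \<bullet> cross3 c a" for a b c :: "real^3"
  by (simp add: inner_vec_def sum_3 cross_components algebra_simps)
 have C: "0 \<le> C" using order_trans[OF norm_ge_zero a(2)] .
 have nle: "norm (cross3 (k x) (a x)) \<le> C * norm (k x)" for k :: "real^2 \<Rightarrow> real^3" and x
 proof -
  have "norm (cross3 (k x) (a x)) \<le> norm (k x) * norm (a x)" by (rule norm_cross3_le)
  also have "\<dots> \<le> norm (k x) * C" by (intro mult_left_mono a) simp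
  finally show ?thesis by (simp add: mult.commute)
 qed
 note [measurable] = a(1)
 have m: "(\<lambda>x. cross3 (k x) (a x)) \<in> borel_measurable borel" if "L2 k" for k :: "real^2 \<Rightarrow> real^3"
  using L2_measurable[OF that] by measurable
 have s: "L2 (\<lambda>x. cross3 (k x) (a x))" if "L2 k" for k :: "real^2 \<Rightarrow> real^3"
  by (rule L2_bound[OF m[OF that] that, of C]) (intro AE_I2 nle)
 have l: "l2 (\<lambda>x. cross3 (g k x) (a x) - cross3 (g' x) (a x)) \<le> C * l2 (\<lambda>x. g k x - g' x)" for k
 proof -
  note d = L2_diff[OF g(1)[of k] g(2)]
  have "l2 (\<lambda>x. cross3 (g k x - g' x) (a x)) \<le> l2 (\<lambda>x. C *R (g k x - g' x))"
   by (rule l2_mono[OF m[OF d] L2_scaleR[OF d]])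
     (use nle[of "\<lambda>x. g k x - g' x"] C in \<open>auto intro!: AE_I2\<close>)
  then show ?thesis using C by (simp add: Cross3.left_diff_distrib)
 qed
 have "(\<lambda>k. l2 (\<lambda>x. cross3 (g k x) (a x) - cross3 (g' x) (a x))) ----> 0"
 proof (rule Lim_null_comparison)
  show "\<forall>\<^sub>F k in sequentially. norm (l2 (\<lambda>x. cross3 (g k x) (a x) - cross3 (g' x) (a x))) \<le> C * l2 (\<lambda>x. g k x - g' x)"
   using l by (intro always_eventually) simp
  show "(\<lambda>k. C * l2 (\<lambda>x. g k x - g' x)) ----> 0" using tendsto_mult_right_zero[OF g(3)] by simp
 qed
 from tendsto_integral_inner[OF f s[OF g(1)] s[OF g(2)] this] show ?thesis by (simp only: cyc[of "a x" for x])
qed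

text \<open>The increments of the truncated map are controlled by those of \<open>u\<close> uniformly in \<open>R \<ge> 1\<close>.\<close>

definition cutoff :: "real \<Rightarrow> 'a::real_normed_vector \<Rightarrow> real" where
 "cutoff R x = max 0 (min 1 (2 - norm x / R))"

lemma cutoff_props:
 assumes "1 \<le> R"
 shows "0 \<le> cutoff R x" "cutoff R x \<le> 1" "norm x \<le> R \<Longrightarrow> cutoff R x = 1" "2 * R \<le> norm x \<Longrightarrow> cutoff R x = 0"
  "\<bar>cutoff R x - cutoff R y\<bar> \<le> norm (x - y)"
proof -
 have R: "0 < R" using assms by simp
 show "0 \<le> cutoff R x" "cutoff R x \<le> 1" by (auto simp: cutoff_def)
 show "norm x \<le> R \<Longrightarrow> cutoff R x = 1" "2 * R \<le> norm x \<Longrightarrow> cutoff R x = 0" using R by (auto simp: cutoff_def field_simps)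
 have "\<bar>norm x / R - norm y / R\<bar> \<le> norm (x - y)"
 proof -
  have "\<bar>norm x / R - norm y / R\<bar> = \<bar>norm x - norm y\<bar> / R" using R by (simp add: diff_divide_distrib[symmetric])
  also have "\<dots> \<le> norm (x - y) / R" using R norm_triangle_ineq3[of x y] by (intro divide_right_mono) auto
  also have "\<dots> \<le> norm (x - y) / 1" using assms by (intro divide_left_mono) auto
  finally show ?thesis by simp
 qed
 then show "\<bar>cutoff R x - cutoff R y\<bar> \<le> norm (x - y)" unfolding cutoff_def by linarith
qed

text \<open>The difference splits into a term with the difference of the vectors and one with the
  difference of the inverse lengths; outside the ball of radius 1/2 each contributes at most twice
  the distance.\<close>

lemma norm_sgn_diff_le:
 fixes f g :: "'a::real_normed_vector"
 assumes "1 / 2 \<le> norm f" "1 / 2 \<le> norm g"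
 shows "norm (sgn f - sgn g) \<le> 4 * norm (f - g)"
proof -
 have f: "f \<noteq> 0" "0 < norm f" and g: "g \<noteq> 0" "0 < norm g" using assms by auto
 have "sgn f - sgn g = inverse (norm f) *R (f - g) + (inverse (norm f) - inverse (norm g)) *R g"
  by (simp add: sgn_div_norm algebra_simps)
 then have "norm (sgn f - sgn g) \<le> inverse (norm f) * norm (f - g) + \<bar>inverse (norm f) - inverse (norm g)\<bar> * norm g"
  using norm_triangle_ineq[of "inverse (norm f) *R (f - g)" "(inverse (norm f) - inverse (norm g)) *R g"] by simp
 also have "\<bar>inverse (norm f) - inverse (norm g)\<bar> * norm g = inverse (norm f) * \<bar>norm g - norm f\<bar>"
 proof -
  have "inverse (norm f) - inverse (norm g) = (norm g - norm f) / (norm f * norm g)" using f g by (simp add: field_simps)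
  then show ?thesis using f g by (simp add: abs_mult field_simps)
 qed
 also have "\<dots> \<le> inverse (norm f) * norm (f - g)"
  using norm_triangle_ineq3[of g f] f by (intro mult_left_mono) (auto simp: norm_minus_commute)
 also have "inverse (norm f) * norm (f - g) + inverse (norm f) * norm (f - g) \<le> 2 * norm (f - g) + 2 * norm (f - g)"
 proof -
  have "inverse (norm f) \<le> inverse (1/2)" using assms by (intro le_imp_inverse_le) auto
  then have "inverse (norm f) * norm (f - g) \<le> 2 * norm (f - g)" by (intro mult_right_mono) auto
  then show ?thesis by simp
 qed
 finally show ?thesis by simp
qed

text \<open>Interpolation to \<open>e3\<close> between the radii \<open>R\<close> and
  \<open>2 * R\<close>, followed by projection back to the sphere; a deviation of at most 1/2 in
  that region keeps the vector away from zero.\<close>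

definition truncate :: "real \<Rightarrow> (real^2 \<Rightarrow> real^3) \<Rightarrow> real^2 \<Rightarrow> real^3" where
 "truncate R u x = sgn (e3 + cutoff R x *R u x)"

lemma truncate_props:
 assumes R: "1 \<le> R" and u: "\<And>x. norm (e3 + u x) = 1" and small: "\<And>x. R \<le> norm x \<Longrightarrow> norm (u x) \<le> 1 / 2"
 shows "norm (truncate R u x) = 1" "norm x \<le> R \<Longrightarrow> truncate R u x = e3 + u x" "2 * R \<le> norm x \<Longrightarrow> truncate R u x = e3"
  "norm (truncate R u x - truncate R u y) \<le> 4 * (norm (u x - u y) + norm (x - y) * norm (u y))"
proof -
 note c = cutoff_props[OF R, where 'a = "real^2"]
 have half: "1 / 2 \<le> norm (e3 + cutoff R x *R u x)" for x
 proof (cases "norm x \<le> R")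
  case True
  then show ?thesis using c(3)[OF True] u[of x] by simp
 next
  case False
  have "norm (cutoff R x *R u x) \<le> 1 * (1 / 2)"
   unfolding norm_scaleR using c(1,2)[of x] small[of x] False by (intro mult_mono) auto
  then show ?thesis using norm_triangle_ineq4[of "e3 + cutoff R x *R u x" "cutoff R x *R u x"] norm_e3 by simp
 qed
 then have nz: "e3 + cutoff R x *R u x \<noteq> 0" for x
  by (metis norm_zero not_le zero_less_divide_iff zero_less_one zero_less_numeral)
 show "norm (truncate R u x) = 1" unfolding truncate_def using nz by (simp add: norm_sgn)
 show "norm x \<le> R \<Longrightarrow> truncate R u x = e3 + u x" unfolding truncate_def using c(3) u by (simp add: sgn_div_norm)
 show "2 * R \<le> norm x \<Longrightarrow> truncate R u x = e3" unfolding truncate_def using c(4) norm_e3 by (simp add: sgn_div_norm)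
 have "cutoff R x *R u x - cutoff R y *R u y = cutoff R x *R (u x - u y) + (cutoff R x - cutoff R y) *R u y"
  by (simp add: algebra_simps)
 then have "norm (cutoff R x *R u x - cutoff R y *R u y) \<le> cutoff R x * norm (u x - u y) + \<bar>cutoff R x - cutoff R y\<bar> * norm (u y)"
  using norm_triangle_ineq[of "cutoff R x *R (u x - u y)" "(cutoff R x - cutoff R y) *R u y"] c(1) by simp
 also have "\<dots> \<le> 1 * norm (u x - u y) + norm (x - y) * norm (u y)" using c by (intro add_mono mult_right_mono) auto
 finally have "norm ((e3 + cutoff R x *R u x) - (e3 + cutoff R y *R u y)) \<le> norm (u x - u y) + norm (x - y) * norm (u y)" by simp
 then have "4 * norm ((e3 + cutoff R x *R u x) - (e3 + cutoff R y *R u y)) \<le> 4 * (norm (u x - u y) + norm (x - y) * norm (u y))"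
  by (rule mult_left_mono) simp
 with norm_sgn_diff_le[OF half[of x] half[of y]]
 show "norm (truncate R u x - truncate R u y) \<le> 4 * (norm (u x - u y) + norm (x - y) * norm (u y))"
  unfolding truncate_def by (rule order_trans)
qed

lemma truncate_continuous:
 assumes R: "1 \<le> R" and u: "\<And>x. norm (e3 + u x) = 1" and small: "\<And>x. R \<le> norm x \<Longrightarrow> norm (u x) \<le> 1 / 2"
  and c: "continuous_on UNIV u"
 shows "continuous_on UNIV (truncate R u)"
proof -
 have nz: "e3 + cutoff R x *R u x \<noteq> 0" for x
  using truncate_props(1)[of R u x, OF R u small] unfolding truncate_def by (auto simp: sgn_zero)
 show ?thesis unfolding truncate_def sgn_div_norm
  by (intro continuous_intros c) (use nz R in \<open>auto simp: cutoff_def intro!: continuous_intros\<close>)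
qed

section \<open>Integrality of the degree of sphere-valued jets\<close>

context
 fixes u :: "real^2 \<Rightarrow> real^3" and G K
 assumes J: "jet2 u G K" and uc: "isUCont u" and sphere: "\<And>x. norm (e3 + u x) = 1"
begin

lemma norm_u_le: "norm (u x) \<le> 2" using norm_triangle_ineq4[of "e3 + u x" e3] sphere[of x] norm_e3 by simp

lemma u_cont: "continuous_on UNIV u" by (rule uniformly_continuous_imp_continuous[OF uc])

lemma n_measurable [measurable]: "(\<lambda>x. e3 + u x) \<in> borel_measurable borel"
 by (intro borel_measurable_continuous_onI continuous_intros u_cont)

lemma dq_scale: "h \<noteq> 0 \<Longrightarrow> (e3 + u (x + h *R axis i 1)) - (e3 + u x) = h *R dq i h u x" by (simp add: dq_def)

lemma det_dq:
 assumes h: "h \<noteq> 0"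
 shows "det_lower h (\<lambda>x. e3 + u x) x = h\<^sup>2 * ((e3 + u x) \<bullet> cross3 (dq 1 h u x) (dq 2 h u (x + h *R e_1)))"
  "det_upper h (\<lambda>x. e3 + u x) x = h\<^sup>2 * ((e3 + u x) \<bullet> cross3 (dq 1 h u (x + h *R e_2)) (dq 2 h u x))"
 unfolding det_lower_def det_upper_def e_1_def e_2_def dq_scale[OF h]
 by (simp_all add: cross_mult_left cross_mult_right power2_eq_square)

text \<open>The corners of a cell require quotients evaluated at translated points; a shift by the
  mesh size adds an error of the order of the mesh size, because second derivatives are square
  integrable.\<close>

lemma dq_shift_limit:
 shows "(\<lambda>k. l2 (\<lambda>x. dq i (hseq k) u (x + hseq k *R axis j 1) - G i x)) ----> 0"
proof (rule Lim_null_comparison)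
 note JD = jet2D[OF J]
 show "\<forall>\<^sub>F k in sequentially. norm (l2 (\<lambda>x. dq i (hseq k) u (x + hseq k *R axis j 1) - G i x)) \<le> hseq k * (l2 (K i i) + l2 (K i j))"
 proof (intro always_eventually allI)
  fix k
  let ?h = "hseq k"
  note s = L2_shift[OF L2_dq[OF JD(1)]] L2_shift[OF JD(3)] JD(3)
  have "l2 (\<lambda>x. dq i ?h u (x + ?h *R axis j 1) - G i x) \<le>
    l2 (\<lambda>x. dq i ?h u (x + ?h *R axis j 1) - G i (x + ?h *R axis j 1)) + l2 (\<lambda>x. G i (x + ?h *R axis j 1) - G i x)"
   by (rule l2_diff_triangle[OF s(1) s(2) s(3)])
  also have "l2 (\<lambda>x. dq i ?h u (x + ?h *R axis j 1) - G i (x + ?h *R axis j 1)) = l2 (\<lambda>x. dq i ?h u x - G i x)"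
   by (rule l2_shift[OF L2_diff[OF L2_dq[OF JD(1)] JD(3)]])
  also have "\<dots> \<le> \<bar>?h\<bar> * l2 (K i i)" by (rule dq_rate[OF JD(2,4,1,3,5) hseq(1)])
  also have "l2 (\<lambda>x. G i (x + ?h *R axis j 1) - G i x) \<le> \<bar>?h\<bar> * l2 (K i j)" by (rule l2_shift_diff_le[OF JD(4,3,5)])
  finally show "norm (l2 (\<lambda>x. dq i ?h u (x + ?h *R axis j 1) - G i x)) \<le> ?h * (l2 (K i i) + l2 (K i j))"
   using hseq(2)[of k] by (simp add: distrib_left)
 qed
 have "hseq ----> 0" using hseq(3) by (simp add: filterlim_at)
 then show "(\<lambda>k. hseq k * (l2 (K i i) + l2 (K i j))) ----> 0" by (rule tendsto_mult_left_zero)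
qed

lemma hseq_tendsto: "hseq ----> 0" using hseq(3) by (simp add: filterlim_at)

lemma modulus:
 assumes "0 < d"
 shows "\<forall>\<^sub>F k in sequentially. \<forall>x y. norm (x - y) \<le> 2 * hseq k \<longrightarrow> norm ((e3 + u x) - (e3 + u y)) \<le> d"
proof -
 obtain r where r: "0 < r" "\<And>x y. dist y x < r \<Longrightarrow> dist (u y) (u x) < d"
  using uc[unfolded uniformly_continuous_on_def, rule_format, OF assms] by blast
 have "\<forall>\<^sub>F k in sequentially. hseq k < r / 2" by (rule order_tendstoD(2)[OF hseq_tendsto]) (use r in simp)
 then show ?thesis
 proof eventually_elim
  case (elim k)
  then show ?case using r(2) by (auto simp: dist_norm intro!: less_imp_le)
 qed
qed

text \<open>Each of the two triangles contributes a quarter of its triple product, and each triple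
  product over \<open>h^2\<close> integrates to \<open>4 * pi\<close> times the degree in the limit;
  hence the factor \<open>2 * pi\<close>.\<close>

lemma cell_angle_limit:
 "(\<lambda>k. (LINT x|lborel. cell_angle (hseq k) (\<lambda>x. e3 + u x) x) / (hseq k)\<^sup>2) ----> 2 * pi * jet_degree u G"
proof -
 note JD = jet2D[OF J]
 let ?n = "\<lambda>x. e3 + u x"
 let ?a = "\<lambda>k x. ?n x \<bullet> cross3 (dq 1 (hseq k) u x) (dq 2 (hseq k) u (x + hseq k *R e_1))"
 let ?b = "\<lambda>k x. ?n x \<bullet> cross3 (dq 1 (hseq k) u (x + hseq k *R e_2)) (dq 2 (hseq k) u x)"
 have sd: "L2 (dq i (hseq k) u)" "L2 (\<lambda>x. dq i (hseq k) u (x + y))" for i k y by (intro L2_shift L2_dq JD)+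
 have n1: "norm (?n x) \<le> 1" for x using sphere by simp
 have dql: "(\<lambda>k. l2 (\<lambda>x. dq i (hseq k) u x - G i x)) ----> 0" for i
  by (rule filterlim_compose[OF dq_tendsto[OF JD(2,1,3)] hseq(3)])
 have la: "(\<lambda>k. LINT x|lborel. ?a k x) ----> 4 * pi * jet_degree u G"
  using tendsto_integral_triple[OF n_measurable n1 sd(1) JD(3) dql sd(2) JD(3) dq_shift_limit[of 2 1], folded e_1_def]
  by (simp add: jet_degree_def e_1_def)
 have lb: "(\<lambda>k. LINT x|lborel. ?b k x) ----> 4 * pi * jet_degree u G"
  using tendsto_integral_triple[OF n_measurable n1 sd(2) JD(3) dq_shift_limit[of 1 2] sd(1) JD(3) dql]
  by (simp add: jet_degree_def e_2_def)
 have ia: "integrable lborel (?a k)" and ib: "integrable lborel (?b k)" for k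
  by (intro integrable_triple[OF n_measurable n1] sd)+
 define B where "B = 2 * (l2 (G 1) * l2 (G 2))"
 have B0: "0 \<le> B" by (simp add: B_def)
 have dqle: "l2 (dq i (hseq k) u) \<le> l2 (G i)" for i k
 proof -
  have "l2 (dq i (hseq k) u) = \<bar>1 / hseq k\<bar> * l2 (\<lambda>x. u (x + hseq k *R axis i 1) - u x)"
   unfolding dq_def[abs_def] by (rule l2_scaleR)
  also have "\<dots> \<le> \<bar>1 / hseq k\<bar> * (\<bar>hseq k\<bar> * l2 (G i))" by (intro mult_left_mono l2_shift_diff_le[OF JD(2,1,3)]) simp
  also have "\<dots> = l2 (G i)" using hseq(1)[of k] by simp
  finally show ?thesis .
 qed
 have tri: "(LINT x|lborel. \<bar>?n x \<bullet> cross3 (f x) (g x)\<bar>) \<le> l2 (G 1) * l2 (G 2)"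
  if fg: "L2 f" "L2 g" "l2 f \<le> l2 (G 1)" "l2 g \<le> l2 (G 2)" for f g
 proof -
  have "(LINT x|lborel. \<bar>?n x \<bullet> cross3 (f x) (g x)\<bar>) \<le> (LINT x|lborel. norm (f x) * norm (g x))"
  proof (intro integral_mono integrable_abs integrable_triple[OF n_measurable n1] integrable_norm_mult fg)
   show "\<bar>?n x \<bullet> cross3 (f x) (g x)\<bar> \<le> norm (f x) * norm (g x)" for x
    using triple_le[of "?n x" "f x" "g x"] sphere[of x] by simp
  qed
  also have "\<dots> \<le> l2 f * l2 g" by (rule integral_norm_mult_le[OF fg(1,2)])
  also have "\<dots> \<le> l2 (G 1) * l2 (G 2)" by (intro mult_mono fg) auto
  finally show ?thesis .
 qed
 have l2s: "l2 (\<lambda>x. dq i (hseq k) u (x + y)) \<le> l2 (G i)" for i k y using l2_shift[OF sd(1)[of i k], of y] dqle by simp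
 \<comment> \<open>The relative error is \<open>d^2\<close>, and the integrated moduli of the triple
   products over the cell area are bounded by \<open>B\<close> independently of the mesh.\<close>
 have near: "\<forall>\<^sub>F k in sequentially. \<bar>(LINT x|lborel. cell_angle (hseq k) ?n x) / (hseq k)\<^sup>2 - ((LINT x|lborel. ?a k x) + (LINT x|lborel. ?b k x)) / 4\<bar> \<le> B * d"
  if d: "0 < d" "d \<le> 1" for d using modulus[OF d(1)]
 proof eventually_elim
  case (elim k)
  let ?h = "hseq k" and ?c = "cell_angle (hseq k) ?n" and ?Q = "\<lambda>x. \<bar>?a k x\<bar> + \<bar>?b k x\<bar>"
  let ?q = "\<lambda>x. ?h\<^sup>2 * ((?a k x + ?b k x) / 4)"
  have h: "0 < ?h" "?h \<noteq> 0" using hseq by auto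
  have bd: "\<bar>?c x - ?q x\<bar> \<le> ?h\<^sup>2 * (d\<^sup>2 * ?Q x)" for x
  proof -
   have "\<bar>?c x - (det_lower ?h ?n x + det_upper ?h ?n x) / 4\<bar> \<le> d\<^sup>2 * (\<bar>det_lower ?h ?n x\<bar> + \<bar>det_upper ?h ?n x\<bar>)"
    by (rule cell_angle_bounds(1)[of ?n ?h d x, OF sphere h(1) d(2)]) (use elim in blast)
   moreover have "(?h\<^sup>2 * ?a k x + ?h\<^sup>2 * ?b k x) / 4 = ?q x" by (simp add: distrib_left)
   moreover have "d\<^sup>2 * (\<bar>?h\<^sup>2 * A\<bar> + \<bar>?h\<^sup>2 * B\<bar>) = ?h\<^sup>2 * (d\<^sup>2 * (\<bar>A\<bar> + \<bar>B\<bar>))" for A B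
    by (simp add: abs_mult algebra_simps)
   ultimately show ?thesis unfolding det_dq[OF h(2)] by (simp only:)
  qed
  have cm: "continuous_on UNIV (?c)"
   by (rule continuous_cell_angle[OF _ sphere _ h(1)]) (use elim d u_cont in \<open>auto intro!: continuous_intros intro: order_trans\<close>)
  have [measurable]: "?c \<in> borel_measurable borel" by (rule borel_measurable_continuous_onI[OF cm])
  have iabs: "integrable lborel (\<lambda>x. ?h\<^sup>2 * (d\<^sup>2 * ?Q x))"
   by (intro integrable_mult_right LINT_integrable_add integrable_abs ia ib)
  have iab: "integrable lborel (\<lambda>x. ?q x)"
   by (intro integrable_mult_right integrable_divide LINT_integrable_add ia ib)
  have idiff: "integrable lborel (\<lambda>x. ?c x - ?q x)"
  proof (rule LINT_integrable_bound[OF iabs])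
   show "(\<lambda>x. ?c x - ?q x) \<in> borel_measurable lborel" using borel_measurable_integrable[OF iab] by measurable
   show "AE x in lborel. norm (?c x - ?q x) \<le> norm (?h\<^sup>2 * (d\<^sup>2 * ?Q x))"
    using bd by (intro AE_I2) (simp add: abs_mult)
  qed
  have icell: "integrable lborel (?c)" using LINT_integrable_add[OF idiff iab] by simp
  have "\<bar>(LINT x|lborel. ?c x) - ?h\<^sup>2 * (((LINT x|lborel. ?a k x) + (LINT x|lborel. ?b k x)) / 4)\<bar>
    = \<bar>LINT x|lborel. ?c x - ?q x\<bar>" using icell iab ia[of k] ib[of k] by simp
  also have "\<dots> \<le> (LINT x|lborel. \<bar>?c x - ?q x\<bar>)" using integral_norm_bound[of lborel "\<lambda>x. ?c x - ?q x"] by simp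
  also have "\<dots> \<le> (LINT x|lborel. ?h\<^sup>2 * (d\<^sup>2 * ?Q x))" by (intro integral_mono integrable_abs idiff iabs bd)
  also have "\<dots> = ?h\<^sup>2 * (d\<^sup>2 * ((LINT x|lborel. \<bar>?a k x\<bar>) + (LINT x|lborel. \<bar>?b k x\<bar>)))"
   using ia[of k] ib[of k] by simp
  also have "\<dots> \<le> ?h\<^sup>2 * (d\<^sup>2 * B)"
  proof (intro mult_left_mono)
   have "(LINT x|lborel. \<bar>?a k x\<bar>) \<le> l2 (G 1) * l2 (G 2)" "(LINT x|lborel. \<bar>?b k x\<bar>) \<le> l2 (G 1) * l2 (G 2)"
    by (intro tri sd dqle l2s)+
   then show "(LINT x|lborel. \<bar>?a k x\<bar>) + (LINT x|lborel. \<bar>?b k x\<bar>) \<le> B" by (simp add: B_def)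
  qed auto
  finally have fin: "\<bar>(LINT x|lborel. ?c x) - ?h\<^sup>2 * (((LINT x|lborel. ?a k x) + (LINT x|lborel. ?b k x)) / 4)\<bar> \<le> ?h\<^sup>2 * (d\<^sup>2 * B)" .
  have "\<bar>X / ?h\<^sup>2 - Y\<bar> \<le> B * d" if "\<bar>X - ?h\<^sup>2 * Y\<bar> \<le> ?h\<^sup>2 * (d\<^sup>2 * B)" for X Y
  proof -
   have "X / ?h\<^sup>2 - Y = (X - ?h\<^sup>2 * Y) / ?h\<^sup>2" using h by (simp add: diff_divide_distrib)
   then have "\<bar>X / ?h\<^sup>2 - Y\<bar> = \<bar>X - ?h\<^sup>2 * Y\<bar> / ?h\<^sup>2" by simp
   also have "\<dots> \<le> (?h\<^sup>2 * (d\<^sup>2 * B)) / ?h\<^sup>2" by (intro divide_right_mono that) simp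
   also have "\<dots> = (B * d) * d" using h by (simp add: power2_eq_square mult_ac)
   also have "\<dots> \<le> B * d" using d B0 by (intro mult_left_le) auto
   finally show ?thesis .
  qed
  from this[OF fin] show ?case .
 qed
 define D where "D k = (LINT x|lborel. cell_angle (hseq k) ?n x) / (hseq k)\<^sup>2 - ((LINT x|lborel. ?a k x) + (LINT x|lborel. ?b k x)) / 4" for k
 have "D ----> 0" by (rule tendsto_zeroI[OF B0]) (use near in \<open>simp add: D_def\<close>)
 then have "(\<lambda>k. D k + ((LINT x|lborel. ?a k x) + (LINT x|lborel. ?b k x)) / 4) ----> 0 + (4 * pi * jet_degree u G + 4 * pi * jet_degree u G) / 4"
  by (intro tendsto_add tendsto_divide la lb tendsto_const) auto
 then show ?thesis by (simp add: D_def mult.assoc)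
qed

text \<open>A shift of length at most 1 moves points outside radius \<open>r + 1\<close> to points
  outside radius \<open>r\<close>, where Cauchy-Schwarz gives the product of two tails.\<close>

lemma integral_mult_tail_le:
 fixes P1 P2 :: "real^2 \<Rightarrow> real"
 assumes P: "L2 P1" "L2 P2" "\<And>x. 0 \<le> P1 x" "\<And>x. 0 \<le> P2 x"
  and ab: "norm a \<le> 1" "norm b \<le> 1"
 shows "integrable lborel (\<lambda>x. indicator (- cball 0 (r + 1)) x * (P1 (x + a) * P2 (x + b)))"
  "(LINT x|lborel. indicator (- cball 0 (r + 1)) x * (P1 (x + a) * P2 (x + b))) \<le>
   l2 (outside r P1) * l2 (outside r P2)"
proof -
 have B: "- cball (0::real^2) s \<in> sets borel" for s by (simp add: borel_open)
 define Q where "Q F = (\<lambda>x::real^2. indicator (- cball 0 r) x *R (F x :: real))" for F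
 have Q: "L2 (Q P1)" "L2 (Q P2)" unfolding Q_def by (intro L2_restrict B P)+
 note Qs = L2_shift[OF Q(1), of a] L2_shift[OF Q(2), of b]
 have i: "integrable lborel (\<lambda>x. norm (Q P1 (x + a)) * norm (Q P2 (x + b)))" by (rule integrable_norm_mult[OF Qs])
 have [measurable]: "P1 \<in> borel_measurable borel" "P2 \<in> borel_measurable borel" using P by auto
 have [measurable]: "- cball (0::real^2) (r + 1) \<in> sets borel" by (rule B)
 have le: "indicator (- cball 0 (r + 1)) x * (P1 (x + a) * P2 (x + b)) \<le> norm (Q P1 (x + a)) * norm (Q P2 (x + b))" for x
 proof (cases "x \<in> - cball 0 (r + 1)")
  case True
  then have "x + a \<in> - cball 0 r" "x + b \<in> - cball 0 r"
   using norm_triangle_ineq4[of "x + a" a] norm_triangle_ineq4[of "x + b" b] ab by auto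
  then show ?thesis using True P(3,4) by (simp add: Q_def)
 qed simp
 show ii: "integrable lborel (\<lambda>x. indicator (- cball 0 (r + 1)) x * (P1 (x + a) * P2 (x + b)))"
  by (rule LINT_integrable_bound[OF i])
    (measurable, use le P(3,4) in \<open>auto intro!: AE_I2 simp: abs_mult\<close>)
 have "(LINT x|lborel. indicator (- cball 0 (r + 1)) x * (P1 (x + a) * P2 (x + b))) \<le> (LINT x|lborel. norm (Q P1 (x + a)) * norm (Q P2 (x + b)))"
  by (rule integral_mono[OF ii i le])
 also have "\<dots> \<le> l2 (\<lambda>x. Q P1 (x + a)) * l2 (\<lambda>x. Q P2 (x + b))" by (rule integral_norm_mult_le[OF Qs])
 also have "\<dots> = l2 (Q P1) * l2 (Q P2)" by (simp only: l2_shift[OF Q(1)] l2_shift[OF Q(2)])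
 finally show "(LINT x|lborel. indicator (- cball 0 (r + 1)) x * (P1 (x + a) * P2 (x + b))) \<le>
   l2 (outside r P1) * l2 (outside r P2)" unfolding Q_def .
qed

text \<open>A common bound for the increments of the map and of its truncation. The factor 4 is the
  Lipschitz constant of the normalization, and the second summand comes from the slope of the
  cutoff.\<close>

definition increment :: "2 \<Rightarrow> real \<Rightarrow> real^2 \<Rightarrow> real" where
 "increment i h x = 4 * (norm (u (x + h *R axis i 1) - u x) + \<bar>h\<bar> * norm (u x))"

text \<open>The third part bounds the tail of an increment by \<open>h\<close> times a quantity that
  is small for large \<open>r\<close> and small \<open>h\<close>; products of two increments are
  then small relative to the cell area \<open>h^2\<close>.\<close>

lemma increment_props:
 shows "0 \<le> increment i h x" "L2 (increment i h)"
  and "h \<noteq> 0 \<Longrightarrow> l2 (outside r (increment i h)) \<le>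
   4 * \<bar>h\<bar> * (\<bar>h\<bar> * l2 (K i i) + l2 (outside r (G i)) + l2 (outside r u))"
proof -
 note JD = jet2D[OF J]
 show "0 \<le> increment i h x" by (simp add: increment_def)
 have s1: "L2 (\<lambda>x. u (x + h *R axis i 1) - u x)" by (intro L2_diff L2_shift JD)
 have "L2 (\<lambda>x. 4 *R (norm (u (x + h *R axis i 1) - u x) + \<bar>h\<bar> *R norm (u x)))"
  by (intro L2_scaleR L2_add L2_norm s1 JD)
 then show si: "L2 (increment i h)" by (simp add: increment_def[abs_def])
 assume h: "h \<noteq> 0"
 have B: "- cball (0::real^2) s \<in> sets borel" for s by (simp add: borel_open)
 let ?I = "\<lambda>x. indicator (- cball 0 r) x :: real"
 note R = L2_restrict[OF B[of r]]
 have sr: "L2 (\<lambda>x. dq i h u x - G i x)" by (intro L2_diff L2_dq JD)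
 have s0: "L2 (\<lambda>x. norm (?I x *R (dq i h u x - G i x)) + norm (?I x *R G i x))" by (intro L2_add L2_norm R sr JD)
 have s: "L2 (\<lambda>x. norm (?I x *R (dq i h u x - G i x)) + norm (?I x *R G i x) + norm (?I x *R u x))"
  by (intro L2_add[OF s0] L2_norm R JD)
 have "l2 (\<lambda>x. ?I x *R increment i h x) \<le> l2 (\<lambda>x. (4 * \<bar>h\<bar>) *R (norm (?I x *R (dq i h u x - G i x)) + norm (?I x *R G i x) + norm (?I x *R u x)))"
 proof (rule l2_mono[OF L2_measurable[OF R[OF si]] L2_scaleR[OF s]], rule AE_I2)
  fix x
  have "norm (u (x + h *R axis i 1) - u x) = \<bar>h\<bar> * norm (dq i h u x)" using h by (simp add: dq_def)
  also have "\<dots> \<le> \<bar>h\<bar> * (norm (dq i h u x - G i x) + norm (G i x))"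
   using norm_triangle_ineq[of "dq i h u x - G i x" "G i x"] by (intro mult_left_mono) auto
  finally have "increment i h x \<le> 4 * (\<bar>h\<bar> * (norm (dq i h u x - G i x) + norm (G i x)) + \<bar>h\<bar> * norm (u x))"
   unfolding increment_def by simp
  also have "\<dots> = 4 * \<bar>h\<bar> * (norm (dq i h u x - G i x) + norm (G i x) + norm (u x))" by (simp add: algebra_simps)
  finally have "increment i h x \<le> 4 * \<bar>h\<bar> * (norm (dq i h u x - G i x) + norm (G i x) + norm (u x))" .
  moreover have "0 \<le> increment i h x" by (simp add: increment_def)
  ultimately show "norm (?I x *R increment i h x) \<le> norm ((4 * \<bar>h\<bar>) *R (norm (?I x *R (dq i h u x - G i x)) + norm (?I x *R G i x) + norm (?I x *R u x)))"
   by (cases "x \<in> cball 0 r") (auto simp: abs_mult)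
 qed
 also have "\<dots> = 4 * \<bar>h\<bar> * l2 (\<lambda>x. norm (?I x *R (dq i h u x - G i x)) + norm (?I x *R G i x) + norm (?I x *R u x))"
  by (simp only: l2_scaleR abs_mult abs_numeral abs_abs)
 also have "\<dots> \<le> 4 * \<bar>h\<bar> * (\<bar>h\<bar> * l2 (K i i) + l2 (\<lambda>x. ?I x *R G i x) + l2 (\<lambda>x. ?I x *R u x))"
 proof (rule mult_left_mono)
  have l2n: "l2 (\<lambda>x. norm (f x)) = l2 f" for f :: "real^2 \<Rightarrow> real^3" by (simp add: l2_def)
  have "l2 (\<lambda>x. norm (?I x *R (dq i h u x - G i x)) + norm (?I x *R G i x) + norm (?I x *R u x))
   \<le> l2 (\<lambda>x. norm (?I x *R (dq i h u x - G i x)) + norm (?I x *R G i x)) + l2 (\<lambda>x. norm (?I x *R u x))"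
   by (rule l2_triangle[OF s0 L2_norm[OF R[OF JD(1)]]])
  also have "l2 (\<lambda>x. norm (?I x *R (dq i h u x - G i x)) + norm (?I x *R G i x))
   \<le> l2 (\<lambda>x. norm (?I x *R (dq i h u x - G i x))) + l2 (\<lambda>x. norm (?I x *R G i x))"
   by (rule l2_triangle[OF L2_norm[OF R[OF sr]] L2_norm[OF R[OF JD(3)]]])
  also have "l2 (\<lambda>x. norm (?I x *R (dq i h u x - G i x))) \<le> l2 (\<lambda>x. dq i h u x - G i x)"
   by (rule l2_mono[OF L2_measurable[OF L2_norm[OF R[OF sr]]] sr])
     (auto simp: indicator_def)
  also have "\<dots> \<le> \<bar>h\<bar> * l2 (K i i)" by (rule dq_rate[OF JD(2,4,1,3,5) h])
  finally show "l2 (\<lambda>x. norm (?I x *R (dq i h u x - G i x)) + norm (?I x *R G i x) + norm (?I x *R u x))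
   \<le> \<bar>h\<bar> * l2 (K i i) + l2 (\<lambda>x. ?I x *R G i x) + l2 (\<lambda>x. ?I x *R u x)" unfolding l2n by simp
 qed simp
 finally show "l2 (\<lambda>x. ?I x *R increment i h x) \<le>
   4 * \<bar>h\<bar> * (\<bar>h\<bar> * l2 (K i i) + l2 (\<lambda>x. ?I x *R G i x) + l2 (\<lambda>x. ?I x *R u x))" .
qed

lemma cell_angle_increment:
 assumes R: "1 \<le> R" and small: "\<And>x. R \<le> norm x \<Longrightarrow> norm (u x) \<le> 1 / 2" and h: "0 < h"
  and n: "\<And>x y. norm (x - y) \<le> 2 * h \<Longrightarrow> norm ((e3 + u x) - (e3 + u y)) \<le> 1"
  and t: "\<And>x y. norm (x - y) \<le> 2 * h \<Longrightarrow> norm (truncate R u x - truncate R u y) \<le> 1"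
 defines "A \<equiv> \<lambda>x. increment 1 h (x + 0) * increment 2 h (x + h *R e_1) + increment 1 h (x + h *R e_2) * increment 2 h (x + 0)"
 shows "\<bar>cell_angle h (\<lambda>x. e3 + u x) x\<bar> \<le> 2 * A x" "\<bar>cell_angle h (truncate R u) x\<bar> \<le> 2 * A x"
proof -
 have P: "norm ((e3 + u (x + h *R axis i 1)) - (e3 + u x)) \<le> increment i h x" for i x
 proof -
  have "norm (u (x + h *R axis i 1) - u x) \<le> 4 * norm (u (x + h *R axis i 1) - u x)" by simp
  also have "\<dots> \<le> increment i h x" unfolding increment_def by simp
  finally show ?thesis by simp
 qed
 have P': "norm (truncate R u (x + h *R axis i 1) - truncate R u x) \<le> increment i h x" for i x
  using truncate_props(4)[of R u "x + h *R axis i 1" x, OF R sphere small] by (simp add: increment_def)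
 note t1 = truncate_props(1)[of R u, OF R sphere small]
 note B1 = det_bounds[of "\<lambda>x. e3 + u x" h "increment 1 h" "increment 2 h" x, OF sphere P[of _ 1, folded e_1_def] P[of _ 2, folded e_2_def]]
 have c1: "\<bar>cell_angle h (\<lambda>x. e3 + u x) x\<bar> \<le> 2 * (\<bar>det_lower h (\<lambda>x. e3 + u x) x\<bar> + \<bar>det_upper h (\<lambda>x. e3 + u x) x\<bar>)"
  by (rule cell_angle_bounds(2)[OF sphere h order_refl n])
 have c2: "\<bar>cell_angle h (truncate R u) x\<bar> \<le> 2 * (\<bar>det_lower h (truncate R u) x\<bar> + \<bar>det_upper h (truncate R u) x\<bar>)"
  by (rule cell_angle_bounds(2)[OF t1 h order_refl t])
 show "\<bar>cell_angle h (\<lambda>x. e3 + u x) x\<bar> \<le> 2 * A x" unfolding A_def add_0_right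
  by (rule order_trans[OF c1]) (intro mult_left_mono add_mono B1, simp)
 note B2 = det_bounds[of "truncate R u" h "increment 1 h" "increment 2 h" x, OF t1 P'[of _ 1, folded e_1_def] P'[of _ 2, folded e_2_def]]
 show "\<bar>cell_angle h (truncate R u) x\<bar> \<le> 2 * A x" unfolding A_def add_0_right
  by (rule order_trans[OF c2]) (intro mult_left_mono add_mono B2; simp)
qed

text \<open>The corners of a cell lie within \<open>2 * h\<close> of its base point, so a margin of
  2 leaves the inner cells unchanged; all other cells are estimated by the increments.\<close>

lemma cell_angle_truncate_diff:
 assumes R: "1 \<le> R" and small: "\<And>x. R \<le> norm x \<Longrightarrow> norm (u x) \<le> 1 / 2" and h: "0 < h" "h \<le> 1"
  and n: "\<And>x y. norm (x - y) \<le> 2 * h \<Longrightarrow> norm ((e3 + u x) - (e3 + u y)) \<le> 1"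
  and t: "\<And>x y. norm (x - y) \<le> 2 * h \<Longrightarrow> norm (truncate R u x - truncate R u y) \<le> 1"
 shows "\<bar>cell_angle h (truncate R u) x - cell_angle h (\<lambda>x. e3 + u x) x\<bar> \<le>
  4 * (indicator (- cball 0 (R - 2)) x * (increment 1 h (x + 0) * increment 2 h (x + h *R e_1)))
  + 4 * (indicator (- cball 0 (R - 2)) x * (increment 1 h (x + h *R e_2) * increment 2 h (x + 0)))"
proof (cases "norm x \<le> R - 2")
 case True
 have near: "truncate R u (x + y) = e3 + u (x + y)" if "norm y \<le> 2 * h" for y
  by (rule truncate_props(2)[OF R sphere small]) (use True that h norm_triangle_ineq[of x y] in auto)
 have e: "norm e_1 = 1" "norm e_2 = 1" by (simp_all add: e_1_def e_2_def)
 have b: "norm (h *R e_1 + h *R e_2) \<le> 2 * h" using h norm_triangle_ineq[of "h *R e_1" "h *R e_2"] e by auto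
 have "cell_angle h (truncate R u) x = cell_angle h (\<lambda>x. e3 + u x) x" unfolding cell_angle_def add.assoc
  using near[of 0] near[of "h *R e_1"] near[of "h *R e_2"] near[OF b] h e by simp
 then show ?thesis using True by simp
next
 case False
 have "\<bar>cell_angle h (truncate R u) x - cell_angle h (\<lambda>x. e3 + u x) x\<bar> \<le>
  4 * (increment 1 h (x + 0) * increment 2 h (x + h *R e_1)) + 4 * (increment 1 h (x + h *R e_2) * increment 2 h (x + 0))"
  using cell_angle_increment[OF R small h(1) n t, of x] unfolding distrib_left by linarith
 then show ?thesis using False by simp
qed

text \<open>The inner cells cancel. In the others each of the two triangles gives a product of two
  tails, bounded by \<open>d\<close> each, with a factor 4.\<close>

lemma cell_angle_truncate_integral:
 assumes R: "1 \<le> R" and small: "\<And>x. R \<le> norm x \<Longrightarrow> norm (u x) \<le> 1 / 2" and h: "0 < h" "h \<le> 1"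
  and n: "\<And>x y. norm (x - y) \<le> 2 * h \<Longrightarrow> norm ((e3 + u x) - (e3 + u y)) \<le> 1"
  and t: "\<And>x y. norm (x - y) \<le> 2 * h \<Longrightarrow> norm (truncate R u x - truncate R u y) \<le> 1"
  and d: "\<And>i. l2 (outside (R - 3) (increment i h)) \<le> d"
 shows "\<bar>(LINT x|lborel. cell_angle h (truncate R u) x) - (LINT x|lborel. cell_angle h (\<lambda>x. e3 + u x) x)\<bar> \<le> 8 * d\<^sup>2"
proof -
 note I = increment_props(2)[of _ h]
 note t1 = truncate_props(1)[of R u, OF R sphere small]
 have e: "norm (h *R e_1) \<le> 1" "norm (h *R e_2) \<le> 1" using h by (simp_all add: e_1_def e_2_def)
 note uct = truncate_continuous[OF R sphere small u_cont]
 have [measurable]: "cell_angle h (truncate R u) \<in> borel_measurable borel"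
  by (rule borel_measurable_continuous_onI[OF continuous_cell_angle[OF uct t1 t h(1)]])
 have [measurable]: "cell_angle h (\<lambda>x. e3 + u x) \<in> borel_measurable borel"
  by (rule borel_measurable_continuous_onI[OF continuous_cell_angle[OF _ sphere n h(1)]]) (intro continuous_intros u_cont)
 have im: "integrable lborel (\<lambda>x. increment 1 h (x + a) * increment 2 h (x + b))" for a b
  using integrable_norm_mult[OF L2_shift[OF I, of 1 a] L2_shift[OF I, of 2 b]] by (simp add: increment_props(1))
 let ?A = "\<lambda>x. 2 * (increment 1 h (x + 0) * increment 2 h (x + h *R e_1) + increment 1 h (x + h *R e_2) * increment 2 h (x + 0))"
 have iA: "integrable lborel ?A" by (intro integrable_mult_right LINT_integrable_add im)
 note ci = cell_angle_increment[OF R small h(1) n t]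
 have i1: "integrable lborel (cell_angle h (truncate R u))" by (rule LINT_integrable_bound[OF iA])
    (measurable, use ci(2) in \<open>auto intro!: AE_I2 intro: order_trans[OF _ abs_ge_self]\<close>)
 have i2: "integrable lborel (cell_angle h (\<lambda>x. e3 + u x))" by (rule LINT_integrable_bound[OF iA])
    (measurable, use ci(1) in \<open>auto intro!: AE_I2 intro: order_trans[OF _ abs_ge_self]\<close>)
 \<comment> \<open>Written as \<open>R - 3 + 1\<close> to match the loss of one unit of radius in
   the tail estimate.\<close>
 let ?T = "\<lambda>a b x. indicator (- cball 0 (R - 3 + 1)) x * (increment 1 h (x + a) * increment 2 h (x + b))"
 have T: "integrable lborel (?T a b)" "(LINT x|lborel. ?T a b x) \<le> d * d" if "norm a \<le> 1" "norm b \<le> 1" for a b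
 proof -
  note tl = integral_mult_tail_le[of "increment 1 h" "increment 2 h" a b "R - 3", OF I I increment_props(1) increment_props(1) that]
  show "integrable lborel (?T a b)" by (rule tl(1))
  have "l2 (outside (R - 3) (increment 1 h)) * l2 (outside (R - 3) (increment 2 h)) \<le> d * d"
   using d[of 1] d[of 2] by (intro mult_mono) (auto intro: order_trans[OF _ d])
  with tl(2) show "(LINT x|lborel. ?T a b x) \<le> d * d" by linarith
 qed
 have z: "norm (0::real^2) \<le> 1" by simp
 have "\<bar>(LINT x|lborel. cell_angle h (truncate R u) x) - (LINT x|lborel. cell_angle h (\<lambda>x. e3 + u x) x)\<bar>
  = \<bar>LINT x|lborel. cell_angle h (truncate R u) x - cell_angle h (\<lambda>x. e3 + u x) x\<bar>"
  by (simp only: Bochner_Integration.integral_diff[OF i1 i2])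
 also have "\<dots> \<le> (LINT x|lborel. \<bar>cell_angle h (truncate R u) x - cell_angle h (\<lambda>x. e3 + u x) x\<bar>)"
  by (rule integral_abs_bound)
 also have "\<dots> \<le> (LINT x|lborel. 4 * ?T 0 (h *R e_1) x + 4 * ?T (h *R e_2) 0 x)" by (rule integral_mono)
    (use i1 i2 T[OF z e(1)] T[OF e(2) z] cell_angle_truncate_diff[OF R small h n t]
    in \<open>auto intro!: integrable_abs Bochner_Integration.integrable_diff LINT_integrable_add integrable_mult_right\<close>)
 also have "\<dots> = 4 * (LINT x|lborel. ?T 0 (h *R e_1) x) + 4 * (LINT x|lborel. ?T (h *R e_2) 0 x)"
  by (subst LINT_add) (use T[OF z e(1)] T[OF e(2) z] in auto)
 also have "\<dots> \<le> 8 * d\<^sup>2" using T(2)[OF z e(1)] T(2)[OF e(2) z] unfolding power2_eq_square by linarith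
 finally show ?thesis .
qed

text \<open>The truncated map has an exactly quantized grid integral; for a fine grid and a large
  radius that of the original map is close to it, and also to \<open>2 * pi\<close> times the
  degree, both relative to the cell area.\<close>

lemma jet_degree_near_int:
 assumes e: "0 < e"
 shows "\<exists>k::int. \<bar>jet_degree u G - k\<bar> \<le> 2 * e"
proof -
 note JD = jet2D[OF J]
 \<comment> \<open>The tails of the increments will be bounded by \<open>12 * h * d\<close>, and the
   truncation error by 8 times the square of this; \<open>8 * 12^2 = 1152\<close> makes it
   \<open>h^2 * e\<close>.\<close>
 define d where "d = sqrt (e / 1152)"
 have d: "0 < d" "d\<^sup>2 = e / 1152" using e by (auto simp: d_def)
 obtain R1 where R1: "0 < R1" "\<And>x. R1 \<le> norm x \<Longrightarrow> norm (u x) \<le> 1 / 2"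
  by (rule uniformly_continuous_decay[OF JD(1) uc, of "1/2"]) auto
 obtain R2 where R2: "\<And>R'. R2 \<le> R' \<Longrightarrow> l2 (outside R' u) < d" by (rule l2_tail[OF JD(1) d(1)]) blast
 have "\<exists>R. \<forall>R'\<ge>R. l2 (outside R' (G i)) < d" for i by (rule l2_tail[OF JD(3)[of i] d(1)]) blast
 then obtain R3 where R3: "\<And>i R'. R3 i \<le> R' \<Longrightarrow> l2 (outside R' (G i)) < d" by metis
 define R where "R = max R1 (max R2 (max (R3 1) (R3 2))) + 3"
 have R: "1 \<le> R" using R1(1) by (simp add: R_def)
 have small: "\<And>x. R \<le> norm x \<Longrightarrow> norm (u x) \<le> 1 / 2" using R1(2) by (simp add: R_def)
 have tails: "l2 (outside (R - 3) u) < d" "l2 (outside (R - 3) (G i)) < d" for i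
 proof -
  show "l2 (outside (R - 3) u) < d" by (rule R2) (simp add: R_def)
  have "i = 1 \<or> i = 2" by (rule exhaust_2)
  then show "l2 (outside (R - 3) (G i)) < d" by (intro R3) (auto simp: R_def)
 qed
 define \<kappa> where "\<kappa> = max 0 (max (l2 (K 1 1)) (l2 (K 2 2)))"
 have \<kappa>: "0 \<le> \<kappa>" "l2 (K i i) \<le> \<kappa>" for i using exhaust_2[of i] by (auto simp: \<kappa>_def)
 \<comment> \<open>The second bound makes \<open>h * \<kappa>\<close> at most \<open>d\<close>; the
   first one serves the mutual distances of values of the truncated map.\<close>
 have "\<forall>\<^sub>F k in sequentially. hseq k < min (1/32) (d / (\<kappa> + 1))"
  by (rule order_tendstoD(2)[OF hseq_tendsto]) (use d \<kappa>(1) in auto)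
 moreover have "\<forall>\<^sub>F k in sequentially. \<forall>x y. norm (x - y) \<le> 2 * hseq k \<longrightarrow> norm ((e3 + u x) - (e3 + u y)) \<le> 1 / 8"
  by (rule modulus) simp
 moreover have "\<forall>\<^sub>F k in sequentially. dist ((LINT x|lborel. cell_angle (hseq k) (\<lambda>x. e3 + u x) x) / (hseq k)\<^sup>2) (2 * pi * jet_degree u G) < e"
  by (rule tendstoD[OF cell_angle_limit e])
 ultimately have "\<forall>\<^sub>F k in sequentially. hseq k < min (1/32) (d / (\<kappa> + 1)) \<and>
  (\<forall>x y. norm (x - y) \<le> 2 * hseq k \<longrightarrow> norm ((e3 + u x) - (e3 + u y)) \<le> 1 / 8) \<and>
  dist ((LINT x|lborel. cell_angle (hseq k) (\<lambda>x. e3 + u x) x) / (hseq k)\<^sup>2) (2 * pi * jet_degree u G) < e"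
  by eventually_elim blast
 then obtain j where j: "hseq j < min (1/32) (d / (\<kappa> + 1))"
  "\<And>x y. norm (x - y) \<le> 2 * hseq j \<Longrightarrow> norm ((e3 + u x) - (e3 + u y)) \<le> 1 / 8"
  "dist ((LINT x|lborel. cell_angle (hseq j) (\<lambda>x. e3 + u x) x) / (hseq j)\<^sup>2) (2 * pi * jet_degree u G) < e"
  unfolding eventually_sequentially by blast
 define h where "h = hseq j"
 have h: "0 < h" "h \<le> 1" "h < 1/32" using hseq(2)[of j] j(1) by (auto simp: h_def)
 have hk: "h * \<kappa> \<le> d"
 proof -
  have "h * (\<kappa> + 1) < d" using j(1) \<kappa>(1) by (simp add: h_def pos_less_divide_eq)
  then show ?thesis using h by (simp add: distrib_left)
 qed
 have n8: "norm ((e3 + u x) - (e3 + u y)) \<le> 1 / 8" if "norm (x - y) \<le> 2 * h" for x y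
  using j(2) that by (simp add: h_def)
 have n: "norm ((e3 + u x) - (e3 + u y)) \<le> 1" if "norm (x - y) \<le> 2 * h" for x y using n8[OF that] by simp
 \<comment> \<open>Numerically \<open>4 * (1/8 + (1/16) * 2) = 1\<close>, from increments of at most
   1/8, points at distance below 1/16 and the bound 2 for the deviation.\<close>
 have t: "norm (truncate R u x - truncate R u y) \<le> 1" if xy: "norm (x - y) \<le> 2 * h" for x y
 proof -
  have "norm (x - y) * norm (u y) \<le> (1/16) * 2" using xy h norm_u_le[of y] by (intro mult_mono) auto
  then show ?thesis using n8[OF xy] truncate_props(4)[of R u x y, OF R sphere small] by simp
 qed
 have inc: "l2 (outside (R - 3) (increment i h)) \<le> 12 * (h * d)" for i
 proof -
  have "l2 (outside (R - 3) (increment i h)) \<le>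
   4 * \<bar>h\<bar> * (\<bar>h\<bar> * l2 (K i i) + l2 (outside (R - 3) (G i)) + l2 (outside (R - 3) u))"
   by (rule increment_props(3)) (use h in simp)
  also have "\<dots> \<le> 4 * \<bar>h\<bar> * (d + d + d)"
  proof (rule mult_left_mono)
   have "\<bar>h\<bar> * l2 (K i i) \<le> h * \<kappa>" using h \<kappa>(2)[of i] by simp
   then show "\<bar>h\<bar> * l2 (K i i) + l2 (outside (R - 3) (G i)) + l2 (outside (R - 3) u) \<le> d + d + d"
    using hk tails(1) tails(2)[of i] by linarith
  qed simp
  finally show ?thesis using h by simp
 qed
 note uct = truncate_continuous[OF R sphere small u_cont]
 obtain k :: int where k: "(LINT x|lborel. cell_angle h (truncate R u) x) = h\<^sup>2 * (2 * pi * k)"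
 proof -
  have "\<exists>k::int. (LINT x|lborel. cell_angle h (truncate R u) x) = h\<^sup>2 * (2 * pi * k)"
  proof (rule cell_angle_quantization[OF uct _ _ _ h(1,2) t])
   show "norm (truncate R u x) = 1" for x by (rule truncate_props(1)[OF R sphere small])
   show "0 < 2 * R" using R by simp
   show "truncate R u x = e3" if "2 * R \<le> norm x" for x by (rule truncate_props(3)[OF R sphere small that])
  qed
  then show ?thesis using that by blast
 qed
 let ?N = "LINT x|lborel. cell_angle h (\<lambda>x. e3 + u x) x"
 have h2: "0 < h\<^sup>2" using h by simp
 have "\<bar>h\<^sup>2 * (2 * pi * k) - ?N\<bar> \<le> 8 * (12 * (h * d))\<^sup>2"
  using cell_angle_truncate_integral[of R h "12 * (h * d)", OF R small h(1,2) n t inc] unfolding k .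
 also have "8 * (12 * (h * d))\<^sup>2 = h\<^sup>2 * e" using d(2) by (simp add: power_mult_distrib)
 finally have "\<bar>h\<^sup>2 * (2 * pi * k) - ?N\<bar> / h\<^sup>2 \<le> e" using h2 by (simp add: pos_divide_le_eq mult.commute)
 moreover have "\<bar>h\<^sup>2 * (2 * pi * k) - ?N\<bar> / h\<^sup>2 = \<bar>2 * pi * k - ?N / h\<^sup>2\<bar>"
 proof -
  have "\<bar>2 * pi * k - ?N / h\<^sup>2\<bar> = \<bar>(h\<^sup>2 * (2 * pi * k) - ?N) / h\<^sup>2\<bar>" using h2 by (simp add: diff_divide_distrib)
  then show ?thesis by (simp only: abs_divide) simp
 qed
 ultimately have "\<bar>2 * pi * k - ?N / h\<^sup>2\<bar> \<le> e" by simp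
 with j(3) have "\<bar>2 * pi * jet_degree u G - 2 * pi * k\<bar> \<le> 2 * e" unfolding dist_real_def h_def by linarith
 moreover have "\<bar>2 * pi * jet_degree u G - 2 * pi * k\<bar> = 2 * pi * \<bar>jet_degree u G - k\<bar>"
 proof -
  have "2 * pi * jet_degree u G - 2 * pi * k = 2 * pi * (jet_degree u G - k)" by (simp add: right_diff_distrib)
  then show ?thesis by (simp only: abs_mult) simp
 qed
 moreover have "1 * \<bar>jet_degree u G - k\<bar> \<le> 2 * pi * \<bar>jet_degree u G - k\<bar>" using pi_gt3 by (intro mult_right_mono) auto
 ultimately have "\<bar>jet_degree u G - k\<bar> \<le> 2 * e" by (metis mult_1 order_trans)
 then show ?thesis by blast
qed

theorem jet_degree_integer: "jet_degree u G \<in> \<int>"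
proof -
 have "\<exists>y\<in>\<int>. dist y (jet_degree u G) < e" if e: "0 < e" for e
 proof -
  obtain k :: int where "\<bar>jet_degree u G - k\<bar> \<le> 2 * (e / 4)" using jet_degree_near_int[of "e/4"] e by auto
  then have "dist (real_of_int k) (jet_degree u G) < e" unfolding dist_real_def using e by linarith
  then show ?thesis by (intro bexI[of _ "real_of_int k"]) auto
 qed
 then have "jet_degree u G \<in> closure \<int>" unfolding closure_approachable by blast
 then show ?thesis by (simp add: closure_closed closed_Ints)
qed

end

section \<open>Profiles\<close>

text \<open>A profile is a limit of the maps seen from moving centres, as in concentration compactness.\<close>

definition profile :: "(nat \<Rightarrow> real^2 \<Rightarrow> real^3) \<Rightarrow> (real^2 \<Rightarrow> real^3) \<Rightarrow> bool" where
 "profile u v \<longleftrightarrow> (\<exists>r y. strict_mono (r :: nat \<Rightarrow> nat) \<and> (\<forall>x. (\<lambda>k. u (r k) (x + y k)) ----> v x))"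

lemma jet_bounded_shift:
 assumes "jet_bounded M u G K"
 shows "jet_bounded M (\<lambda>x. u (x + a)) (\<lambda>i x. G i (x + a)) (\<lambda>i j x. K i j (x + a))"
proof -
 note b = jet_boundedD[OF assms] and J = jet2D[OF jet_boundedD(1)[OF assms]]
 show ?thesis
  unfolding jet_bounded_def using jet2_shift[OF b(1)] b(2-4) by (auto simp: l2_shift[OF J(1)] l2_shift[OF J(3)] l2_shift[OF J(5)])
qed

lemma jet_bounded_diff:
 assumes 1: "jet_bounded M u G K" and 2: "jet_bounded M' u' G' K'"
 shows "jet_bounded (M + M') (\<lambda>x. u x - u' x) (\<lambda>i x. G i x - G' i x) (\<lambda>i j x. K i j x - K' i j x)"
proof -
 note b = jet_boundedD[OF 1] and J = jet2D[OF jet_boundedD(1)[OF 1]]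
 note b' = jet_boundedD[OF 2] and J' = jet2D[OF jet_boundedD(1)[OF 2]]
 show ?thesis unfolding jet_bounded_def
  using jet2_diff[OF b(1) b'(1)] order_trans[OF l2_triangle_diff[OF J(1) J'(1)] add_mono[OF b(2) b'(2)]]
   order_trans[OF l2_triangle_diff[OF J(3) J'(3)] add_mono[OF b(3) b'(3)]]
   order_trans[OF l2_triangle_diff[OF J(5) J'(5)] add_mono[OF b(4) b'(4)]] by blast
qed

lemma continuous_shift: "continuous_on UNIV f \<Longrightarrow> continuous_on UNIV (\<lambda>x::'a::real_normed_vector. f (x + a))"
 by (rule continuous_on_compose2[of UNIV f]) (auto intro!: continuous_intros)

text \<open>A deviation of at most \<open>C\<close> everywhere would force the degree below 1/2, so
  some value exceeds \<open>C\<close>; centring there keeps the limit away from zero at the origin,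
  and the Sobolev bound turns this into energy.\<close>

lemma nontrivial_profile:
 assumes J: "\<And>k. jet2 (u k) (G k) (K k)" and c: "\<And>k. continuous_on UNIV (u k)"
  and E: "\<And>k. jet_energy (u k) (K k) \<le> E" and d: "\<And>k. 1 / 2 \<le> \<bar>jet_degree (u k) (G k)\<bar>"
 obtains r y v Gv Kv where "strict_mono (r :: nat \<Rightarrow> nat)" "\<And>x. (\<lambda>k. u (r k) (x + y k)) ----> v x"
  "jet2 v Gv Kv" "isUCont v" "(2 * pi / (E + 1))\<^sup>2 / 32 \<le> jet_energy v Kv"
proof -
 \<comment> \<open>With this bound on the deviation the degree is at most
   \<open>E / (4 * (E + 1))\<close>, which is below 1/4.\<close>
 define C where "C = 2 * pi / (E + 1)"
 have E0: "0 \<le> E" using jet_energy_nonneg E by (rule order_trans)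
 have C: "0 < C" using E0 by (simp add: C_def)
 have "\<exists>y. C < norm (u k y)" for k
 proof (rule ccontr)
  assume "\<not> ?thesis"
  then have "norm (u k y) \<le> C" for y by (simp add: not_less)
  from jet_degree_le[OF J this] have "\<bar>jet_degree (u k) (G k)\<bar> \<le> C / (8 * pi) * jet_energy (u k) (K k)" .
  also have "\<dots> \<le> C / (8 * pi) * E" using C E by (intro mult_left_mono) auto
  also have "\<dots> = (1 / 4) * (E / (E + 1))" using E0 by (simp add: C_def divide_simps)
  also have "\<dots> \<le> (1 / 4) * 1" using E0 by (intro mult_left_mono) auto
  finally show False using d[of k] by simp
 qed
 then obtain y where y: "\<And>k. C < norm (u k (y k))" by metis
 note JB = jet_bounded_shift[OF jet_bounded_energy[OF J E]]
 note c' = continuous_shift[OF c]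
 obtain r v where r: "strict_mono (r :: nat \<Rightarrow> nat)" and lim: "\<And>x. (\<lambda>k. u (r k) (x + y (r k))) ----> v x"
  by (rule pointwise_subsequence[where u = "\<lambda>k x. u k (x + y k)", OF JB c']) (rule that)
 obtain Gv Kv where Jv: "jet_bounded (sqrt (2 * E)) v Gv Kv"
  by (rule pointwise_limit_jet[where u = "\<lambda>k x. u (r k) (x + y (r k))", OF JB lim]) blast
 have uv: "isUCont v" by (rule pointwise_limit_hoelder(2)[where u = "\<lambda>k x. u (r k) (x + y (r k))", OF JB c' lim])
 note Jv' = jet_boundedD(1)[OF Jv]
 have "C \<le> norm (v 0)"
  by (rule LIMSEQ_le_const[OF tendsto_norm[OF lim]]) (use y in \<open>auto intro!: less_imp_le exI[of _ 0]\<close>)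
 \<comment> \<open>The square of this bound is 32 times the energy, the source of the constant 32 in
   the conclusion.\<close>
 also have "\<dots> \<le> 4 * sqrt (2 * jet_energy v Kv)"
  by (rule sup_bound_bounded[OF jet_bounded_energy[OF Jv' order_refl] uniformly_continuous_imp_continuous[OF uv]])
 finally have "C\<^sup>2 \<le> (4 * sqrt (2 * jet_energy v Kv))\<^sup>2" using C by (intro power_mono) auto
 also have "\<dots> = 32 * jet_energy v Kv" using jet_energy_nonneg[of v Kv] by (simp add: power_mult_distrib)
 finally have "C\<^sup>2 / 32 \<le> jet_energy v Kv" by simp
 then show ?thesis using that[OF r lim Jv' uv] unfolding C_def by blast
qed

text \<open>Subtracting the profile after recentring leaves a pointwise null sequence with bounded
  jets, so both splitting results apply; translation invariance then removes the centres.\<close>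

lemma profile_split:
 assumes J: "\<And>k. jet2 (u k) (G k) (K k)" and c: "\<And>k. continuous_on UNIV (u k)" and E: "\<And>k. jet_energy (u k) (K k) \<le> E"
  and lim: "\<And>x. (\<lambda>k. u (r k) (x + y k)) ----> v x" and Jv: "jet2 v Gv Kv" and ucv: "isUCont v"
 obtains w Gw Kw M where "\<And>k. jet_bounded M (w k) (Gw k) (Kw k)" "\<And>k. continuous_on UNIV (w k)"
  "\<And>k x. w k x = u (r k) (x + y k) - v x" "\<And>x. (\<lambda>k. w k x) ----> 0"
  "(\<lambda>k. jet_degree (u (r k)) (G (r k)) - jet_degree (w k) (Gw k)) ----> jet_degree v Gv"
  "(\<lambda>k. jet_energy (u (r k)) (K (r k)) - jet_energy (w k) (Kw k)) ----> jet_energy v Kv"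
proof -
 define w where "w k x = u (r k) (x + y k) - v x" for k x
 define Gw where "Gw k i x = G (r k) i (x + y k) - Gv i x" for k i x
 define Kw where "Kw k i j x = K (r k) i j (x + y k) - Kv i j x" for k i j x
 have Jb: "jet_bounded (sqrt (2 * E) + sqrt (2 * jet_energy v Kv)) (w k) (Gw k) (Kw k)" for k
  using jet_bounded_diff[OF jet_bounded_shift[OF jet_bounded_energy[OF J E]] jet_bounded_energy[OF Jv order_refl], of "r k" "y k"]
  unfolding w_def[abs_def] Gw_def[abs_def] Kw_def[abs_def] .
 have cv: "continuous_on UNIV v" by (rule uniformly_continuous_imp_continuous[OF ucv])
 have cw: "continuous_on UNIV (w k)" for k unfolding w_def by (intro continuous_on_diff continuous_shift c cv)
 have lw: "(\<lambda>k. w k x) ----> 0" for x using tendsto_diff[OF lim[of x] tendsto_const[of "v x"]] by (simp add: w_def)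
 note C = sup_bound_bounded[OF jet_bounded_energy[OF Jv order_refl] cv]
 have vw: "(\<lambda>x. v x + w k x) = (\<lambda>x. u (r k) (x + y k))" "(\<lambda>i x. Gv i x + Gw k i x) = (\<lambda>i x. G (r k) i (x + y k))"
  "(\<lambda>i j x. Kv i j x + Kw k i j x) = (\<lambda>i j x. K (r k) i j (x + y k))" for k by (auto simp: w_def Gw_def Kw_def)
 show ?thesis by (rule that[OF Jb cw w_def lw])
   (use jet_degree_split[OF Jb cw lw Jv ucv C] jet_energy_split[OF Jb cw lw Jv] in
    \<open>simp_all only: vw jet_degree_shift[OF J] jet_energy_shift[OF J]\<close>)
qed

text \<open>If the new centres escape to infinity, the subtracted profile disappears from view and
  the limit is a profile of \<open>u\<close>. Otherwise they converge along a subsequence, and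
  equicontinuity identifies the limit with that at a fixed centre, which is zero.\<close>

lemma profile_remainder:
 assumes J: "\<And>k. jet_bounded M (w k) (G k) (K k)" and c: "\<And>k. continuous_on UNIV (w k)"
  and w: "\<And>k x. w k x = u (r k) (x + y k) - v x" and r: "strict_mono (r :: nat \<Rightarrow> nat)"
  and lim: "\<And>x. (\<lambda>k. w k x) ----> 0"
  and v: "L2 v" "isUCont v" and p: "profile w z"
 shows "z = (\<lambda>x. 0) \<or> profile u z"
proof -
 obtain s a where s: "strict_mono (s :: nat \<Rightarrow> nat)" and lz: "\<And>x. (\<lambda>k. w (s k) (x + a k)) ----> z x"
  using p by (auto simp: profile_def)
 show ?thesis
 proof (cases "filterlim (\<lambda>k. norm (a k)) at_top sequentially")
  case True
  have vz: "(\<lambda>k. v (x + a k)) ----> 0" for x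
  proof (rule tendstoI)
   fix e :: real assume e: "0 < e"
   then have "0 < e / 2" by simp
   from v this obtain R where "0 < R" and R: "\<And>x. R \<le> norm x \<Longrightarrow> norm (v x) \<le> e / 2"
    by (rule uniformly_continuous_decay) (rule that)
   have "\<forall>\<^sub>F k in sequentially. R + norm x \<le> norm (a k)" using True by (simp add: filterlim_at_top)
   then show "\<forall>\<^sub>F k in sequentially. dist (v (x + a k)) 0 < e"
   proof eventually_elim
    case (elim k)
    then have "R \<le> norm (x + a k)" using norm_diff_ineq[of "a k" x] by (simp add: add.commute)
    from R[OF this] show ?case using e by simp
   qed
  qed
  have "(\<lambda>k. u (r (s k)) (x + (a k + y (s k)))) ----> z x" for x
   using tendsto_add[OF lz[of x] vz[of x]] by (simp add: w add.assoc)
  moreover have "strict_mono (r \<circ> s)" using r s by (rule strict_mono_o)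
  ultimately have "profile u z" unfolding profile_def by (intro exI[of _ "r \<circ> s"] exI[of _ "\<lambda>k. a k + y (s k)"]) simp
  then show ?thesis ..
 next
  case False
  then obtain Z where "\<not> (\<forall>\<^sub>F k in sequentially. Z \<le> norm (a k))" by (auto simp: filterlim_at_top)
  then have "\<exists>\<^sub>F k in sequentially. norm (a k) < Z" by (simp add: not_eventually not_le)
  then have "infinite {k. norm (a k) < Z}" by (simp add: frequently_cofinite flip: cofinite_eq_sequentially)
  then obtain t where t: "strict_mono (t :: nat \<Rightarrow> nat)" "\<And>k. t k \<in> {k. norm (a k) < Z}"
   using infinite_enumerate by blast
  have "\<forall>k. (a \<circ> t) k \<in> cball 0 Z" using t(2) by (auto intro: less_imp_le)
  with compact_cball[of "0 :: real^2" Z] obtain l q where q: "strict_mono (q :: nat \<Rightarrow> nat)" "((a \<circ> t) \<circ> q) ----> l"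
   unfolding compact_def by blast
  have "z x = 0" for x
  proof -
   let ?p = "\<lambda>k. t (q k)"
   have sp: "strict_mono ?p" using t(1) q(1) by (simp add: strict_mono_def)
   have sps: "strict_mono (\<lambda>k. s (?p k))" using s sp by (simp add: strict_mono_def)
   have 1: "(\<lambda>k. w (s (?p k)) (x + a (?p k))) ----> z x"
    using LIMSEQ_subseq_LIMSEQ[OF lz[of x] sp] by (simp add: o_def)
   have 2: "(\<lambda>k. w (s (?p k)) (x + l)) ----> 0"
    using LIMSEQ_subseq_LIMSEQ[OF lim[of "x + l"] sps] by (simp add: o_def)
   have "(\<lambda>k. 4 * M * sqrt (norm (a (?p k) - l))) ----> 4 * M * sqrt (norm (l - l))"
    using q(2) by (intro tendsto_intros) (simp add: o_def)
   then have "(\<lambda>k. 4 * M * sqrt (norm (a (?p k) - l))) ----> 0" by simp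
   then have 3: "(\<lambda>k. w (s (?p k)) (x + a (?p k)) - w (s (?p k)) (x + l)) ----> 0"
    by (rule Lim_null_comparison[rotated])
      (use hoelder_bounded[OF J c, of _ "x + a _" "x + l"] in \<open>auto intro!: always_eventually\<close>)
   have "(\<lambda>k. w (s (?p k)) (x + a (?p k))) ----> 0" using tendsto_add[OF 3 2] by simp
   with 1 show ?thesis by (rule LIMSEQ_unique)
  qed
  then show ?thesis by blast
 qed
qed

definition odd_degree :: "real \<Rightarrow> bool" where
 "odd_degree d \<longleftrightarrow> (\<exists>k::int. odd k \<and> d = of_int k)"

lemma jet2_zero: "jet2 (\<lambda>x. 0) (\<lambda>i x. 0) (\<lambda>i j x. 0)"
 unfolding jet2_def using has_weak_partial_const[where c = 0] by auto

text \<open>The induction runs over the number of quanta \<open>c\<close> that fit into the energy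
  bound. \<open>B\<close> stays fixed so that the quantum is the same at each stage, and the sphere
  condition is imposed on profiles rather than on the sequence, since remainders violate it.\<close>

lemma odd_degree_profile_induct:
 assumes "\<And>k. jet2 (u k) (G k) (K k)" "\<And>k. continuous_on UNIV (u k)"
  "\<And>k. jet_energy (u k) (K k) \<le> E" "E < of_nat n * c" "E \<le> B" "0 < c" "c \<le> (2 * pi / (B + 1))\<^sup>2 / 64"
  "\<And>v x. profile u v \<Longrightarrow> norm (e3 + v x) = 1"
  "(\<lambda>k. jet_degree (u k) (G k)) ----> \<rho>" "odd_degree \<rho>"
 shows "\<exists>v Gv Kv. profile u v \<and> jet2 v Gv Kv \<and> isUCont v \<and> odd_degree (jet_degree v Gv)" using assms
proof (induction n arbitrary: u G K E \<rho>)
 case 0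
 then have "E < 0" by simp
 then show ?case using order_trans[OF jet_energy_nonneg 0(3)] by simp
next
 case (Suc n)
 note J = Suc.prems(1) and cont = Suc.prems(2) and E = Suc.prems(3) and sph = Suc.prems(8) and lim = Suc.prems(9)
 have E0: "0 \<le> E" using order_trans[OF jet_energy_nonneg E] .
 obtain \<rho>i :: int where \<rho>i: "odd \<rho>i" "\<rho> = of_int \<rho>i" using Suc.prems(10) by (auto simp: odd_degree_def)
 have "\<bar>\<rho>\<bar> \<ge> 1" using \<rho>i by (cases "\<rho>i = 0") auto
 then have "\<forall>\<^sub>F k in sequentially. 1 / 2 < \<bar>jet_degree (u k) (G k)\<bar>"
  by (intro order_tendstoD(1)[OF tendsto_rabs[OF lim]]) simp
 then obtain N where N: "\<And>k. N \<le> k \<Longrightarrow> 1 / 2 < \<bar>jet_degree (u k) (G k)\<bar>" by (auto simp: eventually_sequentially)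
 have N': "1 / 2 \<le> \<bar>jet_degree (u (k + N)) (G (k + N))\<bar>" for k using N[of "k + N"] by simp
 obtain r0 y v Gv Kv where r0: "strict_mono (r0 :: nat \<Rightarrow> nat)" and l0: "\<And>x. (\<lambda>k. u (r0 k + N) (x + y k)) ----> v x"
  and Jv: "jet2 v Gv Kv" and ucv: "isUCont v" and Ev: "(2 * pi / (E + 1))\<^sup>2 / 32 \<le> jet_energy v Kv"
  by (rule nontrivial_profile[where u = "\<lambda>k. u (k + N)" and G = "\<lambda>k. G (k + N)" and K = "\<lambda>k. K (k + N)" and E = E, OF J cont E N']) (rule that)
 define r where "r k = r0 k + N" for k
 have r: "strict_mono r" using r0 by (simp add: strict_mono_def r_def)
 have lv: "(\<lambda>k. u (r k) (x + y k)) ----> v x" for x using l0 by (simp add: r_def)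
 have pv: "profile u v" unfolding profile_def using r lv by blast
 \<comment> \<open>The profile carries at least \<open>2 * c\<close>. The energy drop reaches this
   value only in the limit, so half of it is given away to have a drop of more than \<open>c\<close>
   eventually.\<close>
 have "(2 * pi / (B + 1))\<^sup>2 \<le> (2 * pi / (E + 1))\<^sup>2" using E0 Suc.prems(5) by (intro power_mono divide_left_mono) auto
 with Ev Suc.prems(7) have cE: "2 * c \<le> jet_energy v Kv" by linarith
 have "jet_degree v Gv \<in> \<int>" by (rule jet_degree_integer[OF Jv ucv sph[OF pv]])
 then obtain d :: int where d: "jet_degree v Gv = of_int d" by (auto elim: Ints_cases)
 show ?case
 proof (cases "odd d")
  case True
  then show ?thesis using pv Jv ucv d by (auto simp: odd_degree_def)
 next
  case False
  obtain w Gw Kw M where Jb: "\<And>k. jet_bounded M (w k) (Gw k) (Kw k)" and cw: "\<And>k. continuous_on UNIV (w k)"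
   and w: "\<And>k x. w k x = u (r k) (x + y k) - v x" and lw: "\<And>x. (\<lambda>k. w k x) ----> 0"
   and ds: "(\<lambda>k. jet_degree (u (r k)) (G (r k)) - jet_degree (w k) (Gw k)) ----> jet_degree v Gv"
   and es: "(\<lambda>k. jet_energy (u (r k)) (K (r k)) - jet_energy (w k) (Kw k)) ----> jet_energy v Kv"
   by (rule profile_split[where u = u and G = G and K = K and r = r and y = y and E = E, OF J cont E lv Jv ucv]) (rule that)
  have "(\<lambda>k. jet_degree (u (r k)) (G (r k))) ----> \<rho>" using LIMSEQ_subseq_LIMSEQ[OF lim r] by (simp add: o_def)
  from tendsto_diff[OF this ds] have dw: "(\<lambda>k. jet_degree (w k) (Gw k)) ----> \<rho> - jet_degree v Gv" by simp
  have ow: "odd_degree (\<rho> - jet_degree v Gv)"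
   unfolding odd_degree_def using \<rho>i d False by (intro exI[of _ "\<rho>i - d"]) auto
  have "\<forall>\<^sub>F k in sequentially. c < jet_energy (u (r k)) (K (r k)) - jet_energy (w k) (Kw k)"
   by (rule order_tendstoD(1)[OF es]) (use cE Suc.prems(6) in linarith)
  then obtain N' where N': "\<And>k. N' \<le> k \<Longrightarrow> c < jet_energy (u (r k)) (K (r k)) - jet_energy (w k) (Kw k)"
   by (auto simp: eventually_sequentially)
  define w' where "w' k = w (k + N')" for k
  have pw: "z = (\<lambda>x. 0) \<or> profile u z" if z: "profile w' z" for z
  proof (rule profile_remainder[where w = w' and r = "\<lambda>k. r (k + N')" and y = "\<lambda>k. y (k + N')"])
   show "jet_bounded M (w' k) (Gw (k + N')) (Kw (k + N'))" for k unfolding w'_def by (rule Jb)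
   show "continuous_on UNIV (w' k)" for k unfolding w'_def by (rule cw)
   show "w' k x = u (r (k + N')) (x + y (k + N')) - v x" for k x by (simp add: w'_def w)
   show "strict_mono (\<lambda>k. r (k + N'))" using r by (simp add: strict_mono_def)
   show "(\<lambda>k. w' k x) ----> 0" for x unfolding w'_def by (rule LIMSEQ_ignore_initial_segment[OF lw])
  qed (rule jet2D(1)[OF Jv] ucv z)+
  have "\<exists>z Gz Kz. profile w' z \<and> jet2 z Gz Kz \<and> isUCont z \<and> odd_degree (jet_degree z Gz)"
  proof (rule Suc.IH[where u = w' and G = "\<lambda>k. Gw (k + N')" and K = "\<lambda>k. Kw (k + N')" and E = "E - c" and \<rho> = "\<rho> - jet_degree v Gv"])
   show "jet2 (w' k) (Gw (k + N')) (Kw (k + N'))" for k unfolding w'_def by (rule jet_boundedD(1)[OF Jb])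
   show "continuous_on UNIV (w' k)" for k unfolding w'_def by (rule cw)
   show "jet_energy (w' k) (Kw (k + N')) \<le> E - c" for k
    using N'[of "k + N'"] E[of "r (k + N')"] unfolding w'_def by simp
   show "E - c < of_nat n * c" using Suc.prems(4) by (simp add: distrib_right)
   show "E - c \<le> B" using Suc.prems(5,6) by simp
   show "norm (e3 + z x) = 1" if "profile w' z" for z x using pw[OF that] sph norm_e3 by auto
   show "(\<lambda>k. jet_degree (w' k) (Gw (k + N'))) ----> \<rho> - jet_degree v Gv"
    unfolding w'_def by (rule LIMSEQ_ignore_initial_segment[OF dw])
  qed (rule Suc.prems(6,7) ow)+
  then obtain z Gz Kz where z: "profile w' z" "jet2 z Gz Kz" "isUCont z" "odd_degree (jet_degree z Gz)" by blast
  \<comment> \<open>Zero is the one profile of the remainder that need not come from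
    \<open>u\<close>; having degree 0, it is excluded by parity.\<close>
  have "z \<noteq> (\<lambda>x. 0)"
  proof
   assume "z = (\<lambda>x. 0)"
   with z(2) have "jet_degree z Gz = jet_degree (\<lambda>x. 0) (\<lambda>i x. 0)" using jet_degree_unique jet2_zero by blast
   also have "\<dots> = 0" by (simp add: jet_degree_def cross3_simps)
   finally show False using z(4) by (auto simp: odd_degree_def)
  qed
  then show ?thesis using pw[OF z(1)] z by blast
 qed
qed

theorem odd_degree_profile:
 assumes J: "\<And>k. jet2 (u k) (G k) (K k)" and c: "\<And>k. continuous_on UNIV (u k)"
  and E: "\<And>k. jet_energy (u k) (K k) \<le> E" and s: "\<And>k x. norm (e3 + u k x) = 1"
  and d: "(\<lambda>k. jet_degree (u k) (G k)) ----> \<rho>" "odd_degree \<rho>"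
 obtains r y v Gv Kv where "strict_mono (r :: nat \<Rightarrow> nat)" "\<And>x. (\<lambda>k. u (r k) (x + y k)) ----> v x"
  "jet2 v Gv Kv" "isUCont v" "\<And>x. norm (e3 + v x) = 1" "odd_degree (jet_degree v Gv)"
proof -
 have E0: "0 \<le> E" using order_trans[OF jet_energy_nonneg E] .
 define a where "a = (2 * pi / (E + 1))\<^sup>2 / 64"
 have a: "0 < a" using E0 by (simp add: a_def)
 have a': "a \<le> (2 * pi / (E + 1))\<^sup>2 / 64" by (simp add: a_def)
 obtain n where n: "E < of_nat n * a" using reals_Archimedean3[OF a] by blast
 have sph: "norm (e3 + v x) = 1" if p: "profile u v" for v x
 proof -
  obtain r y where "\<And>x. (\<lambda>k. u (r k) (x + y k)) ----> v x" using p by (auto simp: profile_def)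
  from tendsto_norm[OF tendsto_add[OF tendsto_const[of e3] this[of x]]] show ?thesis
   unfolding s by (simp add: LIMSEQ_const_iff)
 qed
 obtain v Gv Kv where v: "profile u v" "jet2 v Gv Kv" "isUCont v" "odd_degree (jet_degree v Gv)"
  using odd_degree_profile_induct[of u G K E n a E \<rho>, OF J c E n order_refl a a'] sph d by blast
 obtain r y where ry: "strict_mono (r :: nat \<Rightarrow> nat)" "\<And>x. (\<lambda>k. u (r k) (x + y k)) ----> v x"
  using v(1) by (auto simp: profile_def)
 show ?thesis by (rule that[OF ry v(2,3) sph[OF v(1)] v(4)])
qed

section \<open>A map of degree minus one with small energy\<close>

lemma emeasure_disc: "emeasure lborel {x::real^2. x \<bullet> x \<le> r} = ennreal (pi * r) * indicator {0..} r"
proof (cases "0 \<le> r")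
 case True
 have "{x::real^2. x \<bullet> x \<le> r} = cball 0 (sqrt r)" using True by (auto simp: norm_eq_sqrt_inner)
 then show ?thesis using True by (simp add: emeasure_cball unit_ball_vol_2)
next
 case False
 have "\<not> x \<bullet> x \<le> r" for x :: "real^2" using False inner_ge_zero[of x] by linarith
 then have "{x::real^2. x \<bullet> x \<le> r} = {}" by simp
 then show ?thesis using False by (simp add: ennreal_neg)
qed

section \<open>Radial integrals by slicing into discs\<close>

lemma inverse_power_deriv:
 assumes "0 < 1 + (r::real)"
 shows "((\<lambda>r. 1 / (1 + r) ^ n) has_real_derivative - (real n / (1 + r) ^ Suc n)) (at r)"
proof -
 have "((\<lambda>r. 1 + r) has_real_derivative 0 + 1) (at r)" by (intro DERIV_add DERIV_const DERIV_ident)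
 from DERIV_inverse'[OF this] have "((\<lambda>r. inverse (1 + r)) has_real_derivative - (inverse (1 + r))\<^sup>2) (at r)"
  using assms by (simp add: power2_eq_square)
 from DERIV_power[OF this, of n] show ?thesis
  by (cases n) (simp_all add: inverse_eq_divide power_one_over power2_eq_square mult.assoc)
qed

lemma inverse_power_limit: "((\<lambda>r::real. 1 / (1 + r) ^ (n + 1)) \<longlongrightarrow> 0) at_top"
proof (rule Lim_null_comparison)
 show "((\<lambda>r::real. inverse (1 + r)) \<longlongrightarrow> 0) at_top"
  by (intro tendsto_inverse_0_at_top filterlim_tendsto_add_at_top[OF tendsto_const filterlim_ident])
 show "\<forall>\<^sub>F r in at_top. norm (1 / (1 + r) ^ (n + 1)) \<le> inverse (1 + r :: real)" using eventually_ge_at_top[of 0]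
 proof eventually_elim
  case (elim r)
  then have "1 * (1 + r) \<le> (1 + r) ^ n * (1 + r)" by (intro mult_right_mono one_le_power) auto
  then have "1 / (1 + r) ^ (n + 1) \<le> 1 / (1 + r)" using elim by (intro divide_left_mono) (auto simp: mult.commute)
  then show ?case using elim by (simp add: inverse_eq_divide)
 qed
qed

text \<open>The integrand is the integral of minus its derivative from \<open>x \<bullet> x\<close>
  to infinity; exchanging the order of integration produces discs of area \<open>pi * r\<close> and
  a one-dimensional integral with explicit antiderivative.\<close>

lemma nn_integral_inverse_power:
 "(\<integral>\<^sup>+x. ennreal (1 / (1 + x \<bullet> x) ^ (m + 2)) \<partial>(lborel :: (real^2) measure)) = ennreal (pi / (m + 1))"
proof -
 let ?f = "\<lambda>r::real. (m + 2) / (1 + r) ^ (m + 3)"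
 have 1: "ennreal (1 / (1 + x \<bullet> x) ^ (m + 2)) = (\<integral>\<^sup>+r. ennreal (?f r) * indicator {x \<bullet> x..} r \<partial>lborel)" for x :: "real^2"
 proof -
  let ?F = "\<lambda>r::real. - 1 / (1 + r) ^ (m + 2)"
  have "(\<integral>\<^sup>+r. ennreal (?f r) * indicator {x \<bullet> x..} r \<partial>lborel) = ennreal (0 - ?F (x \<bullet> x))"
  proof (rule nn_integral_FTC_atLeast)
   fix r :: real assume "x \<bullet> x \<le> r"
   then have r: "0 < 1 + r" using inner_ge_zero[of x] by linarith
   show "(?F has_real_derivative ?f r) (at r)"
   proof -
    have "((\<lambda>r. - (1 / (1 + r) ^ (m + 2))) has_real_derivative - (- (real (m + 2) / (1 + r) ^ Suc (m + 2)))) (at r)"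
     by (rule DERIV_minus[OF inverse_power_deriv[OF r]])
    moreover have "- (- (real (m + 2) / (1 + r) ^ Suc (m + 2))) = ?f r"
     unfolding minus_minus by (simp add: numeral_3_eq_3)
    ultimately show ?thesis by (simp only: minus_divide_left)
   qed
   show "0 \<le> ?f r" using r by simp
  next
   show "(?F \<longlongrightarrow> 0) at_top" using tendsto_minus[OF inverse_power_limit[of "m + 1"]] by simp
  qed simp
  then show ?thesis by simp
 qed
 have "(\<integral>\<^sup>+x. ennreal (1 / (1 + x \<bullet> x) ^ (m + 2)) \<partial>(lborel :: (real^2) measure))
  = (\<integral>\<^sup>+x. (\<integral>\<^sup>+r. ennreal (?f r) * indicator {x \<bullet> x..} r \<partial>lborel) \<partial>(lborel :: (real^2) measure))" unfolding 1 ..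
 also have "\<dots> = (\<integral>\<^sup>+x. (\<integral>\<^sup>+r. ennreal (?f r) * indicator {(x, r). x \<bullet> x \<le> r} (x, r) \<partial>lborel) \<partial>(lborel :: (real^2) measure))"
  by (intro nn_integral_cong) (auto simp: indicator_def)
 also have "\<dots> = (\<integral>\<^sup>+r. (\<integral>\<^sup>+x. ennreal (?f r) * indicator {(x, r). x \<bullet> x \<le> r} (x, r) \<partial>(lborel :: (real^2) measure)) \<partial>lborel)"
  by (rule lborel_pair.Fubini') measurable
 also have "\<dots> = (\<integral>\<^sup>+r. ennreal (?f r) * emeasure lborel {x::real^2. x \<bullet> x \<le> r} \<partial>lborel)"
 proof (rule nn_integral_cong)
  fix r :: real
  have "(\<integral>\<^sup>+x. ennreal (?f r) * indicator {(x, r). x \<bullet> x \<le> r} (x, r) \<partial>(lborel :: (real^2) measure))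
   = (\<integral>\<^sup>+x. ennreal (?f r) * indicator {x. x \<bullet> x \<le> r} x \<partial>(lborel :: (real^2) measure))"
   by (intro nn_integral_cong) (auto simp: indicator_def)
  also have "\<dots> = ennreal (?f r) * emeasure lborel {x::real^2. x \<bullet> x \<le> r}" by (rule nn_integral_cmult_indicator) simp
  finally show "(\<integral>\<^sup>+x. ennreal (?f r) * indicator {(x, r). x \<bullet> x \<le> r} (x, r) \<partial>(lborel :: (real^2) measure))
   = ennreal (?f r) * emeasure lborel {x::real^2. x \<bullet> x \<le> r}" .
 qed
 also have "\<dots> = (\<integral>\<^sup>+r. ennreal (?f r * (pi * r)) * indicator {0..} r \<partial>lborel)" unfolding emeasure_disc
 proof (rule nn_integral_cong)
  fix r :: real
  have "ennreal (?f r * (pi * r)) = ennreal (?f r) * ennreal (pi * r)" if "0 \<le> r"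
   using that by (intro ennreal_mult) auto
  then show "ennreal (?f r) * (ennreal (pi * r) * indicator {0..} r) = ennreal (?f r * (pi * r)) * indicator {0..} r"
   by (simp only: indicator_def) (simp split: if_splits)
 qed
 \<comment> \<open>The antiderivative comes from integration by parts; it vanishes at infinity, and
   at 0 only its second summand survives, with value \<open>- pi / (m + 1)\<close>.\<close>
 also have "\<dots> = ennreal (0 - (- pi * (0 / (1 + 0) ^ (m + 2) + 1 / (real (m + 1) * (1 + 0) ^ (m + 1)))))"
 proof (rule nn_integral_FTC_atLeast)
  fix r :: real assume r0: "0 \<le> r"
  show "((\<lambda>r::real. - pi * (r / (1 + r) ^ (m + 2) + 1 / ((m + 1) * (1 + r) ^ (m + 1)))) has_real_derivative ?f r * (pi * r)) (at r)"
  proof -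
   have r: "0 < 1 + r" using r0 by simp
   have "((\<lambda>r::real. - pi * (r * (1 / (1 + r) ^ (m + 2)) + (1 / (1 + r) ^ (m + 1)) / (m + 1))) has_real_derivative
    - pi * (1 * (1 / (1 + r) ^ (m + 2)) + (- (real (m + 2) / (1 + r) ^ Suc (m + 2))) * r + (- (real (m + 1) / (1 + r) ^ Suc (m + 1))) / (m + 1))) (at r)"
    by (intro DERIV_cmult DERIV_add DERIV_mult DERIV_cdivide inverse_power_deriv r DERIV_ident)
   moreover have "- pi * (1 * (1 / (1 + r) ^ (m + 2)) + (- (real (m + 2) / (1 + r) ^ Suc (m + 2))) * r + (- (real (m + 1) / (1 + r) ^ Suc (m + 1))) / (m + 1)) = ?f r * (pi * r)"
   proof -
    have e: "Suc (m + 2) = m + 3" "Suc (m + 1) = m + 2" by simp_all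
    have "- pi * (1 * (1 / Q) + (- (a / P)) * r + (- (b / Q)) / b) = a / P * (pi * r)" if "b \<noteq> 0" for P Q a b
     using that by (simp add: algebra_simps)
    then show ?thesis unfolding e by simp
   qed
   ultimately show ?thesis by (simp add: mult.commute)
  qed
  show "0 \<le> ?f r * (pi * r)" using r0 by simp
 next
  have "((\<lambda>r::real. r / (1 + r) ^ (m + 2)) \<longlongrightarrow> 0) at_top"
  proof (rule Lim_null_comparison[OF _ inverse_power_limit[of m]])
   show "\<forall>\<^sub>F r::real in at_top. norm (r / (1 + r) ^ (m + 2)) \<le> 1 / (1 + r) ^ (m + 1)" using eventually_ge_at_top[of 0]
   proof eventually_elim
    case (elim r)
    then have "r / (1 + r) ^ (m + 2) \<le> (1 + r) / (1 + r) ^ (m + 2)" by (intro divide_right_mono) auto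
    also have "\<dots> = 1 / (1 + r) ^ (m + 1)" using elim by simp
    finally show ?case using elim by simp
   qed
  qed
  from tendsto_mult[OF tendsto_const[of "- pi"] tendsto_add[OF this tendsto_divide[OF inverse_power_limit[of m] tendsto_const[of "real (m + 1)"]]]]
  show "((\<lambda>r::real. - pi * (r / (1 + r) ^ (m + 2) + 1 / ((m + 1) * (1 + r) ^ (m + 1)))) \<longlongrightarrow> 0) at_top"
   by (simp add: mult.commute)
 qed simp
 finally show ?thesis by simp
qed

lemma inverse_power_integral:
 assumes "2 \<le> n"
 shows "integrable lborel (\<lambda>x::real^2. 1 / (1 + x \<bullet> x) ^ n)"
  "(LINT x|(lborel :: (real^2) measure). 1 / (1 + x \<bullet> x) ^ n) = pi / (real n - 1)"
proof -
 obtain m where m: "n = m + 2" using assms by (metis le_iff_add add.commute)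
 have nn: "0 \<le> 1 / (1 + x \<bullet> x) ^ n" for x :: "real^2" by (simp add: add_nonneg_nonneg)
 note N = nn_integral_inverse_power[of m, folded m]
 show i: "integrable lborel (\<lambda>x::real^2. 1 / (1 + x \<bullet> x) ^ n)" by (rule integrableI_nonneg) (use nn N in auto)
 have "ennreal (LINT x|(lborel :: (real^2) measure). 1 / (1 + x \<bullet> x) ^ n) = ennreal (pi / (m + 1))"
  unfolding N[symmetric] by (rule nn_integral_eq_integral[symmetric, OF i]) (use nn in auto)
 then show "(LINT x|(lborel :: (real^2) measure). 1 / (1 + x \<bullet> x) ^ n) = pi / (real n - 1)"
  by (simp add: ennreal_inj LINT_nonneg[OF nn] m)
qed

text \<open>The square of the bound is integrable over the plane, by the explicit integral with
  exponent 2.\<close>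

lemma L2_decay:
 fixes f :: "real^2 \<Rightarrow> 'b::euclidean_space"
 assumes f: "continuous_on UNIV f" and le: "\<And>x. norm (f x) \<le> C / (1 + x \<bullet> x)"
 shows "L2 f"
proof (rule L2_bound[where C = C])
 have "1 + x \<bullet> x \<noteq> 0" for x :: "real^2" using inner_ge_zero[of x] by linarith
 then show "L2 (\<lambda>x::real^2. 1 / (1 + x \<bullet> x))"
  using inverse_power_integral(1)[of 2] by (simp add: square_integrable_def power_divide)
 show "AE x in lborel. norm (f x) \<le> C * norm (1 / (1 + x \<bullet> x))" using le by (intro AE_I2) (simp add: abs_of_nonneg)
qed (rule borel_measurable_continuous_onI[OF f])


section \<open>Radially symmetric maps\<close>

definition plane_lift :: "real^2 \<Rightarrow> real^3" where
 "plane_lift x = vector [x $ 1, x $ 2, 0]"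

lemma plane_lift_simps [simp]: "plane_lift x $ 1 = x $ 1" "plane_lift x $ 2 = x $ 2" "plane_lift x $ 3 = 0"
 by (simp_all add: plane_lift_def)

lemma bounded_linear_plane_lift: "bounded_linear plane_lift" unfolding linear_conv_bounded_linear[symmetric]
 by (rule linearI) (simp_all add: vec_eq_iff forall_3)

lemma inner_plane: "(x::real^2) \<bullet> y = x $ 1 * y $ 1 + x $ 2 * y $ 2" by (simp add: inner_vec_def UNIV_2)

lemma norm_plane_lift [simp]: "norm (plane_lift x) = norm x"
 by (simp add: norm_eq_sqrt_inner inner_plane inner_vec_def sum_3)

text \<open>The profiles depend on \<open>x \<bullet> x\<close> rather than on the radius, so that
  the map is as regular at the origin as the profiles are, and its derivatives are polynomial in the
  coordinates and the derivatives of the profiles.\<close>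

locale radial_profile =
 fixes A A1 A2 B B1 B2 :: "real \<Rightarrow> real"
 assumes A: "\<And>s. 0 \<le> s \<Longrightarrow> (A has_real_derivative A1 s) (at s)" "\<And>s. 0 \<le> s \<Longrightarrow> (A1 has_real_derivative A2 s) (at s)"
  and B: "\<And>s. 0 \<le> s \<Longrightarrow> (B has_real_derivative B1 s) (at s)" "\<And>s. 0 \<le> s \<Longrightarrow> (B1 has_real_derivative B2 s) (at s)"
  and c2: "continuous_on {0..} A2" "continuous_on {0..} B2"
begin

definition radial_map :: "real^2 \<Rightarrow> real^3" where
 "radial_map x = A (x \<bullet> x) *R plane_lift x + B (x \<bullet> x) *R e3"

definition radial_gradient :: "2 \<Rightarrow> real^2 \<Rightarrow> real^3" where
 "radial_gradient i x = A (x \<bullet> x) *R plane_lift (axis i 1) + (2 * x $ i * A1 (x \<bullet> x)) *R plane_lift x + (2 * x $ i * B1 (x \<bullet> x)) *R e3"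

definition radial_hessian :: "2 \<Rightarrow> 2 \<Rightarrow> real^2 \<Rightarrow> real^3" where
 "radial_hessian i j x = (2 * x $ j * A1 (x \<bullet> x)) *R plane_lift (axis i 1)
  + (2 * (if i = j then 1 else 0) * A1 (x \<bullet> x) + 4 * x $ i * x $ j * A2 (x \<bullet> x)) *R plane_lift x
  + (2 * x $ i * A1 (x \<bullet> x)) *R plane_lift (axis j 1)
  + (2 * (if i = j then 1 else 0) * B1 (x \<bullet> x) + 4 * x $ i * x $ j * B2 (x \<bullet> x)) *R e3"

lemma radial_continuous:
 "f \<in> {A, A1, A2, B, B1, B2} \<Longrightarrow> continuous_on UNIV (\<lambda>x::real^2. f (x \<bullet> x))"
proof -
 assume f: "f \<in> {A, A1, A2, B, B1, B2}"
 have "continuous_on {0..} f" if "\<And>s. 0 \<le> s \<Longrightarrow> (f has_real_derivative g s) (at s)" for f g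
  by (rule continuous_at_imp_continuous_on) (use that DERIV_isCont in auto)
 then have "continuous_on {0..} f" using f A B c2 by blast
 then show "continuous_on UNIV (\<lambda>x::real^2. f (x \<bullet> x))"
  by (rule continuous_on_compose2) (auto intro!: continuous_intros)
qed

lemma radial_map_continuous: "continuous_on UNIV radial_map"
 and radial_gradient_continuous: "continuous_on UNIV (radial_gradient i)"
 and radial_hessian_continuous: "continuous_on UNIV (radial_hessian i j)"
proof -
 have p: "continuous_on UNIV (\<lambda>x. plane_lift x)" by (rule linear_continuous_on[OF bounded_linear_plane_lift])
 show "continuous_on UNIV radial_map" unfolding radial_map_def[abs_def]
  by (intro continuous_intros radial_continuous p) simp_all
 show "continuous_on UNIV (radial_gradient i)" unfolding radial_gradient_def[abs_def]
  by (intro continuous_intros radial_continuous p) simp_all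
 show "continuous_on UNIV (radial_hessian i j)" unfolding radial_hessian_def[abs_def]
  by (intro continuous_intros radial_continuous p) simp_all
qed

lemma line_radial:
 fixes x :: "real^2" and t :: real
 assumes f: "\<And>s. 0 \<le> s \<Longrightarrow> (f has_real_derivative g s) (at s)"
 shows "((\<lambda>t. f ((x + t *R axis i 1) \<bullet> (x + t *R axis i 1))) has_real_derivative
  2 * (x + t *R axis i 1) $ i * g ((x + t *R axis i 1) \<bullet> (x + t *R axis i 1))) (at t)"
proof -
 have e: "(x + t *R axis i 1) \<bullet> (x + t *R axis i 1) = x \<bullet> x + 2 * t * x $ i + t * t" for t
  by (simp add: inner_add_left inner_add_right inner_axis inner_commute[of "axis i 1"] axis_def[of i 1, symmetric] algebra_simps)
 have "((\<lambda>t. (x + t *R axis i 1) \<bullet> (x + t *R axis i 1)) has_real_derivative 2 * (x + t *R axis i 1) $ i) (at t)"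
  unfolding e by (auto intro!: derivative_eq_intros simp: axis_def)
 from DERIV_chain2[OF f[OF inner_ge_zero] this] show ?thesis by (simp add: mult_ac)
qed

lemma line_lift:
 "((\<lambda>t. plane_lift (x + t *R axis i 1)) has_vector_derivative plane_lift (axis i 1)) (at t)"
proof -
 have "((\<lambda>t. x + t *R axis i 1 :: real^2) has_vector_derivative axis i 1) (at t)"
  by (auto intro!: derivative_eq_intros)
 then show ?thesis by (rule bounded_linear.has_vector_derivative[OF bounded_linear_plane_lift])
qed

lemma line_coordinate:
 "((\<lambda>t. (x + t *R axis j (1::real) :: real^2) $ i) has_real_derivative (if i = j then 1 else 0)) (at t)"
 by (auto intro!: derivative_eq_intros simp: axis_def)

lemma radial_gradient_line:
 "((\<lambda>t. radial_map (x + t *R axis i 1)) has_vector_derivative radial_gradient i (x + t *R axis i 1)) (at t)"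
proof -
 let ?y = "\<lambda>t. x + t *R axis i 1" and ?s = "\<lambda>t. (x + t *R axis i 1) \<bullet> (x + t *R axis i 1)"
 have "((\<lambda>t. A (?s t) *R plane_lift (?y t) + B (?s t) *R e3) has_vector_derivative
  (A (?s t) *R plane_lift (axis i 1) + (2 * ?y t $ i * A1 (?s t)) *R plane_lift (?y t)) +
  (B (?s t) *R 0 + (2 * ?y t $ i * B1 (?s t)) *R e3)) (at t)"
  by (intro has_vector_derivative_add has_vector_derivative_scaleR line_radial A B line_lift has_vector_derivative_const)
 then show ?thesis unfolding radial_map_def radial_gradient_def by simp
qed

lemma radial_hessian_line:
 "((\<lambda>t. radial_gradient i (x + t *R axis j 1)) has_vector_derivative radial_hessian i j (x + t *R axis j 1)) (at t)"
proof -
 let ?y = "\<lambda>t. x + t *R axis j 1" and ?s = "\<lambda>t. (x + t *R axis j 1) \<bullet> (x + t *R axis j 1)"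
 have m: "((\<lambda>t. 2 * ?y t $ i * f (?s t)) has_real_derivative
   (2 * (if i = j then 1 else 0) * f (?s t) + 4 * ?y t $ i * ?y t $ j * g (?s t))) (at t)"
  if "\<And>s. 0 \<le> s \<Longrightarrow> (f has_real_derivative g s) (at s)" for f g
  by (rule DERIV_cong[OF DERIV_mult[OF DERIV_cmult[OF line_coordinate[of x j i t], of 2] line_radial[of f g x j t, OF that]]])
    (simp_all add: algebra_simps)
 have "((\<lambda>t. A (?s t) *R plane_lift (axis i 1) + (2 * ?y t $ i * A1 (?s t)) *R plane_lift (?y t) + (2 * ?y t $ i * B1 (?s t)) *R e3) has_vector_derivative
  (A (?s t) *R 0 + (2 * ?y t $ j * A1 (?s t)) *R plane_lift (axis i 1)) +
  ((2 * ?y t $ i * A1 (?s t)) *R plane_lift (axis j 1) + (2 * (if i = j then 1 else 0) * A1 (?s t) + 4 * ?y t $ i * ?y t $ j * A2 (?s t)) *R plane_lift (?y t)) +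
  ((2 * ?y t $ i * B1 (?s t)) *R 0 + (2 * (if i = j then 1 else 0) * B1 (?s t) + 4 * ?y t $ i * ?y t $ j * B2 (?s t)) *R e3)) (at t)"
  by (intro has_vector_derivative_add has_vector_derivative_scaleR line_radial A B line_lift has_vector_derivative_const m)
 then show ?thesis unfolding radial_gradient_def radial_hessian_def by (simp add: add_ac)
qed

lemma radial_jet2:
 assumes "\<And>x. norm (radial_map x) \<le> C / (1 + x \<bullet> x)" "\<And>i x. norm (radial_gradient i x) \<le> C / (1 + x \<bullet> x)"
  "\<And>i j x. norm (radial_hessian i j x) \<le> C / (1 + x \<bullet> x)"
 shows "jet2 radial_map radial_gradient radial_hessian" unfolding jet2_def
 by (intro conjI allI L2_decay[OF radial_map_continuous assms(1)] L2_decay[OF radial_gradient_continuous assms(2)]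
   L2_decay[OF radial_hessian_continuous assms(3)]
   has_weak_partial_classical radial_map_continuous radial_gradient_continuous radial_hessian_continuous radial_gradient_line radial_hessian_line)

lemma radial_laplacian:
 "(\<Sum>i\<in>UNIV. radial_hessian i i x) =
  (8 * A1 (x \<bullet> x) + 4 * (x \<bullet> x) * A2 (x \<bullet> x)) *R plane_lift x + (4 * B1 (x \<bullet> x) + 4 * (x \<bullet> x) * B2 (x \<bullet> x)) *R e3"
proof -
 define a1 a2 b1 b2 where "a1 = A1 (x \<bullet> x)" "a2 = A2 (x \<bullet> x)" "b1 = B1 (x \<bullet> x)" "b2 = B2 (x \<bullet> x)"
 show ?thesis unfolding radial_hessian_def a1_a2_b1_b2_def[symmetric] UNIV_2 inner_plane
  by (simp add: vec_eq_iff forall_3 e3_components axis_def algebra_simps)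
qed

lemma radial_triple:
 "(e3 + radial_map x) \<bullet> cross3 (radial_gradient 1 x) (radial_gradient 2 x) =
  (1 + B (x \<bullet> x)) * A (x \<bullet> x) * (A (x \<bullet> x) + 2 * (x \<bullet> x) * A1 (x \<bullet> x)) - 2 * (x \<bullet> x) * (A (x \<bullet> x))\<^sup>2 * B1 (x \<bullet> x)"
proof -
 define a a1 b b1 where "a = A (x \<bullet> x)" "a1 = A1 (x \<bullet> x)" "b = B (x \<bullet> x)" "b1 = B1 (x \<bullet> x)"
 show ?thesis unfolding radial_map_def radial_gradient_def a_a1_b_b1_def[symmetric] inner_plane
  by (simp add: inner_vec_def sum_3 cross3_def e3_components axis_def algebra_simps power2_eq_square)
qed

lemma radial_norm:
 "(norm (c *R plane_lift x + d *R e3))\<^sup>2 = (x \<bullet> x) * c\<^sup>2 + d\<^sup>2" unfolding power2_norm_eq_inner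
 by (simp add: inner_vec_def sum_3 e3_components inner_plane UNIV_2 algebra_simps power2_eq_square)

end


text \<open>The third component of the map is \<open>1 - 2 / (1 + s)^2\<close>, and
  \<open>prof_A\<close> is then forced by unit length:
  \<open>s * A^2 = 4 * s * (s + 2) / (1 + s)^4\<close>. The inverse stereographic projection, with
  \<open>1 - 2 / (1 + s)\<close>, would not do: its deviation fails to be square integrable over the
  plane.\<close>

definition prof_A :: "real \<Rightarrow> real" where "prof_A s = 2 * sqrt (s + 2) / (1 + s)^2"
definition prof_A1 :: "real \<Rightarrow> real" where "prof_A1 s = - (3 * s + 7) / (sqrt (s + 2) * (1 + s)^3)"
definition prof_A2 :: "real \<Rightarrow> real" where "prof_A2 s = (15 * s\<^sup>2 + 70 * s + 79) / (2 * (s + 2) * sqrt (s + 2) * (1 + s)^4)"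
definition prof_B :: "real \<Rightarrow> real" where "prof_B s = - 2 / (1 + s)^2"
definition prof_B1 :: "real \<Rightarrow> real" where "prof_B1 s = 4 / (1 + s)^3"
definition prof_B2 :: "real \<Rightarrow> real" where "prof_B2 s = - 12 / (1 + s)^4"

lemma prof_deriv_B:
 assumes "0 \<le> s"
 shows "(prof_B has_real_derivative prof_B1 s) (at s)" "(prof_B1 has_real_derivative prof_B2 s) (at s)"
proof -
 have r: "0 < 1 + s" using assms by simp
 show "(prof_B has_real_derivative prof_B1 s) (at s)" using DERIV_cmult[OF inverse_power_deriv[OF r, of 2], of "-2"]
  unfolding prof_B_def[abs_def] prof_B1_def by (simp add: numeral_eq_Suc)
 show "(prof_B1 has_real_derivative prof_B2 s) (at s)" using DERIV_cmult[OF inverse_power_deriv[OF r, of 3], of "4"]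
  unfolding prof_B1_def[abs_def] prof_B2_def by (simp add: numeral_eq_Suc)
qed

lemma prof_deriv_A:
 assumes "0 \<le> s"
 shows "(prof_A has_real_derivative prof_A1 s) (at s)" "(prof_A1 has_real_derivative prof_A2 s) (at s)"
proof -
 have r: "0 < 1 + s" using assms by simp
 define q where "q = sqrt (s + 2)"
 define t where "t = 1 + s"
 have qt: "0 < q" "0 < t" "q * q = t + 1" "s = t - 1" using assms by (auto simp: q_def t_def)
 have ds: "((\<lambda>s. sqrt (s + 2)) has_real_derivative inverse q / 2) (at s)"
  unfolding q_def using assms by (auto intro!: derivative_eq_intros)
 have di: "((\<lambda>s. inverse (sqrt (s + 2))) has_real_derivative - (inverse q * (inverse q / 2) * inverse q)) (at s)"
  using DERIV_inverse'[OF ds] qt(1) by (simp add: q_def)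
 have "((\<lambda>s. 2 * (sqrt (s + 2) * (1 / (1 + s)^2))) has_real_derivative 2 * (inverse q / 2 * (1 / t^2) + - (2 / t ^ 3) * q)) (at s)"
  using DERIV_cmult[OF DERIV_mult[OF ds inverse_power_deriv[OF r, of 2]], of 2] by (simp add: q_def t_def numeral_3_eq_3)
 moreover have "2 * (inverse q / 2 * (1 / t^2) + - (2 / t ^ 3) * q) = prof_A1 s"
 proof -
  have "2 * (inverse q / 2 * (1 / t^2) + - (2 / t ^ 3) * q) = (t - 4 * (q * q)) / (q * t ^ 3)"
   using qt(1,2) by (simp add: divide_simps power2_eq_square power3_eq_cube)
  also have "t - 4 * (q * q) = - (3 * s + 7)" unfolding qt(3) t_def by simp
  finally show ?thesis unfolding prof_A1_def q_def t_def .
 qed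
 ultimately show "(prof_A has_real_derivative prof_A1 s) (at s)" by (simp add: prof_A_def[abs_def])
 have d3: "((\<lambda>s. - (3 * s + 7)) has_real_derivative - 3) (at s)" by (auto intro!: derivative_eq_intros)
 have "((\<lambda>s. - (3 * s + 7) * (inverse (sqrt (s + 2)) * (1 / (1 + s)^3))) has_real_derivative
  - 3 * (inverse q * (1 / t ^ 3)) + (- (inverse q * (inverse q / 2) * inverse q) * (1 / t ^ 3) + - (3 / t ^ 4) * inverse q) * (- (3 * s + 7))) (at s)"
  using DERIV_mult[OF d3 DERIV_mult[OF di inverse_power_deriv[OF r, of 3]]] by (simp add: q_def t_def numeral_eq_Suc)
 moreover have "- 3 * (inverse q * (1 / t ^ 3)) + (- (inverse q * (inverse q / 2) * inverse q) * (1 / t ^ 3) + - (3 / t ^ 4) * inverse q) * (- (3 * s + 7)) = prof_A2 s"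
 proof -
  have "- 3 * (inverse q * (1 / t ^ 3)) + (- (inverse q * (inverse q / 2) * inverse q) * (1 / t ^ 3) + - (3 / t ^ 4) * inverse q) * (- c)
   = (- 6 * (q * q) * t + c * t + 6 * c * (q * q)) / (2 * (q * q) * q * t ^ 4)" for c
   using qt(1,2) by (simp add: field_simps power4_eq_xxxx power3_eq_cube)
  from this[of "3 * s + 7"] have "- 3 * (inverse q * (1 / t ^ 3)) + (- (inverse q * (inverse q / 2) * inverse q) * (1 / t ^ 3) + - (3 / t ^ 4) * inverse q) * (- (3 * s + 7))
   = (- 6 * (t + 1) * t + (3 * s + 7) * t + 6 * (3 * s + 7) * (t + 1)) / (2 * (t + 1) * q * t ^ 4)" unfolding qt(3) .
  also have "- 6 * (t + 1) * t + (3 * s + 7) * t + 6 * (3 * s + 7) * (t + 1) = 15 * s\<^sup>2 + 70 * s + 79"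
   by (simp add: t_def algebra_simps power2_eq_square)
  finally show ?thesis by (simp add: prof_A2_def q_def t_def add.commute)
 qed
 moreover have "- (3 * s + 7) * (inverse (sqrt (s + 2)) * (1 / (1 + s)^3)) = prof_A1 s" for s
  by (simp only: prof_A1_def inverse_eq_divide times_divide_times_eq times_divide_eq_right mult_1_right divide_divide_eq_left)
 ultimately show "(prof_A1 has_real_derivative prof_A2 s) (at s)" by (simp only:)
qed

lemma prof_continuous: "continuous_on {0..} prof_A2" "continuous_on {0..} prof_B2"
 unfolding prof_A2_def[abs_def] prof_B2_def[abs_def] by (auto intro!: continuous_intros)

interpretation test: radial_profile prof_A prof_A1 prof_A2 prof_B prof_B1 prof_B2
 by unfold_locales (rule prof_deriv_A prof_deriv_B prof_continuous, assumption?)+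

text \<open>In the jet of the map the profiles are multiplied by powers of the norm of
  \<open>x\<close>, that is of \<open>sqrt s\<close>; these are the combinations that occur, all
  with the decay required for square integrability.\<close>

lemma prof_bounds:
 assumes s: "0 \<le> s"
 defines "t \<equiv> 1 + s"
 shows "\<bar>prof_A s\<bar> * sqrt s \<le> 4 / t" "\<bar>prof_A s\<bar> \<le> 4 / t" "\<bar>prof_A1 s\<bar> * s \<le> 14 / t"
  "\<bar>prof_A1 s\<bar> * sqrt s \<le> 7 / t" "\<bar>prof_A2 s\<bar> * (s * sqrt s) \<le> 40 / t"
  "\<bar>prof_B s\<bar> \<le> 2 / t" "\<bar>prof_B1 s\<bar> * sqrt s \<le> 4 / t" "\<bar>prof_B1 s\<bar> \<le> 4 / t" "\<bar>prof_B2 s\<bar> * s \<le> 12 / t"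
proof -
 define q where "q = sqrt (s + 2)"
 have t: "1 \<le> t" "s = t - 1" "s \<le> t" using s by (auto simp: t_def)
 have q: "1 \<le> q" "q * q = t + 1" "sqrt s \<le> q" using s by (auto simp: q_def t_def)
 have q2: "q \<le> 2 * t" "q * q \<le> 2 * t"
 proof -
  show 2: "q * q \<le> 2 * t" using t q by simp
  have "q * 1 \<le> q * q" using q by (intro mult_left_mono) auto
  then show "q \<le> 2 * t" using 2 by simp
 qed
 have sq: "sqrt s * sqrt s = s" using s by simp
 have s0: "0 \<le> sqrt s" using s by simp
 have st: "sqrt s \<le> t"
 proof (rule real_le_lsqrt)
  have "1 * t \<le> t * t" using t by (intro mult_right_mono) auto
  then show "s \<le> t\<^sup>2" using t(3) by (simp add: power2_eq_square)
 qed (use t s in auto)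
 have inv: "1 / t ^ Suc n \<le> 1 / t" for n
 proof -
  have "t * 1 \<le> t * t ^ n" using t by (intro mult_left_mono one_le_power) auto
  then show ?thesis using t by (intro divide_left_mono) auto
 qed
 have i2: "1 / t ^ 2 \<le> 1 / t" and i3: "1 / t ^ 3 \<le> 1 / t" and i4: "1 / t ^ 4 \<le> 1 / t"
  using inv[of 1] inv[of 2] inv[of 3] by (simp_all add: numeral_eq_Suc)
 have A: "\<bar>prof_A s\<bar> = 2 * q / t^2" using s by (simp add: prof_A_def q_def t_def)
 have A1: "\<bar>prof_A1 s\<bar> \<le> 7 / (q * t^2)"
 proof -
  have "\<bar>prof_A1 s\<bar> = (3 * s + 7) / (q * t^3)" using s by (simp add: prof_A1_def q_def t_def abs_mult abs_divide)
  also have "\<dots> \<le> (7 * t) / (q * t^3)" using q t by (intro divide_right_mono) auto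
  also have "\<dots> = 7 / (q * t^2)" using t q by (simp add: power2_eq_square power3_eq_cube)
  finally show ?thesis .
 qed
 have A2: "\<bar>prof_A2 s\<bar> \<le> 40 / (q * q * q * t^2)"
 proof -
  have "\<bar>prof_A2 s\<bar> = (15 * s\<^sup>2 + 70 * s + 79) / (2 * (q * q * q) * t^4)"
   using s by (simp add: prof_A2_def q_def t_def abs_mult abs_divide add_nonneg_nonneg mult.assoc)
  also have "\<dots> \<le> (80 * t^2) / (2 * (q * q * q) * t^4)"
  proof (rule divide_right_mono)
   have "0 \<le> s * s" by simp
   then show "15 * s\<^sup>2 + 70 * s + 79 \<le> 80 * t^2" using s by (simp add: t_def power2_eq_square algebra_simps)
   show "0 \<le> 2 * (q * q * q) * t^4" using q(1) t(1) by simp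
  qed
  also have "\<dots> = 40 / (q * q * q * t^2)" using t q by (simp add: power2_eq_square power4_eq_xxxx)
  finally show ?thesis .
 qed
 have q0: "0 < q" "0 < t" using q t by auto
 show "\<bar>prof_A s\<bar> * sqrt s \<le> 4 / t"
 proof -
  have "\<bar>prof_A s\<bar> * sqrt s \<le> 2 * q / t^2 * q" unfolding A using q q0 by (intro mult_left_mono) auto
  also have "\<dots> = 2 * (q * q) / t^2" by simp
  also have "\<dots> \<le> 2 * (2 * t) / t^2" using q2 q0 by (intro divide_right_mono mult_left_mono) auto
  also have "\<dots> = 4 / t" using q0 by (simp add: power2_eq_square)
  finally show ?thesis .
 qed
 show "\<bar>prof_A s\<bar> \<le> 4 / t"
 proof -
  have "2 * q / t^2 \<le> 2 * (2 * t) / t^2" using q2 q0 by (intro divide_right_mono mult_left_mono) auto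
  also have "\<dots> = 4 / t" using q0 by (simp add: power2_eq_square)
  finally show ?thesis unfolding A .
 qed
 show "\<bar>prof_A1 s\<bar> * s \<le> 14 / t"
 proof -
  have "s \<le> q * q" using t q by simp
  with A1 have "\<bar>prof_A1 s\<bar> * s \<le> 7 / (q * t^2) * (q * q)" using q0 s by (intro mult_mono) auto
  also have "\<dots> = 7 * q / t^2" using q0 by simp
  also have "\<dots> \<le> 7 * (2 * t) / t^2" using q2 q0 by (intro divide_right_mono mult_left_mono) auto
  also have "\<dots> = 14 / t" using q0 by (simp add: power2_eq_square)
  finally show ?thesis .
 qed
 show "\<bar>prof_A1 s\<bar> * sqrt s \<le> 7 / t"
 proof -
  have "\<bar>prof_A1 s\<bar> * sqrt s \<le> 7 / (q * t^2) * q" using A1 q q0 s by (intro mult_mono) auto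
  also have "\<dots> = 7 * (1 / t^2)" using q0 by simp
  also have "\<dots> \<le> 7 * (1 / t)" by (intro mult_left_mono i2) simp
  finally show ?thesis by simp
 qed
 show "\<bar>prof_A2 s\<bar> * (s * sqrt s) \<le> 40 / t"
 proof -
  have "s * sqrt s \<le> (q * q) * q" using q t s by (intro mult_mono) auto
  then have "\<bar>prof_A2 s\<bar> * (s * sqrt s) \<le> 40 / (q * q * q * t^2) * ((q * q) * q)"
   by (rule mult_mono[OF A2]) (use q0 s in auto)
  also have "\<dots> = 40 * (1 / t^2)" using q0 by simp
  also have "\<dots> \<le> 40 * (1 / t)" by (intro mult_left_mono i2) simp
  finally show ?thesis by simp
 qed
 have B: "\<bar>prof_B s\<bar> = 2 * (1 / t^2)" "\<bar>prof_B1 s\<bar> = 4 * (1 / t^3)" "\<bar>prof_B2 s\<bar> = 12 * (1 / t^4)"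
  using s by (simp_all add: prof_B_def prof_B1_def prof_B2_def t_def abs_divide)
 show "\<bar>prof_B s\<bar> \<le> 2 / t" unfolding B using i2 by simp
 show "\<bar>prof_B1 s\<bar> \<le> 4 / t" unfolding B using i3 by simp
 show "\<bar>prof_B1 s\<bar> * sqrt s \<le> 4 / t"
 proof -
  have "4 * (1 / t^3) * sqrt s \<le> 4 * (1 / t^3) * t" using st q0 by (intro mult_left_mono) auto
  also have "\<dots> = 4 * (1 / t^2)" using q0 by (simp add: power2_eq_square power3_eq_cube)
  finally show ?thesis unfolding B using i2 by simp
 qed
 show "\<bar>prof_B2 s\<bar> * s \<le> 12 / t"
 proof -
  have "12 * (1 / t^4) * s \<le> 12 * (1 / t^4) * t" using t q0 by (intro mult_left_mono) auto
  also have "\<dots> = 12 * (1 / t^3)" using q0 by (simp add: power4_eq_xxxx power3_eq_cube)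
  finally show ?thesis unfolding B using i3 by simp
 qed
qed


definition test_map :: "real^2 \<Rightarrow> real^3" where "test_map = test.radial_map"
definition test_gradient where "test_gradient = test.radial_gradient"
definition test_hessian where "test_hessian = test.radial_hessian"

lemma test_jet: "jet2 test_map test_gradient test_hessian"
 and test_continuous: "continuous_on UNIV test_map"
proof -
 show "continuous_on UNIV test_map" unfolding test_map_def by (rule test.radial_map_continuous)
 have nl: "norm (c *R plane_lift y) = \<bar>c\<bar> * norm y" "norm (c *R e3) = \<bar>c\<bar>" for c and y by (simp_all add: norm_e3)
 \<comment> \<open>The hessian is decisive: its four terms contribute at most 14, 174, 14 and 56
   times \<open>1 / (1 + x \<bullet> x)\<close>, which add up to 258.\<close>
 have b: "norm (test.radial_map x) \<le> 258 / (1 + x \<bullet> x)"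
  "norm (test.radial_gradient i x) \<le> 258 / (1 + x \<bullet> x)"
  "norm (test.radial_hessian i j x) \<le> 258 / (1 + x \<bullet> x)" for i j x
 proof -
  define s where "s = x \<bullet> x"
  have s: "0 \<le> s" "norm x = sqrt s" by (simp_all add: s_def norm_eq_sqrt_inner)
  have ss: "sqrt s * sqrt s = s" using s by simp
  have xi: "\<bar>x $ i\<bar> \<le> sqrt s" for i using component_le_norm_cart[of x i] s by simp
  define T where "T = 1 / (1 + s)"
  have T: "0 < T" using s by (simp add: T_def)
  have pb: "\<bar>prof_A s\<bar> * sqrt s \<le> 4 * T" "\<bar>prof_A s\<bar> \<le> 4 * T" "\<bar>prof_A1 s\<bar> * s \<le> 14 * T"
   "\<bar>prof_A1 s\<bar> * sqrt s \<le> 7 * T" "\<bar>prof_A2 s\<bar> * (s * sqrt s) \<le> 40 * T"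
   "\<bar>prof_B s\<bar> \<le> 2 * T" "\<bar>prof_B1 s\<bar> * sqrt s \<le> 4 * T" "\<bar>prof_B1 s\<bar> \<le> 4 * T" "\<bar>prof_B2 s\<bar> * s \<le> 12 * T"
   using prof_bounds[OF s(1)] by (simp_all add: T_def)
  have c1: "\<bar>2 * x $ i * f s\<bar> \<le> 2 * (\<bar>f s\<bar> * sqrt s)" for f :: "real \<Rightarrow> real" and i
   using mult_right_mono[OF xi[of i], of "\<bar>f s\<bar>"] by (simp add: abs_mult mult.commute)
  have c2: "\<bar>2 * (if i = j then 1 else 0) * f s + 4 * x $ i * x $ j * g s\<bar> \<le> 2 * \<bar>f s\<bar> + 4 * (\<bar>g s\<bar> * s)" for f g :: "real \<Rightarrow> real" and i j
  proof -
   have "\<bar>x $ i\<bar> * \<bar>x $ j\<bar> \<le> sqrt s * sqrt s" by (intro mult_mono xi) (use s in auto)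
   then have "\<bar>g s\<bar> * (\<bar>x $ i\<bar> * \<bar>x $ j\<bar>) \<le> \<bar>g s\<bar> * s" unfolding ss by (intro mult_left_mono) auto
   then have "\<bar>4 * x $ i * x $ j * g s\<bar> \<le> 4 * (\<bar>g s\<bar> * s)" by (simp add: abs_mult mult_ac)
   moreover have "\<bar>2 * (if i = j then 1 else 0) * f s\<bar> \<le> 2 * \<bar>f s\<bar>" by (simp add: abs_mult)
   ultimately show ?thesis by linarith
  qed
  have ax: "norm (axis i (1::real) :: real^2) = 1" for i by simp
  have "norm (test.radial_map x) \<le> \<bar>prof_A s\<bar> * sqrt s + \<bar>prof_B s\<bar>" unfolding test.radial_map_def s_def[symmetric]
   by (rule order_trans[OF norm_triangle_ineq]) (simp only: nl s(2))
  with pb(1,6) T have "norm (test.radial_map x) \<le> 258 * T" by linarith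
  then show "norm (test.radial_map x) \<le> 258 / (1 + x \<bullet> x)" by (simp add: T_def s_def)
  have "norm (test.radial_gradient i x) \<le>
   \<bar>prof_A s\<bar> + \<bar>2 * x $ i * prof_A1 s\<bar> * sqrt s + \<bar>2 * x $ i * prof_B1 s\<bar>"
   unfolding test.radial_gradient_def s_def[symmetric]
   by (rule order_trans[OF norm_triangle_ineq] add_mono order_refl)+ (simp_all only: nl s(2) ax mult_1_right order_refl)
  moreover have "\<bar>2 * x $ i * prof_A1 s\<bar> * sqrt s \<le> 2 * (\<bar>prof_A1 s\<bar> * s)"
   using mult_right_mono[OF c1[of i prof_A1], of "sqrt s"] s by (simp add: mult.assoc)
  ultimately have "norm (test.radial_gradient i x) \<le> 258 * T" using pb(2,3,7) c1[of i prof_B1] T by linarith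
  then show "norm (test.radial_gradient i x) \<le> 258 / (1 + x \<bullet> x)" by (simp add: T_def s_def)
  have "norm (test.radial_hessian i j x) \<le>
   \<bar>2 * x $ j * prof_A1 s\<bar> + \<bar>2 * (if i = j then 1 else 0) * prof_A1 s + 4 * x $ i * x $ j * prof_A2 s\<bar> * sqrt s
   + \<bar>2 * x $ i * prof_A1 s\<bar> + \<bar>2 * (if i = j then 1 else 0) * prof_B1 s + 4 * x $ i * x $ j * prof_B2 s\<bar>"
   unfolding test.radial_hessian_def s_def[symmetric]
   by (rule order_trans[OF norm_triangle_ineq] add_mono order_refl)+ (simp_all only: nl s(2) ax mult_1_right order_refl)
  moreover have "\<bar>2 * (if i = j then 1 else 0) * prof_A1 s + 4 * x $ i * x $ j * prof_A2 s\<bar> * sqrt s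
   \<le> 2 * (\<bar>prof_A1 s\<bar> * sqrt s) + 4 * (\<bar>prof_A2 s\<bar> * (s * sqrt s))"
   using mult_right_mono[OF c2[of i j prof_A1 prof_A2], of "sqrt s"] s by (simp only: distrib_right mult.assoc) simp
  ultimately have "norm (test.radial_hessian i j x) \<le> 258 * T"
   using pb(4,5,8,9) c1[of i prof_A1] c1[of j prof_A1] c2[of i j prof_B1 prof_B2] T by linarith
  then show "norm (test.radial_hessian i j x) \<le> 258 / (1 + x \<bullet> x)" by (simp add: T_def s_def)
 qed
 show "jet2 test_map test_gradient test_hessian"
  unfolding test_map_def test_gradient_def test_hessian_def by (rule test.radial_jet2[OF b])
qed

lemma test_values:
 fixes x :: "real^2"
 defines "t \<equiv> 1 + x \<bullet> x"
 shows "norm (e3 + test_map x) = 1" "(norm (test_map x))\<^sup>2 = 4 * (1 / t ^ 2)"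
  "(e3 + test_map x) \<bullet> cross3 (test_gradient 1 x) (test_gradient 2 x) = - 8 * (1 / t ^ 3)"
  "(norm (\<Sum>i\<in>UNIV. test_hessian i i x))\<^sup>2 \<le>
   1682 * (1 / t ^ 7) - 1682 * (1 / t ^ 8) + 18 * (1 / t ^ 3) + 256 * (4 * (1 / t ^ 6) - 12 * (1 / t ^ 7) + 9 * (1 / t ^ 8))"
proof -
 define s where "s = x \<bullet> x"
 have s: "0 \<le> s" by (simp add: s_def)
 have t: "1 \<le> t" "s = t - 1" using s by (auto simp: t_def s_def)
 define q where "q = sqrt (s + 2)"
 have "q * q = s + 2" using s by (simp add: q_def)
 then have q: "0 < q" "q * q = t + 1" using s by (auto simp: q_def t(2))
 have P: "prof_A s = 2 * q / t^2" "prof_A1 s = - (3 * s + 7) / (q * t^3)" "prof_A2 s = (15 * s\<^sup>2 + 70 * s + 79) / (2 * (q * q) * q * t^4)"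
  "prof_B s = - 2 / t^2" "prof_B1 s = 4 / t^3" "prof_B2 s = - 12 / t^4"
 proof -
  have e: "1 + s = t" "s + 2 = q * q" using q(2) by (simp_all add: t)
  have "sqrt (q * q) = q" using q(1) by simp
  note e = e this
  show "prof_A s = 2 * q / t^2" "prof_A1 s = - (3 * s + 7) / (q * t^3)" "prof_A2 s = (15 * s\<^sup>2 + 70 * s + 79) / (2 * (q * q) * q * t^4)"
   "prof_B s = - 2 / t^2" "prof_B1 s = 4 / t^3" "prof_B2 s = - 12 / t^4"
   unfolding prof_A_def prof_A1_def prof_A2_def prof_B_def prof_B1_def prof_B2_def e by (rule refl)+
 qed
 have t0: "0 < t" using t by simp
 have ts: "t * t = s * (t + 1) + 1" by (simp add: t algebra_simps)
 have "(norm (e3 + test_map x))\<^sup>2 = s * (prof_A s)\<^sup>2 + (1 + prof_B s)\<^sup>2"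
  using test.radial_norm[of "prof_A s" x "1 + prof_B s"]
  unfolding test_map_def test.radial_map_def s_def[symmetric] by (simp add: algebra_simps)
 also have "\<dots> = (4 * (s * (q * q)) + (t * t - 2) * (t * t - 2)) / t^4"
  unfolding P using t0 by (simp add: field_simps power2_eq_square power4_eq_xxxx)
 also have "4 * (s * (q * q)) + (t * t - 2) * (t * t - 2) = t ^ 4"
  unfolding q(2) t(2) by (simp add: algebra_simps power4_eq_xxxx)
 finally have "(norm (e3 + test_map x))\<^sup>2 = 1" using t0 by simp
 moreover have "norm (e3 + test_map x) = sqrt ((norm (e3 + test_map x))\<^sup>2)" by simp
 ultimately show "norm (e3 + test_map x) = 1" by simp
 have "(norm (test_map x))\<^sup>2 = s * (prof_A s)\<^sup>2 + (prof_B s)\<^sup>2"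
  unfolding test_map_def test.radial_map_def test.radial_norm s_def ..
 also have "\<dots> = (4 * (s * (q * q)) + 4) / t^4"
  unfolding P using t0 by (simp add: field_simps power2_eq_square power4_eq_xxxx)
 also have "4 * (s * (q * q)) + 4 = 4 * (t * t)" unfolding q(2) ts by simp
 also have "4 * (t * t) / t^4 = 4 * (1 / t ^ 2)" using t0 by (simp add: power2_eq_square power4_eq_xxxx)
 finally show "(norm (test_map x))\<^sup>2 = 4 * (1 / t ^ 2)" .
 have "(e3 + test_map x) \<bullet> cross3 (test_gradient 1 x) (test_gradient 2 x) =
  (1 + prof_B s) * prof_A s * (prof_A s + 2 * s * prof_A1 s) - 2 * s * (prof_A s)\<^sup>2 * prof_B1 s"
  unfolding test_map_def test_gradient_def test.radial_triple s_def ..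
 also have "\<dots> = ((t * t - 2) * (4 * (q * q) * t - 4 * (s * (3 * s + 7))) - 32 * (s * (q * q))) / t^7"
 proof -
  have "(1 + - 2 / t^2) * (2 * q / t^2) * (2 * q / t^2 + 2 * s * (- c / (q * t^3))) - 2 * s * (2 * q / t^2)\<^sup>2 * (4 / t^3)
   = ((t * t - 2) * (4 * (q * q) * t - 4 * (s * c)) - 32 * (s * (q * q))) / t^7" for c
   using q(1) t0 by (simp add: field_simps power_numeral_reduce power2_eq_square)
  then show ?thesis unfolding P .
 qed
 also have "(t * t - 2) * (4 * (q * q) * t - 4 * (s * (3 * s + 7))) - 32 * (s * (q * q)) = - 8 * t ^ 4"
  unfolding q(2) t(2) by (simp add: algebra_simps power4_eq_xxxx)
 also have "- 8 * t ^ 4 / t ^ 7 = - 8 * (1 / t ^ 3)" using t0 by (simp add: power_numeral_reduce)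
 finally show "(e3 + test_map x) \<bullet> cross3 (test_gradient 1 x) (test_gradient 2 x) = - 8 * (1 / t ^ 3)" .
 have "(norm (\<Sum>i\<in>UNIV. test_hessian i i x))\<^sup>2 = s * (8 * prof_A1 s + 4 * s * prof_A2 s)\<^sup>2 + (4 * prof_B1 s + 4 * s * prof_B2 s)\<^sup>2"
  unfolding test_hessian_def test.radial_laplacian test.radial_norm s_def ..
 also have "s * (8 * prof_A1 s + 4 * s * prof_A2 s)\<^sup>2 \<le> 1682 * (1 / t ^ 7) - 1682 * (1 / t ^ 8) + 18 * (1 / t ^ 3)"
 proof -
  \<comment> \<open>After cancellation the tangential factor of the Laplacian is
    \<open>M / (q * t^4)\<close>. Since \<open>q * q\<close> is at least 2, the value of
    \<open>M\<close> lies between -58 and \<open>6 * s^2\<close>, so its square is at most the sum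
    of the two squares.\<close>
  define M where "M = 6 * s\<^sup>2 - 58 + 4 / (q * q)"
  have "8 * prof_A1 s + 4 * s * prof_A2 s = (2 * s * (15 * s\<^sup>2 + 70 * s + 79) - 8 * (q * q) * t * (3 * s + 7)) / (q * q * q * t^4)"
  proof -
   have "8 * (- c / (q * t^3)) + 4 * s * (d / (2 * (q * q) * q * t^4)) = (2 * s * d - 8 * (q * q) * t * c) / (q * q * q * t^4)" for c d
    using q(1) t0 by (simp add: field_simps power_numeral_reduce)
   then show ?thesis unfolding P .
  qed
  also have "2 * s * (15 * s\<^sup>2 + 70 * s + 79) - 8 * (q * q) * t * (3 * s + 7) = (6 * s\<^sup>2 - 58) * (q * q) + 4"
   unfolding q(2) t(2) by (simp add: algebra_simps power2_eq_square)
  also have "((6 * s\<^sup>2 - 58) * (q * q) + 4) / (q * q * q * t^4) = M / (q * t^4)"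
   using q(1) t0 by (simp add: M_def field_simps)
  finally have "s * (8 * prof_A1 s + 4 * s * prof_A2 s)\<^sup>2 = s * M\<^sup>2 / ((q * q) * t ^ 8)"
   by (simp add: power2_eq_square power_numeral_reduce)
  also have "\<dots> \<le> s * M\<^sup>2 / (2 * t ^ 8)" using s t0 q t by (intro divide_left_mono mult_right_mono) auto
  also have "\<dots> \<le> s * (58\<^sup>2 + (6 * s\<^sup>2)\<^sup>2) / (2 * t ^ 8)"
  proof (intro divide_right_mono mult_left_mono)
   have f: "0 \<le> 4 / (q * q)" "4 / (q * q) \<le> 2" using q t by (auto simp: pos_divide_le_eq)
   have m: "M \<le> 6 * s\<^sup>2" "- M \<le> 58" using f zero_le_power2[of s] unfolding M_def by linarith+
   show "M\<^sup>2 \<le> 58\<^sup>2 + (6 * s\<^sup>2)\<^sup>2"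
   proof (cases "0 \<le> M")
    case True
    then have "M\<^sup>2 \<le> (6 * s\<^sup>2)\<^sup>2" by (rule power_mono[OF m(1)])
    then show ?thesis by simp
   next
    case False
    then have "(- M)\<^sup>2 \<le> 58\<^sup>2" using m by (intro power_mono) auto
    moreover have "0 \<le> (6 * s\<^sup>2)\<^sup>2" by simp
    ultimately show ?thesis unfolding power2_minus by linarith
   qed
  qed (use s t0 in auto)
  \<comment> \<open>Here \<open>58^2 / 2 = 1682\<close> and \<open>6^2 / 2 = 18\<close>; the factor
    \<open>s = t - 1\<close> in the first part is expanded to reach pure powers of
    \<open>t\<close>.\<close>
  also have "\<dots> = 1682 * (1 / t ^ 7) - 1682 * (1 / t ^ 8) + 18 * (s ^ 5 / t ^ 8)"
  proof -
   have "1682 * (1 / t ^ 7) - 1682 * (1 / t ^ 8) = 1682 * (s / t ^ 8)"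
    unfolding t(2) using t0 by (simp add: diff_divide_distrib power_numeral_reduce)
   then show ?thesis by (simp add: power_numeral_reduce power2_eq_square distrib_left add_divide_distrib)
  qed
  also have "s ^ 5 / t ^ 8 \<le> t ^ 5 / t ^ 8" using s t t0 by (intro divide_right_mono power_mono) auto
  also have "t ^ 5 / t ^ 8 = 1 / t ^ 3" using t0 by (simp add: power_numeral_reduce)
  finally show ?thesis by simp
 qed
 also have "(4 * prof_B1 s + 4 * s * prof_B2 s)\<^sup>2 = 256 * (4 * (1 / t ^ 6) - 12 * (1 / t ^ 7) + 9 * (1 / t ^ 8))"
 proof -
  have "4 * prof_B1 s + 4 * s * prof_B2 s = 16 * (3 - 2 * t) / t ^ 4"
   unfolding P unfolding t(2) using t0 by (simp add: field_simps power_numeral_reduce)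
  then have "(4 * prof_B1 s + 4 * s * prof_B2 s)\<^sup>2 = 256 * ((3 - 2 * t) * (3 - 2 * t)) / t ^ 8"
   by (simp only: power_divide power_mult_distrib flip: power_mult) (simp add: power2_eq_square)
  also have "\<dots> = 256 * (4 * (1 / t ^ 6) - 12 * (1 / t ^ 7) + 9 * (1 / t ^ 8))"
   using t0 by (simp add: field_simps power_numeral_reduce)
  finally show ?thesis .
 qed
 finally show "(norm (\<Sum>i\<in>UNIV. test_hessian i i x))\<^sup>2 \<le>
   1682 * (1 / t ^ 7) - 1682 * (1 / t ^ 8) + 18 * (1 / t ^ 3) + 256 * (4 * (1 / t ^ 6) - 12 * (1 / t ^ 7) + 9 * (1 / t ^ 8))" by simp
qed


section \<open>Degree and energy under dilations\<close>

lemma l2_affine: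
 fixes f :: "real^2 \<Rightarrow> 'b::euclidean_space"
 assumes c: "c \<noteq> 0" and f[measurable]: "f \<in> borel_measurable borel"
 shows "(l2 (\<lambda>x. f (a + c *R x)))\<^sup>2 = (l2 f)\<^sup>2 / c\<^sup>2" unfolding l2_power2
 by (subst integral_affine[OF c, where f = "\<lambda>x. (norm (f x))\<^sup>2"]) (auto simp: inverse_eq_divide)

lemma jet_degree_affine:
 assumes c: "c \<noteq> 0" and J: "jet2 u G K"
 shows "jet_degree (\<lambda>x. u (a + c *R x)) (\<lambda>i x. c *R G i (a + c *R x)) = jet_degree u G"
proof -
 note JD = jet2D[OF J]
 note [measurable] = JD(1,3)[THEN L2_measurable]
 let ?F = "\<lambda>x. (e3 + u x) \<bullet> cross3 (G 1 x) (G 2 x)"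
 have m: "?F \<in> borel_measurable borel" by measurable
 have "(LINT x|lborel. (e3 + u (a + c *R x)) \<bullet> cross3 (c *R G 1 (a + c *R x)) (c *R G 2 (a + c *R x)))
  = (LINT x|lborel. c\<^sup>2 * ?F (a + c *R x))"
  by (simp add: cross_mult_left cross_mult_right power2_eq_square mult.assoc)
 also have "\<dots> = c\<^sup>2 * ((1 / \<bar>c\<bar> ^ DIM(real^2)) *R (LINT x|lborel. ?F x))"
  by (subst integral_mult_right_zero) (simp only: integral_affine[OF c m])
 also have "\<dots> = (LINT x|lborel. ?F x)" using c by simp
 finally show ?thesis unfolding jet_degree_def by simp
qed

lemma jet_energy_affine:
 assumes c: "c \<noteq> 0" and J: "jet2 u G K"
 shows "jet_energy (\<lambda>x. u (a + c *R x)) (\<lambda>i j x. (c * c) *R K i j (a + c *R x)) =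
  ((l2 u)\<^sup>2 / c\<^sup>2 + c\<^sup>2 * (l2 (\<lambda>x. \<Sum>i\<in>UNIV. K i i x))\<^sup>2) / 2"
proof -
 note JD = jet2D[OF J]
 note [measurable] = JD(1,5)[THEN L2_measurable]
 have "(\<lambda>x. \<Sum>i\<in>UNIV. (c * c) *R K i i (a + c *R x)) = (\<lambda>x. (c * c) *R (\<lambda>x. \<Sum>i\<in>UNIV. K i i x) (a + c *R x))"
  by (simp add: scaleR_sum_right)
 then have "(l2 (\<lambda>x. \<Sum>i\<in>UNIV. (c * c) *R K i i (a + c *R x)))\<^sup>2 = (c * c)\<^sup>2 * (l2 (\<lambda>x. (\<lambda>x. \<Sum>i\<in>UNIV. K i i x) (a + c *R x)))\<^sup>2"
  by (simp only: l2_scaleR power_mult_distrib power2_abs)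
 also have "\<dots> = (c * c)\<^sup>2 * ((l2 (\<lambda>x. \<Sum>i\<in>UNIV. K i i x))\<^sup>2 / c\<^sup>2)" by (subst l2_affine[OF c]) simp_all
 also have "\<dots> = c\<^sup>2 * (l2 (\<lambda>x. \<Sum>i\<in>UNIV. K i i x))\<^sup>2" using c by (simp add: power2_eq_square)
 finally show ?thesis unfolding jet_energy_def by (subst l2_affine[OF c]) simp_all
qed

lemma test_integrals:
 "(l2 test_map)\<^sup>2 = 4 * pi" "(l2 (\<lambda>x. \<Sum>i\<in>UNIV. test_hessian i i x))\<^sup>2 \<le> 72 * pi" "jet_degree test_map test_gradient = - 1"
proof -
 let ?P = "\<lambda>n x. 1 / (1 + (x::real^2) \<bullet> x) ^ n"
 note I = inverse_power_integral
 note JD = jet2D[OF test_jet]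
 have "(l2 test_map)\<^sup>2 = (LINT x|lborel. 4 * ?P 2 x)" unfolding l2_power2 test_values(2) ..
 then show "(l2 test_map)\<^sup>2 = 4 * pi" by (simp only: integral_mult_right_zero I(2)[OF order_refl]) simp
 have "jet_degree test_map test_gradient = 1 / (4 * pi) * (LINT x|lborel. - 8 * ?P 3 x)"
  unfolding jet_degree_def test_values(3) ..
 moreover have "(LINT x|lborel. - 8 * ?P 3 x) = - 8 * (pi / 2)" by (subst integral_mult_right_zero, subst I(2)) auto
 ultimately show "jet_degree test_map test_gradient = - 1" by simp
 let ?H = "\<lambda>x. 1682 * ?P 7 x - 1682 * ?P 8 x + 18 * ?P 3 x + 256 * (4 * ?P 6 x - 12 * ?P 7 x + 9 * ?P 8 x)"
 have n: "2 \<le> (3::nat)" "2 \<le> (6::nat)" "2 \<le> (7::nat)" "2 \<le> (8::nat)" by simp_all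
 have iP: "integrable lborel (\<lambda>x. c * ?P n x)" if "2 \<le> n" for c n by (rule integrable_mult_right[OF I(1)[OF that]])
 have j: "integrable lborel (\<lambda>x. 4 * ?P 6 x - 12 * ?P 7 x)" "integrable lborel (\<lambda>x. 4 * ?P 6 x - 12 * ?P 7 x + 9 * ?P 8 x)"
  "integrable lborel (\<lambda>x. 1682 * ?P 7 x - 1682 * ?P 8 x)" "integrable lborel (\<lambda>x. 1682 * ?P 7 x - 1682 * ?P 8 x + 18 * ?P 3 x)"
  by (intro LINT_integrable_add Bochner_Integration.integrable_diff iP n)+
 have k: "integrable lborel (\<lambda>x. 256 * (4 * ?P 6 x - 12 * ?P 7 x + 9 * ?P 8 x))" by (rule integrable_mult_right[OF j(2)])
 have "(l2 (\<lambda>x. \<Sum>i\<in>UNIV. test_hessian i i x))\<^sup>2 = (LINT x|lborel. (norm (\<Sum>i\<in>UNIV. test_hessian i i x))\<^sup>2)"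
  by (rule l2_power2)
 also have "\<dots> \<le> (LINT x|lborel. ?H x)"
 proof (rule integral_mono[OF _ _ test_values(4)])
  show "integrable lborel (\<lambda>x. (norm (\<Sum>i\<in>UNIV. test_hessian i i x))\<^sup>2)" by (intro integrable_power2 L2_sum JD)
  show "integrable lborel ?H" by (rule LINT_integrable_add[OF j(4) k])
 qed
 also have "\<dots> = 1682 * (pi / 6) - 1682 * (pi / 7) + 18 * (pi / 2) + 256 * (4 * (pi / 5) - 12 * (pi / 6) + 9 * (pi / 7))"
  unfolding LINT_add[OF j(4) k] LINT_add[OF j(3) iP[OF n(1)]]
   Bochner_Integration.integral_diff[OF iP[OF n(3)] iP[OF n(4)]] integral_mult_right_zero
   LINT_add[OF j(1) iP[OF n(4)]] Bochner_Integration.integral_diff[OF iP[OF n(2)] iP[OF n(3)]]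
   I(2)[OF n(1)] I(2)[OF n(2)] I(2)[OF n(3)] I(2)[OF n(4)] by simp
 \<comment> \<open>The sum is about \<open>70.99 * pi\<close>: the three groups give about 40.05, 9
   and 21.94 times \<open>pi\<close>.\<close>
 also have "\<dots> \<le> 72 * pi" by (simp add: field_simps)
 finally show "(l2 (\<lambda>x. \<Sum>i\<in>UNIV. test_hessian i i x))\<^sup>2 \<le> 72 * pi" .
qed

text \<open>The dilation balances the two terms of the energy; the undilated map does not meet the bound.\<close>

theorem small_energy_jet:
 obtains u G K where "jet2 u G K" "isUCont u" "\<And>x. norm (e3 + u x) = 1"
  "jet_degree u G = - 1" "jet_energy u K < 24 * pi"
proof -
 \<comment> \<open>For \<open>c^2 = 1/2\<close> the bound on the energy becomes
   \<open>(8 + 36) * pi / 2 = 22 * pi\<close>.\<close>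
 define c :: real where "c = 1 / sqrt 2"
 have c: "c \<noteq> 0" "c\<^sup>2 = 1 / 2" by (simp_all add: c_def power_divide)
 define u where "u x = test_map (0 + c *R x)" for x
 define G where "G i x = c *R test_gradient i (0 + c *R x)" for i x
 define K where "K i j x = (c * c) *R test_hessian i j (0 + c *R x)" for i j x
 have J: "jet2 u G K"
  using jet2_affine[OF c(1) test_jet, of 0] unfolding u_def[abs_def] G_def[abs_def] K_def[abs_def] .
 have cont: "continuous_on UNIV u"
  unfolding u_def by (rule continuous_on_compose2[OF test_continuous]) (auto intro!: continuous_intros)
 have uc: "isUCont u" by (rule pointwise_limit_hoelder(2)[OF jet_bounded_energy[OF J order_refl] cont tendsto_const])
 have s: "norm (e3 + u x) = 1" for x unfolding u_def by (rule test_values(1))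
 have d: "jet_degree u G = - 1"
  using jet_degree_affine[OF c(1) test_jet, of 0] test_integrals(3) unfolding u_def[abs_def] G_def[abs_def] by simp
 have "jet_energy u K = ((4 * pi) / (1 / 2) + 1 / 2 * (l2 (\<lambda>x. \<Sum>i\<in>UNIV. test_hessian i i x))\<^sup>2) / 2"
  using jet_energy_affine[OF c(1) test_jet, of 0] unfolding u_def[abs_def] K_def[abs_def] test_integrals(1) c(2) .
 also have "\<dots> \<le> ((4 * pi) / (1 / 2) + 1 / 2 * (72 * pi)) / 2"
  using test_integrals(2) by (intro divide_right_mono add_left_mono mult_left_mono) auto
 also have "\<dots> < 24 * pi" by simp
 finally have "jet_energy u K < 24 * pi" .
 with that J uc s d show ?thesis by blast
qed

section \<open>Compactness of minimizing sequences\<close>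

abbreviation deviation :: "plane_map \<Rightarrow> plane_map" where
 "deviation m \<equiv> \<lambda>x. m x - e3"

abbreviation gradient :: "plane_map \<Rightarrow> 2 \<Rightarrow> plane_map" where
 "gradient m \<equiv> \<lambda>i. weak_partial i m"

abbreviation hessian :: "plane_map \<Rightarrow> 2 \<Rightarrow> 2 \<Rightarrow> plane_map" where
 "hessian m \<equiv> \<lambda>i j. weak_partial j (weak_partial i m)"

lemma weak_partial_deviation: "weak_partial i (deviation m) = weak_partial i m"
 using has_weak_partial_add_const[of i m "- e3"] by (simp add: weak_partial_def)

lemma admissible_jet:
 assumes "m \<in> admissible"
 shows "jet2 (deviation m) (gradient m) (hessian m)" "isUCont (deviation m)"
  "norm (e3 + deviation m x) = 1"
proof -
 show "jet2 (deviation m) (gradient m) (hessian m)"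
  using assms jet2_weak_partial[of "deviation m"] by (simp add: admissible_def weak_partial_deviation)
 show "isUCont (deviation m)"
  using assms by (auto simp: admissible_def intro!: uniformly_continuous_on_diff uniformly_continuous_on_const)
 show "norm (e3 + deviation m x) = 1" using assms by (simp add: admissible_def)
qed

lemma degree_Q_jet: "degree_Q m = jet_degree (deviation m) (gradient m)" by (simp add: degree_Q_def jet_degree_def)

lemma F0_jet:
 assumes "m \<in> admissible"
 shows "F0 m = jet_energy (deviation m) (hessian m)"
proof -
 note J = jet2D[OF admissible_jet(1)[OF assms]]
 have "F0 m = 1/2 * ((LINT x|lborel. (norm (weak_laplacian m x))\<^sup>2) + (LINT x|lborel. (norm (m x - e3))\<^sup>2))"
  unfolding F0_def weak_laplacian_def by (subst LINT_add) (intro integrable_power2 L2_sum J refl)+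
 then show ?thesis by (simp add: jet_energy_def l2_power2 weak_laplacian_def)
qed

lemma dirichlet_jet:
 assumes "m \<in> admissible"
 shows "dirichlet m = ((l2 (weak_partial 1 m))\<^sup>2 + (l2 (weak_partial 2 m))\<^sup>2) / 2"
proof -
 note J = jet2D[OF admissible_jet(1)[OF assms]]
 have "dirichlet m = 1/2 * ((LINT x|lborel. (norm (weak_partial 1 m x))\<^sup>2) + (LINT x|lborel. (norm (weak_partial 2 m x))\<^sup>2))"
  unfolding dirichlet_def grad_sq_def UNIV_2 by (simp, subst LINT_add) (intro integrable_power2 J refl)+
 then show ?thesis by (simp add: l2_power2)
qed

text \<open>Converts the jet formulation back to the functionals of the statement, whose values are
  insensitive to the chosen representatives of the derivatives.\<close>

lemma jet_admissible:
 assumes J: "jet2 u G K" and uc: "isUCont u" and s: "\<And>x. norm (e3 + u x) = 1"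
 defines "m \<equiv> \<lambda>x. e3 + u x"
 shows "m \<in> admissible" "degree_Q m = jet_degree u G" "F0 m = jet_energy u K"
  "dirichlet m = ((l2 (G 1))\<^sup>2 + (l2 (G 2))\<^sup>2) / 2"
proof -
 have d: "deviation m = u" by (simp add: m_def)
 show m: "m \<in> admissible" unfolding admissible_def
  using s uc jet2_sobolev_H[OF J] by (auto simp: d m_def intro!: uniformly_continuous_on_add uniformly_continuous_on_const)
 note J' = admissible_jet(1)[OF m, unfolded d]
 show "degree_Q m = jet_degree u G" unfolding degree_Q_jet d by (rule jet_degree_unique[OF J' J])
 show "F0 m = jet_energy u K" unfolding F0_jet[OF m] d by (rule jet_energy_unique[OF J' J])
 have "weak_partial i m = weak_partial i u" for i using weak_partial_deviation[of i m] by (simp only: d)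
 then show "dirichlet m = ((l2 (G 1))\<^sup>2 + (l2 (G 2))\<^sup>2) / 2"
  unfolding dirichlet_jet[OF m] by (simp only: jet2_l2(1)[OF J])
qed

text \<open>The interpolation of the gradient between deviation and Laplacian. The factor 1/2 is the
  reason for the threshold \<open>H = 1/4\<close>, where \<open>sqrt H = 1/2\<close>.\<close>

lemma dirichlet_le_F0:
 assumes "m \<in> admissible"
 shows "dirichlet m \<le> F0 m / 2" "0 \<le> F0 m" "0 \<le> dirichlet m"
 using gradient_le_energy[OF admissible_jet(1)[OF assms]] jet_energy_nonneg[of "deviation m" "hessian m"]
 unfolding dirichlet_jet[OF assms] F0_jet[OF assms] by auto

text \<open>The Laplacian controls all second derivatives and interpolation controls the gradient,
  so energies tending to zero mean convergence to zero in H2.\<close>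

lemma H2_norm_le_energy:
 fixes w :: "real^2 \<Rightarrow> 'b::euclidean_space"
 assumes J: "jet2 w G K"
 shows "(H2_norm w)\<^sup>2 \<le> 5 * jet_energy w K"
proof -
 have "(H2_norm w)\<^sup>2 = (l2 w)\<^sup>2 + ((l2 (G 1))\<^sup>2 + (l2 (G 2))\<^sup>2) + (l2 (\<lambda>x. \<Sum>i\<in>UNIV. K i i x))\<^sup>2"
  unfolding sobolev_representative_bounds(1)[OF jet2_sobolev_H[OF J]] jet2_l2[OF J] hessian_l2[OF J] by (simp add: UNIV_2)
 note eq = this
 have "h \<le> 5 * ((a + c) / 2)" if "h = a + g + c" "g \<le> (a + c) / 2" "0 \<le> a" "0 \<le> c" for a c g h :: real
  using that by (simp add: field_simps)
 from this[OF eq gradient_le_energy[OF J, unfolded jet_energy_def] zero_le_power2 zero_le_power2]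
 show ?thesis unfolding jet_energy_def .
qed

section \<open>The infimum of the limit problem\<close>

lemma F0_bdd_below: "bdd_below (F0 ` admissible_neg1)"
 by (rule bdd_belowI2[of _ 0]) (auto simp: admissible_neg1_def intro: dirichlet_le_F0(2))

lemma I_hat_le: "n \<in> admissible_neg1 \<Longrightarrow> I_hat_neg1_0 \<le> F0 n"
 unfolding I_hat_neg1_0_def by (rule cINF_lower[OF F0_bdd_below])

lemma I_hat_bound: "admissible_neg1 \<noteq> {}" "I_hat_neg1_0 < 24 * pi"
proof -
 obtain u G K where u: "jet2 u G K" "isUCont u" "\<And>x. norm (e3 + u x) = 1"
  "jet_degree u G = - 1" "jet_energy u K < 24 * pi" by (rule small_energy_jet) (rule that)
 note a = jet_admissible[OF u(1-3)]
 have n: "(\<lambda>x. e3 + u x) \<in> admissible_neg1" using a(1,2) u(4) by (simp add: admissible_neg1_def)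
 then show "admissible_neg1 \<noteq> {}" by blast
 show "I_hat_neg1_0 < 24 * pi" using I_hat_le[OF n] a(3) u(5) by simp
qed

text \<open>Reflecting the target instead of the plane acts on the whole jet by one linear isometry
  that fixes \<open>e3\<close>; it preserves the energy and reverses the sign of the degree.\<close>

definition reflect :: "real^3 \<Rightarrow> real^3" where
 "reflect v = vector [v $ 1, - v $ 2, v $ 3]"

lemma reflect_props:
 "bounded_linear reflect" "reflect v \<bullet> reflect w = v \<bullet> w" "reflect e3 = e3"
 "reflect a \<bullet> cross3 (reflect b) (reflect c) = - (a \<bullet> cross3 b c)"
proof -
 have r: "reflect v $ 1 = v $ 1" "reflect v $ 2 = - v $ 2" "reflect v $ 3 = v $ 3" for v
  by (simp_all add: reflect_def)
 show "bounded_linear reflect"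
  unfolding linear_conv_bounded_linear[symmetric] by (rule linearI) (simp_all add: vec_eq_iff forall_3 r)
 show "reflect v \<bullet> reflect w = v \<bullet> w" by (simp add: inner_vec_def sum_3 r)
 show "reflect e3 = e3" by (simp add: vec_eq_iff forall_3 r e3_components)
 show "reflect a \<bullet> cross3 (reflect b) (reflect c) = - (a \<bullet> cross3 b c)"
  by (simp add: inner_vec_def sum_3 cross3_def r algebra_simps)
qed

lemma jet_reflect:
 assumes J: "jet2 u G K"
 shows "jet2 (\<lambda>x. reflect (u x)) (\<lambda>i x. reflect (G i x)) (\<lambda>i j x. reflect (K i j x))"
  "jet_degree (\<lambda>x. reflect (u x)) (\<lambda>i x. reflect (G i x)) = - jet_degree u G"
  "jet_energy (\<lambda>x. reflect (u x)) (\<lambda>i j x. reflect (K i j x)) = jet_energy u K"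
proof -
 interpret R: bounded_linear reflect by (rule reflect_props)
 have n: "norm (reflect v) = norm v" for v by (simp add: norm_eq_sqrt_inner reflect_props)
 show "jet2 (\<lambda>x. reflect (u x)) (\<lambda>i x. reflect (G i x)) (\<lambda>i j x. reflect (K i j x))"
  by (rule jet2_bounded_linear[OF reflect_props(1) J])
 have e: "e3 + reflect v = reflect (e3 + v)" for v by (simp add: R.add reflect_props)
 show "jet_degree (\<lambda>x. reflect (u x)) (\<lambda>i x. reflect (G i x)) = - jet_degree u G"
  unfolding jet_degree_def e reflect_props(4) by simp
 show "jet_energy (\<lambda>x. reflect (u x)) (\<lambda>i j x. reflect (K i j x)) = jet_energy u K"
  unfolding jet_energy_def l2_def R.sum[symmetric] n ..
qed

theorem minimizing_sequence_compact:
 assumes n: "\<And>k. n k \<in> admissible_neg1" and lim: "(\<lambda>k. F0 (n k)) ----> I_hat_neg1_0"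
 obtains r y N where "strict_mono (r :: nat \<Rightarrow> nat)" "N \<in> minimizers_G"
  "\<And>k. sobolev_H 2 (\<lambda>x. n (r k) (x + y k) - N x)"
  "(\<lambda>k. H2_norm (\<lambda>x. n (r k) (x + y k) - N x)) ----> 0"
proof -
 have adm: "n k \<in> admissible" "degree_Q (n k) = - 1" for k using n by (auto simp: admissible_neg1_def)
 note A = admissible_jet[OF adm(1)]
 obtain E where E: "\<And>k. F0 (n k) \<le> E"
  using convergent_imp_Bseq[OF convergentI[OF lim]] unfolding Bseq_def by (metis abs_le_D1 real_norm_def)
 have dQ: "jet_degree (deviation (n k)) (gradient (n k)) = - 1" for k using adm by (simp add: degree_Q_jet)
 have E': "jet_energy (deviation (n k)) (hessian (n k)) \<le> E" for k using E[of k] F0_jet[OF adm(1)] by simp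
 have ca: "continuous_on UNIV (deviation (n k))" for k by (rule uniformly_continuous_imp_continuous[OF A(2)])
 have od1: "odd_degree (- 1)" unfolding odd_degree_def by (intro exI[of _ "- 1"]) simp
 have ld: "(\<lambda>k. jet_degree (deviation (n k)) (gradient (n k))) ----> - 1" unfolding dQ by simp
 obtain r y v Gv Kv where r: "strict_mono (r :: nat \<Rightarrow> nat)" and lv: "\<And>x. (\<lambda>k. deviation (n (r k)) (x + y k)) ----> v x"
  and Jv: "jet2 v Gv Kv" and ucv: "isUCont v" and sv: "\<And>x. norm (e3 + v x) = 1"
  and od: "odd_degree (jet_degree v Gv)"
  by (rule odd_degree_profile[where u = "\<lambda>k. deviation (n k)" and G = "\<lambda>k. gradient (n k)" and K = "\<lambda>k. hessian (n k)", OF A(1) ca E' A(3) ld od1]) (rule that)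
 obtain w Gw Kw M where Jb: "\<And>k. jet_bounded M (w k) (Gw k) (Kw k)" and cw: "\<And>k. continuous_on UNIV (w k)"
  and w: "\<And>k x. w k x = deviation (n (r k)) (x + y k) - v x"
  and ds: "(\<lambda>k. - 1 - jet_degree (w k) (Gw k)) ----> jet_degree v Gv"
  and es: "(\<lambda>k. F0 (n (r k)) - jet_energy (w k) (Kw k)) ----> jet_energy v Kv"
  by (rule profile_split[where u = "\<lambda>k. deviation (n k)" and G = "\<lambda>k. gradient (n k)" and K = "\<lambda>k. hessian (n k)" and r = r and y = y,
     OF A(1) ca E' lv Jv ucv, unfolded dQ F0_jet[OF adm(1), symmetric]]) (rule that)
 note Jw = jet_boundedD(1)[OF Jb]
 have lF: "(\<lambda>k. F0 (n (r k))) ----> I_hat_neg1_0" using LIMSEQ_subseq_LIMSEQ[OF lim r] by (simp add: o_def)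
 have ew: "(\<lambda>k. jet_energy (w k) (Kw k)) ----> I_hat_neg1_0 - jet_energy v Kv" using tendsto_diff[OF lF es] by simp
 have up: "jet_energy v Kv \<le> I_hat_neg1_0" using LIMSEQ_le_const[OF ew, of 0] jet_energy_nonneg by auto
 obtain d :: int where d: "odd d" "jet_degree v Gv = of_int d" using od by (auto simp: odd_degree_def)
 \<comment> \<open>The splitting leaves the profile at most the energy \<open>I_hat_neg1_0\<close>,
   which lies below \<open>24 * pi\<close>; odd degrees of modulus 3 or more are thus
   impossible.\<close>
 have "\<bar>jet_degree v Gv\<bar> \<le> jet_energy v Kv / (8 * pi)" by (rule jet_degree_sphere_le[OF Jv sv])
 also have "\<dots> < 3" using up I_hat_bound(2) by (simp add: pos_divide_less_eq)
 finally have "\<bar>d\<bar> < 3" unfolding d(2) by simp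
 with d(1) have "d = 0 \<or> d = 1 \<or> d = - 1 \<or> d = 2 \<or> d = - 2" by linarith
 with d have d1: "jet_degree v Gv = 1 \<or> jet_degree v Gv = - 1" by auto
 \<comment> \<open>At this stage degree 1 is still possible; the reflected profile then competes
   with the same energy.\<close>
 have "I_hat_neg1_0 \<le> jet_energy v Kv"
 proof (cases "jet_degree v Gv = - 1")
  case True
  note a = jet_admissible[OF Jv ucv sv]
  have "(\<lambda>x. e3 + v x) \<in> admissible_neg1" using a True by (simp add: admissible_neg1_def)
  from I_hat_le[OF this] show ?thesis unfolding a(3) .
 next
  case False
  note R = jet_reflect[OF Jv]
  interpret L: bounded_linear reflect by (rule reflect_props)
  have e: "e3 + reflect v = reflect (e3 + v)" for v by (simp add: L.add reflect_props)
  have "isUCont (\<lambda>x. reflect (v x))" by (rule L.uniformly_continuous_on[OF ucv])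
  moreover have "norm (e3 + reflect (v x)) = 1" for x using sv[of x] by (simp add: e norm_eq_sqrt_inner reflect_props)
  ultimately have a: "(\<lambda>x. e3 + reflect (v x)) \<in> admissible" "degree_Q (\<lambda>x. e3 + reflect (v x)) = - jet_degree v Gv"
   "F0 (\<lambda>x. e3 + reflect (v x)) = jet_energy v Kv" using jet_admissible[OF R(1)] R(2,3) by auto
  have "(\<lambda>x. e3 + reflect (v x)) \<in> admissible_neg1" using a d1 False by (simp add: admissible_neg1_def)
  from I_hat_le[OF this] show ?thesis unfolding a(3) .
 qed
 with up have Ev: "jet_energy v Kv = I_hat_neg1_0" by simp
 then have ew0: "(\<lambda>k. jet_energy (w k) (Kw k)) ----> 0" using ew by simp
 \<comment> \<open>With all energy in the profile the remainder has no degree left in the limit,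
   which excludes degree 1 after the fact.\<close>
 have "(\<lambda>k. jet_degree (w k) (Gw k)) ----> 0"
 proof (rule Lim_null_comparison)
  show "\<forall>\<^sub>F k in sequentially. norm (jet_degree (w k) (Gw k)) \<le> 4 * M / (8 * pi) * jet_energy (w k) (Kw k)"
   using jet_degree_le[OF Jw sup_bound_bounded[OF Jb cw]] by (intro always_eventually) auto
  show "(\<lambda>k. 4 * M / (8 * pi) * jet_energy (w k) (Kw k)) ----> 0" by (rule tendsto_mult_right_zero[OF ew0])
 qed
 from tendsto_diff[OF tendsto_const[of "- 1"] this] have "(\<lambda>k. - 1 - jet_degree (w k) (Gw k)) ----> - 1" by simp
 then have dv: "jet_degree v Gv = - 1" by (rule LIMSEQ_unique[OF ds])
 define N where "N = (\<lambda>x. e3 + v x)"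
 note a = jet_admissible[OF Jv ucv sv]
 have N: "N \<in> minimizers_G" using a dv Ev by (simp add: minimizers_G_def admissible_neg1_def N_def)
 have wN: "(\<lambda>x. n (r k) (x + y k) - N x) = w k" for k by (auto simp: w N_def)
 have "(\<lambda>k. H2_norm (w k)) ----> 0"
 proof (rule Lim_null_comparison)
  show "\<forall>\<^sub>F k in sequentially. norm (H2_norm (w k)) \<le> sqrt (5 * jet_energy (w k) (Kw k))"
   using H2_norm_le_energy[OF Jw] by (intro always_eventually allI) (simp add: real_le_rsqrt abs_le_square_iff)
  show "(\<lambda>k. sqrt (5 * jet_energy (w k) (Kw k))) ----> 0"
   using tendsto_real_sqrt[OF tendsto_mult_right_zero[OF ew0, of 5]] by simp
 qed
 then show ?thesis using that[OF r N, of y] jet2_sobolev_H[OF Jw] unfolding wN by blast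
qed

text \<open>The Dirichlet energy ignores translations and is continuous in H2, so the centres drop
  out.\<close>

lemma minimizing_dirichlet:
 assumes n: "\<And>k. n k \<in> admissible_neg1" and r: "N \<in> minimizers_G"
  and s: "\<And>k. sobolev_H 2 (\<lambda>x. n (r k) (x + y k) - N x)"
  and lim: "(\<lambda>k. H2_norm (\<lambda>x. n (r k) (x + y k) - N x)) ----> 0"
 shows "(\<lambda>k. dirichlet (n (r k))) ----> dirichlet N"
proof -
 have adm: "n k \<in> admissible" "N \<in> admissible" for k using n r by (auto simp: admissible_neg1_def minimizers_G_def)
 note J = admissible_jet(1)[OF adm(1)] and JN = admissible_jet(1)[OF adm(2)]
 have "(\<lambda>k. l2 (weak_partial i (n (r k)))) ----> l2 (weak_partial i N)" for i
 proof -
  have "\<bar>l2 (weak_partial i (n (r k))) - l2 (weak_partial i N)\<bar> \<le> H2_norm (\<lambda>x. n (r k) (x + y k) - N x)" for k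
  proof -
   have J': "jet2 (\<lambda>x. n (r k) (x + y k) - N x) (\<lambda>i x. weak_partial i (n (r k)) (x + y k) - weak_partial i N x)
    (\<lambda>i j x. hessian (n (r k)) i j (x + y k) - hessian N i j x)"
    using jet2_diff[OF jet2_shift[OF J] JN, of "r k" "y k"] by simp
   have sq: "L2 (weak_partial i (n (r k)))" by (rule jet2D(3)[OF J])
   have "\<bar>l2 (\<lambda>x. weak_partial i (n (r k)) (x + y k)) - l2 (weak_partial i N)\<bar> \<le>
    l2 (\<lambda>x. weak_partial i (n (r k)) (x + y k) - weak_partial i N x)"
    by (rule abs_l2_diff_le[OF L2_shift[OF sq] jet2D(3)[OF JN]])
   also have "\<dots> = l2 (weak_partial i (\<lambda>x. n (r k) (x + y k) - N x))" by (rule jet2_l2(1)[OF J', symmetric])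
   also have "\<dots> \<le> H2_norm (\<lambda>x. n (r k) (x + y k) - N x)" by (rule sobolev_representative_bounds(4)[OF s])
   finally show ?thesis unfolding l2_shift[OF sq] .
  qed
  then have "(\<lambda>k. l2 (weak_partial i (n (r k))) - l2 (weak_partial i N)) ----> 0"
   by (intro Lim_null_comparison[OF _ lim] always_eventually) auto
  then show ?thesis by (rule LIM_zero_cancel)
 qed
 then show ?thesis unfolding dirichlet_jet[OF adm(1)] dirichlet_jet[OF adm(2)] by (intro tendsto_intros) auto
qed

lemma minimizers_nonempty: "minimizers_G \<noteq> {}"
proof -
 have "\<exists>n. n \<in> admissible_neg1 \<and> F0 n < I_hat_neg1_0 + 1 / real (Suc k)" for k
  using cINF_less_iff[OF I_hat_bound(1) F0_bdd_below, of "I_hat_neg1_0 + 1 / real (Suc k)"]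
  unfolding I_hat_neg1_0_def[symmetric] by auto
 then obtain n where n: "\<And>k. n k \<in> admissible_neg1" "\<And>k. F0 (n k) < I_hat_neg1_0 + 1 / real (Suc k)" by metis
 have l: "(\<lambda>k. I_hat_neg1_0 + 1 / real (Suc k)) ----> I_hat_neg1_0"
  using tendsto_add[OF tendsto_const LIMSEQ_inverse_real_of_nat, of I_hat_neg1_0] by (simp add: inverse_eq_divide)
 have "(\<lambda>k. F0 (n k)) ----> I_hat_neg1_0"
  by (rule tendsto_sandwich[OF _ _ tendsto_const l]) (use n I_hat_le in \<open>auto intro!: always_eventually less_imp_le\<close>)
 from n(1) this show ?thesis by (rule minimizing_sequence_compact) blast
qed

lemma dirichlet_bdd: "bdd_above (dirichlet ` minimizers_G)" by (rule bdd_aboveI2[of _ _ "I_hat_neg1_0 / 2"])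
   (auto simp: minimizers_G_def admissible_neg1_def dest: dirichlet_le_F0(1))

lemma dirichlet_le_D_star: "n \<in> minimizers_G \<Longrightarrow> dirichlet n \<le> D_star"
 unfolding D_star_def by (rule cSUP_upper[OF _ dirichlet_bdd])

text \<open>A sequence in \<open>minimizers_G\<close> is itself a minimizing sequence of
  \<open>F0\<close>, so compactness up to translations applies to a maximizing sequence of
  \<open>dirichlet\<close>.\<close>

lemma D_star_attained: "\<exists>n\<in>minimizers_G. dirichlet n = D_star"
proof -
 have "\<exists>n. n \<in> minimizers_G \<and> D_star - 1 / real (Suc k) < dirichlet n" for k
  using less_cSUP_iff[OF minimizers_nonempty dirichlet_bdd, of "D_star - 1 / real (Suc k)"]
  unfolding D_star_def[symmetric] by auto
 then obtain n where n: "\<And>k. n k \<in> minimizers_G" "\<And>k. D_star - 1 / real (Suc k) < dirichlet (n k)" by metis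
 have n1: "n k \<in> admissible_neg1" "F0 (n k) = I_hat_neg1_0" for k using n(1)[of k] by (auto simp: minimizers_G_def)
 have l: "(\<lambda>k. D_star - 1 / real (Suc k)) ----> D_star"
  using tendsto_diff[OF tendsto_const LIMSEQ_inverse_real_of_nat, of D_star] by (simp add: inverse_eq_divide)
 have dl: "(\<lambda>k. dirichlet (n k)) ----> D_star"
  by (rule tendsto_sandwich[OF _ _ l tendsto_const]) (use n dirichlet_le_D_star in \<open>auto intro!: always_eventually less_imp_le\<close>)
 have "(\<lambda>k. F0 (n k)) ----> I_hat_neg1_0" unfolding n1(2) by simp
 with n1(1) obtain r y N where r: "strict_mono (r :: nat \<Rightarrow> nat)" and N: "N \<in> minimizers_G"
  and s: "\<And>k. sobolev_H 2 (\<lambda>x. n (r k) (x + y k) - N x)" "(\<lambda>k. H2_norm (\<lambda>x. n (r k) (x + y k) - N x)) ----> 0"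
  by (rule minimizing_sequence_compact) (rule that)
 have "(\<lambda>k. dirichlet (n (r k))) ----> D_star" using LIMSEQ_subseq_LIMSEQ[OF dl r] by (simp add: o_def)
 with minimizing_dirichlet[of n N r y, OF n1(1) N s] have "dirichlet N = D_star" by (rule LIMSEQ_unique)
 with N show ?thesis by blast
qed

section \<open>The limit of large fields\<close>

lemma energy_jet:
 assumes m: "m \<in> admissible"
 shows "energy H m = - dirichlet m + (l2 (weak_laplacian m))\<^sup>2 / 2 + H * ((l2 (deviation m))\<^sup>2 / 2)"
proof -
 note J = jet2D[OF admissible_jet(1)[OF m]]
 have lap: "L2 (weak_laplacian m)" unfolding weak_laplacian_def[abs_def] by (intro L2_sum J)
 \<comment> \<open>On the unit sphere the field term is half the squared deviation, which makes it
   quadratic in the jet.\<close>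
 have e: "1 - m x $ 3 = (norm (m x - e3))\<^sup>2 / 2" for x
 proof -
  have "(norm (m x - e3))\<^sup>2 = (norm (m x))\<^sup>2 + (norm e3)\<^sup>2 - 2 * (m x \<bullet> e3)"
   by (simp add: power2_norm_eq_inner inner_diff_left inner_diff_right inner_commute)
  then show ?thesis using m by (simp add: admissible_def norm_e3 inner_vec_def sum_3 e3_components)
 qed
 have g: "integrable lborel (grad_sq m)" unfolding grad_sq_def[abs_def]
  by (intro Bochner_Integration.integrable_sum integrable_power2 J)
 have "energy H m = (LINT x|lborel. (- (1/2) * grad_sq m x + 1/2 * (norm (weak_laplacian m x))\<^sup>2) + H * ((norm (m x - e3))\<^sup>2 / 2))"
  unfolding energy_def e ..
 also have "\<dots> = (LINT x|lborel. - (1/2) * grad_sq m x) + (LINT x|lborel. 1/2 * (norm (weak_laplacian m x))\<^sup>2)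
  + (LINT x|lborel. H * ((norm (m x - e3))\<^sup>2 / 2))"
 proof -
  have i: "integrable lborel (\<lambda>x. - (1/2) * grad_sq m x)" "integrable lborel (\<lambda>x. 1/2 * (norm (weak_laplacian m x))\<^sup>2)"
   "integrable lborel (\<lambda>x. H * ((norm (m x - e3))\<^sup>2 / 2))"
   by (intro integrable_mult_right integrable_divide g integrable_power2 lap J)+
  show ?thesis unfolding LINT_add[OF LINT_integrable_add[OF i(1,2)] i(3)] LINT_add[OF i(1,2)] ..
 qed
 finally show ?thesis unfolding dirichlet_def l2_power2 by simp
qed

text \<open>In two dimensions the Dirichlet energy is invariant under dilations, while the squared
  norms of deviation and Laplacian scale by \<open>1 / c^2\<close> and \<open>c^2\<close>; the field
  strength \<open>1 / c^4\<close> balances both.\<close>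

lemma rescaled:
 fixes a :: "real^2"
 assumes m: "m \<in> admissible_neg1" and c: "0 < c"
 defines "n \<equiv> \<lambda>x. m (a + c *R x)"
 shows "n \<in> admissible_neg1" "energy (1 / c ^ 4) m = F0 n / c\<^sup>2 - dirichlet n"
proof -
 have m': "m \<in> admissible" "degree_Q m = - 1" using m by (auto simp: admissible_neg1_def)
 note A = admissible_jet[OF m'(1)]
 have c0: "c \<noteq> 0" using c by simp
 let ?u = "\<lambda>x. deviation m (a + c *R x)" and ?G = "\<lambda>i x. c *R gradient m i (a + c *R x)"
  and ?K = "\<lambda>i j x. (c * c) *R hessian m i j (a + c *R x)"
 have J: "jet2 ?u ?G ?K" by (rule jet2_affine[OF c0 A(1)])
 have cont: "continuous_on UNIV ?u"
  by (rule continuous_on_compose2[OF uniformly_continuous_imp_continuous[OF A(2)]]) (auto intro!: continuous_intros)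
 have uc: "isUCont ?u"
  by (rule pointwise_limit_hoelder(2)[where u = "\<lambda>k. ?u", OF jet_bounded_energy[OF J order_refl] cont tendsto_const])
 have s: "norm (e3 + ?u x) = 1" for x by (rule A(3))
 have n: "n = (\<lambda>x. e3 + ?u x)" by (simp add: n_def)
 note B = jet_admissible[OF J uc s, folded n]
 show "n \<in> admissible_neg1"
  using B(1,2) m'(2) jet_degree_affine[OF c0 A(1), of a] unfolding degree_Q_jet by (simp add: admissible_neg1_def degree_Q_jet)
 have g: "(l2 (?G i))\<^sup>2 = (l2 (gradient m i))\<^sup>2" for i
 proof -
  have "(l2 (?G i))\<^sup>2 = c\<^sup>2 * (l2 (\<lambda>x. gradient m i (a + c *R x)))\<^sup>2" by (simp add: power_mult_distrib)
  also have "\<dots> = c\<^sup>2 * ((l2 (gradient m i))\<^sup>2 / c\<^sup>2)" by (subst l2_affine[OF c0]) (use jet2D(3)[OF A(1)] in auto)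
  finally show ?thesis using c0 by simp
 qed
 have d: "dirichlet n = dirichlet m" unfolding B(4) g dirichlet_jet[OF m'(1)] ..
 have "F0 n = ((l2 (deviation m))\<^sup>2 / c\<^sup>2 + c\<^sup>2 * (l2 (weak_laplacian m))\<^sup>2) / 2"
  unfolding B(3) jet_energy_affine[OF c0 A(1)] weak_laplacian_def[abs_def] ..
 then have "F0 n / c\<^sup>2 = (l2 (weak_laplacian m))\<^sup>2 / 2 + 1 / c ^ 4 * ((l2 (deviation m))\<^sup>2 / 2)"
  using c0 by (simp add: add_divide_distrib power2_eq_square power4_eq_xxxx)
 then show "energy (1 / c ^ 4) m = F0 n / c\<^sup>2 - dirichlet n" unfolding energy_jet[OF m'(1)] d by simp
qed

lemma scale_factor:
 assumes "0 < H"
 defines "c \<equiv> H powr (-1/4)"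
 shows "0 < c" "1 / c ^ 4 = H" "1 / c\<^sup>2 = sqrt H"
proof -
 show "0 < c" using assms by (simp add: c_def)
 have p: "c ^ n = H powr (- real n / 4)" for n using assms by (simp add: c_def powr_powr flip: powr_realpow)
 show "1 / c ^ 4 = H" unfolding p using assms by (simp add: powr_minus inverse_eq_divide)
 show "1 / c\<^sup>2 = sqrt H" unfolding p using assms by (simp add: powr_minus powr_half_sqrt inverse_eq_divide)
qed

lemma energy_rescaled:
 fixes a :: "real^2"
 assumes "m \<in> admissible_neg1" "0 < H"
 defines "n \<equiv> \<lambda>x. m (a + H powr (-1/4) *R x)"
 shows "n \<in> admissible_neg1" "energy H m = sqrt H * F0 n - dirichlet n"
proof -
 note c = scale_factor[OF assms(2)]
 show "n \<in> admissible_neg1" unfolding n_def by (rule rescaled(1)[OF assms(1) c(1)])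
 have "energy H m = F0 n * (1 / (H powr (-1/4))\<^sup>2) - dirichlet n"
  using rescaled(2)[OF assms(1) c(1), of a] unfolding c(2) n_def by simp
 then show "energy H m = sqrt H * F0 n - dirichlet n" unfolding c(3) by simp
qed

text \<open>Undoing the dilation turns every competitor of the limit problem into one for
  \<open>energy H\<close>. The infimum is a genuine lower bound because \<open>sqrt H\<close> of at
  least 1/2 makes the energy nonnegative.\<close>

lemma I_neg1_le:
 assumes H: "1 / 4 < H" and n: "n \<in> admissible_neg1"
 shows "I_neg1 H \<le> sqrt H * F0 n - dirichlet n"
proof -
 have H0: "0 < H" using H by simp
 have half: "1 / 2 \<le> sqrt H" using real_sqrt_le_mono[of "1/4" H] H by (simp add: real_sqrt_divide)
 have "0 \<le> energy H m" if m: "m \<in> admissible_neg1" for m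
 proof -
  let ?n = "\<lambda>x. m (0 + H powr (-1/4) *R x)"
  note e = energy_rescaled[OF m H0, of 0]
  have a: "?n \<in> admissible" using e(1) by (simp add: admissible_neg1_def)
  have "1 / 2 * F0 ?n \<le> sqrt H * F0 ?n" by (intro mult_right_mono half dirichlet_le_F0(2)[OF a])
  then show ?thesis unfolding e(2) using dirichlet_le_F0(1)[OF a] by linarith
 qed
 then have b: "bdd_below (energy H ` admissible_neg1)" by (intro bdd_belowI2[of _ 0])
 define c where "c = H powr (-1/4)"
 note c = scale_factor[OF H0, folded c_def]
 define m where "m x = n (0 + (1 / c) *R x)" for x
 have m: "m \<in> admissible_neg1" unfolding m_def by (rule rescaled(1)[OF n]) (use c in simp)
 have "(\<lambda>x. m (0 + H powr (-1/4) *R x)) = n" unfolding c_def[symmetric] using c(1) by (simp add: m_def)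
 with energy_rescaled(2)[OF m H0, of 0] have "energy H m = sqrt H * F0 n - dirichlet n" by simp
 with cINF_lower[OF b m] show ?thesis unfolding I_neg1_def by simp
qed

lemma minimizer_bounds:
 assumes H: "1 < H" and m: "m \<in> admissible_neg1" and e: "energy H m = I_neg1 H"
 defines "n \<equiv> \<lambda>x. m (0 + H powr (-1/4) *R x)"
 shows "n \<in> admissible_neg1" "I_neg1 H = sqrt H * F0 n - dirichlet n"
  "sqrt H * (F0 n - I_hat_neg1_0) \<le> dirichlet n - D_star" "D_star \<le> dirichlet n" "F0 n \<le> 2 * I_hat_neg1_0"
proof -
 have H0: "0 < H" using H by simp
 note s = energy_rescaled[OF m H0, of 0, folded n_def]
 show nA: "n \<in> admissible_neg1" and I: "I_neg1 H = sqrt H * F0 n - dirichlet n" using s e by auto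
 obtain N where N: "N \<in> minimizers_G" "dirichlet N = D_star" using D_star_attained by blast
 then have "N \<in> admissible_neg1" "F0 N = I_hat_neg1_0" by (auto simp: minimizers_G_def)
 with I_neg1_le[of H N] H N have up: "I_neg1 H \<le> sqrt H * I_hat_neg1_0 - D_star" by simp
 then show 1: "sqrt H * (F0 n - I_hat_neg1_0) \<le> dirichlet n - D_star" unfolding I by (simp add: right_diff_distrib)
 have ge: "I_hat_neg1_0 \<le> F0 n" by (rule I_hat_le[OF nA])
 moreover have "0 \<le> sqrt H * (F0 n - I_hat_neg1_0)" using ge H0 by simp
 ultimately show "D_star \<le> dirichlet n" using 1 by linarith
 have nad: "n \<in> admissible" using nA by (simp add: admissible_neg1_def)
 have Nad: "N \<in> admissible" using N by (simp add: minimizers_G_def admissible_neg1_def)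
 \<comment> \<open>With \<open>sqrt H\<close> at least 1 the excess of \<open>F0\<close> is at most
   \<open>dirichlet n\<close>, hence at most half of \<open>F0 n\<close>; solving for
   \<open>F0 n\<close> gives the factor 2.\<close>
 have "1 * (F0 n - I_hat_neg1_0) \<le> sqrt H * (F0 n - I_hat_neg1_0)" using ge H by (intro mult_right_mono) auto
 from order_trans[OF this 1] dirichlet_le_F0(1)[OF nad] dirichlet_le_F0(3)[OF Nad] N(2) show "F0 n \<le> 2 * I_hat_neg1_0"
  unfolding mult_1 by linarith
qed

lemma H2_norm_nonneg: "0 \<le> H2_norm f" unfolding H2_norm_def by (auto intro!: add_nonneg_nonneg sum_nonneg LINT_nonneg)

lemma distance_to_G_star:
 assumes H: "\<And>k. 1 < H k" "filterlim H at_top sequentially"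
  and m: "\<And>k. m k \<in> admissible_neg1" "\<And>k. energy (H k) (m k) = I_neg1 (H k)"
 defines "n \<equiv> \<lambda>k x. m k (0 + H k powr (-1/4) *R x)"
 obtains r where "strict_mono (r :: nat \<Rightarrow> nat)" "(\<lambda>k. dirichlet (n (r k))) ----> D_star"
  "(\<lambda>k. INF (a, N)\<in>UNIV \<times> G_star. H2_norm (\<lambda>x. m (r k) (a + H (r k) powr (-1/4) *R x) - N x)) ----> 0"
proof -
 have n_abs: "n k = (\<lambda>x. m k (0 + H k powr (-1/4) *R x))" for k by (simp add: n_def)
 note B = minimizer_bounds[OF H(1) m, folded n_abs]
 have F: "(\<lambda>k. F0 (n k)) ----> I_hat_neg1_0"
 proof (rule tendsto_sandwich)
  \<comment> \<open>The Dirichlet energy is at most half of \<open>F0\<close>, which is at most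
    \<open>2 * I_hat_neg1_0\<close>; so the gain over \<open>D_star\<close> is at most
    \<open>?C\<close>, and the excess of \<open>F0\<close> is of order one over
    \<open>sqrt H\<close>.\<close>
  let ?C = "I_hat_neg1_0 - D_star"
  show "\<forall>\<^sub>F k in sequentially. I_hat_neg1_0 \<le> F0 (n k)" using I_hat_le[OF B(1)] by (intro always_eventually) auto
  show "\<forall>\<^sub>F k in sequentially. F0 (n k) \<le> I_hat_neg1_0 + ?C / sqrt (H k)"
  proof (intro always_eventually allI)
   fix k
   have "n k \<in> admissible" using B(1)[of k] by (simp add: admissible_neg1_def)
   from dirichlet_le_F0(1)[OF this] B(3,5)[of k] have "sqrt (H k) * (F0 (n k) - I_hat_neg1_0) \<le> ?C" by linarith
   then have "F0 (n k) - I_hat_neg1_0 \<le> ?C / sqrt (H k)" using H(1)[of k] by (simp add: pos_le_divide_eq mult.commute)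
   then show "F0 (n k) \<le> I_hat_neg1_0 + ?C / sqrt (H k)" by simp
  qed
  have "(\<lambda>k. ?C / sqrt (H k)) ----> 0"
   by (intro tendsto_divide_0[OF tendsto_const] filterlim_at_top_imp_at_infinity filterlim_compose[OF sqrt_at_top H(2)])
  from tendsto_add[OF tendsto_const this] show "(\<lambda>k. I_hat_neg1_0 + ?C / sqrt (H k)) ----> I_hat_neg1_0" by simp
 qed (rule tendsto_const)
 obtain r y N where r: "strict_mono (r :: nat \<Rightarrow> nat)" and N: "N \<in> minimizers_G"
  and s: "\<And>k. sobolev_H 2 (\<lambda>x. n (r k) (x + y k) - N x)" "(\<lambda>k. H2_norm (\<lambda>x. n (r k) (x + y k) - N x)) ----> 0"
  by (rule minimizing_sequence_compact[OF B(1) F]) (rule that)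
 have dl: "(\<lambda>k. dirichlet (n (r k))) ----> dirichlet N" by (rule minimizing_dirichlet[of n N r y, OF B(1) N s])
 \<comment> \<open>The lower bound survives the limit, so the limiting minimizer has maximal
   Dirichlet energy.\<close>
 have "D_star \<le> dirichlet N" by (rule LIMSEQ_le_const[OF dl]) (use B(4) in blast)
 with dirichlet_le_D_star[OF N] have DN: "dirichlet N = D_star" by simp
 with N have NG: "N \<in> G_star" by (simp add: G_star_def)
 have "(\<lambda>k. INF (a, N)\<in>UNIV \<times> G_star. H2_norm (\<lambda>x. m (r k) (a + H (r k) powr (-1/4) *R x) - N x)) ----> 0"
 proof (rule tendsto_sandwich[OF _ _ tendsto_const s(2)])
  have ne: "UNIV \<times> G_star \<noteq> {}" using NG by blast
  show "\<forall>\<^sub>F k in sequentially. 0 \<le> (INF (a, N)\<in>UNIV \<times> G_star. H2_norm (\<lambda>x. m (r k) (a + H (r k) powr (-1/4) *R x) - N x))"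
   using ne by (intro always_eventually allI cINF_greatest) (auto simp: H2_norm_nonneg)
  show "\<forall>\<^sub>F k in sequentially. (INF (a, N)\<in>UNIV \<times> G_star. H2_norm (\<lambda>x. m (r k) (a + H (r k) powr (-1/4) *R x) - N x))
   \<le> H2_norm (\<lambda>x. n (r k) (x + y k) - N x)"
  proof (intro always_eventually allI)
   fix k
   let ?f = "\<lambda>(a, N). H2_norm (\<lambda>x. m (r k) (a + H (r k) powr (-1/4) *R x) - N x)"
   have b: "bdd_below (?f ` (UNIV \<times> G_star))" by (rule bdd_belowI2[of _ 0]) (auto simp: H2_norm_nonneg)
   \<comment> \<open>A translation by \<open>y k\<close> of the rescaled map is a translation by the
     rescaled vector of the original one.\<close>
   have "(H (r k) powr (-1/4) *R y k, N) \<in> UNIV \<times> G_star" using NG by simp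
   from cINF_lower[OF b this]
   show "(INF (a, N)\<in>UNIV \<times> G_star. H2_norm (\<lambda>x. m (r k) (a + H (r k) powr (-1/4) *R x) - N x))
    \<le> H2_norm (\<lambda>x. n (r k) (x + y k) - N x)" by (simp add: n_def scaleR_add_right add.commute)
  qed
 qed
 with r dl[unfolded DN] show ?thesis by (rule that)
qed

theorem theorem1p3:
  shows "bdd_above (dirichlet ` minimizers_G)
    \<and> (\<exists>n\<in>minimizers_G. dirichlet n = D_star)
    \<and> G_star \<noteq> {}
    \<and> (\<forall>m :: real \<Rightarrow> plane_map.
        (\<forall>H>1/4. m H \<in> admissible_neg1 \<and> energy H (m H) = I_neg1 H) \<longrightarrow>
        ((\<lambda>H. INF (a, n)\<in>UNIV \<times> G_star.
               H2_norm (\<lambda>x. m H (a + H powr (-1/4) *\<^sub>R x) - n x)) \<longlongrightarrow> 0) at_top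
        \<and> (\<lambda>H. I_neg1 H - (sqrt H * I_hat_neg1_0 - D_star)) \<in> o[at_top](\<lambda>_. 1))"
proof (intro conjI allI impI)
 show "bdd_above (dirichlet ` minimizers_G)" by (rule dirichlet_bdd)
 show "\<exists>n\<in>minimizers_G. dirichlet n = D_star" by (rule D_star_attained)
 then show ne: "G_star \<noteq> {}" by (auto simp: G_star_def)
 fix m :: "real \<Rightarrow> plane_map"
 assume "\<forall>H>1/4. m H \<in> admissible_neg1 \<and> energy H (m H) = I_neg1 H"
 then have m: "m H \<in> admissible_neg1" "energy H (m H) = I_neg1 H" if "1 < H" for H using that by auto
 define n where "n H x = m H (0 + H powr (-1/4) *R x)" for H x
 have n_abs: "n H = (\<lambda>x. m H (0 + H powr (-1/4) *R x))" for H by (auto simp: n_def)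
 define f where "f H = (INF (a, n)\<in>UNIV \<times> G_star. H2_norm (\<lambda>x. m H (a + H powr (-1/4) *R x) - n x))" for H
 define g where "g H = dirichlet (n H) - D_star" for H
 have f0: "0 \<le> f H" for H unfolding f_def using ne by (intro cINF_greatest) (auto simp: H2_norm_nonneg)
 have g0: "0 \<le> g H" if "1 < H" for H using minimizer_bounds(4)[OF that m[OF that]] by (simp add: g_def n_abs)
 \<comment> \<open>Both quantities are nonnegative for large \<open>H\<close>, so their sum handles
   the two limits with one extraction; the continuous parameter is reduced to sequences by
   contradiction.\<close>
 have fg: "((\<lambda>H. f H + g H) \<longlongrightarrow> 0) at_top"
 proof (rule tendstoI, rule ccontr)
  fix e :: real assume e: "0 < e"
  assume "\<not> (\<forall>\<^sub>F H in at_top. dist (f H + g H) 0 < e)"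
  then have "\<exists>H\<ge>b. \<not> dist (f H + g H) 0 < e" for b by (auto simp: eventually_at_top_linorder)
  \<comment> \<open>The summand 2 keeps every parameter above 1.\<close>
  then have "\<exists>H. real k + 2 \<le> H \<and> \<not> dist (f H + g H) 0 < e" for k :: nat by blast
  then obtain H where H: "\<And>k. real k + 2 \<le> H k" "\<And>k. \<not> dist (f (H k) + g (H k)) 0 < e" by metis
  have H1: "1 < H k" for k using H(1)[of k] by simp
  have Ht: "filterlim H at_top sequentially"
   by (rule filterlim_at_top_mono[OF filterlim_real_sequentially]) (use H(1) in \<open>auto intro!: always_eventually order_trans[OF _ H(1)]\<close>)
  obtain r where r: "strict_mono (r :: nat \<Rightarrow> nat)" "(\<lambda>k. dirichlet (n (H (r k)))) ----> D_star" "(\<lambda>k. f (H (r k))) ----> 0"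
   using distance_to_G_star[of H "\<lambda>k. m (H k)", OF H1 Ht m(1)[OF H1] m(2)[OF H1]] unfolding f_def n_abs by blast
  have "(\<lambda>k. f (H (r k)) + g (H (r k))) ----> 0"
   using tendsto_add[OF r(3) tendsto_diff[OF r(2) tendsto_const[of D_star]]] by (simp add: g_def)
  from tendstoD[OF this e] have "\<forall>\<^sub>F k in sequentially. False" by eventually_elim (use H(2) in blast)
  then show False by simp
 qed
 have "\<forall>\<^sub>F H in at_top. (1::real) < H" by (rule eventually_gt_at_top)
 then have bounds: "\<forall>\<^sub>F H in at_top. 0 \<le> f H \<and> f H \<le> f H + g H \<and> - (f H + g H) \<le> - g H"
  by eventually_elim (use f0 g0 in auto)
 have "(f \<longlongrightarrow> 0) at_top"
  by (rule tendsto_sandwich[OF _ _ tendsto_const fg]) (use bounds in \<open>auto elim: eventually_mono\<close>)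
 then show "((\<lambda>H. INF (a, n)\<in>UNIV \<times> G_star. H2_norm (\<lambda>x. m H (a + H powr (-1/4) *R x) - n x)) \<longlongrightarrow> 0) at_top"
  unfolding f_def .
 have "((\<lambda>H. I_neg1 H - (sqrt H * I_hat_neg1_0 - D_star)) \<longlongrightarrow> 0) at_top"
 proof (rule Lim_null_comparison[OF _ fg])
  show "\<forall>\<^sub>F H in at_top. norm (I_neg1 H - (sqrt H * I_hat_neg1_0 - D_star)) \<le> f H + g H"
   using eventually_gt_at_top[of "1::real"]
  proof eventually_elim
   case (elim H)
   note B = minimizer_bounds[OF elim m[OF elim], folded n_abs]
   \<comment> \<open>The error of the expansion is the excess of \<open>F0\<close> times
     \<open>sqrt H\<close>, minus \<open>g H\<close>; this scaled excess lies between 0 and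
     \<open>g H\<close>.\<close>
   have "0 \<le> sqrt H * (F0 (n H) - I_hat_neg1_0)" using I_hat_le[OF B(1)] elim by simp
   moreover have "I_neg1 H - (sqrt H * I_hat_neg1_0 - D_star) = sqrt H * (F0 (n H) - I_hat_neg1_0) - g H"
    unfolding B(2) g_def by (simp add: right_diff_distrib)
   ultimately show ?case using B(3) f0[of H] unfolding g_def real_norm_def by linarith
  qed
 qed
 then show "(\<lambda>H. I_neg1 H - (sqrt H * I_hat_neg1_0 - D_star)) \<in> o[at_top](\<lambda>_. 1)" by (intro smalloI_tendsto) auto
qed

end
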